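(* Let $0<\alpha\le1$, $p\ge2$, $g\in H=L^2(\mathbb T^2)$, and let $\Lambda\subset\mathbb R^2$ be compact with $\Lambda=-\Lambda$ and $0$ an interior point of $\Lambda$. (1) Let $a\in(-\sqrt{4\pi\alpha},\sqrt{4\pi\alpha})$. Then $$\lim_{N\to\infty}\exp_{N\Lambda}(a\cdot)=\sum_{n=0}^\infty\frac{a^n}{n!}\Phi_n(\cdot)\quad\text{in }L^2(\mu_0;H^{-\alpha}(\mathbb T^2)).$$ Denote the right-hand side (the Wick exponential) by $:\!\exp(az)\!:$, $z\in E$. (2) Let $a\in(-\sqrt{4\pi},\sqrt{4\pi})$. Then $$\lim_{N\to\infty}\big(\exp_{N\Lambda}(a\cdot),g\big)_H=\sum_{n=0}^\infty\frac{a^n}{n!}\Phi_n(\cdot)(g)\quad\text{in }L^2(\mu_0).$$ Denote the right-hand side by $:\!\exp(az)\!:(g)$. Furthermore, if $g\in H^\alpha(\mathbb T^2)$ and $a\in(-\sqrt{4\pi\alpha},\sqrt{4\pi\alpha})$, then $:\!\exp(az)\!:(g)={}_{H^{-\alpha}}\langle:\!\exp(az)\!:,g\rangle_{H^\alpha}$ for $\mu_0$-a.e. $z\in E$. (3) If $|a|<\sqrt{\frac{4\pi\alpha}{p-1}}$, then $:\!\exp(a\cdot)\!:$ belongs to $L^p(\mu_0;H^{-\alpha}(\mathbb T^2))$. Furthermore, if $|a|<\sqrt{\frac{4\pi}{p-1}}$, then $:\!\exp(a\cdot)\!:(g)$ belongs to $L^p(\mu_0)$.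
   Context: $\mathbb T^2=(\mathbb R/2\pi\mathbb Z)^2$ with Lebesgue measure; $\{e_k\}_{k\in\mathbb Z^2}$ is the real orthonormal basis of $H=L^2(\mathbb T^2)$ (real-valued): $e_{(0,0)}=\frac1{2\pi}$, $e_k(x)=\frac1{\sqrt2\pi}\cos(k\cdot x)$ if $k\in\mathbb Z^2_+:=\{k_1>0\}\cup\{k_1=0,k_2>0\}$, $e_k(x)=\frac1{\sqrt2\pi}\sin(k\cdot x)$ if $k\in-\mathbb Z^2_+$. $H^s(\mathbb T^2)$ is the real Sobolev space with $\|u\|_{H^s}^2=\sum_k(1+|k|^2)^s\langle u,e_k\rangle^2$; ${}_{H^{-\alpha}}\langle\cdot,\cdot\rangle_{H^\alpha}$ is the dual pairing extending the $L^2$ inner product. Fix $\delta>0$ and $E=H^{-\delta}(\mathbb T^2)$. $\mu_0$ is the centered Gaussian probability measure on $E$ with $\int_E\langle z,l_1\rangle\langle z,l_2\rangle\mu_0(dz)=((1-\Delta)^{-1}l_1,l_2)_H$, $l_1,l_2\in E^*=H^\delta(\mathbb T^2)$. For $\Lambda$ as in the claim (and dilates $N\Lambda=\{Nx;x\in\Lambda\}$) put $(\Pi_\Lambda z)(x)=\sum_{k\in\Lambda\cap\mathbb Z^2}\langle z,e_k\rangle e_k(x)$, $\rho_\Lambda=\mathbb E^{\mu_0}[(\Pi_\Lambda z)(x)^2]^{1/2}$ (independent of $x$), $\exp_\Lambda(az)_x=\exp\{a(\Pi_\Lambda z)(x)-\frac{(a\rho_\Lambda)^2}2\}$, and $\Phi_{n,\Lambda}(z)_x=\sqrt{n!}\,\rho_\Lambda^n\,\mathbb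 H_n(\rho_\Lambda^{-1}(\Pi_\Lambda z)(x))$ with $\mathbb H_n(\xi)=\frac{(-1)^n}{\sqrt{n!}}e^{\xi^2/2}(\frac d{d\xi})^ne^{-\xi^2/2}$. The Wick power $\Phi_n$ is the limit of $\Phi_{n,N\Lambda}$ as $N\to\infty$ in $L^p(\mu_0;H^{-\alpha}(\mathbb T^2))$ ($p\ge1$, $\alpha>0$), and, for $g\in H$, $\Phi_n(\cdot)(g)$ is the limit of $\int_{\mathbb T^2}\Phi_{n,N\Lambda}(\cdot)_x\,g(x)dx$ in $L^p(\mu_0)$, $p\ge1$; these limits exist and do not depend on $\Lambda$. *)

theory Defs
  imports "HOL-Probability.Probability"
begin

text \<open>The torus is represented by its fundamental domain with Lebesgue measure; functions on the
  torus are functions on \<^typ>\<open>real \<times> real\<close> of which only the values on that domain matter.\<close>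

definition torus :: "(real \<times> real) measure" where
  "torus = restrict_space lborel ({0..<2 * pi} \<times> {0..<2 * pi})"

definition L2_torus :: "(real \<times> real \<Rightarrow> real) set" where
  "L2_torus = {g \<in> borel_measurable torus. integrable torus (\<lambda>x. (g x)\<^sup>2)}"

definition inner_H :: "(real \<times> real \<Rightarrow> real) \<Rightarrow> (real \<times> real \<Rightarrow> real) \<Rightarrow> real" where
  "inner_H f g = (\<integral>x. f x * g x \<partial>torus)"

definition Z2_plus :: "(int \<times> int) set" where
  "Z2_plus = {k. fst k > 0} \<union> {k. fst k = 0 \<and> snd k > 0}"

definition dot :: "int \<times> int \<Rightarrow> real \<times> real \<Rightarrow> real" where
  "dot k x = of_int (fst k) * fst x + of_int (snd k) * snd x"

definition basis_e :: "int \<times> int \<Rightarrow> real \<times> real \<Rightarrow> real" where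
  "basis_e k x =
     (if k = (0, 0) then 1 / (2 * pi)
      else if k \<in> Z2_plus then cos (dot k x) / (sqrt 2 * pi)
      else sin (dot k x) / (sqrt 2 * pi))"

text \<open>A (real) distribution \<open>u\<close> on the torus is represented by the family of its coefficients
  \<open>\<langle>u, e\<^sub>k\<rangle>\<close>. A function \<open>f\<close> is regarded as a distribution through \<open>fourier_coeffs f\<close>.\<close>

type_synonym distribution = "int \<times> int \<Rightarrow> real"

definition fourier_coeffs :: "(real \<times> real \<Rightarrow> real) \<Rightarrow> distribution" where
  "fourier_coeffs f = (\<lambda>k. inner_H f (basis_e k))"

definition bracket2 :: "int \<times> int \<Rightarrow> real" where
  "bracket2 k = 1 + (of_int (fst k))\<^sup>2 + (of_int (snd k))\<^sup>2"

definition sobolev :: "real \<Rightarrow> distribution set" where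
  "sobolev s = {u. (\<lambda>k. bracket2 k powr s * (u k)\<^sup>2) summable_on UNIV}"

definition sobolev_norm :: "real \<Rightarrow> distribution \<Rightarrow> real" where
  "sobolev_norm s u = sqrt (\<Sum>\<^sub>\<infinity>k. bracket2 k powr s * (u k)\<^sup>2)"

definition sobolev_dist :: "real \<Rightarrow> distribution \<Rightarrow> distribution \<Rightarrow> real" where
  "sobolev_dist s u v = sobolev_norm s (\<lambda>k. u k - v k)"

definition sobolev_borel :: "real \<Rightarrow> distribution measure" where
  "sobolev_borel s =
     sigma (sobolev s) {U. openin (Metric_space.mtopology (sobolev s) (sobolev_dist s)) U}"

text \<open>The pairing between \<open>sobolev (-s)\<close> and \<open>sobolev s\<close>; on square summable families it is the
  \<open>L\<^sup>2\<close> inner product, by Parseval.\<close>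

definition pairing :: "distribution \<Rightarrow> distribution \<Rightarrow> real" where
  "pairing u v = (\<Sum>\<^sub>\<infinity>k. u k * v k)"

text \<open>The inverse of \<open>1 - \<Delta>\<close>, using \<open>(1 - \<Delta>) e\<^sub>k = (1 + \<bar>k\<bar>\<^sup>2) e\<^sub>k\<close>.\<close>

definition resolvent :: "distribution \<Rightarrow> distribution" where
  "resolvent l = (\<lambda>k. l k / bracket2 k)"

definition centered_normal :: "real \<Rightarrow> real measure" where
  "centered_normal \<sigma> =
     (if \<sigma> = 0 then return borel 0 else density lborel (normal_density 0 \<sigma>))"

definition centered_gaussian :: "real \<Rightarrow> distribution measure \<Rightarrow> bool" where
  "centered_gaussian s M \<longleftrightarrow>
     prob_space M \<and> sets M = sets (sobolev_borel s) \<and>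
     (\<forall>l \<in> sobolev (- s). \<exists>\<sigma>\<ge>0. distr M borel (\<lambda>z. pairing z l) = centered_normal \<sigma>)"

definition free_field :: "real \<Rightarrow> distribution measure \<Rightarrow> bool" where
  "free_field \<delta> M \<longleftrightarrow>
     centered_gaussian (- \<delta>) M \<and>
     (\<forall>l1 \<in> sobolev \<delta>. \<forall>l2 \<in> sobolev \<delta>.
        (\<integral>z. pairing z l1 * pairing z l2 \<partial>M) = pairing (resolvent l1) l2)"

definition cutoff_set :: "(real \<times> real) set \<Rightarrow> bool" where
  "cutoff_set \<Lambda> \<longleftrightarrow> compact \<Lambda> \<and> \<Lambda> = uminus ` \<Lambda> \<and> 0 \<in> interior \<Lambda>"

definition dilate :: "nat \<Rightarrow> (real \<times> real) set \<Rightarrow> (real \<times> real) set" where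
  "dilate N \<Lambda> = (\<lambda>x. real N *\<^sub>R x) ` \<Lambda>"

definition cutoff_proj :: "(real \<times> real) set \<Rightarrow> distribution \<Rightarrow> real \<times> real \<Rightarrow> real" where
  "cutoff_proj \<Lambda> z x = (\<Sum>k | (of_int (fst k), of_int (snd k)) \<in> \<Lambda>. z k * basis_e k x)"

text \<open>For symmetric \<open>\<Lambda>\<close> the value does not depend on \<open>x\<close>.\<close>

definition rho :: "distribution measure \<Rightarrow> (real \<times> real) set \<Rightarrow> real \<times> real \<Rightarrow> real" where
  "rho M \<Lambda> x = sqrt (\<integral>z. (cutoff_proj \<Lambda> z x)\<^sup>2 \<partial>M)"

definition exp_cutoff ::
  "distribution measure \<Rightarrow> (real \<times> real) set \<Rightarrow> real \<Rightarrow> distribution \<Rightarrow> real \<times> real \<Rightarrow> real" where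
  "exp_cutoff M \<Lambda> a z x = exp (a * cutoff_proj \<Lambda> z x - (a * rho M \<Lambda> x)\<^sup>2 / 2)"

definition hermite :: "nat \<Rightarrow> real \<Rightarrow> real" where
  "hermite n \<xi> =
     (-1) ^ n / sqrt (fact n) * exp (\<xi>\<^sup>2 / 2) * (deriv ^^ n) (\<lambda>t. exp (- t\<^sup>2 / 2)) \<xi>"

definition wick_cutoff ::
  "distribution measure \<Rightarrow> nat \<Rightarrow> (real \<times> real) set \<Rightarrow> distribution \<Rightarrow> real \<times> real \<Rightarrow> real" where
  "wick_cutoff M n \<Lambda> z x =
     sqrt (fact n) * rho M \<Lambda> x ^ n * hermite n (inverse (rho M \<Lambda> x) * cutoff_proj \<Lambda> z x)"

definition Lp_sobolev ::
  "distribution measure \<Rightarrow> real \<Rightarrow> real \<Rightarrow> (distribution \<Rightarrow> distribution) set" where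
  "Lp_sobolev M p s =
     {F \<in> measurable M (sobolev_borel s). integrable M (\<lambda>z. sobolev_norm s (F z) powr p)}"

definition tendsto_Lp_sobolev ::
  "distribution measure \<Rightarrow> real \<Rightarrow> real \<Rightarrow>
   (nat \<Rightarrow> distribution \<Rightarrow> distribution) \<Rightarrow> (distribution \<Rightarrow> distribution) \<Rightarrow> bool" where
  "tendsto_Lp_sobolev M p s F G \<longleftrightarrow>
     (\<forall>N. F N \<in> Lp_sobolev M p s) \<and> G \<in> Lp_sobolev M p s \<and>
     (\<lambda>N. (\<integral>z. sobolev_dist s (F N z) (G z) powr p \<partial>M) powr (1 / p)) \<longlonglongrightarrow> 0"

definition Lp :: "distribution measure \<Rightarrow> real \<Rightarrow> (distribution \<Rightarrow> real) set" where
  "Lp M p = {f \<in> borel_measurable M. integrable M (\<lambda>z. \<bar>f z\<bar> powr p)}"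

definition tendsto_Lp ::
  "distribution measure \<Rightarrow> real \<Rightarrow> (nat \<Rightarrow> distribution \<Rightarrow> real) \<Rightarrow> (distribution \<Rightarrow> real) \<Rightarrow> bool"
  where
  "tendsto_Lp M p f g \<longleftrightarrow>
     (\<forall>N. f N \<in> Lp M p) \<and> g \<in> Lp M p \<and>
     (\<lambda>N. (\<integral>z. \<bar>f N z - g z\<bar> powr p \<partial>M) powr (1 / p)) \<longlonglongrightarrow> 0"

definition sums_Lp_sobolev ::
  "distribution measure \<Rightarrow> real \<Rightarrow> real \<Rightarrow>
   (nat \<Rightarrow> distribution \<Rightarrow> distribution) \<Rightarrow> (distribution \<Rightarrow> distribution) \<Rightarrow> bool" where
  "sums_Lp_sobolev M p s F G \<longleftrightarrow> tendsto_Lp_sobolev M p s (\<lambda>m z k. \<Sum>n<m. F n z k) G"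

definition sums_Lp ::
  "distribution measure \<Rightarrow> real \<Rightarrow> (nat \<Rightarrow> distribution \<Rightarrow> real) \<Rightarrow> (distribution \<Rightarrow> real) \<Rightarrow> bool"
  where
  "sums_Lp M p f g \<longleftrightarrow> tendsto_Lp M p (\<lambda>m z. \<Sum>n<m. f n z) g"

text \<open>\<open>F\<close> is (a version of) the Wick power \<open>\<Phi>\<^sub>n\<close>, and \<open>f\<close> is (a version of) \<open>\<Phi>\<^sub>n(\<cdot>)(g)\<close>.\<close>

definition is_wick_power ::
  "distribution measure \<Rightarrow> nat \<Rightarrow> (distribution \<Rightarrow> distribution) \<Rightarrow> bool" where
  "is_wick_power M n F \<longleftrightarrow>
     (\<forall>\<Lambda> p \<beta>. cutoff_set \<Lambda> \<longrightarrow> p \<ge> 1 \<longrightarrow> \<beta> > 0 \<longrightarrow>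
        tendsto_Lp_sobolev M p (- \<beta>) (\<lambda>N z. fourier_coeffs (wick_cutoff M n (dilate N \<Lambda>) z)) F)"

definition is_wick_power_at ::
  "distribution measure \<Rightarrow> nat \<Rightarrow> (real \<times> real \<Rightarrow> real) \<Rightarrow> (distribution \<Rightarrow> real) \<Rightarrow> bool" where
  "is_wick_power_at M n g f \<longleftrightarrow>
     (\<forall>\<Lambda> p. cutoff_set \<Lambda> \<longrightarrow> p \<ge> 1 \<longrightarrow>
        tendsto_Lp M p (\<lambda>N z. inner_H (wick_cutoff M n (dilate N \<Lambda>) z) g) f)"

text \<open>Versions of the Wick exponential: sums, where they exist, of the series in
  \<open>L\<^sup>2(M; H\<^sup>-\<^sup>\<alpha>)\<close> and in \<open>L\<^sup>2(M)\<close>, for versions \<open>\<Phi> n\<close> of the Wick powers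
  and \<open>\<Phi>g n\<close> of their evaluations at \<open>g\<close>.\<close>

definition wick_exp ::
  "distribution measure \<Rightarrow> real \<Rightarrow> (nat \<Rightarrow> distribution \<Rightarrow> distribution) \<Rightarrow> real \<Rightarrow>
   distribution \<Rightarrow> distribution" where
  "wick_exp M \<alpha> \<Phi> a = (SOME W. sums_Lp_sobolev M 2 (- \<alpha>) (\<lambda>n z k. a ^ n / fact n * \<Phi> n z k) W)"

definition wick_exp_at ::
  "distribution measure \<Rightarrow> (nat \<Rightarrow> distribution \<Rightarrow> real) \<Rightarrow> real \<Rightarrow> distribution \<Rightarrow> real" where
  "wick_exp_at M \<Phi>g a = (SOME w. sums_Lp M 2 (\<lambda>n z. a ^ n / fact n * \<Phi>g n z) w)"

end

theory Submission
  imports Defs "HOL-Real_Asymp.Real_Asymp"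
begin

text \<open>The coefficient 1 / (4\<pi>) comes from averaging. Summing by parts along either axis
  bounds the covariance by (1 / 2\<pi>) log (1 / |sin|) in that coordinate alone; the mean of the
  two bounds puts half of the singularity on each coordinate. The exponential kernel is then below a
  product of one-dimensional singularities of exponent \<theta> =
  \<open>b\<^sup>2 / (4 * pi)\<close>, each integrable exactly for \<theta> < 1, which is the
  threshold 4\<pi>. In the norm of H^-\<alpha> the weights are dominated by products of
  one-dimensional weights of exponent \<beta> < \<alpha>, whose kernel adds 1 - \<beta> to the
  exponent, and \<theta> + 1 - \<beta> < 1 can be arranged when \<theta> < \<alpha>. The Gaussian
  hypothesis concerns one linear functional at a time, so the independence of the coordinates, on
  which the tensorisation rests, has to be extracted from characteristic functions. The Wick
  exponential is a chosen sum of its series. Every claim about it therefore goes through an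
  existence proof for that sum, carried out in coordinates and corrected on a null set so that the
  values lie in the Sobolev space everywhere.\<close>

text \<open>The truncated field has covariance \<open>G\<^sub>N(x, y) = \<Sum>\<^sub>k e\<^sub>k(x) e\<^sub>k(y) / (1 + \<bar>k\<bar>\<^sup>2)\<close>, summed over the lattice points
  of \<open>N \<Lambda>\<close>, and Abel summation bounds it from above by
  \<open>- (1 / 4\<pi>) (log \<bar>sin ((x\<^sub>1 - y\<^sub>1) / 2)\<bar> + log \<bar>sin ((x\<^sub>2 - y\<^sub>2) / 2)\<bar>)\<close> plus a constant that does
  not depend on \<open>N\<close>. Since \<open>exp\<^sub>N(az)\<^sub>x exp\<^sub>N(az)\<^sub>y\<close> has expectation \<open>exp (a\<^sup>2 G\<^sub>N(x, y))\<close>, the second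
  moment of the tested Wick exponential is a quadratic form with this kernel, and it stays bounded as
  \<open>N \<rightarrow> \<infinity>\<close> whenever \<open>a\<^sup>2 < 4\<pi>\<close> (test functions in \<open>L\<^sup>2\<close>) or \<open>a\<^sup>2 < 4\<pi>\<alpha>\<close> (norm of \<open>H\<^sup>-\<^sup>\<alpha>\<close>).

  Wick powers of different order are orthogonal, so for \<open>\<bar>a\<bar> < \<bar>b\<bar>\<close> the tail of the series at \<open>a\<close> from order
  \<open>m\<close> on has at most \<open>(a / b)\<^sup>2\<^sup>m\<close> times the second moment of the exponential at \<open>b\<close>. The series
  therefore converges geometrically and uniformly in \<open>N\<close>, which permits the interchange of the two limits.

  For \<open>L\<^sup>p\<close>, Gaussian hypercontractivity bounds the \<open>L\<^sup>p\<close> norm at \<open>a\<close> by the \<open>L\<^sup>2\<close> norm at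
  \<open>a \<surd>(p - 1)\<close>. It is obtained directly for Hilbert norms of Wick exponentials: a two-point inequality
  is tensorised over fair coins, and the central limit theorem passes from coins to Gaussians.\<close>

section \<open>The two-point inequality\<close>

text \<open>The tangent at the mean \<open>m\<close> lies above the concave power at both points,
  and its linear terms cancel in the average. The tangent inequality also covers the argument
  0.\<close>

lemma powr_average_le:
  fixes a b r :: real
  assumes "0 \<le> a" "0 \<le> b" "0 < r" "r \<le> 1"
  shows "(a powr r + b powr r) / 2 \<le> ((a + b) / 2) powr r"
proof (cases "a + b = 0")
  case True
  then have "a = 0" "b = 0" using assms by linarith+
  then show ?thesis using assms by simp
next
  case False
  define m where "m = (a + b) / 2"
  have m: "m > 0" using False assms unfolding m_def by simp
  have tangent: "x powr r \<le> m powr r * (1 + r * (x / m - 1))" if "x \<ge> 0" for x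
  proof -
    have "(x / m) powr r \<le> 1 + r * (x / m - 1)"
    proof (cases "x = 0")
      case True then show ?thesis using assms by simp
    next
      case False
      define y where "y = x / m"
      have y: "y > 0" using False that m unfolding y_def by simp
      \<comment> \<open>Convexity of exp between 0 and \<open>ln y\<close> is Bernoulli's inequality
        for an exponent r at most 1.\<close>
      have "exp ((1 - r) *\<^sub>R 0 + r *\<^sub>R ln y) \<le> (1 - r) * exp 0 + r * exp (ln y)"
        by (rule convex_onD[OF exp_convex]) (use assms in auto)
      then have "y powr r \<le> (1 - r) + r * y" using y by (simp add: powr_def)
      then show ?thesis unfolding y_def[symmetric] by (simp add: algebra_simps)
    qed
    then have "m powr r * (x / m) powr r \<le> m powr r * (1 + r * (x / m - 1))"
      by (intro mult_left_mono) auto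
    then show ?thesis using m that by (simp add: powr_divide)
  qed
  have "a powr r + b powr r \<le> m powr r * (1 + r * (a / m - 1)) + m powr r * (1 + r * (b / m - 1))"
    using tangent[of a] tangent[of b] assms by linarith
  also have "\<dots> = m powr r * (2 + r * ((a + b) / m - 2))"
    by (simp add: algebra_simps add_divide_distrib)
  also have "(a + b) / m = 2" using m unfolding m_def by (simp add: field_simps)
  finally show ?thesis unfolding m_def by simp
qed

text \<open>With G for the left side, the claim reads G^(2/p) \<le> 1 + (p - 1) x^2. Both sides
  agree at 0, so derivatives are compared: G' is controlled by G'' through the mean value theorem,
  and G'' by a power mean inequality.\<close>

lemma two_point_inequality_unit:
  fixes p x :: real
  assumes p: "p \<ge> 2" and x: "0 \<le> x" "x \<le> 1"
  shows "((1 + x) powr p + (1 - x) powr p) / 2 \<le> (1 + (p - 1) * x\<^sup>2) powr (p / 2)"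
proof -
  define G where "G = (\<lambda>x::real. ((1 + x) powr p + (1 - x) powr p) / 2)"
  define G1 where "G1 = (\<lambda>x::real. p / 2 * ((1 + x) powr (p - 1) - (1 - x) powr (p - 1)))"
  define G2 where "G2 = (\<lambda>x::real. p * (p - 1) / 2 * ((1 + x) powr (p - 2) + (1 - x) powr (p - 2)))"
  have dG: "(G has_real_derivative G1 x) (at x)" if "0 \<le> x" "x < 1" for x
    unfolding G_def G1_def using that
    by (auto intro!: derivative_eq_intros simp: field_simps)
  have dG1: "(G1 has_real_derivative G2 x) (at x)" if "0 \<le> x" "x < 1" for x
    unfolding G1_def G2_def using that
    by (auto intro!: derivative_eq_intros simp: field_simps)
  have G1_nonneg: "G1 x \<ge> 0" if "0 \<le> x" "x < 1" for x
  proof -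
    have "(1 - x) powr (p - 1) \<le> (1 + x) powr (p - 1)"
      using that p by (intro powr_mono2) auto
    then show ?thesis unfolding G1_def using p by simp
  qed
  have G_mono: "G s \<le> G t" if "0 \<le> s" "s \<le> t" "t < 1" for s t
  proof (rule DERIV_nonneg_imp_nondecreasing[OF that(2)])
    fix r assume "s \<le> r" "r \<le> t"
    then have "0 \<le> r" "r < 1" using that by auto
    then show "\<exists>y. (G has_real_derivative y) (at r) \<and> 0 \<le> y" using dG G1_nonneg by blast
  qed
  have G0: "G 0 = 1" unfolding G_def by simp
  have G_ge1: "G t \<ge> 1" if "0 \<le> t" "t < 1" for t
    using G_mono[of 0 t] that G0 by simp
  \<comment> \<open>Since \<open>(1 + s) powr (p - 2)\<close> is the power 1 - 2/p of
    \<open>(1 + s) powr p\<close>, concavity compares the average in \<open>G2\<close> with the one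
    in \<open>G\<close>. For p = 2 this exponent is 0 and the estimate is G \<ge> 1.\<close>
  have G2_le: "G2 s \<le> p * (p - 1) * G s powr (1 - 2 / p)" if "0 \<le> s" "s < 1" for s
  proof (cases "p = 2")
    case True
    then show ?thesis using that G_ge1[OF that] unfolding G2_def by simp
  next
    case False
    then have "p > 2" using p by simp
    have "((1 + s) powr (p - 2) + (1 - s) powr (p - 2)) / 2
       = (((1 + s) powr p) powr (1 - 2 / p) + ((1 - s) powr p) powr (1 - 2 / p)) / 2"
      using \<open>p > 2\<close> by (simp add: powr_powr algebra_simps)
    also have "\<dots> \<le> G s powr (1 - 2 / p)"
      unfolding G_def by (rule powr_average_le) (use \<open>p > 2\<close> in \<open>auto simp: field_simps\<close>)
    finally have "p * (p - 1) * (((1 + s) powr (p - 2) + (1 - s) powr (p - 2)) / 2) \<le> p * (p - 1) * G s powr (1 - 2 / p)"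
      using p by (intro mult_left_mono) auto
    then show ?thesis unfolding G2_def by simp
  qed
  have G1_le: "G1 t \<le> p * (p - 1) * t * G t powr (1 - 2 / p)" if "0 \<le> t" "t < 1" for t
  proof (cases "t = 0")
    case True then show ?thesis unfolding G1_def by simp
  next
    case False
    then have "t > 0" using that by simp
    obtain s where s: "0 < s" "s < t" "G1 t - G1 0 = (t - 0) * G2 s"
    proof -
      have t1: "t < 1" by fact
      have "\<exists>z>0. z < t \<and> G1 t - G1 0 = (t - 0) * G2 z"
      proof (rule MVT2[OF \<open>0 < t\<close>])
        fix y assume "0 \<le> y" "y \<le> t"
        then show "(G1 has_real_derivative G2 y) (at y)" using t1 by (intro dG1) auto
      qed
      then show ?thesis using that by blast
    qed
    have "G1 t = t * G2 s" using s(3) unfolding G1_def by simp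
    also have "\<dots> \<le> t * (p * (p - 1) * G s powr (1 - 2 / p))"
      using G2_le[of s] s that by (intro mult_left_mono) auto
    also have "\<dots> \<le> t * (p * (p - 1) * G t powr (1 - 2 / p))"
      using s that p G_ge1[of s] G_mono[of s t] \<open>t > 0\<close>
      by (intro mult_left_mono powr_mono2) auto
    finally show ?thesis by (simp add: mult_ac)
  qed
  define D where "D = (\<lambda>x. 1 + (p - 1) * x\<^sup>2 - G x powr (2 / p))"
  have D_nonneg: "D t \<ge> 0" if "0 \<le> t" "t < 1" for t
  proof -
    have "D 0 \<le> D t"
    proof (rule DERIV_nonneg_imp_nondecreasing[OF that(1)])
      fix s assume s: "0 \<le> s" "s \<le> t"
      then have s1: "s < 1" using that by simp
      have Gpos: "G s > 0" using G_ge1[OF s(1) s1] by simp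
      have "(D has_real_derivative (p - 1) * (2 * s) - 2 / p * G s powr (2 / p - 1) * G1 s) (at s)"
      proof -
        have "((\<lambda>x. G x powr (2 / p)) has_real_derivative (2 / p * G s powr (2 / p - 1)) * G1 s) (at s)"
          by (rule DERIV_chain2[OF has_real_derivative_powr[OF Gpos] dG[OF s(1) s1]])
        moreover have "((\<lambda>x. 1 + (p - 1) * x\<^sup>2) has_real_derivative (p - 1) * (2 * s)) (at s)"
          by (auto intro!: derivative_eq_intros)
        ultimately show ?thesis unfolding D_def by (intro DERIV_diff)
      qed
      moreover have "2 / p * G s powr (2 / p - 1) * G1 s \<le> (p - 1) * (2 * s)"
      proof -
        have "2 / p * G s powr (2 / p - 1) * G1 s \<le> 2 / p * G s powr (2 / p - 1) * (p * (p - 1) * s * G s powr (1 - 2 / p))"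
          by (rule mult_left_mono[OF G1_le[OF s(1) s1]]) (use p in simp)
        also have "\<dots> = (p - 1) * (2 * s) * (G s powr (2 / p - 1) * G s powr (1 - 2 / p))"
          using p by simp
        also have "G s powr (2 / p - 1) * G s powr (1 - 2 / p) = 1"
          using Gpos by (simp add: powr_add[symmetric])
        finally show ?thesis by simp
      qed
      ultimately show "\<exists>y. (D has_real_derivative y) (at s) \<and> 0 \<le> y" by (intro exI conjI) auto
    qed
    then show ?thesis unfolding D_def using G0 by simp
  qed
  have main: "G t \<le> (1 + (p - 1) * t\<^sup>2) powr (p / 2)" if "0 \<le> t" "t < 1" for t
  proof -
    have "G t = (G t powr (2 / p)) powr (p / 2)" using G_ge1[OF that] p by (simp add: powr_powr)
    also have "\<dots> \<le> (1 + (p - 1) * t\<^sup>2) powr (p / 2)"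
      using D_nonneg[OF that] p unfolding D_def by (intro powr_mono2) auto
    finally show ?thesis .
  qed
  show ?thesis
  proof (cases "x < 1")
    case True
    then show ?thesis using main[of x] x unfolding G_def by simp
  next
    case False
    then have x1: "x = 1" using x by simp
    \<comment> \<open>At x = 1 the base 1 - x vanishes, outside the range of the derivative
      computations; the endpoint follows by left continuity.\<close>
    have "G 1 \<le> (1 + (p - 1) * 1\<^sup>2) powr (p / 2)"
    proof (rule tendsto_le[of "at_left (1::real)"])
      show "(G \<longlongrightarrow> G 1) (at_left 1)" unfolding G_def using p
        by (intro tendsto_intros tendsto_powr') (simp_all add: eventually_at_left_field exI[of _ 0])
      have "isCont (\<lambda>t. (1 + (p - 1) * t\<^sup>2) powr (p / 2)) 1"
        using p by (intro continuous_intros) auto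
      then show "((\<lambda>t. (1 + (p - 1) * t\<^sup>2) powr (p / 2)) \<longlongrightarrow> (1 + (p - 1) * 1\<^sup>2) powr (p / 2)) (at_left 1)"
        by (simp add: isCont_def filterlim_at_split)
      show "\<forall>\<^sub>F t in at_left 1. G t \<le> (1 + (p - 1) * t\<^sup>2) powr (p / 2)"
        by (rule eventually_at_leftI[of 0]) (auto intro!: main)
    qed simp
    then show ?thesis using x1 unfolding G_def by simp
  qed
qed

text \<open>By homogeneity only the ratio matters, and it may be taken at most 1. If v > u the roles
  are exchanged on the left, and the right side only increases because p - 1 \<ge> 1.\<close>

lemma two_point_inequality:
  fixes p u v :: real
  assumes p: "p \<ge> 2" and uv: "0 \<le> u" "0 \<le> v"
  shows "((u + v) powr p + \<bar>u - v\<bar> powr p) / 2 \<le> (u\<^sup>2 + (p - 1) * v\<^sup>2) powr (p / 2)"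
proof -
  have hom: "((a + b) powr p + (a - b) powr p) / 2 \<le> (a\<^sup>2 + (p - 1) * b\<^sup>2) powr (p / 2)"
    if "0 \<le> b" "b \<le> a" for a b :: real
  proof (cases "a = 0")
    case True then show ?thesis using that p by simp
  next
    case False
    then have a: "a > 0" using that by simp
    have eq: "a + b = a * (1 + b / a)" "a - b = a * (1 - b / a)" "a\<^sup>2 + (p - 1) * b\<^sup>2 = a\<^sup>2 * (1 + (p - 1) * (b / a)\<^sup>2)"
      using a by (auto simp: field_simps power2_eq_square)
    have ba: "0 \<le> b / a" "b / a \<le> 1" using a that by auto
    have "((a + b) powr p + (a - b) powr p) / 2 = a powr p * (((1 + b / a) powr p + (1 - b / a) powr p) / 2)"
      unfolding eq(1,2) using powr_mult[of a "1 + b / a" p] powr_mult[of a "1 - b / a" p] a ba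
      by (simp only: distrib_left add_divide_distrib times_divide_eq_right)
    also have "\<dots> \<le> a powr p * (1 + (p - 1) * (b / a)\<^sup>2) powr (p / 2)"
      by (intro mult_left_mono two_point_inequality_unit ba p) auto
    also have "a powr p = (a\<^sup>2) powr (p / 2)" using a by (simp add: powr_powr flip: powr_numeral)
    also have "(a\<^sup>2) powr (p / 2) * (1 + (p - 1) * (b / a)\<^sup>2) powr (p / 2) = (a\<^sup>2 + (p - 1) * b\<^sup>2) powr (p / 2)"
      unfolding eq(3) using p by (subst powr_mult) auto
    finally show ?thesis .
  qed
  show ?thesis
  proof (cases "v \<le> u")
    case True then show ?thesis using hom[of v u] uv by simp
  next
    case False
    then have uv': "u \<le> v" by simp
    have "u\<^sup>2 \<le> v\<^sup>2" using uv uv' by (simp add: power_mono)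
    then have "0 \<le> (p - 2) * (v\<^sup>2 - u\<^sup>2)" using p by (intro mult_nonneg_nonneg) auto
    then have le: "v\<^sup>2 + (p - 1) * u\<^sup>2 \<le> u\<^sup>2 + (p - 1) * v\<^sup>2" by (simp add: algebra_simps)
    have "((u + v) powr p + \<bar>u - v\<bar> powr p) / 2 \<le> (v\<^sup>2 + (p - 1) * u\<^sup>2) powr (p / 2)"
      using hom[of u v] uv uv' by (simp add: add.commute)
    also have "\<dots> \<le> (u\<^sup>2 + (p - 1) * v\<^sup>2) powr (p / 2)"
      using le p by (intro powr_mono2) auto
    finally show ?thesis .
  qed
qed

text \<open>\<open>A + B\<close> and \<open>A - B\<close> are convex combinations of
  \<open>A + C\<close> and \<open>A - C\<close>, with the weights t and 1 - t exchanged; the two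
  convexity inequalities are added.\<close>

lemma powr_convex_pair:
  fixes A B C q :: real
  assumes q: "q \<ge> 1" and B: "\<bar>B\<bar> \<le> C" "C \<le> A"
  shows "(A + B) powr q + (A - B) powr q \<le> (A + C) powr q + (A - C) powr q"
proof (cases "C = 0")
  case True then show ?thesis using B by simp
next
  case False
  then have C: "C > 0" using B by linarith
  define t where "t = (1 + B / C) / 2"
  have "-1 \<le> B / C" "B / C \<le> 1" using B C by (auto simp: field_simps abs_le_iff)
  then have t: "0 \<le> t" "t \<le> 1" unfolding t_def by auto
  have cvx: "(s * x + (1 - s) * y) powr q \<le> s * x powr q + (1 - s) * y powr q"
    if "0 \<le> s" "s \<le> 1" "x \<ge> 0" "y \<ge> 0" for s x y :: real
  proof -
    \<comment> \<open>Convexity is applied at the positive points x + e and y + e, and e tends to 0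
      to include vanishing arguments.\<close>
    have lim: "((\<lambda>e. s * (x + e) powr q + (1 - s) * (y + e) powr q - (s * (x + e) + (1 - s) * (y + e)) powr q)
       \<longlongrightarrow> s * (x + 0) powr q + (1 - s) * (y + 0) powr q - (s * (x + 0) + (1 - s) * (y + 0)) powr q) (at_right 0)"
      using q that by (intro tendsto_intros tendsto_powr') (auto intro!: eventually_at_rightI[of 0 1])
    have "0 \<le> s * (x + 0) powr q + (1 - s) * (y + 0) powr q - (s * (x + 0) + (1 - s) * (y + 0)) powr q"
    proof (rule tendsto_lowerbound[OF lim])
      show "\<forall>\<^sub>F e in at_right 0. 0 \<le> s * (x + e) powr q + (1 - s) * (y + e) powr q - (s * (x + e) + (1 - s) * (y + e)) powr q"
      proof (rule eventually_at_rightI[of 0 1])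
        fix e :: real assume e: "e \<in> {0<..<1}"
        have "((1 - s) *\<^sub>R (y + e) + s *\<^sub>R (x + e)) powr q \<le> (1 - s) * (y + e) powr q + s * (x + e) powr q"
          by (rule convex_onD[OF powr_convex[OF q]]) (use e that in auto)
        then show "0 \<le> s * (x + e) powr q + (1 - s) * (y + e) powr q - (s * (x + e) + (1 - s) * (y + e)) powr q"
          by (simp add: add.commute)
      qed simp
    qed simp
    then show ?thesis by simp
  qed
  have 1: "A + B = t * (A + C) + (1 - t) * (A - C)" "A - B = (1 - t) * (A + C) + (1 - (1 - t)) * (A - C)"
    unfolding t_def using C by (auto simp: field_simps)
  have "(A + B) powr q \<le> t * (A + C) powr q + (1 - t) * (A - C) powr q"
    unfolding 1(1) by (rule cvx) (use t B C in auto)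
  moreover have "(A - B) powr q \<le> (1 - t) * (A + C) powr q + (1 - (1 - t)) * (A - C) powr q"
    unfolding 1(2) by (rule cvx) (use t B C in auto)
  ultimately have "(A + B) powr q + (A - B) powr q \<le> (t * (A + C) powr q + (1 - t) * (A - C) powr q)
      + ((1 - t) * (A + C) powr q + (1 - (1 - t)) * (A - C) powr q)" by (rule add_mono)
  also have "\<dots> = (A + C) powr q + (A - C) powr q" by (simp add: left_diff_distrib)
  finally show ?thesis .
qed

text \<open>U and V play the squared norms of two Hilbert vectors and W twice their inner product.
  For fixed norms the left side is largest for parallel vectors, by \<open>powr_convex_pair\<close>,
  and that case is the scalar inequality with p = 2 q. So the scalar constant survives for Hilbert
  norms.\<close>

lemma two_point_inequality_Gram:
  fixes U V W q :: real
  assumes q: "q \<ge> 1" and U: "U \<ge> 0" and V: "V \<ge> 0" and W: "W\<^sup>2 \<le> 4 * U * V"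
  shows "((U + W + V) powr q + (U - W + V) powr q) / 2 \<le> (U + (2 * q - 1) * V) powr q"
proof -
  define u v where "u = sqrt U" and "v = sqrt V"
  have uv: "u \<ge> 0" "v \<ge> 0" "U = u\<^sup>2" "V = v\<^sup>2" unfolding u_def v_def using U V by auto
  have "W\<^sup>2 \<le> (2 * u * v)\<^sup>2" using W unfolding uv(3,4) by (simp add: power_mult_distrib)
  then have Wle: "\<bar>W\<bar> \<le> 2 * u * v" using uv(1,2) abs_le_square_iff[of W "2 * u * v"] by simp
  have assoc: "U + W + V = (U + V) + W" "U - W + V = (U + V) - W" by simp_all
  have "((U + V) + W) powr q + ((U + V) - W) powr q \<le> ((U + V) + 2 * u * v) powr q + ((U + V) - 2 * u * v) powr q"
    using sum_squares_bound[of u v] unfolding uv(3,4) by (intro powr_convex_pair q Wle)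
  also have "(U + V) + 2 * u * v = (u + v)\<^sup>2"
    unfolding uv(3,4) by (simp add: power2_eq_square algebra_simps)
  also have "(U + V) - 2 * u * v = \<bar>u - v\<bar>\<^sup>2"
    unfolding uv(3,4) by (simp add: power2_eq_square algebra_simps)
  also have "((u + v)\<^sup>2) powr q = (u + v) powr (2 * q)"
    using uv(1,2) powr_powr[of "u + v" 2 q] by simp
  also have "(\<bar>u - v\<bar>\<^sup>2) powr q = \<bar>u - v\<bar> powr (2 * q)"
    using powr_powr[of "\<bar>u - v\<bar>" 2 q] by simp
  finally have "((U + W + V) powr q + (U - W + V) powr q) / 2 \<le> ((u + v) powr (2 * q) + \<bar>u - v\<bar> powr (2 * q)) / 2"
    unfolding assoc by (rule divide_right_mono) simp
  also have "\<dots> \<le> (u\<^sup>2 + (2 * q - 1) * v\<^sup>2) powr (2 * q / 2)"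
    using q uv(1,2) by (intro two_point_inequality) auto
  finally show ?thesis unfolding uv(3,4) by simp
qed

section \<open>Lattice sums\<close>

lemma Abel_summation_bound:
  fixes h c :: "nat \<Rightarrow> real"
  assumes dec: "\<And>k. A \<le> k \<Longrightarrow> h (Suc k) \<le> h k" and nonneg: "\<And>k. h k \<ge> 0"
    and B: "\<And>n. \<bar>\<Sum>k=A..<n. c k\<bar> \<le> B"
  shows "\<bar>\<Sum>k=A..<n. h k * c k\<bar> \<le> h A * B"
proof (cases "A \<le> n")
  case False
  then show ?thesis using nonneg[of A] B[of 0] by simp
next
  case True
  \<comment> \<open>Summation by parts with the boundary term moved to the left: each step adds
    \<open>h n - h (Suc n)\<close> times a partial sum, and these bounds telescope.\<close>
  have "\<bar>(\<Sum>k=A..<n. h k * c k) - h n * (\<Sum>k=A..<n. c k)\<bar> \<le> (h A - h n) * B"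
    using True
  proof (induction n rule: dec_induct)
    case base
    then show ?case by simp
  next
    case (step n)
    have "(\<Sum>k=A..<Suc n. h k * c k) - h (Suc n) * (\<Sum>k=A..<Suc n. c k)
        = ((\<Sum>k=A..<n. h k * c k) - h n * (\<Sum>k=A..<n. c k)) + (h n - h (Suc n)) * (\<Sum>k=A..<Suc n. c k)"
      using step.hyps by (simp add: algebra_simps)
    also have "\<bar>\<dots>\<bar> \<le> (h A - h n) * B + (h n - h (Suc n)) * B"
    proof (rule order_trans[OF abs_triangle_ineq add_mono])
      show "\<bar>(h n - h (Suc n)) * (\<Sum>k=A..<Suc n. c k)\<bar> \<le> (h n - h (Suc n)) * B"
        using dec[OF step.hyps(1)] mult_left_mono[OF B[of "Suc n"], of "h n - h (Suc n)"]
        by (simp add: abs_mult)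
    qed (rule step.IH)
    finally show ?case by (simp add: algebra_simps)
  qed
  moreover have "\<bar>h n * (\<Sum>k=A..<n. c k)\<bar> \<le> h n * B"
    using mult_left_mono[OF B[of n] nonneg[of n]] nonneg[of n] by (simp add: abs_mult)
  ultimately have "\<bar>\<Sum>k=A..<n. h k * c k\<bar> \<le> (h A - h n) * B + h n * B" by linarith
  then show ?thesis by (simp add: left_diff_distrib)
qed

text \<open>Multiplication by 2 sin (t / 2) telescopes the sum. The bound does not involve the
  starting index A, so Abel summation may begin at any frequency.\<close>

lemma cos_sum_bound:
  fixes t :: real
  assumes "sin (t / 2) \<noteq> 0"
  shows "\<bar>\<Sum>k=A..<n. cos (real k * t)\<bar> \<le> 1 / \<bar>sin (t / 2)\<bar>"
proof (cases "A \<le> n")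
  case False
  then show ?thesis by simp
next
  case True
  have "2 * sin (t / 2) * (\<Sum>k=A..<n. cos (real k * t)) = sin ((real n - 1 / 2) * t) - sin ((real A - 1 / 2) * t)"
    using True
  proof (induction n rule: dec_induct)
    case base
    then show ?case by simp
  next
    case (step n)
    have e: "(real (Suc n) - 1 / 2) * t = real n * t + t / 2" "(real n - 1 / 2) * t = real n * t - t / 2"
      by (auto simp: algebra_simps)
    have "2 * sin (t / 2) * cos (real n * t) = sin ((real (Suc n) - 1 / 2) * t) - sin ((real n - 1 / 2) * t)"
      unfolding e by (simp add: sin_add sin_diff)
    then show ?case using step by (simp add: distrib_left)
  qed
  also have "\<bar>\<dots>\<bar> \<le> 2"
    using abs_sin_le_one[of "(real n - 1 / 2) * t"] abs_sin_le_one[of "(real A - 1 / 2) * t"] by linarith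
  finally have "\<bar>sin (t / 2)\<bar> * \<bar>\<Sum>k=A..<n. cos (real k * t)\<bar> \<le> 1" by (simp add: abs_mult)
  then show ?thesis using assms by (simp add: field_simps)
qed

lemma sum_symmetric_interval:
  fixes f :: "int \<Rightarrow> real"
  assumes "\<And>k. f (- k) = f k"
  shows "(\<Sum>k\<in>{- int m..int m}. f k) = f 0 + 2 * (\<Sum>k=1..<Suc m. f (int k))"
proof (induction m)
  case 0
  then show ?case by simp
next
  case (Suc m)
  have "{- int (Suc m)..int (Suc m)} = insert (- int (Suc m)) (insert (int (Suc m)) {- int m..int m})" by auto
  then have "(\<Sum>k\<in>{- int (Suc m)..int (Suc m)}. f k) = f (- int (Suc m)) + (f (int (Suc m)) + (\<Sum>k\<in>{- int m..int m}. f k))"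
    by simp
  then show ?case using Suc assms[of "int (Suc m)"] by simp
qed

lemma sum_reflect_interval:
  fixes f :: "int \<Rightarrow> real"
  shows "(\<Sum>k\<in>{- int m..int m}. f (- k)) = (\<Sum>k\<in>{- int m..int m}. f k)"
  by (rule sum.reindex_bij_witness[of _ uminus uminus]) auto

text \<open>Comparison with the integral of 1 / (A^2 + x^2), whose primitive arctan (x / A) / A
  stays below pi / (2 A).\<close>

lemma sum_inverse_square_shift:
  fixes A :: real
  assumes A: "A > 0"
  shows "(\<Sum>k\<in>{- int m..int m}. 1 / (A\<^sup>2 + (of_int k)\<^sup>2)) \<le> 1 / A\<^sup>2 + pi / A"
proof -
  have step: "1 / (A\<^sup>2 + (real (Suc k))\<^sup>2) \<le> (arctan (real (Suc k) / A) - arctan (real k / A)) / A" for k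
  proof -
    obtain z where z: "real k / A < z" "z < real (Suc k) / A"
       "arctan (real (Suc k) / A) - arctan (real k / A) = (real (Suc k) / A - real k / A) * inverse (1 + z\<^sup>2)"
      using MVT2[of "real k / A" "real (Suc k) / A" arctan "\<lambda>z. inverse (1 + z\<^sup>2)"] A
      by (auto simp: divide_strict_right_mono intro: DERIV_arctan)
    have z0: "0 \<le> z" using z(1) A by (smt (verit) divide_nonneg_pos of_nat_0_le_iff)
    have "(A * z)\<^sup>2 \<le> (real (Suc k))\<^sup>2"
      using z z0 A by (intro power_mono) (auto simp: field_simps)
    then have "1 / (A\<^sup>2 + (real (Suc k))\<^sup>2) \<le> 1 / (A\<^sup>2 + (A * z)\<^sup>2)"
      using A by (intro divide_left_mono mult_pos_pos add_pos_nonneg) auto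
    also have "\<dots> = (1 / A * inverse (1 + z\<^sup>2)) / A"
      using A by (simp add: power2_eq_square field_simps)
    also have "1 / A * inverse (1 + z\<^sup>2) = arctan (real (Suc k) / A) - arctan (real k / A)"
      unfolding z(3) by (simp add: diff_divide_distrib[symmetric])
    finally show ?thesis .
  qed
  have "(\<Sum>k=1..<Suc m. 1 / (A\<^sup>2 + (real k)\<^sup>2)) \<le> arctan (real m / A) / A"
  proof (induction m)
    case (Suc m)
    then show ?case using step[of m] by (simp add: diff_divide_distrib)
  qed simp
  also have "\<dots> \<le> (pi / 2) / A"
    using arctan_bounded[of "real m / A"] A by (intro divide_right_mono) auto
  finally have "(\<Sum>k=1..<Suc m. 1 / (A\<^sup>2 + (real k)\<^sup>2)) \<le> pi / 2 / A" .
  then show ?thesis by (subst sum_symmetric_interval) (auto simp: field_simps)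
qed

text \<open>The shift is A = sqrt (1 + j^2), replaced by j for j > 0. The leading part pi / j,
  summed over j, produces the logarithms below.\<close>

lemma sum_bracket2_row:
  "(\<Sum>l\<in>{- int m..int m}. 1 / bracket2 (int j, l)) \<le> (if j = 0 then 1 + pi else 1 / (real j)\<^sup>2 + pi / real j)"
proof -
  have *: "(\<Sum>l\<in>{- int m..int m}. 1 / bracket2 (int j, l)) = (\<Sum>l\<in>{- int m..int m}. 1 / ((sqrt (1 + (real j)\<^sup>2))\<^sup>2 + (of_int l)\<^sup>2))"
    unfolding bracket2_def by (intro sum.cong) auto
  have pos: "sqrt (1 + (real j)\<^sup>2) > 0" by (simp add: add_pos_nonneg)
  have "(\<Sum>l\<in>{- int m..int m}. 1 / bracket2 (int j, l)) \<le> 1 / (1 + (real j)\<^sup>2) + pi / sqrt (1 + (real j)\<^sup>2)"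
    unfolding * using sum_inverse_square_shift[OF pos, of m] by simp
  also have "\<dots> \<le> (if j = 0 then 1 + pi else 1 / (real j)\<^sup>2 + pi / real j)"
  proof (cases "j = 0")
    case False
    have "real j \<le> sqrt (1 + (real j)\<^sup>2)" by (rule real_le_rsqrt) simp
    then show ?thesis using False
      by (auto intro!: add_mono divide_left_mono mult_pos_pos add_pos_nonneg)
  qed simp
  finally show ?thesis .
qed

lemma sum_inverse_le_ln:
  assumes "1 \<le> m" "m \<le> n"
  shows "(\<Sum>j=m..<Suc n. 1 / real j) \<le> 1 + ln (real n / real m)"
  using assms(2)
proof (induction n rule: dec_induct)
  case base
  then show ?case using assms by simp
next
  case (step n)
  have n: "n \<ge> 1" using step assms by linarith
  have "ln (real n / real (Suc n)) \<le> real n / real (Suc n) - 1" using n by (intro ln_le_minus_one) auto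
  also have "\<dots> = - (1 / real (Suc n))" by (simp add: field_simps)
  finally have "1 / real (Suc n) \<le> ln (real (Suc n)) - ln (real n)" using n by (simp add: ln_div)
  then show ?case using step n assms by (simp add: ln_div)
qed

lemma sum_inverse_square_le: "(\<Sum>j=1..<Suc n. 1 / (real j)\<^sup>2) \<le> 2"
proof -
  have bound: "(\<Sum>j=1..<Suc (Suc n). 1 / (real j)\<^sup>2) \<le> 2 - 1 / real (Suc n)" for n
  proof (induction n)
    case (Suc n)
    have "1 / (real (Suc (Suc n)))\<^sup>2 \<le> 1 / (real (Suc n) * real (Suc (Suc n)))"
      unfolding power2_eq_square by (intro divide_left_mono mult_right_mono mult_pos_pos) auto
    also have "\<dots> = 1 / real (Suc n) - 1 / real (Suc (Suc n))" by (simp add: field_simps)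
    finally show ?case using Suc by simp
  qed simp
  show ?thesis
  proof (cases n)
    case (Suc k)
    then show ?thesis using bound[of k] by (smt (verit) divide_nonneg_nonneg of_nat_0_le_iff)
  qed simp
qed

text \<open>The bound is uniform in the length m of the strip. Its leading term 2 pi ln L, divided
  by 4 pi^2 in the covariance, is the source of the coefficient 1 / (2 pi) of the logarithmic
  singularity.\<close>

lemma strip_sum_le:
  assumes "1 \<le> L"
  shows "(\<Sum>l\<in>{- int m..int m}. \<Sum>k\<in>{- int L..int L}. 1 / bracket2 (k, l)) \<le> 5 + 3 * pi + 2 * pi * ln (real L)"
proof -
  have "(\<Sum>l\<in>{- int m..int m}. \<Sum>k\<in>{- int L..int L}. 1 / bracket2 (k, l))
     = (\<Sum>k\<in>{- int L..int L}. \<Sum>l\<in>{- int m..int m}. 1 / bracket2 (k, l))" by (rule sum.swap)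
  also have "\<dots> = (\<Sum>l\<in>{- int m..int m}. 1 / bracket2 (0, l)) + 2 * (\<Sum>j=1..<Suc L. \<Sum>l\<in>{- int m..int m}. 1 / bracket2 (int j, l))"
    by (rule sum_symmetric_interval) (simp add: bracket2_def)
  also have "\<dots> \<le> (1 + pi) + 2 * (\<Sum>j=1..<Suc L. 1 / (real j)\<^sup>2 + pi * (1 / real j))"
    using sum_bracket2_row[of 0 m]
    by (intro add_mono mult_left_mono sum_mono order_trans[OF sum_bracket2_row]) auto
  also have "\<dots> = (1 + pi) + 2 * ((\<Sum>j=1..<Suc L. 1 / (real j)\<^sup>2) + pi * (\<Sum>j=1..<Suc L. 1 / real j))"
    by (simp add: sum.distrib sum_distrib_left del: sum.op_ivl_Suc)
  also have "\<dots> \<le> (1 + pi) + 2 * (2 + pi * (1 + ln (real L / real 1)))"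
    using sum_inverse_le_ln[of 1 L] assms
    by (intro add_mono mult_left_mono sum_inverse_square_le) auto
  also have "\<dots> = 5 + 3 * pi + 2 * pi * ln (real L)" by (simp add: algebra_simps)
  finally show ?thesis .
qed

definition lattice_box :: "nat \<Rightarrow> (int \<times> int) set" where
  "lattice_box m = {- int m..int m} \<times> {- int m..int m}"

lemma finite_lattice_box [simp]: "finite (lattice_box m)"
  unfolding lattice_box_def by simp

lemma bracket2_ge1: "bracket2 k \<ge> 1"
  unfolding bracket2_def by simp

lemma bracket2_pos: "bracket2 k > 0"
  using bracket2_ge1[of k] by linarith

text \<open>The square annulus is covered by a vertical and a horizontal pair of strips with equal
  sums. The harmonic sum from m + 1 to n is at most 1 + ln \<kappa>: only the ratio of the sizes
  enters, so the bound is uniform in scale.\<close>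

lemma annulus_sum_le:
  assumes n: "real n \<le> \<kappa> * (real m + 1)" and \<kappa>: "\<kappa> \<ge> 1"
  shows "(\<Sum>k\<in>lattice_box n - lattice_box m. 1 / bracket2 k) \<le> 8 + 4 * pi * (1 + ln \<kappa>)"
proof -
  define A where "A = {k \<in> lattice_box n. \<bar>fst k\<bar> > int m}"
  define B where "B = {k \<in> lattice_box n. \<bar>snd k\<bar> > int m}"
  have strip: "(\<Sum>k\<in>A. 1 / bracket2 k) \<le> 4 + 2 * pi * (1 + ln \<kappa>)"
  proof (cases "m < n")
    case False
    then have "A = {}" unfolding A_def lattice_box_def by force
    then show ?thesis using \<kappa> by simp
  next
    case True
    have A_eq: "A = {k \<in> {- int n..int n}. \<bar>k\<bar> > int m} \<times> {- int n..int n}"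
      unfolding A_def lattice_box_def by auto
    have "(\<Sum>k\<in>A. 1 / bracket2 k) = (\<Sum>k\<in>{k \<in> {- int n..int n}. \<bar>k\<bar> > int m}. \<Sum>l\<in>{- int n..int n}. 1 / bracket2 (k, l))"
      unfolding A_eq by (subst sum.cartesian_product) (auto intro: sum.cong)
    also have "\<dots> = (\<Sum>k\<in>{- int n..int n}. if \<bar>k\<bar> > int m then \<Sum>l\<in>{- int n..int n}. 1 / bracket2 (k, l) else 0)"
      by (subst sum.inter_filter) auto
    also have "\<dots> = 2 * (\<Sum>j=1..<Suc n. if \<bar>int j\<bar> > int m then \<Sum>l\<in>{- int n..int n}. 1 / bracket2 (int j, l) else 0)"
      by (subst sum_symmetric_interval) (auto simp: bracket2_def)
    also have "(\<Sum>j=1..<Suc n. if \<bar>int j\<bar> > int m then \<Sum>l\<in>{- int n..int n}. 1 / bracket2 (int j, l) else 0)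
       = (\<Sum>j=Suc m..<Suc n. \<Sum>l\<in>{- int n..int n}. 1 / bracket2 (int j, l))"
    proof -
      have "{x \<in> {1..<Suc n}. int m < \<bar>int x\<bar>} = {Suc m..<Suc n}" by auto
      then show ?thesis by (subst sum.inter_filter[symmetric]) (simp_all only: finite_atLeastLessThan)
    qed
    also have "\<dots> \<le> (\<Sum>j=Suc m..<Suc n. 1 / (real j)\<^sup>2 + pi * (1 / real j))"
      by (intro sum_mono order_trans[OF sum_bracket2_row]) auto
    also have "\<dots> = (\<Sum>j=Suc m..<Suc n. 1 / (real j)\<^sup>2) + pi * (\<Sum>j=Suc m..<Suc n. 1 / real j)"
      by (simp add: sum.distrib sum_distrib_left del: sum.op_ivl_Suc)
    also have "(\<Sum>j=Suc m..<Suc n. 1 / (real j)\<^sup>2) \<le> (\<Sum>j=1..<Suc n. 1 / (real j)\<^sup>2)"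
      by (rule sum_mono2) auto
    also have "\<dots> \<le> 2" by (rule sum_inverse_square_le)
    also have "(\<Sum>j=Suc m..<Suc n. 1 / real j) \<le> 1 + ln (real n / real (Suc m))"
      using True by (intro sum_inverse_le_ln) auto
    also have "ln (real n / real (Suc m)) \<le> ln \<kappa>"
      using True n \<kappa> by (intro ln_mono) (auto simp: field_simps)
    finally show ?thesis by simp
  qed
  have "(\<Sum>k\<in>B. 1 / bracket2 k) = (\<Sum>k\<in>A. 1 / bracket2 k)"
    by (rule sum.reindex_bij_witness[of _ prod.swap prod.swap])
      (auto simp: A_def B_def lattice_box_def bracket2_def add_ac)
  moreover have "(\<Sum>k\<in>lattice_box n - lattice_box m. 1 / bracket2 k) \<le> (\<Sum>k\<in>A. 1 / bracket2 k) + (\<Sum>k\<in>B. 1 / bracket2 k)"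
  proof -
    have fin: "finite A" "finite B" unfolding A_def B_def by auto
    have "lattice_box n - lattice_box m \<subseteq> A \<union> B" unfolding A_def B_def lattice_box_def by auto
    then have "(\<Sum>k\<in>lattice_box n - lattice_box m. 1 / bracket2 k) \<le> (\<Sum>k\<in>A \<union> B. 1 / bracket2 k)"
      using fin bracket2_pos by (intro sum_mono2) (auto simp: less_imp_le)
    also have "\<dots> \<le> (\<Sum>k\<in>A. 1 / bracket2 k) + (\<Sum>k\<in>B. 1 / bracket2 k)"
      using fin bracket2_pos by (subst sum_Un) (auto intro!: sum_nonneg simp: less_imp_le)
    finally show ?thesis .
  qed
  ultimately show ?thesis using strip by simp
qed

text \<open>Averaging over k and - k removes the sine part of cos (k t + b), and only the phase
  factor cos b remains.\<close>

lemma cos_interval_sum: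
  fixes D :: "int \<Rightarrow> real"
  assumes even: "\<And>k. D (- k) = D k"
  shows "(\<Sum>k\<in>{- int m..int m}. cos (of_int k * t + b) * D k) = cos b * (D 0 + 2 * (\<Sum>k=1..<Suc m. D (int k) * cos (real k * t)))"
proof -
  have "2 * (\<Sum>k\<in>{- int m..int m}. cos (of_int k * t + b) * D k)
     = (\<Sum>k\<in>{- int m..int m}. cos (of_int k * t + b) * D k) + (\<Sum>k\<in>{- int m..int m}. cos (of_int (- k) * t + b) * D (- k))"
    using sum_reflect_interval[of "\<lambda>k. cos (of_int k * t + b) * D k"] by simp
  also have "\<dots> = (\<Sum>k\<in>{- int m..int m}. 2 * cos b * (D k * cos (of_int k * t)))"
    unfolding sum.distrib[symmetric] by (intro sum.cong refl) (simp add: even cos_add cos_diff algebra_simps)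
  also have "\<dots> = 2 * cos b * (\<Sum>k\<in>{- int m..int m}. D k * cos (of_int k * t))" by (simp add: sum_distrib_left)
  also have "(\<Sum>k\<in>{- int m..int m}. D k * cos (of_int k * t)) = D 0 + 2 * (\<Sum>k=1..<Suc m. D (int k) * cos (real k * t))"
    by (subst sum_symmetric_interval) (auto simp: even)
  finally show ?thesis by simp
qed

text \<open>Frequencies up to L are bounded by absolute values and the others by Abel summation. L
  is free; it will be taken of the order of 1 / |sin (t / 2)|.\<close>

lemma cos_sum_split_bound:
  fixes D :: "nat \<Rightarrow> real"
  assumes s: "sin (t / 2) \<noteq> 0" and dec: "\<And>k. D (Suc k) \<le> D k" and nonneg: "\<And>k. D k \<ge> 0"
  shows "\<bar>\<Sum>k=1..<Suc m. D k * cos (real k * t)\<bar> \<le> (\<Sum>k=1..<Suc L. D k) + D (Suc L) * (1 / \<bar>sin (t / 2)\<bar>)"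
proof -
  have first: "\<bar>\<Sum>k=1..<Suc n. D k * cos (real k * t)\<bar> \<le> (\<Sum>k=1..<Suc L. D k)" if "n \<le> L" for n
  proof -
    have "\<bar>\<Sum>k=1..<Suc n. D k * cos (real k * t)\<bar> \<le> (\<Sum>k=1..<Suc n. \<bar>D k * cos (real k * t)\<bar>)" by (rule sum_abs)
    also have "\<dots> \<le> (\<Sum>k=1..<Suc n. D k)"
      by (intro sum_mono) (use nonneg in \<open>simp add: abs_mult mult_left_le\<close>)
    also have "\<dots> \<le> (\<Sum>k=1..<Suc L. D k)" using that nonneg by (intro sum_mono2) auto
    finally show ?thesis .
  qed
  show ?thesis
  proof (cases "m \<le> L")
    case True
    then show ?thesis using first[OF True] nonneg[of "Suc L"] by (smt (verit) divide_nonneg_nonneg mult_nonneg_nonneg abs_ge_zero)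
  next
    case False
    have "(\<Sum>k=1..<Suc m. D k * cos (real k * t)) = (\<Sum>k=1..<Suc L. D k * cos (real k * t)) + (\<Sum>k=Suc L..<Suc m. D k * cos (real k * t))"
      using False by (subst sum.atLeastLessThan_concat) auto
    moreover have "\<bar>\<Sum>k=Suc L..<Suc m. D k * cos (real k * t)\<bar> \<le> D (Suc L) * (1 / \<bar>sin (t / 2)\<bar>)"
      by (rule Abel_summation_bound) (auto intro: dec nonneg cos_sum_bound[OF s])
    ultimately show ?thesis using first[of L] by linarith
  qed
qed

text \<open>For each fixed second frequency l the row in the first frequency is summed with
  cancellation; the sum over l is then absolute. The singularity therefore involves t1
  alone.\<close>

lemma box_cos_sum_bound:
  assumes s: "sin (t1 / 2) \<noteq> 0"
  shows "\<bar>\<Sum>k\<in>lattice_box m. cos (dot k (t1, t2)) / bracket2 k\<bar> \<le> 2 * pi * ln (1 / \<bar>sin (t1 / 2)\<bar>) + (7 + 5 * pi + 2 * pi * ln 2)"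
proof -
  define \<sigma> where "\<sigma> = \<bar>sin (t1 / 2)\<bar>"
  have \<sigma>: "0 < \<sigma>" "\<sigma> \<le> 1" using s unfolding \<sigma>_def by auto
  \<comment> \<open>This choice balances the two parts: the strip of width L costs 2 pi ln L, which
    is 2 pi ln (1 / \<sigma>) up to a constant, while \<open>2 / \<sigma>\<close> times the row sum
    at L + 1 stays bounded because 1 / (L + 1) \<le> \<sigma>.\<close>
  define L where "L = nat \<lceil>1 / \<sigma>\<rceil>"
  have L1: "1 / \<sigma> \<le> real L" unfolding L_def by (simp add: of_nat_ceiling)
  have L2: "real L \<le> 2 / \<sigma>"
  proof -
    have "real L \<le> 1 / \<sigma> + 1" unfolding L_def using \<sigma> by (simp add: of_nat_nat)
    also have "\<dots> \<le> 2 / \<sigma>" using \<sigma> by (simp add: field_simps)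
    finally show ?thesis .
  qed
  have L: "L \<ge> 1" using L1 \<sigma> by (smt (verit) less_one linorder_not_le of_nat_0 zero_less_divide_1_iff less_divide_eq_1_pos)
  have row: "\<bar>\<Sum>k\<in>{- int m..int m}. cos (dot (k, l) (t1, t2)) / bracket2 (k, l)\<bar>
     \<le> (\<Sum>k\<in>{- int L..int L}. 1 / bracket2 (k, l)) + 2 / \<sigma> * (1 / bracket2 (int (Suc L), l))" for l
  proof -
    define D where "D = (\<lambda>k. 1 / bracket2 (k, l))"
    have De: "D (- k) = D k" for k unfolding D_def bracket2_def by simp
    have Dn: "D k \<ge> 0" for k unfolding D_def using bracket2_pos[of "(k, l)"] by simp
    have Dd: "D (int (Suc k)) \<le> D (int k)" for k
    proof -
      have "bracket2 (int k, l) \<le> bracket2 (int (Suc k), l)" by (simp add: bracket2_def power2_eq_square algebra_simps)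
      then show ?thesis unfolding D_def using bracket2_pos by (intro divide_left_mono mult_pos_pos) auto
    qed
    have "(\<Sum>k\<in>{- int m..int m}. cos (dot (k, l) (t1, t2)) / bracket2 (k, l)) = (\<Sum>k\<in>{- int m..int m}. cos (of_int k * t1 + of_int l * t2) * D k)"
      unfolding D_def dot_def by simp
    also have "\<dots> = cos (of_int l * t2) * (D 0 + 2 * (\<Sum>k=1..<Suc m. D (int k) * cos (real k * t1)))"
      by (rule cos_interval_sum) (rule De)
    also have "\<bar>\<dots>\<bar> \<le> 1 * \<bar>D 0 + 2 * (\<Sum>k=1..<Suc m. D (int k) * cos (real k * t1))\<bar>"
      unfolding abs_mult by (intro mult_right_mono) auto
    also have "\<dots> \<le> D 0 + 2 * ((\<Sum>k=1..<Suc L. D (int k)) + D (int (Suc L)) * (1 / \<sigma>))"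
      using cos_sum_split_bound[of t1 "\<lambda>k. D (int k)" m L] s Dn Dd Dn[of 0] unfolding \<sigma>_def by (smt (verit))
    also have "\<dots> = (\<Sum>k\<in>{- int L..int L}. D k) + 2 / \<sigma> * D (int (Suc L))"
      by (subst sum_symmetric_interval) (auto simp: De algebra_simps)
    finally show ?thesis unfolding D_def .
  qed
  have "(\<Sum>k\<in>lattice_box m. cos (dot k (t1, t2)) / bracket2 k) = (\<Sum>l\<in>{- int m..int m}. \<Sum>k\<in>{- int m..int m}. cos (dot (k, l) (t1, t2)) / bracket2 (k, l))"
    unfolding lattice_box_def by (subst sum.swap, subst sum.cartesian_product) (auto intro: sum.cong)
  also have "\<bar>\<dots>\<bar> \<le> (\<Sum>l\<in>{- int m..int m}. (\<Sum>k\<in>{- int L..int L}. 1 / bracket2 (k, l)) + 2 / \<sigma> * (1 / bracket2 (int (Suc L), l)))"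
    by (rule order_trans[OF sum_abs]) (intro sum_mono row)
  also have "\<dots> = (\<Sum>l\<in>{- int m..int m}. \<Sum>k\<in>{- int L..int L}. 1 / bracket2 (k, l)) + 2 / \<sigma> * (\<Sum>l\<in>{- int m..int m}. 1 / bracket2 (int (Suc L), l))"
    by (simp add: sum.distrib sum_distrib_left)
  also have "\<dots> \<le> (5 + 3 * pi + 2 * pi * ln (real L)) + (2 + 2 * pi)"
  proof (intro add_mono strip_sum_le L)
    have inv: "1 / real (Suc L) \<le> \<sigma>" using L1 \<sigma> by (simp add: field_simps)
    have "(\<Sum>l\<in>{- int m..int m}. 1 / bracket2 (int (Suc L), l)) \<le> 1 / (real (Suc L))\<^sup>2 + pi / real (Suc L)"
      using sum_bracket2_row[of "Suc L" m] by simp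
    also have "\<dots> = (1 / real (Suc L)) * (1 / real (Suc L)) + pi * (1 / real (Suc L))" by (simp add: power2_eq_square)
    also have "\<dots> \<le> 1 * \<sigma> + pi * \<sigma>"
      using inv by (intro add_mono mult_mono mult_left_mono) auto
    finally have "2 / \<sigma> * (\<Sum>l\<in>{- int m..int m}. 1 / bracket2 (int (Suc L), l)) \<le> 2 / \<sigma> * (1 * \<sigma> + pi * \<sigma>)"
      using \<sigma> by (intro mult_left_mono) auto
    also have "\<dots> = 2 + 2 * pi" using \<sigma> by (simp add: field_simps)
    finally show "2 / \<sigma> * (\<Sum>l\<in>{- int m..int m}. 1 / bracket2 (int (Suc L), l)) \<le> 2 + 2 * pi" .
  qed
  also have "\<dots> \<le> 2 * pi * ln (1 / \<sigma>) + (7 + 5 * pi + 2 * pi * ln 2)"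
  proof -
    have "ln (real L) \<le> ln (2 / \<sigma>)" using L L2 by (intro ln_mono) auto
    also have "\<dots> = ln 2 + ln (1 / \<sigma>)" using \<sigma> by (simp add: ln_div)
    finally have "2 * pi * ln (real L) \<le> 2 * pi * (ln 2 + ln (1 / \<sigma>))" by (intro mult_left_mono) auto
    then show ?thesis by (simp add: algebra_simps)
  qed
  finally show ?thesis unfolding \<sigma>_def .
qed

section \<open>Fourier analysis on the torus\<close>

abbreviation circle_set :: "real set" where "circle_set \<equiv> {0..<2 * pi}"

lemma space_torus [simp]: "space torus = circle_set \<times> circle_set"
  unfolding torus_def by (simp add: space_restrict_space)

lemma borel_circle_square [measurable]: "circle_set \<times> circle_set \<in> sets borel"
  by (intro borel_Times) auto

lemma borel_measurable_torus: "f \<in> borel_measurable borel \<Longrightarrow> f \<in> borel_measurable torus"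
  unfolding torus_def by (rule measurable_restrict_space1) simp

lemma measurable_torus_fst [measurable]: "fst \<in> torus \<rightarrow>\<^sub>M (borel :: real measure)"
  and measurable_torus_snd [measurable]: "snd \<in> torus \<rightarrow>\<^sub>M (borel :: real measure)"
  by (auto intro!: borel_measurable_torus borel_measurable_continuous_onI continuous_intros)

lemma nn_integral_torus:
  assumes [measurable]: "f \<in> borel_measurable borel"
  shows "(\<integral>\<^sup>+x. f x \<partial>torus) = (\<integral>\<^sup>+x\<in>circle_set. (\<integral>\<^sup>+y\<in>circle_set. f (x, y) \<partial>lborel) \<partial>lborel)"
proof -
  have [measurable]: "f \<in> borel_measurable (lborel \<Otimes>\<^sub>M lborel)" using assms by (simp add: lborel_prod)
  have "(\<integral>\<^sup>+x. f x \<partial>torus) = (\<integral>\<^sup>+z. f z * indicator (circle_set \<times> circle_set) z \<partial>(lborel \<Otimes>\<^sub>M lborel))"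
    unfolding torus_def by (subst nn_integral_restrict_space) (auto simp: lborel_prod)
  also have "\<dots> = (\<integral>\<^sup>+x. \<integral>\<^sup>+y. f (x, y) * indicator (circle_set \<times> circle_set) (x, y) \<partial>lborel \<partial>lborel)"
    by (subst lborel.nn_integral_fst[symmetric]) auto
  also have "\<dots> = (\<integral>\<^sup>+x\<in>circle_set. (\<integral>\<^sup>+y\<in>circle_set. f (x, y) \<partial>lborel) \<partial>lborel)"
    by (intro nn_integral_cong) (auto simp: indicator_def nn_integral_multc intro!: nn_integral_cong)
  finally show ?thesis .
qed

lemma nn_integral_torus_product:
  assumes [measurable]: "f \<in> borel_measurable borel" "g \<in> borel_measurable borel"
  shows "(\<integral>\<^sup>+x. f (fst x) * g (snd x) \<partial>torus) = (\<integral>\<^sup>+x\<in>circle_set. f x \<partial>lborel) * (\<integral>\<^sup>+y\<in>circle_set. g y \<partial>lborel)"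
proof -
  have "(\<lambda>x::real\<times>real. f (fst x) * g (snd x)) \<in> borel_measurable borel"
    unfolding borel_prod[symmetric] by measurable
  then have "(\<integral>\<^sup>+x. f (fst x) * g (snd x) \<partial>torus) = (\<integral>\<^sup>+x\<in>circle_set. (\<integral>\<^sup>+y\<in>circle_set. f x * g y \<partial>lborel) \<partial>lborel)"
    by (subst nn_integral_torus) auto
  also have "\<dots> = (\<integral>\<^sup>+x. f x * indicator circle_set x * (\<integral>\<^sup>+y\<in>circle_set. g y \<partial>lborel) \<partial>lborel)"
    by (intro nn_integral_cong) (simp add: mult_ac nn_integral_cmult)
  also have "\<dots> = (\<integral>\<^sup>+x\<in>circle_set. f x \<partial>lborel) * (\<integral>\<^sup>+y\<in>circle_set. g y \<partial>lborel)"
    by (subst nn_integral_multc) auto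
  finally show ?thesis .
qed

lemma emeasure_torus: "emeasure torus (space torus) = ennreal (4 * pi\<^sup>2)"
proof -
  have "emeasure torus (space torus) = (\<integral>\<^sup>+x. 1 * 1 \<partial>torus)" by simp
  also have "\<dots> = (\<integral>\<^sup>+x\<in>circle_set. 1 \<partial>lborel) * (\<integral>\<^sup>+y\<in>circle_set. 1 \<partial>lborel)"
    by (rule nn_integral_torus_product) auto
  also have "\<dots> = ennreal (4 * pi\<^sup>2)"
    by (simp add: nn_integral_indicator ennreal_mult[symmetric] power2_eq_square)
  finally show ?thesis .
qed

lemma finite_measure_torus: "finite_measure torus"
  by standard (simp add: emeasure_torus del: space_torus)

interpretation torus: finite_measure torus by (rule finite_measure_torus)

lemma integral_torus_product:
  fixes f g :: "real \<Rightarrow> real"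
  assumes f: "continuous_on UNIV f" and g: "continuous_on UNIV g"
  shows "(\<integral>x. f (fst x) * g (snd x) \<partial>torus) = (LBINT x:circle_set. f x) * (LBINT y:circle_set. g y)"
proof -
  have [measurable]: "f \<in> borel_measurable borel" "g \<in> borel_measurable borel"
    using f g by (auto intro: borel_measurable_continuous_onI)
  have intf: "set_integrable lborel circle_set f" and intg: "set_integrable lborel circle_set g"
    using continuous_on_subset[OF f subset_UNIV] continuous_on_subset[OF g subset_UNIV]
    by (auto intro: set_integrable_subset[OF borel_integrable_atLeastAtMost'[of 0 "2 * pi"]])
  have "(\<integral>x. f (fst x) * g (snd x) \<partial>torus)
     = (\<integral>z. (indicator circle_set (fst z) * f (fst z)) * (indicator circle_set (snd z) * g (snd z)) \<partial>(lborel \<Otimes>\<^sub>M lborel))"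
    unfolding torus_def by (subst integral_restrict_space) (auto simp: lborel_prod indicator_def intro!: Bochner_Integration.integral_cong)
  also have "\<dots> = (LBINT x:circle_set. f x) * (LBINT y:circle_set. g y)"
  proof -
    have int: "integrable lborel (\<lambda>x. indicator circle_set x * f x)" "integrable lborel (\<lambda>x. indicator circle_set x * g x)"
      using intf intg unfolding set_integrable_def by simp_all
    define F G where "F = (\<lambda>x. indicator circle_set x * f x)" and "G = (\<lambda>x. indicator circle_set x * g x)"
    have F: "integrable lborel F" and G: "integrable lborel G" using int unfolding F_def G_def .
    have [measurable]: "F \<in> borel_measurable borel" "G \<in> borel_measurable borel" unfolding F_def G_def by measurable
    have i: "integrable (lborel \<Otimes>\<^sub>M lborel) (\<lambda>(x, y). F x * G y)"
    proof (rule lborel_pair.Fubini_integrable)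
      have "integrable lborel (\<lambda>x. \<bar>F x\<bar> * (\<integral>y. \<bar>G y\<bar> \<partial>lborel))" using F by (intro integrable_mult_left integrable_abs)
      then show "integrable lborel (\<lambda>x. \<integral>y. norm (case (x, y) of (x, y) \<Rightarrow> F x * G y) \<partial>lborel)"
        by (simp add: abs_mult)
      show "AE x in lborel. integrable lborel (\<lambda>y. case (x, y) of (x, y) \<Rightarrow> F x * G y)" using G by simp
    qed measurable
    have "(\<integral>z. F (fst z) * G (snd z) \<partial>(lborel \<Otimes>\<^sub>M lborel)) = (\<integral>x. \<integral>y. F x * G y \<partial>lborel \<partial>lborel)"
      using lborel_pair.integral_fst'[OF i] by (simp add: case_prod_unfold)
    also have "\<dots> = (\<integral>x. F x \<partial>lborel) * (\<integral>x. G x \<partial>lborel)" by simp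
    finally show ?thesis unfolding set_lebesgue_integral_def F_def G_def by simp
  qed
  finally show ?thesis .
qed

lemma integral_circle_cos_sin:
  "(LBINT x:circle_set. cos (of_int m * x)) = (if m = 0 then 2 * pi else 0)"
  "(LBINT x:circle_set. sin (of_int m * x)) = 0"
proof -
  have AE: "(LBINT x:circle_set. f x) = (LBINT x:{0..2 * pi}. f x)" if "continuous_on UNIV f" for f :: "real \<Rightarrow> real"
  proof -
    have [measurable]: "f \<in> borel_measurable borel" using that by (rule borel_measurable_continuous_onI)
    have "AE x in lborel. x \<noteq> 2 * pi" by (rule AE_lborel_singleton)
    then show ?thesis unfolding set_lebesgue_integral_def
      by (intro integral_cong_AE) (auto simp: indicator_def elim!: eventually_mono)
  qed
  show "(LBINT x:circle_set. cos (of_int m * x)) = (if m = 0 then 2 * pi else 0)"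
  proof (cases "m = 0")
    case True
    then show ?thesis by (simp add: set_lebesgue_integral_def)
  next
    case False
    have "(LBINT x:{0..2 * pi}. cos (of_int m * x)) = sin (of_int m * (2 * pi)) / of_int m - sin (of_int m * 0) / of_int m"
      unfolding set_lebesgue_integral_def
      by (rule integral_FTC_Icc)
         (use False in \<open>auto intro!: derivative_eq_intros continuous_intros simp: has_real_derivative_iff_has_vector_derivative[symmetric]\<close>)
    also have "\<dots> = 0" using False sin_int_2pin[of m] by (simp add: mult_ac)
    finally show ?thesis using False by (subst AE) (auto intro!: continuous_intros)
  qed
  show "(LBINT x:circle_set. sin (of_int m * x)) = 0"
  proof (cases "m = 0")
    case False
    have "(LBINT x:{0..2 * pi}. sin (of_int m * x)) = - cos (of_int m * (2 * pi)) / of_int m - (- cos (of_int m * 0) / of_int m)"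
      unfolding set_lebesgue_integral_def
      by (rule integral_FTC_Icc)
         (use False in \<open>auto intro!: derivative_eq_intros continuous_intros simp: has_real_derivative_iff_has_vector_derivative[symmetric]\<close>)
    also have "\<dots> = 0" using False cos_int_2pin[of m] by (simp add: mult_ac)
    finally show ?thesis by (subst AE) (auto intro!: continuous_intros)
  qed (simp add: set_lebesgue_integral_def)
qed

text \<open>The phase \<open>\<phi>\<close> covers sine and cosine together, so all integrals of
  products of basis functions reduce to this one.\<close>

lemma integral_torus_cos:
  "(\<integral>x. cos (dot m x - \<phi>) \<partial>torus) = (if m = (0, 0) then 4 * pi\<^sup>2 * cos \<phi> else 0)"
proof -
  define a b where "a = fst m" and "b = snd m"
  have cont: "continuous_on UNIV (\<lambda>x. cos (of_int n * x :: real))" "continuous_on UNIV (\<lambda>x. sin (of_int n * x :: real))" for n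
    by (auto intro!: continuous_intros)
  have int: "integrable torus (\<lambda>x. f (of_int a * fst x) * g (of_int b * snd x))"
    if "\<And>x. \<bar>f x\<bar> \<le> 1" "\<And>x. \<bar>g x\<bar> \<le> 1" "f \<in> borel_measurable borel" "g \<in> borel_measurable borel" for f g :: "real \<Rightarrow> real"
  proof -
    note [measurable] = that(3,4)
    show ?thesis
      using that(1,2) by (intro torus.integrable_const_bound[of _ 1]) (auto simp: abs_mult mult_le_one)
  qed
  note [measurable] = borel_measurable_cos borel_measurable_sin
  have sc: "sin \<in> borel_measurable (borel :: real measure)" "cos \<in> borel_measurable (borel :: real measure)"
    by (auto intro!: borel_measurable_continuous_onI continuous_intros)
  have "cos (dot m x - \<phi>) = cos \<phi> * (cos (of_int a * fst x) * cos (of_int b * snd x)) - cos \<phi> * (sin (of_int a * fst x) * sin (of_int b * snd x))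
     + sin \<phi> * (sin (of_int a * fst x) * cos (of_int b * snd x)) + sin \<phi> * (cos (of_int a * fst x) * sin (of_int b * snd x))" for x
    unfolding dot_def a_def b_def by (simp add: cos_diff cos_add sin_add algebra_simps)
  then have "(\<integral>x. cos (dot m x - \<phi>) \<partial>torus) = cos \<phi> * (\<integral>x. cos (of_int a * fst x) * cos (of_int b * snd x) \<partial>torus)
     - cos \<phi> * (\<integral>x. sin (of_int a * fst x) * sin (of_int b * snd x) \<partial>torus)
     + sin \<phi> * (\<integral>x. sin (of_int a * fst x) * cos (of_int b * snd x) \<partial>torus) + sin \<phi> * (\<integral>x. cos (of_int a * fst x) * sin (of_int b * snd x) \<partial>torus)"
    by (simp add: int sc Bochner_Integration.integral_add Bochner_Integration.integral_diff)
  also have "\<dots> = (if m = (0, 0) then 4 * pi\<^sup>2 * cos \<phi> else 0)"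
    unfolding integral_torus_product[OF cont(1) cont(1)] integral_torus_product[OF cont(2) cont(2)]
      integral_torus_product[OF cont(1) cont(2)] integral_torus_product[OF cont(2) cont(1)] integral_circle_cos_sin
    by (auto simp: a_def b_def power2_eq_square prod_eq_iff)
  finally show ?thesis .
qed

text \<open>Amplitude and phase write every basis element as one shifted cosine; the phase pi / 2
  produces the sines.\<close>

definition basis_amp :: "int \<times> int \<Rightarrow> real" where
  "basis_amp k = (if k = (0, 0) then 1 / (2 * pi) else 1 / (sqrt 2 * pi))"

definition basis_phase :: "int \<times> int \<Rightarrow> real" where
  "basis_phase k = (if k = (0, 0) \<or> k \<in> Z2_plus then 0 else pi / 2)"

lemma Z2_plus_cases: "k = (0, 0) \<or> k \<in> Z2_plus \<or> - k \<in> Z2_plus"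
  "k \<in> Z2_plus \<Longrightarrow> - k \<notin> Z2_plus" "(0, 0) \<notin> Z2_plus"
  unfolding Z2_plus_def by (cases k; auto)+

lemma basis_e_cos: "basis_e k x = basis_amp k * cos (dot k x - basis_phase k)"
  unfolding basis_e_def basis_amp_def basis_phase_def
  by (auto simp: cos_diff dot_def Z2_plus_cases(3))

lemma abs_basis_e_le: "\<bar>basis_e k x\<bar> \<le> 1"
proof -
  have "1 * 1 \<le> sqrt 2 * pi" using pi_gt3 real_sqrt_ge_1_iff[of 2] by (intro mult_mono) auto
  moreover have "1 \<le> 2 * pi" using pi_gt3 by linarith
  ultimately
  have "0 \<le> basis_amp k" "basis_amp k \<le> 1" unfolding basis_amp_def by auto
  then show ?thesis unfolding basis_e_cos abs_mult
    using mult_le_one[of "\<bar>basis_amp k\<bar>" "\<bar>cos (dot k x - basis_phase k)\<bar>"] by auto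
qed

lemma borel_measurable_basis_e [measurable]: "basis_e k \<in> borel_measurable torus"
proof -
  have "basis_e k = (\<lambda>x. basis_amp k * cos (dot k x - basis_phase k))" by (auto simp: basis_e_cos)
  moreover have "\<dots> \<in> borel_measurable borel"
    unfolding dot_def by (intro borel_measurable_continuous_onI continuous_intros)
  ultimately show ?thesis by (auto intro: borel_measurable_torus)
qed

lemma dot_add: "dot (k + l) x = dot k x + dot l x" and dot_diff: "dot (k - l) x = dot k x - dot l x"
  and dot_minus: "dot (- k) x = - dot k x"
  unfolding dot_def by (auto simp: algebra_simps)

lemma basis_e_mult:
  "basis_e k x * basis_e l x = basis_amp k * basis_amp l / 2 *
     (cos (dot (k - l) x - (basis_phase k - basis_phase l)) + cos (dot (k + l) x - (basis_phase k + basis_phase l)))"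
proof -
  have "2 * (cos u * cos v) = cos (u - v) + cos (u + v)" for u v :: real by (simp add: cos_add cos_diff)
  from this[of "dot k x - basis_phase k" "dot l x - basis_phase l"]
  have "cos (dot k x - basis_phase k) * cos (dot l x - basis_phase l) =
     (cos (dot (k - l) x - (basis_phase k - basis_phase l)) + cos (dot (k + l) x - (basis_phase k + basis_phase l))) / 2"
    unfolding dot_add dot_diff by (simp add: algebra_simps)
  then show ?thesis unfolding basis_e_cos by (simp add: mult_ac)
qed

lemma borel_measurable_cos_dot [measurable]: "(\<lambda>x. cos (dot k x - c)) \<in> borel_measurable torus"
  unfolding dot_def by (intro borel_measurable_torus borel_measurable_continuous_onI continuous_intros)

lemma basis_orthonormal: "inner_H (basis_e k) (basis_e l) = (if k = l then 1 else 0)"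
proof -
  have int: "integrable torus (\<lambda>x. cos (dot j x - c))" for j c
    by (intro torus.integrable_const_bound[of _ 1]) auto
  have "inner_H (basis_e k) (basis_e l) = basis_amp k * basis_amp l / 2 *
     ((\<integral>x. cos (dot (k - l) x - (basis_phase k - basis_phase l)) \<partial>torus) + (\<integral>x. cos (dot (k + l) x - (basis_phase k + basis_phase l)) \<partial>torus))"
    unfolding inner_H_def basis_e_mult by (simp add: int)
  also have "\<dots> = (if k = l then 1 else 0)"
  proof (cases "k = l")
    case True
    show ?thesis
    proof (cases "k = (0, 0)")
      case True then show ?thesis using \<open>k = l\<close> unfolding integral_torus_cos basis_amp_def basis_phase_def
        by (simp add: power2_eq_square field_simps zero_prod_def)
    next
      case False
      then have "k + k \<noteq> (0, 0)" by (cases k) auto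
      then show ?thesis using False \<open>k = l\<close> unfolding integral_torus_cos basis_amp_def
        by (simp add: power2_eq_square field_simps zero_prod_def)
    qed
  next
    case False
    then have kl: "k - l \<noteq> (0, 0)" by (cases k; cases l) auto
    show ?thesis
    proof (cases "k + l = (0, 0)")
      case True
      then have l: "l = - k" by (cases k; cases l) (auto simp: eq_neg_iff_add_eq_0)
      with False have k0: "k \<noteq> (0, 0)" by (cases k) auto
      \<comment> \<open>Of k and - k exactly one lies in \<open>Z2_plus\<close>: the two elements
        are cosine and sine of the same frequency up to sign, and their phases add to pi / 2, which
        kills the remaining mean.\<close>
      then have "basis_phase k + basis_phase l = pi / 2"
        using Z2_plus_cases(1)[of k] Z2_plus_cases(2)[of k] l unfolding basis_phase_def by (cases k) auto
      then have "cos (basis_phase k + basis_phase l) = 0" by (simp only: cos_pi_half)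
      then show ?thesis using kl True False unfolding integral_torus_cos by simp
    next
      case False
      then show ?thesis using kl \<open>k \<noteq> l\<close> unfolding integral_torus_cos by simp
    qed
  qed
  finally show ?thesis .
qed

lemma L2_torus_integrable: "g \<in> L2_torus \<Longrightarrow> integrable torus g"
proof -
  assume "g \<in> L2_torus"
  then have [measurable]: "g \<in> borel_measurable torus" and sq: "integrable torus (\<lambda>x. (g x)\<^sup>2)"
    unfolding L2_torus_def by auto
  have "integrable torus (\<lambda>x. 1 + (g x)\<^sup>2)" using sq by simp
  then show ?thesis
  proof (rule Bochner_Integration.integrable_bound, goal_cases)
    case 2
    have "\<bar>u\<bar> \<le> 1 + u\<^sup>2" for u :: real
      using sum_squares_bound[of "\<bar>u\<bar>" 1] by simp
    then show ?case by (intro AE_I2) simp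
  qed simp
qed

lemma bounded_in_L2_torus:
  assumes [measurable]: "f \<in> borel_measurable torus" and B: "\<And>x. x \<in> space torus \<Longrightarrow> \<bar>f x\<bar> \<le> B"
  shows "f \<in> L2_torus"
proof -
  have "\<bar>f x\<bar>\<^sup>2 \<le> B\<^sup>2" if "x \<in> space torus" for x using B[OF that] by (intro power_mono) auto
  then have "integrable torus (\<lambda>x. (f x)\<^sup>2)" by (intro torus.integrable_const_bound[of _ "B\<^sup>2"]) auto
  then show ?thesis unfolding L2_torus_def by simp
qed

lemma basis_in_L2_torus: "basis_e k \<in> L2_torus"
  by (rule bounded_in_L2_torus[of _ 1]) (auto simp: abs_basis_e_le)

lemma integrable_bounded_mult:
  assumes "g \<in> L2_torus" and [measurable]: "f \<in> borel_measurable torus" and "\<And>x. x \<in> space torus \<Longrightarrow> \<bar>f x\<bar> \<le> B"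
  shows "integrable torus (\<lambda>x. f x * g x)"
proof (rule Bochner_Integration.integrable_bound)
  show "integrable torus (\<lambda>x. B * g x)" using L2_torus_integrable[OF assms(1)] by simp
  show "AE x in torus. norm (f x * g x) \<le> norm (B * g x)"
  proof (rule AE_I2)
    fix x assume "x \<in> space torus"
    from assms(3)[OF this] have "\<bar>f x\<bar> \<le> \<bar>B\<bar>" by simp
    then show "norm (f x * g x) \<le> norm (B * g x)" by (simp add: abs_mult mult_right_mono)
  qed
qed (use L2_torus_integrable[OF assms(1)] in measurable)

lemma Bessel_inequality:
  assumes f: "f \<in> L2_torus" and S: "finite S"
  shows "(\<Sum>k\<in>S. (fourier_coeffs f k)\<^sup>2) \<le> inner_H f f"
proof -
  have [measurable]: "f \<in> borel_measurable torus" and sq: "integrable torus (\<lambda>x. f x * f x)"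
    using f unfolding L2_torus_def by (auto simp: power2_eq_square)
  have ife: "integrable torus (\<lambda>x. f x * basis_e k x)" for k
    using integrable_bounded_mult[OF f borel_measurable_basis_e abs_basis_e_le, of k] by (simp add: mult.commute)
  have iee: "integrable torus (\<lambda>x. basis_e k x * basis_e l x)" for k l
    by (rule integrable_bounded_mult[OF basis_in_L2_torus borel_measurable_basis_e abs_basis_e_le])
  define c where "c = fourier_coeffs f"
  define h where "h = (\<lambda>x. \<Sum>k\<in>S. c k * basis_e k x)"
  have h1: "(\<integral>x. f x * h x \<partial>torus) = (\<Sum>k\<in>S. (c k)\<^sup>2)" and ih1: "integrable torus (\<lambda>x. f x * h x)"
  proof -
    have eq: "f x * h x = (\<Sum>k\<in>S. c k * (f x * basis_e k x))" for x unfolding h_def by (simp add: sum_distrib_left mult_ac)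
    show "integrable torus (\<lambda>x. f x * h x)" unfolding eq using ife by simp
    show "(\<integral>x. f x * h x \<partial>torus) = (\<Sum>k\<in>S. (c k)\<^sup>2)" unfolding eq using ife
      by (simp add: c_def fourier_coeffs_def inner_H_def power2_eq_square)
  qed
  have h2: "(\<integral>x. h x * h x \<partial>torus) = (\<Sum>k\<in>S. (c k)\<^sup>2)" and ih2: "integrable torus (\<lambda>x. h x * h x)"
  proof -
    have eq: "h x * h x = (\<Sum>k\<in>S. \<Sum>l\<in>S. c k * c l * (basis_e k x * basis_e l x))" for x
      unfolding h_def sum_product by (simp add: mult_ac)
    show "integrable torus (\<lambda>x. h x * h x)" unfolding eq using iee by simp
    have "(\<integral>x. h x * h x \<partial>torus) = (\<Sum>k\<in>S. \<Sum>l\<in>S. c k * c l * inner_H (basis_e k) (basis_e l))"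
      unfolding eq inner_H_def using iee by simp
    also have "\<dots> = (\<Sum>k\<in>S. (c k)\<^sup>2)"
      unfolding basis_orthonormal using S by (simp add: if_distrib[of "\<lambda>u. _ * u"] power2_eq_square cong: if_cong)
    finally show "(\<integral>x. h x * h x \<partial>torus) = (\<Sum>k\<in>S. (c k)\<^sup>2)" .
  qed
  have "0 \<le> (\<integral>x. (f x - h x)\<^sup>2 \<partial>torus)" by simp
  also have "\<dots> = (\<integral>x. f x * f x - 2 * (f x * h x) + h x * h x \<partial>torus)"
    by (simp add: power2_eq_square algebra_simps)
  also have "\<dots> = inner_H f f - (\<Sum>k\<in>S. (c k)\<^sup>2)"
    using sq ih1 ih2 h1 h2 by (simp add: inner_H_def)
  finally show ?thesis unfolding c_def by simp
qed

section \<open>Trigonometric polynomials\<close>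

definition trig_polynomial :: "(real \<times> real \<Rightarrow> real) \<Rightarrow> bool" where
  "trig_polynomial f \<longleftrightarrow> (\<exists>S c. finite S \<and> (\<forall>x. f x = (\<Sum>k\<in>S. c k * basis_e k x)))"

lemma trig_polynomial_basis: "trig_polynomial (basis_e k)"
  unfolding trig_polynomial_def by (intro exI[of _ "{k}"] exI[of _ "\<lambda>_. 1"]) auto

lemma trig_polynomial_scale: "trig_polynomial f \<Longrightarrow> trig_polynomial (\<lambda>x. a * f x)"
  unfolding trig_polynomial_def
proof (elim exE conjE)
  fix S c assume "finite S" "\<forall>x. f x = (\<Sum>k\<in>S. c k * basis_e k x)"
  then show "\<exists>S c. finite S \<and> (\<forall>x. a * f x = (\<Sum>k\<in>S. c k * basis_e k x))"
    by (intro exI[of _ S] exI[of _ "\<lambda>k. a * c k"]) (auto simp: sum_distrib_left mult_ac)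
qed

lemma trig_polynomial_add:
  assumes "trig_polynomial f" "trig_polynomial g"
  shows "trig_polynomial (\<lambda>x. f x + g x)"
proof -
  obtain S c where S: "finite S" "\<And>x. f x = (\<Sum>k\<in>S. c k * basis_e k x)" using assms(1) unfolding trig_polynomial_def by auto
  obtain T d where T: "finite T" "\<And>x. g x = (\<Sum>k\<in>T. d k * basis_e k x)" using assms(2) unfolding trig_polynomial_def by auto
  have "f x + g x = (\<Sum>k\<in>S \<union> T. ((if k \<in> S then c k else 0) + (if k \<in> T then d k else 0)) * basis_e k x)" for x
  proof -
    have "(\<Sum>k\<in>S \<union> T. (if k \<in> S then c k else 0) * basis_e k x) = f x"
      unfolding S(2) using S(1) T(1) by (intro sum.mono_neutral_cong_right) auto
    moreover have "(\<Sum>k\<in>S \<union> T. (if k \<in> T then d k else 0) * basis_e k x) = g x"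
      unfolding T(2) using S(1) T(1) by (intro sum.mono_neutral_cong_right) auto
    ultimately show ?thesis by (simp only: distrib_right sum.distrib)
  qed
  then show ?thesis unfolding trig_polynomial_def using S(1) T(1)
    by (intro exI[of _ "S \<union> T"] exI[of _ "\<lambda>k. (if k \<in> S then c k else 0) + (if k \<in> T then d k else 0)"]) blast
qed

lemma trig_polynomial_const: "trig_polynomial (\<lambda>x. a)"
proof -
  have "(\<lambda>x. a) = (\<lambda>x. (a * (2 * pi)) * basis_e (0, 0) x)" unfolding basis_e_def by auto
  then show ?thesis using trig_polynomial_scale[OF trig_polynomial_basis] by metis
qed

lemma trig_polynomial_sum: "finite I \<Longrightarrow> (\<And>i. i \<in> I \<Longrightarrow> trig_polynomial (f i)) \<Longrightarrow> trig_polynomial (\<lambda>x. \<Sum>i\<in>I. f i x)"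
  by (induction I rule: finite_induct) (auto intro: trig_polynomial_const trig_polynomial_add)

lemma trig_polynomial_cos: "trig_polynomial (\<lambda>x. cos (dot m x - \<phi>))"
proof -
  have "\<exists>a b. \<forall>x. cos (dot m x - \<phi>) = a * basis_e m x + b * basis_e (- m) x"
  proof -
    consider "m = (0, 0)" | "m \<noteq> (0, 0)" "m \<in> Z2_plus" "- m \<notin> Z2_plus" | "m \<noteq> (0, 0)" "m \<notin> Z2_plus" "- m \<in> Z2_plus"
      using Z2_plus_cases(1)[of m] Z2_plus_cases(2)[of m] Z2_plus_cases(3) by metis
    then show ?thesis
    proof cases
      case 1
      then show ?thesis by (intro exI[of _ "2 * pi * cos \<phi>"] exI[of _ 0]) (simp add: basis_e_def dot_def)
    next
      case 2
      then have "- m \<noteq> (0, 0)" by (cases m) auto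
      then show ?thesis using 2
        by (intro exI[of _ "sqrt 2 * pi * cos \<phi>"] exI[of _ "- (sqrt 2 * pi * sin \<phi>)"])
           (simp add: basis_e_def dot_minus cos_diff)
    next
      case 3
      then have "- m \<noteq> (0, 0)" by (cases m) auto
      then show ?thesis using 3
        by (intro exI[of _ "sqrt 2 * pi * sin \<phi>"] exI[of _ "sqrt 2 * pi * cos \<phi>"])
           (simp add: basis_e_def dot_minus cos_diff)
    qed
  qed
  then obtain a b where "\<And>x. cos (dot m x - \<phi>) = a * basis_e m x + b * basis_e (- m) x" by blast
  then show ?thesis by (simp add: trig_polynomial_add trig_polynomial_scale trig_polynomial_basis)
qed

lemma trig_polynomial_mult:
  assumes "trig_polynomial f" "trig_polynomial g"
  shows "trig_polynomial (\<lambda>x. f x * g x)"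
proof -
  obtain S c where S: "finite S" "\<And>x. f x = (\<Sum>k\<in>S. c k * basis_e k x)" using assms(1) unfolding trig_polynomial_def by auto
  obtain T d where T: "finite T" "\<And>x. g x = (\<Sum>k\<in>T. d k * basis_e k x)" using assms(2) unfolding trig_polynomial_def by auto
  have "(\<lambda>x. f x * g x) = (\<lambda>x. \<Sum>k\<in>S. \<Sum>l\<in>T. (c k * d l) * (basis_e k x * basis_e l x))"
    unfolding S(2) T(2) sum_product by (simp add: mult_ac)
  moreover have "trig_polynomial \<dots>"
    unfolding basis_e_mult using S T
    by (intro trig_polynomial_sum trig_polynomial_scale trig_polynomial_add trig_polynomial_cos)
  ultimately show ?thesis by simp
qed

text \<open>Only finitely many coefficients are nonzero, so the pairing is a finite sum. Applied to
  the truncated Wick powers, this links evaluation at g with the dual pairing.\<close>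

lemma trig_polynomial_pairing:
  assumes "trig_polynomial f" and g: "g \<in> L2_torus"
  shows "inner_H f g = pairing (fourier_coeffs f) (fourier_coeffs g)"
proof -
  obtain S c where S: "finite S" "\<And>x. f x = (\<Sum>k\<in>S. c k * basis_e k x)" using assms(1) unfolding trig_polynomial_def by auto
  have iee: "integrable torus (\<lambda>x. basis_e k x * basis_e l x)" for k l
    by (rule integrable_bounded_mult[OF basis_in_L2_torus borel_measurable_basis_e abs_basis_e_le])
  have ige: "integrable torus (\<lambda>x. basis_e k x * g x)" for k
    by (rule integrable_bounded_mult[OF g borel_measurable_basis_e abs_basis_e_le])
  have coeff: "fourier_coeffs f l = (if l \<in> S then c l else 0)" for l
  proof -
    have "fourier_coeffs f l = (\<Sum>k\<in>S. c k * inner_H (basis_e k) (basis_e l))"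
      unfolding fourier_coeffs_def inner_H_def S(2) sum_distrib_right mult.assoc using iee by simp
    also have "\<dots> = (if l \<in> S then c l else 0)"
      unfolding basis_orthonormal using S(1) by (simp add: if_distrib[of "\<lambda>u. _ * u"] cong: if_cong)
    finally show ?thesis .
  qed
  have "inner_H f g = (\<Sum>k\<in>S. c k * fourier_coeffs g k)"
    unfolding fourier_coeffs_def inner_H_def S(2) sum_distrib_right mult.assoc using ige by (simp add: mult.commute)
  also have "\<dots> = (\<Sum>\<^sub>\<infinity>k\<in>S. fourier_coeffs f k * fourier_coeffs g k)"
    using S(1) by (simp add: coeff)
  also have "\<dots> = pairing (fourier_coeffs f) (fourier_coeffs g)"
    unfolding pairing_def by (rule infsum_cong_neutral) (auto simp: coeff)
  finally show ?thesis .
qed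

section \<open>Sobolev spaces\<close>

abbreviation lattice_point :: "nat \<Rightarrow> int \<times> int" where "lattice_point \<equiv> from_nat_into UNIV"

lemma bij_lattice_point: "bij lattice_point"
  using bij_betw_from_nat_into[of "UNIV :: (int \<times> int) set"]
  by (simp add: countableI_type infinite_UNIV_char_0 finite_prod)

lemma nn_integral_lattice: "(\<integral>\<^sup>+k. f k \<partial>count_space UNIV) = (\<Sum>n. f (lattice_point n))" for f :: "int \<times> int \<Rightarrow> ennreal"
  by (subst nn_integral_bij_count_space[OF bij_lattice_point, symmetric]) (rule nn_integral_count_space_nat)

text \<open>Values in \<open>ennreal\<close> make the squared norm total and measurable before any
  summability is known. Two weights occur: the Sobolev weight, and the indicator of the origin,
  which leaves the square of one coordinate.\<close>

definition wnorm2 :: "(int \<times> int \<Rightarrow> real) \<Rightarrow> distribution \<Rightarrow> ennreal" where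
  "wnorm2 w u = (\<integral>\<^sup>+k. ennreal (w k * (u k)\<^sup>2) \<partial>count_space UNIV)"

lemma nonneg_summable_on_iff:
  fixes f :: "'a \<Rightarrow> real"
  assumes "\<And>k. f k \<ge> 0"
  shows "f summable_on UNIV \<longleftrightarrow> (\<integral>\<^sup>+k. ennreal (f k) \<partial>count_space UNIV) < \<infinity>"
proof -
  have "f summable_on UNIV \<longleftrightarrow> Infinite_Sum.abs_summable_on f UNIV" using assms by simp
  also have "\<dots> \<longleftrightarrow> integrable (count_space UNIV) f" unfolding abs_summable_equivalent abs_summable_on_def ..
  also have "\<dots> \<longleftrightarrow> (\<integral>\<^sup>+k. ennreal (f k) \<partial>count_space UNIV) < \<infinity>"
    using assms by (simp add: integrable_iff_bounded)
  finally show ?thesis .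
qed

lemma nn_integral_infsum:
  fixes f :: "'a \<Rightarrow> real"
  assumes "\<And>k. f k \<ge> 0" and "f summable_on UNIV"
  shows "(\<integral>\<^sup>+k. ennreal (f k) \<partial>count_space UNIV) = ennreal (infsum f UNIV)"
proof -
  have abs: "Infinite_Sum.abs_summable_on f UNIV" using assms by simp
  then have "integrable (count_space UNIV) f" unfolding abs_summable_equivalent abs_summable_on_def .
  then have "(\<integral>\<^sup>+k. ennreal (f k) \<partial>count_space UNIV) = ennreal (\<integral>k. f k \<partial>count_space UNIV)"
    using assms by (intro nn_integral_eq_integral) auto
  also have "(\<integral>k. f k \<partial>count_space UNIV) = infsetsum f UNIV" by (simp add: infsetsum_def)
  also have "\<dots> = infsum f UNIV" using abs by (intro infsetsum_infsum) (simp only: abs_summable_equivalent)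
  finally show ?thesis .
qed

lemma wnorm2_SUP: "wnorm2 w u = (SUP n. \<Sum>k\<in>lattice_point ` {..<n}. ennreal (w k * (u k)\<^sup>2))"
proof -
  have "inj_on lattice_point {..<n}" for n using bij_lattice_point by (meson bij_is_inj inj_on_subset subset_UNIV)
  then show ?thesis unfolding wnorm2_def nn_integral_lattice
    by (simp add: suminf_eq_SUP sum.reindex)
qed

lemma wnorm2_le:
  assumes "\<And>S. finite S \<Longrightarrow> (\<Sum>k\<in>S. w k * (u k)\<^sup>2) \<le> C" "\<And>k. w k \<ge> 0"
  shows "wnorm2 w u \<le> ennreal C"
  unfolding wnorm2_SUP using assms by (intro SUP_least) (auto simp: sum_ennreal intro!: ennreal_leI)

lemma wnorm2_ge: "finite S \<Longrightarrow> (\<And>k. w k \<ge> 0) \<Longrightarrow> ennreal (\<Sum>k\<in>S. w k * (u k)\<^sup>2) \<le> wnorm2 w u"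
proof -
  assume S: "finite S" and w: "\<And>k. w k \<ge> 0"
  have "ennreal (\<Sum>k\<in>S. w k * (u k)\<^sup>2) = (\<integral>\<^sup>+k\<in>S. ennreal (w k * (u k)\<^sup>2) \<partial>count_space UNIV)"
    using S w by (subst nn_integral_count_space_indicator[symmetric]) (auto simp: nn_integral_count_space_finite sum_ennreal)
  also have "\<dots> \<le> wnorm2 w u" unfolding wnorm2_def by (intro nn_integral_mono) (auto simp: indicator_def)
  finally show ?thesis .
qed

lemma borel_measurable_wnorm2 [measurable (raw)]:
  assumes "\<And>k. (\<lambda>z. F z k) \<in> borel_measurable M"
  shows "(\<lambda>z. wnorm2 w (F z)) \<in> borel_measurable M"
  unfolding wnorm2_def nn_integral_lattice using assms by measurable

text \<open>From (u + v)^2 \<le> 2 u^2 + 2 v^2. This form of the triangle inequality integrates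
  directly, and the factors 2 are harmless in limits.\<close>

lemma wnorm2_add_le:
  assumes w: "\<And>k. w k \<ge> 0"
  shows "wnorm2 w (\<lambda>k. u k + v k) \<le> 2 * wnorm2 w u + 2 * wnorm2 w v"
proof -
  have "wnorm2 w (\<lambda>k. u k + v k) \<le> (\<integral>\<^sup>+k. 2 * ennreal (w k * (u k)\<^sup>2) + 2 * ennreal (w k * (v k)\<^sup>2) \<partial>count_space UNIV)"
    unfolding wnorm2_def
  proof (rule nn_integral_mono)
    fix k
    have "(u k + v k)\<^sup>2 \<le> 2 * (u k)\<^sup>2 + 2 * (v k)\<^sup>2"
      using sum_squares_bound[of "u k" "v k"] by (simp add: power2_eq_square algebra_simps)
    from mult_left_mono[OF this w[of k]]
    have "ennreal (w k * (u k + v k)\<^sup>2) \<le> ennreal (2 * (w k * (u k)\<^sup>2) + 2 * (w k * (v k)\<^sup>2))"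
      by (intro ennreal_leI) (simp add: algebra_simps)
    also have "\<dots> = 2 * ennreal (w k * (u k)\<^sup>2) + 2 * ennreal (w k * (v k)\<^sup>2)"
      using w by (simp add: ennreal_plus ennreal_mult)
    finally show "ennreal (w k * (u k + v k)\<^sup>2) \<le> 2 * ennreal (w k * (u k)\<^sup>2) + 2 * ennreal (w k * (v k)\<^sup>2)" .
  qed
  also have "\<dots> = 2 * wnorm2 w u + 2 * wnorm2 w v"
    unfolding wnorm2_def by (simp add: nn_integral_add nn_integral_cmult)
  finally show ?thesis .
qed

lemma wnorm2_scale: "wnorm2 w (\<lambda>k. c * u k) = ennreal (c\<^sup>2) * wnorm2 w u"
proof -
  have "ennreal (w k * (c * u k)\<^sup>2) = ennreal (c\<^sup>2) * ennreal (w k * (u k)\<^sup>2)" for k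
    by (simp add: ennreal_mult'[symmetric] power_mult_distrib mult_ac)
  then show ?thesis unfolding wnorm2_def by (simp add: nn_integral_cmult)
qed

lemma wnorm2_minus_commute: "wnorm2 w (\<lambda>k. u k - v k) = wnorm2 w (\<lambda>k. v k - u k)"
  unfolding wnorm2_def by (simp add: power2_commute)

lemma wnorm2_zero [simp]: "wnorm2 w (\<lambda>k. 0) = 0"
  unfolding wnorm2_def by simp

definition sob_weight :: "real \<Rightarrow> int \<times> int \<Rightarrow> real" where
  "sob_weight s k = bracket2 k powr s"

lemma sob_weight_pos: "sob_weight s k > 0"
  unfolding sob_weight_def using bracket2_pos[of k] by simp

lemma sob_weight_nonneg: "sob_weight s k \<ge> 0"
  using sob_weight_pos[of s k] by simp

lemma sobolev_iff: "u \<in> sobolev s \<longleftrightarrow> wnorm2 (sob_weight s) u < \<infinity>"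
  unfolding sobolev_def wnorm2_def sob_weight_def
  by (simp add: nonneg_summable_on_iff)

lemma sobolev_norm_wnorm2: "u \<in> sobolev s \<Longrightarrow> ennreal ((sobolev_norm s u)\<^sup>2) = wnorm2 (sob_weight s) u"
  unfolding sobolev_def sobolev_norm_def wnorm2_def sob_weight_def
  by (subst nn_integral_infsum) (auto simp: infsum_nonneg)

lemma sobolev_norm_nonneg: "sobolev_norm s u \<ge> 0"
  unfolding sobolev_norm_def by (auto intro!: infsum_nonneg)

lemma sobolev_norm_sqrt: "u \<in> sobolev s \<Longrightarrow> sobolev_norm s u = sqrt (enn2real (wnorm2 (sob_weight s) u))"
  using sobolev_norm_wnorm2[of u s] sobolev_norm_nonneg[of s u] by (metis enn2real_ennreal real_sqrt_abs abs_of_nonneg zero_le_power2)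

lemma sobolev_diff: "u \<in> sobolev s \<Longrightarrow> v \<in> sobolev s \<Longrightarrow> (\<lambda>k. u k - v k) \<in> sobolev s"
  and sobolev_add: "u \<in> sobolev s \<Longrightarrow> v \<in> sobolev s \<Longrightarrow> (\<lambda>k. u k + v k) \<in> sobolev s"
proof -
  have add: "(\<lambda>k. u k + v k) \<in> sobolev s" if "u \<in> sobolev s" "v \<in> sobolev s" for u v
  proof -
    have "wnorm2 (sob_weight s) (\<lambda>k. u k + v k) \<le> 2 * wnorm2 (sob_weight s) u + 2 * wnorm2 (sob_weight s) v"
      by (rule wnorm2_add_le) (rule sob_weight_nonneg)
    also have "\<dots> < \<infinity>" using that unfolding sobolev_iff by (simp add: ennreal_mult_less_top)
    finally show ?thesis unfolding sobolev_iff .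
  qed
  then show "u \<in> sobolev s \<Longrightarrow> v \<in> sobolev s \<Longrightarrow> (\<lambda>k. u k + v k) \<in> sobolev s" .
  assume "u \<in> sobolev s" "v \<in> sobolev s"
  moreover from this have "(\<lambda>k. - v k) \<in> sobolev s" unfolding sobolev_def by simp
  ultimately show "(\<lambda>k. u k - v k) \<in> sobolev s" using add[of u "\<lambda>k. - v k"] by simp
qed

lemma sobolev_scale: "u \<in> sobolev s \<Longrightarrow> (\<lambda>k. c * u k) \<in> sobolev s"
  unfolding sobolev_iff wnorm2_scale by (simp add: ennreal_mult_less_top)

lemma sobolev_zero: "(\<lambda>k. 0) \<in> sobolev s"
  unfolding sobolev_iff by simp

lemma sobolev_sum: "(\<And>i. i \<in> I \<Longrightarrow> f i \<in> sobolev s) \<Longrightarrow> (\<lambda>k. \<Sum>i\<in>I. f i k) \<in> sobolev s"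
  by (induction I rule: infinite_finite_induct) (auto intro: sobolev_zero sobolev_add)

lemma sobolev_norm_triangle:
  assumes u: "u \<in> sobolev s" and v: "v \<in> sobolev s"
  shows "sobolev_norm s (\<lambda>k. u k + v k) \<le> sobolev_norm s u + sobolev_norm s v"
proof -
  let ?w = "\<lambda>k. sqrt (bracket2 k powr s)"
  have le: "L2_set (\<lambda>k. ?w k * u k) S \<le> sobolev_norm s u" if "finite S" "u \<in> sobolev s" for u S
    unfolding L2_set_def sobolev_norm_def using that
    by (intro real_sqrt_le_mono) (auto simp: power_mult_distrib sobolev_def intro!: finite_sum_le_infsum)
  have "(\<Sum>\<^sub>\<infinity>k. bracket2 k powr s * (u k + v k)\<^sup>2) \<le> (sobolev_norm s u + sobolev_norm s v)\<^sup>2"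
  proof (rule infsum_le_finite_sums)
    show "(\<lambda>k. bracket2 k powr s * (u k + v k)\<^sup>2) summable_on UNIV"
      using sobolev_add[OF u v] unfolding sobolev_def by simp
    fix S :: "(int \<times> int) set" assume S: "finite S"
    have "L2_set (\<lambda>k. ?w k * u k + ?w k * v k) S \<le> sobolev_norm s u + sobolev_norm s v"
      using L2_set_triangle_ineq[of "\<lambda>k. ?w k * u k" "\<lambda>k. ?w k * v k" S] le[OF S u] le[OF S v] by linarith
    then have "(L2_set (\<lambda>k. ?w k * u k + ?w k * v k) S)\<^sup>2 \<le> (sobolev_norm s u + sobolev_norm s v)\<^sup>2"
      by (intro power_mono) auto
    then show "(\<Sum>k\<in>S. bracket2 k powr s * (u k + v k)\<^sup>2) \<le> (sobolev_norm s u + sobolev_norm s v)\<^sup>2"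
      unfolding L2_set_def by (simp add: sum_nonneg power_mult_distrib flip: distrib_left)
  qed
  then show ?thesis unfolding sobolev_norm_def[of s "\<lambda>k. u k + v k"]
    by (intro real_le_lsqrt) (auto intro!: add_nonneg_nonneg sobolev_norm_nonneg infsum_nonneg)
qed

lemma abs_coeff_le_sobolev_norm:
  assumes "u \<in> sobolev s"
  shows "sqrt (bracket2 k powr s) * \<bar>u k\<bar> \<le> sobolev_norm s u"
proof -
  have "(\<Sum>k\<in>{k}. bracket2 k powr s * (u k)\<^sup>2) \<le> (\<Sum>\<^sub>\<infinity>k. bracket2 k powr s * (u k)\<^sup>2)"
    using assms by (intro finite_sum_le_infsum) (auto simp: sobolev_def)
  then have "sqrt (bracket2 k powr s * (u k)\<^sup>2) \<le> sobolev_norm s u"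
    unfolding sobolev_norm_def by (intro real_sqrt_le_mono) simp
  then show ?thesis by (simp add: real_sqrt_mult)
qed

lemma Metric_space_sobolev: "Metric_space (sobolev s) (sobolev_dist s)"
proof
  fix x y z
  show "0 \<le> sobolev_dist s x y" unfolding sobolev_dist_def by (rule sobolev_norm_nonneg)
  show "sobolev_dist s x y = sobolev_dist s y x"
    unfolding sobolev_dist_def sobolev_norm_def by (simp add: power2_commute)
  assume x: "x \<in> sobolev s" and y: "y \<in> sobolev s"
  show "(sobolev_dist s x y = 0) = (x = y)"
  proof
    assume "sobolev_dist s x y = 0"
    then have "sqrt (bracket2 k powr s) * \<bar>x k - y k\<bar> \<le> 0" for k
      using abs_coeff_le_sobolev_norm[OF sobolev_diff[OF x y], of k] unfolding sobolev_dist_def by simp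
    moreover have "sqrt (bracket2 k powr s) > 0" for k using bracket2_pos[of k] by simp
    ultimately have "\<bar>x k - y k\<bar> \<le> 0" for k by (meson mult_le_0_iff not_le)
    then show "x = y" by auto
  qed (simp add: sobolev_dist_def sobolev_norm_def)
  assume z: "z \<in> sobolev s"
  show "sobolev_dist s x z \<le> sobolev_dist s x y + sobolev_dist s y z"
    using sobolev_norm_triangle[OF sobolev_diff[OF x y] sobolev_diff[OF y z]] unfolding sobolev_dist_def by simp
qed

lemma space_sobolev_borel [simp]: "space (sobolev_borel s) = sobolev s"
  and sets_sobolev_borel: "sets (sobolev_borel s) = sigma_sets (sobolev s) {U. openin (Metric_space.mtopology (sobolev s) (sobolev_dist s)) U}"
proof -
  interpret Metric_space "sobolev s" "sobolev_dist s" by (rule Metric_space_sobolev)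
  have "{U. openin mtopology U} \<subseteq> Pow (sobolev s)" using openin_mtopology by auto
  then show "space (sobolev_borel s) = sobolev s"
    "sets (sobolev_borel s) = sigma_sets (sobolev s) {U. openin mtopology U}"
    unfolding sobolev_borel_def by (auto simp: space_measure_of sets_measure_of)
qed

text \<open>Coordinate evaluation is Lipschitz for the Sobolev distance; the constant is the inverse
  square root of the weight.\<close>

lemma borel_measurable_coeff: "(\<lambda>u. u k) \<in> borel_measurable (sobolev_borel s)"
proof (rule borel_measurableI)
  interpret Metric_space "sobolev s" "sobolev_dist s" by (rule Metric_space_sobolev)
  fix S :: "real set" assume S: "open S"
  have "openin mtopology {u \<in> sobolev s. u k \<in> S}"
    unfolding openin_mtopology
  proof (intro conjI allI impI)
    fix u assume u: "u \<in> {u \<in> sobolev s. u k \<in> S}"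
    then obtain e where e: "e > 0" "ball (u k) e \<subseteq> S" using S open_contains_ball by blast
    define c where "c = sqrt (bracket2 k powr s)"
    have c: "c > 0" unfolding c_def using bracket2_pos[of k] by simp
    have "mball u (c * e) \<subseteq> {u \<in> sobolev s. u k \<in> S}"
    proof
      fix v assume "v \<in> mball u (c * e)"
      then have v: "v \<in> sobolev s" and d: "sobolev_norm s (\<lambda>k. u k - v k) < c * e"
        unfolding mball_def sobolev_dist_def by auto
      have "c * \<bar>u k - v k\<bar> < c * e"
        using abs_coeff_le_sobolev_norm[OF sobolev_diff[of u s v], of k] u v d unfolding c_def by auto
      then have "v k \<in> ball (u k) e" using c by (simp add: dist_real_def)
      then show "v \<in> {u \<in> sobolev s. u k \<in> S}" using e v by auto
    qed
    then show "\<exists>r>0. mball u r \<subseteq> {u \<in> sobolev s. u k \<in> S}" using c e by (intro exI[of _ "c * e"]) auto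
  qed auto
  then show "(\<lambda>u. u k) -` S \<inter> space (sobolev_borel s) \<in> sets (sobolev_borel s)"
    unfolding sets_sobolev_borel by (auto simp: vimage_def Int_def conj_commute intro: sigma_sets.Basic)
qed

section \<open>Separability and measurability through coordinates\<close>

definition rational_coeffs :: "((int \<times> int) \<times> rat) list \<Rightarrow> distribution" where
  "rational_coeffs xs k = (case map_of xs k of None \<Rightarrow> 0 | Some q \<Rightarrow> of_rat q)"

lemma rational_coeffs_finite: "finite {k. rational_coeffs xs k \<noteq> 0}"
proof (rule finite_subset)
  show "{k. rational_coeffs xs k \<noteq> 0} \<subseteq> dom (map_of xs)"
    unfolding rational_coeffs_def by (auto split: option.splits)
qed (rule finite_dom_map_of)

lemma finite_support_sobolev: "finite {k. u k \<noteq> 0} \<Longrightarrow> u \<in> sobolev s"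
  unfolding sobolev_def mem_Collect_eq
  by (rule summable_on_cong_neutral[THEN iffD1, rotated -1, of _ "{k. u k \<noteq> 0}", OF summable_on_finite]) auto

text \<open>Truncate to a finite set carrying all but e^2 / 4 of the squared norm, then round the
  kept coefficients to rationals. The indexing lists form a countable type, so this is a countable
  dense set.\<close>

lemma rational_coeffs_dense:
  assumes u: "u \<in> sobolev s" and e: "e > 0"
  shows "\<exists>xs. sobolev_dist s (rational_coeffs xs) u < e"
proof -
  let ?f = "\<lambda>k. bracket2 k powr s * (u k)\<^sup>2"
  have sm: "?f summable_on UNIV" using u unfolding sobolev_def by simp
  have e2: "e\<^sup>2 / 2 > 0" using e by simp
  obtain S where S: "finite S" "dist (sum ?f S) (infsum ?f UNIV) \<le> e\<^sup>2 / 4"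
    using infsum_finite_approximation[OF sm, of "e\<^sup>2 / 4"] e by (auto simp: zero_less_power2)
  have tail: "(\<Sum>\<^sub>\<infinity>k\<in>- S. ?f k) \<le> e\<^sup>2 / 4"
  proof -
    have "infsum ?f UNIV = infsum ?f S + infsum ?f (- S)"
      using infsum_Un_disjoint[of ?f S "- S"] S sm summable_on_subset_banach[OF sm] by (auto simp: Compl_partition)
    then show ?thesis using S by (auto simp: dist_real_def)
  qed
  \<comment> \<open>The added 1 keeps n positive when S is empty; rounding then costs at most e^2 /
    4 in total.\<close>
  define n where "n = real (card S) + 1"
  have n: "n > 0" unfolding n_def by simp
  have "\<exists>q::rat. bracket2 k powr s * (of_rat q - u k)\<^sup>2 \<le> e\<^sup>2 / (4 * n)" for k
  proof -
    define c where "c = bracket2 k powr s"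
    have c: "c > 0" unfolding c_def using bracket2_pos[of k] by simp
    define r where "r = e / (2 * sqrt (c * n))"
    have r: "r > 0" unfolding r_def using e c n by simp
    obtain q where q: "u k < of_rat q" "of_rat q < u k + r" using of_rat_dense[of "u k" "u k + r"] r by auto
    have "(of_rat q - u k)\<^sup>2 \<le> r\<^sup>2" using q r by (intro power_mono) auto
    then have "c * (of_rat q - u k)\<^sup>2 \<le> c * r\<^sup>2" using c by (intro mult_left_mono) auto
    also have "\<dots> = e\<^sup>2 / (4 * n)" unfolding r_def using c n by (simp add: power_divide power_mult_distrib field_simps)
    finally show ?thesis unfolding c_def by blast
  qed
  then obtain q :: "int \<times> int \<Rightarrow> rat" where q: "\<And>k. bracket2 k powr s * (of_rat (q k) - u k)\<^sup>2 \<le> e\<^sup>2 / (4 * n)" by metis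
  obtain l where l: "set l = S" using S finite_list by blast
  define xs where "xs = map (\<lambda>k. (k, q k)) l"
  have xs: "rational_coeffs xs k = (if k \<in> S then of_rat (q k) else 0)" for k
    unfolding rational_coeffs_def xs_def using l by (auto simp: map_of_map_restrict restrict_map_def)
  let ?g = "\<lambda>k. bracket2 k powr s * (rational_coeffs xs k - u k)\<^sup>2"
  have "(\<lambda>k. rational_coeffs xs k - u k) \<in> sobolev s"
    by (intro sobolev_diff u finite_support_sobolev rational_coeffs_finite)
  then have sg: "?g summable_on UNIV" unfolding sobolev_def by simp
  have "infsum ?g UNIV = infsum ?g S + infsum ?g (- S)"
    using infsum_Un_disjoint[of ?g S "- S"] S sg summable_on_subset_banach[OF sg] by (auto simp: Compl_partition)
  also have "infsum ?g S = (\<Sum>k\<in>S. ?g k)" using S by simp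
  also have "\<dots> \<le> (\<Sum>k\<in>S. e\<^sup>2 / (4 * n))" by (intro sum_mono) (use q xs in auto)
  also have "\<dots> = real (card S) / n * (e\<^sup>2 / 4)" by simp
  also have "\<dots> \<le> 1 * (e\<^sup>2 / 4)" using n by (intro mult_right_mono) (auto simp: n_def)
  also have "infsum ?g (- S) = infsum ?f (- S)" by (intro infsum_cong) (auto simp: xs)
  also note tail
  finally have "infsum ?g UNIV \<le> e\<^sup>2 / 2" by simp
  then have "infsum ?g UNIV < e\<^sup>2" using e by (smt (verit) e2 field_sum_of_halves)
  then have "sqrt (infsum ?g UNIV) < e" using e real_sqrt_less_mono[of "infsum ?g UNIV" "e\<^sup>2"] by simp
  then show ?thesis unfolding sobolev_dist_def sobolev_norm_def by blast
qed

text \<open>By density of \<open>rational_coeffs\<close> each open set is a countable union of balls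
  with rational centre and radius, and membership in a ball is a condition on \<open>wnorm2\<close>,
  a measurable function of the coordinates.\<close>

lemma measurable_sobolev_borelI:
  assumes coeff: "\<And>k. (\<lambda>z. F z k) \<in> borel_measurable M" and range: "\<And>z. z \<in> space M \<Longrightarrow> F z \<in> sobolev s"
  shows "F \<in> M \<rightarrow>\<^sub>M sobolev_borel s"
proof (rule measurable_sigma_sets[OF sets_sobolev_borel])
  interpret Metric_space "sobolev s" "sobolev_dist s" by (rule Metric_space_sobolev)
  show "{U. openin mtopology U} \<subseteq> Pow (sobolev s)" using openin_mtopology by auto
  show "F \<in> space M \<rightarrow> sobolev s" using range by auto
  fix U assume "U \<in> {U. openin mtopology U}"
  then have U: "U \<subseteq> sobolev s" "\<And>u. u \<in> U \<Longrightarrow> \<exists>r>0. mball u r \<subseteq> U" unfolding openin_mtopology by auto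
  define I where "I = {i :: ((int \<times> int) \<times> rat) list \<times> rat. mball (rational_coeffs (fst i)) (of_rat (snd i)) \<subseteq> U}"
  have "U = (\<Union>i\<in>I. mball (rational_coeffs (fst i)) (of_rat (snd i)))"
  proof (intro equalityI subsetI)
    fix u assume u: "u \<in> U"
    then have us: "u \<in> sobolev s" using U by auto
    obtain r where r: "r > 0" "mball u r \<subseteq> U" using U(2)[OF u] by auto
    obtain q :: rat where q: "0 < real_of_rat q" "of_rat q < r / 2" using of_rat_dense[of 0 "r / 2"] r by auto
    obtain xs where xs: "sobolev_dist s (rational_coeffs xs) u < of_rat q" using rational_coeffs_dense[OF us q(1)] by auto
    have xss: "rational_coeffs xs \<in> sobolev s" by (intro finite_support_sobolev rational_coeffs_finite)
    have "mball (rational_coeffs xs) (of_rat q) \<subseteq> mball u r"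
    proof
      fix v assume v: "v \<in> mball (rational_coeffs xs) (of_rat q)"
      then have vs: "v \<in> sobolev s" "sobolev_dist s (rational_coeffs xs) v < of_rat q" by (auto simp: mball_def)
      have "sobolev_dist s u v \<le> sobolev_dist s u (rational_coeffs xs) + sobolev_dist s (rational_coeffs xs) v"
        by (rule triangle[OF us xss vs(1)])
      also have "\<dots> < r" using xs vs(2) q commute[of u "rational_coeffs xs"] by linarith
      finally show "v \<in> mball u r" using us vs by (auto simp: mball_def)
    qed
    then have "(xs, q) \<in> I" using r unfolding I_def by auto
    moreover have "u \<in> mball (rational_coeffs xs) (of_rat q)" using xs us xss by (auto simp: mball_def)
    ultimately show "u \<in> (\<Union>i\<in>I. mball (rational_coeffs (fst i)) (of_rat (snd i)))" by (intro UN_I[of "(xs, q)"]) auto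
  qed (auto simp: I_def)
  then have "F -` U \<inter> space M = (\<Union>i\<in>I. F -` mball (rational_coeffs (fst i)) (of_rat (snd i)) \<inter> space M)" by auto
  also have "\<dots> \<in> sets M"
  proof (intro sets.countable_UN'')
    show "countable I" by (rule countableI_type)
    fix i assume "i \<in> I"
    obtain xs q where i: "i = (xs, q)" by (cases i)
    have xss: "rational_coeffs xs \<in> sobolev s" by (intro finite_support_sobolev rational_coeffs_finite)
    have [measurable]: "(\<lambda>z. wnorm2 (sob_weight s) (\<lambda>k. rational_coeffs xs k - F z k)) \<in> borel_measurable M"
      by (intro borel_measurable_wnorm2 borel_measurable_diff coeff borel_measurable_const)
    have "F -` mball (rational_coeffs xs) (of_rat q) \<inter> space M = {z \<in> space M. sqrt (enn2real (wnorm2 (sob_weight s) (\<lambda>k. rational_coeffs xs k - F z k))) < of_rat q}"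
      using range xss sobolev_diff[OF xss range] by (auto simp: mball_def sobolev_dist_def sobolev_norm_sqrt)
    also have "\<dots> \<in> sets M" by measurable
    finally show "F -` mball (rational_coeffs (fst i)) (of_rat (snd i)) \<inter> space M \<in> sets M" unfolding i by simp
  qed
  finally show "F -` U \<inter> space M \<in> sets M" .
qed

lemma measurable_sobolev_borelD:
  assumes "F \<in> M \<rightarrow>\<^sub>M sobolev_borel s"
  shows "(\<lambda>z. F z k) \<in> borel_measurable M" "z \<in> space M \<Longrightarrow> F z \<in> sobolev s"
  using measurable_compose[OF assms borel_measurable_coeff] measurable_space[OF assms] by auto

section \<open>Coordinates of the free field\<close>

lemma std_normal_exp:
  "integrable std_normal_distribution (\<lambda>x. exp (c * x))" "(\<integral>x. exp (c * x) \<partial>std_normal_distribution) = exp (c\<^sup>2 / 2)"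
proof -
  \<comment> \<open>Completing the square: the tilted standard normal density is the normal density
    centred at c.\<close>
  have eq: "std_normal_density x *\<^sub>R exp (c * x) = exp (c\<^sup>2 / 2) * normal_density c 1 x" for x
    unfolding normal_density_def by (simp add: exp_add[symmetric] power2_eq_square field_simps)
  show "integrable std_normal_distribution (\<lambda>x. exp (c * x))"
    by (subst integrable_density) (auto simp: eq simp del: real_scaleR_def)
  show "(\<integral>x. exp (c * x) \<partial>std_normal_distribution) = exp (c\<^sup>2 / 2)"
    by (subst integral_density) (auto simp: eq simp del: real_scaleR_def)
qed

lemma iexp_cos_sin: "iexp u = complex_of_real (cos u) + \<i> * complex_of_real (sin u)"
  by (simp add: cis_conv_exp[symmetric] complex_eq_iff)

text \<open>Weighting by \<open>h\<close> does not change the law of \<open>X\<close> if it does not change its characteristic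
  function. This turns one-dimensional uniqueness into a criterion for joint independence.\<close>

lemma (in prob_space) weighted_std_normal:
  assumes [measurable]: "h \<in> borel_measurable M" "X \<in> borel_measurable M"
    and h: "\<And>z. 0 \<le> h z" "\<And>z. h z \<le> C"
    and cos: "\<And>t. (\<integral>z. h z * cos (t * X z) \<partial>M) = (\<integral>z. h z \<partial>M) * exp (- t\<^sup>2 / 2)"
    and sin: "\<And>t. (\<integral>z. h z * sin (t * X z) \<partial>M) = 0"
    and A[measurable]: "A \<in> sets borel"
  shows "(\<integral>z. h z * indicator A (X z) \<partial>M) = (\<integral>z. h z \<partial>M) * measure std_normal_distribution A"
proof -
  define c where "c = (\<integral>z. h z \<partial>M)"
  have C: "0 \<le> C" using h[of undefined] by linarith
  have inth: "integrable M (\<lambda>z. h z * f z)" if "f \<in> borel_measurable M" "\<And>z. \<bar>f z\<bar> \<le> 1" for f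
  proof (rule integrable_const_bound[of _ C])
    show "AE z in M. norm (h z * f z) \<le> C"
      using h that(2) mult_mono[of "\<bar>h _\<bar>" C "\<bar>f _\<bar>" 1] C by (intro AE_I2) (auto simp: abs_mult)
  qed (use that in measurable)
  have h_int: "integrable M h" using inth[of "\<lambda>_. 1"] by simp
  have "c \<ge> 0" unfolding c_def using h by (intro integral_nonneg_AE) auto
  show ?thesis
  proof (cases "c = 0")
    case True
    then have "AE z in M. h z = 0"
      using h_int h integral_nonneg_eq_0_iff_AE[of M h] unfolding c_def by auto
    then have "(\<integral>z. h z * indicator A (X z) \<partial>M) = (\<integral>z. 0 \<partial>M)" by (intro integral_cong_AE) auto
    then show ?thesis using True unfolding c_def by simp
  next
    case False
    then have c: "c > 0" using \<open>c \<ge> 0\<close> by simp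
    \<comment> \<open>Tilting by \<open>h / c\<close> gives a probability measure; the hypotheses
      say that X has the standard normal characteristic function under it.\<close>
    define N where "N = density M (\<lambda>z. ennreal (h z / c))"
    have "prob_space N"
    proof
      have "emeasure N (space N) = (\<integral>\<^sup>+z. ennreal (h z / c) \<partial>M)"
        unfolding N_def by (subst emeasure_density) (auto simp: indicator_def intro!: nn_integral_cong)
      also have "\<dots> = ennreal (\<integral>z. h z / c \<partial>M)" using h_int h c by (intro nn_integral_eq_integral) auto
      also have "(\<integral>z. h z / c \<partial>M) = 1" using c unfolding c_def by simp
      finally show "emeasure N (space N) = 1" by simp
    qed
    then interpret N: prob_space N .
    have [measurable]: "X \<in> borel_measurable N" unfolding N_def by simp
    define D where "D = distr N borel X"
    have rd: "real_distribution D" unfolding D_def by (rule N.real_distribution_distr) simp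
    have "char D = char std_normal_distribution"
    proof
      fix t
      have ints: "integrable N (\<lambda>z. cos (t * X z))" "integrable N (\<lambda>z. sin (t * X z))"
        by (auto intro!: N.integrable_const_bound[of _ 1])
      have "char D t = (CLINT z|N. iexp (t * X z))" unfolding char_def D_def by (subst integral_distr) auto
      also have "\<dots> = (CLINT z|N. complex_of_real (cos (t * X z)) + \<i> * complex_of_real (sin (t * X z)))"
        by (simp only: iexp_cos_sin)
      also have "\<dots> = complex_of_real (\<integral>z. cos (t * X z) \<partial>N) + \<i> * complex_of_real (\<integral>z. sin (t * X z) \<partial>N)"
        using ints by simp
      also have "(\<integral>z. cos (t * X z) \<partial>N) = exp (- t\<^sup>2 / 2)"
      proof -
        have "(\<integral>z. cos (t * X z) \<partial>N) = (\<integral>z. h z * cos (t * X z) / c \<partial>M)"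
          unfolding N_def using h c by (subst integral_density) auto
        then show ?thesis using cos[of t] c unfolding c_def by simp
      qed
      also have "(\<integral>z. sin (t * X z) \<partial>N) = 0"
      proof -
        have "(\<integral>z. sin (t * X z) \<partial>N) = (\<integral>z. h z * sin (t * X z) / c \<partial>M)"
          unfolding N_def using h c by (subst integral_density) auto
        then show ?thesis using sin[of t] c unfolding c_def by simp
      qed
      finally show "char D t = char std_normal_distribution t" by (simp add: char_std_normal_distribution)
    qed
    then have "D = std_normal_distribution" using Levy_uniqueness[OF rd real_dist_normal_dist] by simp
    then have "measure std_normal_distribution A = measure D A" by simp
    also have "\<dots> = measure N (X -` A \<inter> space N)" unfolding D_def by (rule measure_distr) auto
    also have "\<dots> = (\<integral>z. indicator (X -` A \<inter> space N) z \<partial>N)" by simp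
    also have "\<dots> = (\<integral>z. indicator A (X z) \<partial>N)" by (intro Bochner_Integration.integral_cong) (auto simp: indicator_def)
    also have "\<dots> = (\<integral>z. h z * indicator A (X z) / c \<partial>M)"
      unfolding N_def using h c by (subst integral_density) auto
    finally show ?thesis using c unfolding c_def[symmetric] by simp
  qed
qed

locale gaussian_free_field =
  fixes \<delta> :: real and M :: "distribution measure"
  assumes free_field: "free_field \<delta> M"
begin

sublocale prob_space M
  using free_field unfolding free_field_def centered_gaussian_def by simp

lemma sets_M: "sets M = sets (sobolev_borel (- \<delta>))"
  using free_field unfolding free_field_def centered_gaussian_def by simp

lemma measurable_coordinate [measurable]: "(\<lambda>z. z k) \<in> borel_measurable M"
  using borel_measurable_coeff measurable_cong_sets[OF sets_M refl] by blast

definition lin :: "(int \<times> int) set \<Rightarrow> (int \<times> int \<Rightarrow> real) \<Rightarrow> distribution \<Rightarrow> real" where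
  "lin J t z = (\<Sum>k\<in>J. t k * z k)"

definition lin_var :: "(int \<times> int) set \<Rightarrow> (int \<times> int \<Rightarrow> real) \<Rightarrow> real" where
  "lin_var J t = (\<Sum>k\<in>J. (t k)\<^sup>2 / bracket2 k)"

lemma measurable_lin [measurable]: "lin J t \<in> borel_measurable M"
  unfolding lin_def by measurable

lemma lin_var_nonneg: "lin_var J t \<ge> 0"
  unfolding lin_var_def using bracket2_pos by (intro sum_nonneg) (simp add: less_imp_le)

text \<open>The Gaussian hypothesis supplies some standard deviation \<sigma>; the covariance
  identity with both arguments equal to the finitely supported l determines it.\<close>

lemma law_lin:
  assumes J: "finite J"
  shows "distr M borel (lin J t) = centered_normal (sqrt (lin_var J t))"
proof -
  define l where "l = (\<lambda>k. if k \<in> J then t k else 0)"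
  have ls: "l \<in> sobolev \<delta>" unfolding l_def using J by (intro finite_support_sobolev) (auto intro: finite_subset[of _ J])
  have pair: "pairing u l = (\<Sum>k\<in>J. u k * t k)" for u
  proof -
    have "pairing u l = (\<Sum>\<^sub>\<infinity>k\<in>J. u k * l k)"
      unfolding pairing_def by (rule infsum_cong_neutral) (auto simp: l_def)
    then show ?thesis using J by (simp add: l_def)
  qed
  have pl: "(\<lambda>z. pairing z l) = lin J t" unfolding pair lin_def by (simp add: mult.commute)
  obtain \<sigma> where \<sigma>: "\<sigma> \<ge> 0" "distr M borel (lin J t) = centered_normal \<sigma>"
    using free_field ls unfolding free_field_def centered_gaussian_def by (auto simp: pl[symmetric])
  have "(\<integral>z. lin J t z * lin J t z \<partial>M) = pairing (resolvent l) l"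
    using free_field ls unfolding free_field_def pl[symmetric] by blast
  also have "\<dots> = lin_var J t"
    unfolding pair unfolding lin_var_def resolvent_def l_def by (simp add: power2_eq_square)
  finally have "lin_var J t = (\<integral>x. x\<^sup>2 \<partial>centered_normal \<sigma>)"
    unfolding \<sigma>(2)[symmetric] by (subst integral_distr) (auto simp: power2_eq_square)
  also have "\<dots> = \<sigma>\<^sup>2"
  proof (cases "\<sigma> = 0")
    case True
    then show ?thesis unfolding centered_normal_def by (simp add: integral_return)
  next
    case False
    then have "\<sigma> > 0" using \<sigma> by simp
    have "(\<integral>x. x\<^sup>2 \<partial>centered_normal \<sigma>) = (\<integral>x. normal_density 0 \<sigma> x * (x - 0) ^ (2 * 1) \<partial>lborel)"
      unfolding centered_normal_def using False by (simp add: integral_density)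
    also have "\<dots> = \<sigma>\<^sup>2"
      using has_bochner_integral_integral_eq[OF normal_moment_even[OF \<open>\<sigma> > 0\<close>, of 0 1]] by simp
    finally show ?thesis .
  qed
  finally have "sqrt (lin_var J t) = \<sigma>" using \<sigma> by simp
  then show ?thesis using \<sigma> by simp
qed

lemma law_lin_standard:
  assumes J: "finite J" and v: "lin_var J t > 0"
  shows "distr M borel (\<lambda>z. lin J t z / sqrt (lin_var J t)) = std_normal_distribution"
proof -
  define s where "s = (\<lambda>k. t k / sqrt (lin_var J t))"
  have "lin J t z / sqrt (lin_var J t) = lin J s z" for z
    unfolding lin_def s_def by (simp add: sum_divide_distrib)
  moreover have "lin_var J s = 1"
  proof -
    have "lin_var J s = (\<Sum>k\<in>J. (t k)\<^sup>2 / bracket2 k) / lin_var J t"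
      unfolding sum_divide_distrib using v
      by (subst lin_var_def, intro sum.cong) (auto simp: s_def power_divide mult.commute)
    also have "\<dots> = lin_var J t / lin_var J t" unfolding lin_var_def ..
    finally have "lin_var J s = lin_var J t / lin_var J t" .
    then show ?thesis using v by simp
  qed
  ultimately show ?thesis using law_lin[OF J, of s] unfolding centered_normal_def by simp
qed

lemma lin_zero_var:
  assumes J: "finite J" and v: "\<not> lin_var J t > 0"
  shows "lin J t z = 0"
proof -
  have "lin_var J t = 0" using v lin_var_nonneg[of J t] by simp
  then have "\<forall>k\<in>J. (t k)\<^sup>2 / bracket2 k = 0"
    unfolding lin_var_def using J bracket2_pos by (subst (asm) sum_nonneg_eq_0_iff) (auto simp: less_imp_le)
  then have "\<forall>k\<in>J. t k = 0" using bracket2_pos by (metis divide_eq_0_iff less_irrefl power_eq_0_iff)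
  then show ?thesis unfolding lin_def by simp
qed

lemma expectation_exp_lin:
  assumes J: "finite J"
  shows "integrable M (\<lambda>z. exp (lin J t z))" "(\<integral>z. exp (lin J t z) \<partial>M) = exp (lin_var J t / 2)"
proof -
  have "integrable M (\<lambda>z. exp (lin J t z)) \<and> (\<integral>z. exp (lin J t z) \<partial>M) = exp (lin_var J t / 2)"
  proof (cases "lin_var J t > 0")
    case False
    then show ?thesis using lin_zero_var[OF J False] lin_var_nonneg[of J t] by (simp add: prob_space)
  next
    case True
    define c where "c = sqrt (lin_var J t)"
    have c: "c > 0" "c\<^sup>2 = lin_var J t" unfolding c_def using True by auto
    have law: "distr M borel (\<lambda>z. lin J t z / c) = std_normal_distribution" unfolding c_def by (rule law_lin_standard[OF J True])
    have e: "exp (lin J t z) = exp (c * (lin J t z / c))" for z using c by simp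
    have "integrable M (\<lambda>z. exp (c * (lin J t z / c)))"
      using std_normal_exp(1)[of c] unfolding law[symmetric] by (subst (asm) integrable_distr_eq) auto
    moreover have "(\<integral>z. exp (c * (lin J t z / c)) \<partial>M) = exp (c\<^sup>2 / 2)"
      using std_normal_exp(2)[of c] unfolding law[symmetric] by (subst (asm) integral_distr) auto
    ultimately show ?thesis unfolding e c by simp
  qed
  then show "integrable M (\<lambda>z. exp (lin J t z))" "(\<integral>z. exp (lin J t z) \<partial>M) = exp (lin_var J t / 2)" by auto
qed

lemma expectation_cos_sin_lin:
  assumes J: "finite J"
  shows "(\<integral>z. cos (lin J t z) \<partial>M) = exp (- lin_var J t / 2)" "(\<integral>z. sin (lin J t z) \<partial>M) = 0"
proof -
  have "(\<integral>z. cos (lin J t z) \<partial>M) = exp (- lin_var J t / 2) \<and> (\<integral>z. sin (lin J t z) \<partial>M) = 0"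
  proof (cases "lin_var J t > 0")
    case False
    then show ?thesis using lin_zero_var[OF J False] lin_var_nonneg[of J t] by (simp add: prob_space)
  next
    case True
    define c where "c = sqrt (lin_var J t)"
    have c: "c > 0" "c\<^sup>2 = lin_var J t" unfolding c_def using True by auto
    have law: "distr M borel (\<lambda>z. lin J t z / c) = std_normal_distribution" unfolding c_def by (rule law_lin_standard[OF J True])
    have ints: "integrable M (\<lambda>z. cos (lin J t z))" "integrable M (\<lambda>z. sin (lin J t z))"
      by (auto intro!: integrable_const_bound[of _ 1])
    have "complex_of_real (exp (- c\<^sup>2 / 2)) = char std_normal_distribution c" by (simp add: char_std_normal_distribution)
    also have "\<dots> = (CLINT z|M. iexp (lin J t z))"
      unfolding law[symmetric] char_def using c by (subst integral_distr) auto
    also have "\<dots> = (CLINT z|M. complex_of_real (cos (lin J t z)) + \<i> * complex_of_real (sin (lin J t z)))"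
      by (simp only: iexp_cos_sin)
    also have "\<dots> = complex_of_real (\<integral>z. cos (lin J t z) \<partial>M) + \<i> * complex_of_real (\<integral>z. sin (lin J t z) \<partial>M)"
      using ints by simp
    finally have *: "complex_of_real (exp (- c\<^sup>2 / 2)) = complex_of_real (\<integral>z. cos (lin J t z) \<partial>M) + \<i> * complex_of_real (\<integral>z. sin (lin J t z) \<partial>M)" .
    show ?thesis using arg_cong[OF *, of Re] arg_cong[OF *, of Im] c by simp
  qed
  then show "(\<integral>z. cos (lin J t z) \<partial>M) = exp (- lin_var J t / 2)" "(\<integral>z. sin (lin J t z) \<partial>M) = 0" by auto
qed

section \<open>Independence of the normalised coordinates\<close>

definition std_coord :: "int \<times> int \<Rightarrow> distribution \<Rightarrow> real" where
  "std_coord k z = sqrt (bracket2 k) * z k"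

lemma measurable_std_coord [measurable]: "std_coord k \<in> borel_measurable M"
  unfolding std_coord_def by measurable

text \<open>Induction on \<open>J'\<close>: one coordinate after the other passes from the
  characteristic function to an indicator. The next coordinate is seen through nonnegative bounded
  weights built from the indicators already present and the remaining phase, and
  \<open>weighted_std_normal\<close> applies to each weight. With \<open>J' = J\<close> the formula
  determines the joint law.\<close>

lemma coordinates_independent_aux:
  assumes J: "finite J" and J': "J' \<subseteq> J" and A: "\<And>k. A k \<in> sets borel"
  shows "(\<integral>z. (\<Prod>k\<in>J'. indicator (A k) (std_coord k z)) * cos (\<Sum>k\<in>J - J'. s k * std_coord k z) \<partial>M)
       = (\<Prod>k\<in>J'. measure std_normal_distribution (A k)) * exp (- (\<Sum>k\<in>J - J'. (s k)\<^sup>2) / 2)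
     \<and> (\<integral>z. (\<Prod>k\<in>J'. indicator (A k) (std_coord k z)) * sin (\<Sum>k\<in>J - J'. s k * std_coord k z) \<partial>M) = 0"
  using finite_subset[OF J' J] J'
proof (induction J' arbitrary: s rule: finite_induct)
  case empty
  have lin: "(\<Sum>k\<in>J. s k * std_coord k z) = lin J (\<lambda>k. s k * sqrt (bracket2 k)) z" for z
    unfolding lin_def std_coord_def by (simp add: mult_ac)
  have var: "lin_var J (\<lambda>k. s k * sqrt (bracket2 k)) = (\<Sum>k\<in>J. (s k)\<^sup>2)"
    unfolding lin_var_def using bracket2_pos by (intro sum.cong) (auto simp: power_mult_distrib less_imp_le, metis less_irrefl)
  show ?case using expectation_cos_sin_lin[OF J, of "\<lambda>k. s k * sqrt (bracket2 k)"] unfolding lin[symmetric] var by simp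
next
  case (insert k J')
  note [measurable] = A
  define Y where "Y = (\<lambda>z. \<Prod>k\<in>J'. indicator (A k) (std_coord k z) :: real)"
  define V where "V = (\<lambda>z. \<Sum>k\<in>J - insert k J'. s k * std_coord k z)"
  define v where "v = (\<Sum>k\<in>J - insert k J'. (s k)\<^sup>2)"
  define p where "p = (\<Prod>k\<in>J'. measure std_normal_distribution (A k))"
  define X where "X = std_coord k"
  have [measurable]: "Y \<in> borel_measurable M" "V \<in> borel_measurable M" "X \<in> borel_measurable M"
    unfolding Y_def V_def X_def by measurable
  have Y: "0 \<le> Y z" "Y z \<le> 1" for z unfolding Y_def by (auto intro!: prod_nonneg prod_le_1)
  have split: "J - J' = insert k (J - insert k J')" using insert by auto
  \<comment> \<open>The frequencies s are free in the induction hypothesis: a = 0 drops the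
    remaining phase V, while a = 1 with t and - t gives products of trigonometric functions by the
    addition formulas.\<close>
  have IH: "(\<integral>z. Y z * cos (a * V z + t * X z) \<partial>M) = p * exp (- (a\<^sup>2 * v + t\<^sup>2) / 2)" "(\<integral>z. Y z * sin (a * V z + t * X z) \<partial>M) = 0" for a t
  proof -
    define r where "r = (\<lambda>j. if j = k then t else a * s j)"
    have "(\<Sum>j\<in>J - J'. r j * std_coord j z) = a * V z + t * X z" for z
      unfolding split V_def X_def r_def using J by (simp add: sum_distrib_left mult_ac)
    moreover have "(\<Sum>j\<in>J - J'. (r j)\<^sup>2) = a\<^sup>2 * v + t\<^sup>2"
      unfolding split v_def r_def using J by (simp add: sum_distrib_left power_mult_distrib)
    ultimately show "(\<integral>z. Y z * cos (a * V z + t * X z) \<partial>M) = p * exp (- (a\<^sup>2 * v + t\<^sup>2) / 2)" "(\<integral>z. Y z * sin (a * V z + t * X z) \<partial>M) = 0"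
      using insert.IH[of r] insert.prems unfolding Y_def p_def by auto
  qed
  have intY: "integrable M (\<lambda>z. Y z * f z)" if "f \<in> borel_measurable M" "\<And>z. \<bar>f z\<bar> \<le> 1" for f
  proof (rule integrable_const_bound[of _ 1])
    show "AE z in M. norm (Y z * f z) \<le> 1"
      using Y that(2) by (intro AE_I2) (auto simp: abs_mult intro!: mult_le_one)
  qed (use that in measurable)
  have abs1: "\<bar>cos u * cos w\<bar> \<le> 1" "\<bar>cos u * sin w\<bar> \<le> 1" "\<bar>sin u * cos w\<bar> \<le> 1" "\<bar>sin u * sin w\<bar> \<le> 1" for u w :: real
    by (auto simp: abs_mult intro!: mult_le_one)
  have Yc: "(\<integral>z. Y z * cos (t * X z) \<partial>M) = p * exp (- t\<^sup>2 / 2)" "(\<integral>z. Y z * sin (t * X z) \<partial>M) = 0" for t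
    using IH[of 0 t] by auto
  have prodc: "(\<integral>z. Y z * (cos (V z) * cos (t * X z)) \<partial>M) = p * exp (- v / 2) * exp (- t\<^sup>2 / 2)"
    "(\<integral>z. Y z * (cos (V z) * sin (t * X z)) \<partial>M) = 0"
    "(\<integral>z. Y z * (sin (V z) * cos (t * X z)) \<partial>M) = 0"
    "(\<integral>z. Y z * (sin (V z) * sin (t * X z)) \<partial>M) = 0" for t
  proof -
    have i: "integrable M (\<lambda>z. Y z * cos (V z + t * X z))" "integrable M (\<lambda>z. Y z * cos (V z - t * X z))"
      "integrable M (\<lambda>z. Y z * sin (V z + t * X z))" "integrable M (\<lambda>z. Y z * sin (V z - t * X z))" for t
      by (auto intro!: intY)
    have I1: "(\<integral>z. Y z * cos (V z + t * X z) \<partial>M) = p * exp (- (v + t\<^sup>2) / 2)" "(\<integral>z. Y z * sin (V z + t * X z) \<partial>M) = 0"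
      using IH[of 1 t] by auto
    have I2: "(\<integral>z. Y z * cos (V z - t * X z) \<partial>M) = p * exp (- (v + t\<^sup>2) / 2)" "(\<integral>z. Y z * sin (V z - t * X z) \<partial>M) = 0"
      using IH[of 1 "- t"] by auto
    have ex: "exp (- (v + t\<^sup>2) / 2) = exp (- v / 2) * exp (- t\<^sup>2 / 2)" by (simp add: exp_add[symmetric] field_simps)
    have e1: "Y z * (cos (V z) * cos (t * X z)) = (Y z * cos (V z + t * X z) + Y z * cos (V z - t * X z)) / 2" for z
      by (simp add: cos_add cos_diff algebra_simps)
    show "(\<integral>z. Y z * (cos (V z) * cos (t * X z)) \<partial>M) = p * exp (- v / 2) * exp (- t\<^sup>2 / 2)"
      unfolding e1 using i I1 I2 unfolding ex by simp
    have e2: "Y z * (cos (V z) * sin (t * X z)) = (Y z * sin (V z + t * X z) - Y z * sin (V z - t * X z)) / 2" for z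
      by (simp add: sin_add sin_diff algebra_simps)
    show "(\<integral>z. Y z * (cos (V z) * sin (t * X z)) \<partial>M) = 0" unfolding e2 using i I1 I2 by simp
    have e3: "Y z * (sin (V z) * cos (t * X z)) = (Y z * sin (V z + t * X z) + Y z * sin (V z - t * X z)) / 2" for z
      by (simp add: sin_add sin_diff algebra_simps)
    show "(\<integral>z. Y z * (sin (V z) * cos (t * X z)) \<partial>M) = 0" unfolding e3 using i I1 I2 by simp
    have e4: "Y z * (sin (V z) * sin (t * X z)) = (Y z * cos (V z - t * X z) - Y z * cos (V z + t * X z)) / 2" for z
      by (simp add: cos_add cos_diff algebra_simps)
    show "(\<integral>z. Y z * (sin (V z) * sin (t * X z)) \<partial>M) = 0" unfolding e4 using i I1 I2 by simp
  qed
  have EY: "(\<integral>z. Y z \<partial>M) = p" and EYcos: "(\<integral>z. Y z * cos (V z) \<partial>M) = p * exp (- v / 2)" and EYsin: "(\<integral>z. Y z * sin (V z) \<partial>M) = 0"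
    using Yc[of 0] prodc[of 0] by auto
  have iY: "integrable M Y" "integrable M (\<lambda>z. Y z * cos (V z))" "integrable M (\<lambda>z. Y z * sin (V z))"
    using intY[of "\<lambda>_. 1"] by (auto intro!: intY)
  have iY2: "integrable M (\<lambda>z. Y z * cos (t * X z))" "integrable M (\<lambda>z. Y z * sin (t * X z))"
    "integrable M (\<lambda>z. Y z * (cos (V z) * cos (t * X z)))" "integrable M (\<lambda>z. Y z * (cos (V z) * sin (t * X z)))"
    "integrable M (\<lambda>z. Y z * (sin (V z) * cos (t * X z)))" "integrable M (\<lambda>z. Y z * (sin (V z) * sin (t * X z)))" for t
    using abs1 by (auto intro!: intY)
  let ?m = "measure std_normal_distribution (A k)"
  have W0: "(\<integral>z. Y z * indicator (A k) (X z) \<partial>M) = p * ?m"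
    using weighted_std_normal[of Y X 1 "A k"] Y Yc EY by simp
  \<comment> \<open>\<open>Y * cos V\<close> can be negative, so Y is added to keep the weight
    nonnegative; subtracting \<open>W0\<close> recovers the wanted moment. The sine is treated in
    the same way.\<close>
  have W1: "(\<integral>z. (Y z * (1 + cos (V z))) * indicator (A k) (X z) \<partial>M) = (p + p * exp (- v / 2)) * ?m"
  proof (subst weighted_std_normal[where C = 2])
    show "0 \<le> Y z * (1 + cos (V z))" for z using Y(1)[of z] cos_ge_minus_one[of "V z"] by (intro mult_nonneg_nonneg) linarith+
    show "Y z * (1 + cos (V z)) \<le> 2" for z
    proof -
      have "Y z * (1 + cos (V z)) \<le> 1 * 2"
        using Y[of z] cos_ge_minus_one[of "V z"] cos_le_one[of "V z"] by (intro mult_mono) linarith+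
      then show ?thesis by simp
    qed
    show "(\<integral>z. Y z * (1 + cos (V z)) * cos (t * X z) \<partial>M) = (\<integral>z. Y z * (1 + cos (V z)) \<partial>M) * exp (- t\<^sup>2 / 2)" for t
      unfolding distrib_left distrib_right mult_1_right mult.assoc using iY iY2[of t] Yc[of t] prodc[of t] EY EYcos
      by (simp add: algebra_simps)
    show "(\<integral>z. Y z * (1 + cos (V z)) * sin (t * X z) \<partial>M) = 0" for t
      unfolding distrib_left distrib_right mult_1_right mult.assoc using iY2[of t] Yc[of t] prodc[of t] by simp
    show "(\<integral>z. Y z * (1 + cos (V z)) \<partial>M) * ?m = (p + p * exp (- v / 2)) * ?m"
      unfolding distrib_left mult_1_right using iY EY EYcos by simp
  qed simp_all
  have W2: "(\<integral>z. (Y z * (1 + sin (V z))) * indicator (A k) (X z) \<partial>M) = p * ?m"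
  proof (subst weighted_std_normal[where C = 2])
    show "0 \<le> Y z * (1 + sin (V z))" for z using Y(1)[of z] sin_ge_minus_one[of "V z"] by (intro mult_nonneg_nonneg) linarith+
    show "Y z * (1 + sin (V z)) \<le> 2" for z
    proof -
      have "Y z * (1 + sin (V z)) \<le> 1 * 2"
        using Y[of z] sin_ge_minus_one[of "V z"] sin_le_one[of "V z"] by (intro mult_mono) linarith+
      then show ?thesis by simp
    qed
    show "(\<integral>z. Y z * (1 + sin (V z)) * cos (t * X z) \<partial>M) = (\<integral>z. Y z * (1 + sin (V z)) \<partial>M) * exp (- t\<^sup>2 / 2)" for t
      unfolding distrib_left distrib_right mult_1_right mult.assoc using iY iY2[of t] Yc[of t] prodc[of t] EY EYsin
      by (simp add: algebra_simps)
    show "(\<integral>z. Y z * (1 + sin (V z)) * sin (t * X z) \<partial>M) = 0" for t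
      unfolding distrib_left distrib_right mult_1_right mult.assoc using iY2[of t] Yc[of t] prodc[of t] by simp
    show "(\<integral>z. Y z * (1 + sin (V z)) \<partial>M) * ?m = p * ?m"
      unfolding distrib_left mult_1_right using iY EY EYsin by simp
  qed simp_all
  have iI: "integrable M (\<lambda>z. Y z * indicator (A k) (X z))" "integrable M (\<lambda>z. Y z * (cos (V z) * indicator (A k) (X z)))"
    "integrable M (\<lambda>z. Y z * (sin (V z) * indicator (A k) (X z)))"
    by (auto intro!: intY simp: indicator_def)
  have R1: "(\<integral>z. Y z * (cos (V z) * indicator (A k) (X z)) \<partial>M) = p * exp (- v / 2) * ?m"
    using W1 W0 iI unfolding distrib_left distrib_right mult_1_right mult.assoc by (simp add: algebra_simps)
  have R2: "(\<integral>z. Y z * (sin (V z) * indicator (A k) (X z)) \<partial>M) = 0"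
    using W2 W0 iI unfolding distrib_left distrib_right mult_1_right mult.assoc by (simp add: algebra_simps)
  have prodY: "(\<Prod>j\<in>insert k J'. indicator (A j) (std_coord j z)) * c = Y z * (c * indicator (A k) (X z))" for z and c :: real
    unfolding Y_def X_def using insert.hyps by simp
  have Vz: "(\<Sum>k\<in>J - insert k J'. s k * std_coord k z) = V z" for z unfolding V_def ..
  show ?case unfolding prodY Vz v_def[symmetric] R1 R2 using insert.hyps unfolding p_def by simp
qed

lemma distr_std_coords:
  assumes J: "finite J"
  shows "distr M (PiM J (\<lambda>_. borel)) (\<lambda>z. \<lambda>k\<in>J. std_coord k z) = PiM J (\<lambda>_. std_normal_distribution)"
proof -
  interpret N: real_distribution std_normal_distribution by (rule real_dist_normal_dist)
  interpret product_sigma_finite "\<lambda>_ :: int \<times> int. std_normal_distribution" by standard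
  show ?thesis
  proof (rule PiM_eqI)
    show "sets (distr M (PiM J (\<lambda>_. borel)) (\<lambda>z. \<lambda>k\<in>J. std_coord k z)) = sets (PiM J (\<lambda>_. std_normal_distribution))"
      by (simp cong: sets_PiM_cong)
    fix A :: "int \<times> int \<Rightarrow> real set" assume A: "\<And>i. i \<in> J \<Longrightarrow> A i \<in> sets std_normal_distribution"
    define B where "B = (\<lambda>k. if k \<in> J then A k else UNIV)"
    have B: "B k \<in> sets borel" for k unfolding B_def using A[of k] by auto
    have AB: "Pi\<^sub>E J A = Pi\<^sub>E J B" unfolding B_def by (rule PiE_cong) simp
    note [measurable] = B
    have "emeasure (distr M (PiM J (\<lambda>_. borel)) (\<lambda>z. \<lambda>k\<in>J. std_coord k z)) (Pi\<^sub>E J B) = emeasure M {z \<in> space M. \<forall>k\<in>J. std_coord k z \<in> B k}"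
      using J B by (subst emeasure_distr) (auto intro!: arg_cong[where f = "emeasure M"] sets_PiM_I_finite)
    also have "\<dots> = ennreal (measure M {z \<in> space M. \<forall>k\<in>J. std_coord k z \<in> B k})"
      by (simp add: emeasure_eq_measure)
    also have "measure M {z \<in> space M. \<forall>k\<in>J. std_coord k z \<in> B k} = (\<integral>z. indicator {z \<in> space M. \<forall>k\<in>J. std_coord k z \<in> B k} z \<partial>M)"
      by (simp add: Int_absorb1)
    also have "\<dots> = (\<integral>z. (\<Prod>k\<in>J. indicator (B k) (std_coord k z) :: real) \<partial>M)"
      using J by (intro Bochner_Integration.integral_cong) (auto simp: indicator_def prod_zero_iff)
    also have "\<dots> = (\<Prod>k\<in>J. measure std_normal_distribution (B k))"
      using coordinates_independent_aux[where J = J and J' = J and A = B and s = "\<lambda>_. 0"] J B by simp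
    also have "ennreal \<dots> = (\<Prod>k\<in>J. emeasure std_normal_distribution (B k))"
      by (simp add: N.emeasure_eq_measure prod_ennreal)
    also have "\<dots> = (\<Prod>k\<in>J. emeasure std_normal_distribution (A k))" by (intro prod.cong) (auto simp: B_def)
    finally show "emeasure (distr M (PiM J (\<lambda>_. borel)) (\<lambda>z. \<lambda>k\<in>J. std_coord k z)) (Pi\<^sub>E J A) = (\<Prod>k\<in>J. emeasure std_normal_distribution (A k))"
      unfolding AB .
  qed (rule J)
qed

end

section \<open>Wick monomials\<close>

text \<open>Taylor coefficient of order i in a of exp (- a^2 v / 2). Its Cauchy product with the
  series of exp (a \<xi>) has the coefficients \<open>wick n \<xi> v\<close>.\<close>

definition gauss_coeff :: "nat \<Rightarrow> real \<Rightarrow> real" where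
  "gauss_coeff i v = (if even i then (- v / 2) ^ (i div 2) / fact (i div 2) else 0)"

text \<open>The Wick monomial \<open>:\<xi>\<^sup>n:\<close> of a centered Gaussian variable of variance \<open>v\<close>, divided by \<open>n!\<close>.\<close>

definition wick :: "nat \<Rightarrow> real \<Rightarrow> real \<Rightarrow> real" where
  "wick n \<xi> v = (\<Sum>j\<le>n. \<xi> ^ j / fact j * gauss_coeff (n - j) v)"

lemma gauss_coeff_sums: "(\<lambda>i. a ^ i * gauss_coeff i v) sums exp (- (a\<^sup>2 * v / 2))"
proof -
  have "(\<lambda>n. (- (a\<^sup>2 * v / 2)) ^ n /\<^sub>R fact n) sums exp (- (a\<^sup>2 * v / 2))" by (rule exp_converges)
  also have "(\<lambda>n. (- (a\<^sup>2 * v / 2)) ^ n /\<^sub>R fact n) = (\<lambda>n. a ^ (2 * n) * gauss_coeff (2 * n) v)"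
  proof
    fix n
    have "(- (a\<^sup>2 * v / 2)) ^ n = (a\<^sup>2 * (- v / 2)) ^ n" by simp
    also have "\<dots> = a ^ (2 * n) * (- v / 2) ^ n" unfolding power_mult_distrib power_mult ..
    finally have e: "(- (a\<^sup>2 * v / 2)) ^ n = a ^ (2 * n) * (- v / 2) ^ n" .
    have g: "gauss_coeff (2 * n) v = (- v / 2) ^ n / fact n" by (simp add: gauss_coeff_def)
    show "(- (a\<^sup>2 * v / 2)) ^ n /\<^sub>R fact n = a ^ (2 * n) * gauss_coeff (2 * n) v"
      unfolding e g by (simp only: real_scaleR_def divide_real_def mult_ac)
  qed
  finally have "(\<lambda>n. a ^ (2 * n) * gauss_coeff (2 * n) v) sums exp (- (a\<^sup>2 * v / 2))" .
  moreover have "a ^ i * gauss_coeff i v = 0" if "i \<notin> range (\<lambda>n. 2 * n)" for i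
  proof -
    have "odd i"
    proof
      assume "even i"
      then have "i = (\<lambda>n. 2 * n) (i div 2)" by simp
      then show False using that by blast
    qed
    then show ?thesis unfolding gauss_coeff_def by simp
  qed
  moreover have "strict_mono (\<lambda>n::nat. 2 * n)" by (simp add: strict_mono_def)
  ultimately show ?thesis by (subst sums_mono_reindex[symmetric, of "\<lambda>n. 2 * n"])
qed

lemma abs_gauss_coeff: "\<bar>gauss_coeff i v\<bar> = gauss_coeff i (- \<bar>v\<bar>)"
  unfolding gauss_coeff_def by (simp add: power_abs power_divide abs_mult)

lemma wick_sums: "(\<lambda>n. a ^ n * wick n \<xi> v) sums exp (a * \<xi> - a\<^sup>2 * v / 2)"
proof -
  have "(\<lambda>n. \<Sum>j\<le>n. ((a * \<xi>) ^ j / fact j) * (a ^ (n - j) * gauss_coeff (n - j) v)) sums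
      ((\<Sum>j. (a * \<xi>) ^ j / fact j) * (\<Sum>i. a ^ i * gauss_coeff i v))"
  proof (rule Cauchy_product_sums)
    have "norm ((a * \<xi>) ^ j / fact j) = \<bar>a * \<xi>\<bar> ^ j /\<^sub>R fact j" for j by (simp add: power_abs divide_inverse abs_mult mult.commute)
    then show "summable (\<lambda>j. norm ((a * \<xi>) ^ j / fact j))" using sums_summable[OF exp_converges[of "\<bar>a * \<xi>\<bar>"]] by simp
    have "norm (a ^ i * gauss_coeff i v) = \<bar>a\<bar> ^ i * gauss_coeff i (- \<bar>v\<bar>)" for i
      by (simp add: abs_mult power_abs abs_gauss_coeff)
    then show "summable (\<lambda>i. norm (a ^ i * gauss_coeff i v))" using sums_summable[OF gauss_coeff_sums[of "\<bar>a\<bar>" "- \<bar>v\<bar>"]] by simp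
  qed
  moreover have "(\<Sum>j\<le>n. ((a * \<xi>) ^ j / fact j) * (a ^ (n - j) * gauss_coeff (n - j) v)) = a ^ n * wick n \<xi> v" for n
    unfolding wick_def sum_distrib_left
    by (intro sum.cong) (auto simp: power_mult_distrib mult_ac simp flip: power_add)
  moreover have "(\<Sum>j. (a * \<xi>) ^ j / fact j) = exp (a * \<xi>)"
    unfolding exp_def by (simp add: divide_inverse mult.commute)
  moreover have "(\<Sum>i. a ^ i * gauss_coeff i v) = exp (- (a\<^sup>2 * v / 2))" using gauss_coeff_sums by (rule sums_unique[symmetric])
  ultimately show ?thesis by (simp add: exp_add[symmetric])
qed

text \<open>Replacing v by - |v| makes every coefficient nonnegative. The polynomial at |\<xi>| is
  then a majorant whose generating function is again an explicit exponential.\<close>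

lemma abs_wick_le: "\<bar>wick n \<xi> v\<bar> \<le> wick n \<bar>\<xi>\<bar> (- \<bar>v\<bar>)"
  unfolding wick_def by (rule order_trans[OF sum_abs]) (auto simp: abs_mult power_abs abs_gauss_coeff)

lemma abs_wick_sum_le: "(\<Sum>n<m. \<bar>a ^ n * wick n \<xi> v\<bar>) \<le> exp (\<bar>a\<bar> * \<bar>\<xi>\<bar> + a\<^sup>2 * \<bar>v\<bar> / 2)"
proof -
  have "(\<Sum>n<m. \<bar>a ^ n * wick n \<xi> v\<bar>) \<le> (\<Sum>n<m. \<bar>a\<bar> ^ n * wick n \<bar>\<xi>\<bar> (- \<bar>v\<bar>))"
    by (intro sum_mono) (simp add: abs_mult power_abs abs_wick_le mult_left_mono)
  also have "\<dots> \<le> (\<Sum>n. \<bar>a\<bar> ^ n * wick n \<bar>\<xi>\<bar> (- \<bar>v\<bar>))"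
  proof (rule sum_le_suminf)
    show "summable (\<lambda>n. \<bar>a\<bar> ^ n * wick n \<bar>\<xi>\<bar> (- \<bar>v\<bar>))" using sums_summable[OF wick_sums] .
    show "0 \<le> \<bar>a\<bar> ^ n * wick n \<bar>\<xi>\<bar> (- \<bar>v\<bar>)" for n
      using order_trans[OF abs_ge_zero abs_wick_le[of n \<xi> v]] by simp
  qed simp
  also have "\<dots> = exp (\<bar>a\<bar> * \<bar>\<xi>\<bar> + a\<^sup>2 * \<bar>v\<bar> / 2)" using sums_unique[OF wick_sums[of "\<bar>a\<bar>" "\<bar>\<xi>\<bar>" "- \<bar>v\<bar>"]] by simp
  finally show ?thesis .
qed

lemma abs_wick_term_le: "\<bar>a ^ n * wick n \<xi> v\<bar> \<le> exp (\<bar>a\<bar> * \<bar>\<xi>\<bar> + a\<^sup>2 * \<bar>v\<bar> / 2)"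
proof -
  have "0 \<le> (\<Sum>n<n. \<bar>a ^ n * wick n \<xi> v\<bar>)" by (intro sum_nonneg) simp
  then show ?thesis using abs_wick_sum_le[of a \<xi> v "Suc n"] unfolding sum.lessThan_Suc by linarith
qed

lemma wick_homogeneous: "wick n (c * \<xi>) (c\<^sup>2 * v) = c ^ n * wick n \<xi> v"
proof -
  have g: "gauss_coeff i (c\<^sup>2 * v) = c ^ i * gauss_coeff i v" for i
  proof (cases "even i")
    case True
    then obtain m where m: "i = 2 * m" by (elim evenE)
    have "(- (c\<^sup>2 * v) / 2) ^ m = (c\<^sup>2 * (- v / 2)) ^ m" by simp
    also have "\<dots> = c ^ (2 * m) * (- v / 2) ^ m" unfolding power_mult_distrib by (simp add: power_mult)
    finally show ?thesis unfolding gauss_coeff_def m by simp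
  qed (simp add: gauss_coeff_def)
  show ?thesis unfolding wick_def sum_distrib_left
  proof (intro sum.cong refl)
    fix j assume "j \<in> {..n}"
    then have "c ^ n = c ^ j * c ^ (n - j)" by (simp flip: power_add)
    then show "(c * \<xi>) ^ j / fact j * gauss_coeff (n - j) (c\<^sup>2 * v) = c ^ n * (\<xi> ^ j / fact j * gauss_coeff (n - j) v)"
      unfolding g by (simp add: power_mult_distrib)
  qed
qed

text \<open>The factor n + 1 is split as j + (n + 1 - j) in each term of the convolution: the first
  part lowers the power of \<xi>, the second lowers the Gaussian coefficient by two. This is the
  three-term recursion of the Hermite polynomials.\<close>

lemma wick_Suc: "real (Suc n) * wick (Suc n) \<xi> v = \<xi> * wick n \<xi> v - (if n = 0 then 0 else v * wick (n - 1) \<xi> v)"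
proof -
  define u where "u = (\<lambda>j. \<xi> ^ j / fact j)"
  define h where "h = (\<lambda>i. real i * gauss_coeff i v)"
  have u: "real (Suc j) * u (Suc j) = \<xi> * u j" for j unfolding u_def by (simp add: divide_simps del: of_nat_Suc)
  have h0: "h 0 = 0" "h (Suc 0) = 0" unfolding h_def gauss_coeff_def by auto
  have h2: "h (Suc (Suc i)) = - v * gauss_coeff i v" for i
  proof (cases "even i")
    case True
    then obtain b where b: "i = 2 * b" by (elim evenE)
    have e1: "real (Suc (Suc i)) = 2 * real (Suc b)" unfolding b by simp
    have e2: "gauss_coeff (Suc (Suc i)) v = (- v / 2) ^ Suc b / fact (Suc b)" unfolding gauss_coeff_def b by simp
    have e3: "gauss_coeff i v = (- v / 2) ^ b / fact b" unfolding gauss_coeff_def b by simp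
    have e4: "2 * B * ((- v / 2 * q) / (B * F)) = - v * (q / F)" if "B \<noteq> 0" for B q F :: real
      using that by simp
    have e5: "(- v / 2) ^ Suc b / fact (Suc b) = (- v / 2 * (- v / 2) ^ b) / (real (Suc b) * fact b)"
      unfolding fact_Suc power_Suc of_nat_mult of_nat_fact ..
    show ?thesis unfolding h_def e1 e2 e3 e5 by (rule e4) simp
  qed (simp add: h_def gauss_coeff_def)
  have "real (Suc n) * wick (Suc n) \<xi> v = (\<Sum>j\<le>Suc n. real j * u j * gauss_coeff (Suc n - j) v) + (\<Sum>j\<le>Suc n. u j * h (Suc n - j))"
    unfolding wick_def u_def[symmetric] h_def sum_distrib_left sum.distrib[symmetric]
  proof (intro sum.cong refl)
    fix j assume "j \<in> {..Suc n}"
    then have r: "real (Suc n) = real j + real (Suc n - j)" by (simp add: of_nat_diff)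
    show "real (Suc n) * (\<xi> ^ j / fact j * gauss_coeff (Suc n - j) v) = real j * u j * gauss_coeff (Suc n - j) v + u j * (real (Suc n - j) * gauss_coeff (Suc n - j) v)"
      unfolding r u_def by (simp only: distrib_right mult.assoc) (simp only: mult_ac)
  qed
  also have "(\<Sum>j\<le>Suc n. real j * u j * gauss_coeff (Suc n - j) v) = \<xi> * wick n \<xi> v"
    unfolding sum.atMost_Suc_shift wick_def sum_distrib_left
  proof -
    have "real (Suc j) * u (Suc j) * gauss_coeff (Suc n - Suc j) v = \<xi> * (\<xi> ^ j / fact j * gauss_coeff (n - j) v)" for j
      unfolding u by (simp add: u_def)
    then show "real 0 * u 0 * gauss_coeff (Suc n - 0) v + (\<Sum>j\<le>n. real (Suc j) * u (Suc j) * gauss_coeff (Suc n - Suc j) v)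
       = (\<Sum>j\<le>n. \<xi> * (\<xi> ^ j / fact j * gauss_coeff (n - j) v))" by (simp only: of_nat_0 mult_zero_left add_0)
  qed
  also have "(\<Sum>j\<le>Suc n. u j * h (Suc n - j)) = - (if n = 0 then 0 else v * wick (n - 1) \<xi> v)"
  proof (cases n)
    case 0
    then show ?thesis by (simp add: h0)
  next
    case (Suc m)
    have "(\<Sum>j\<le>Suc (Suc m). u j * h (Suc (Suc m) - j)) = (\<Sum>j\<le>m. u j * h (Suc (Suc m) - j))" by (simp add: h0 Suc_diff_le)
    also have "\<dots> = (\<Sum>j\<le>m. u j * (- v * gauss_coeff (m - j) v))" by (intro sum.cong refl) (simp add: Suc_diff_le h2)
    also have "\<dots> = - (v * wick m \<xi> v)" unfolding wick_def u_def by (simp add: sum_distrib_left sum_negf mult_ac)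
    finally show ?thesis using Suc by simp
  qed
  finally show ?thesis by simp
qed

lemma wick_0 [simp]: "wick 0 \<xi> v = 1"
  unfolding wick_def gauss_coeff_def by simp

lemma DERIV_wick: "((\<lambda>\<xi>. wick n \<xi> v) has_real_derivative (if n = 0 then 0 else wick (n - 1) \<xi> v)) (at \<xi>)"
proof (cases n)
  case (Suc m)
  have "((\<lambda>\<xi>. \<Sum>j\<le>Suc m. \<xi> ^ j / fact j * gauss_coeff (Suc m - j) v) has_real_derivative
     (\<Sum>j\<le>Suc m. real j * \<xi> ^ (j - 1) / fact j * gauss_coeff (Suc m - j) v)) (at \<xi>)"
  proof (rule DERIV_sum)
    fix j
    show "((\<lambda>\<xi>. \<xi> ^ j / fact j * gauss_coeff (Suc m - j) v) has_real_derivative real j * \<xi> ^ (j - 1) / fact j * gauss_coeff (Suc m - j) v) (at \<xi>)"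
      by (intro DERIV_cmult_right DERIV_cdivide) (auto intro!: derivative_eq_intros)
  qed
  also have "(\<Sum>j\<le>Suc m. real j * \<xi> ^ (j - 1) / fact j * gauss_coeff (Suc m - j) v) = wick m \<xi> v"
    unfolding sum.atMost_Suc_shift wick_def by (auto intro!: sum.cong simp: divide_simps simp del: of_nat_Suc)
  finally show ?thesis unfolding Suc wick_def[of "Suc m", abs_def] by simp
qed simp

text \<open>Rodrigues' formula meets the generating function: the product rule,
  \<open>DERIV_wick\<close> and \<open>wick_Suc\<close> turn one more derivative of
  \<open>wick n\<close> times the Gaussian into the next member.\<close>

lemma hermite_wick: "hermite n \<xi> = sqrt (fact n) * wick n \<xi> 1"
proof -
  have "(deriv ^^ n) (\<lambda>t. exp (- t\<^sup>2 / 2)) = (\<lambda>\<xi>. (-1) ^ n * fact n * wick n \<xi> 1 * exp (- \<xi>\<^sup>2 / 2))"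
  proof (induction n)
    case (Suc n)
    have "deriv (\<lambda>\<xi>. (-1) ^ n * fact n * wick n \<xi> 1 * exp (- \<xi>\<^sup>2 / 2)) \<xi> = (-1) ^ Suc n * fact (Suc n) * wick (Suc n) \<xi> 1 * exp (- \<xi>\<^sup>2 / 2)" for \<xi> :: real
    proof (rule DERIV_imp_deriv)
      have "((\<lambda>\<xi>. (-1) ^ n * fact n * wick n \<xi> 1 * exp (- \<xi>\<^sup>2 / 2)) has_real_derivative
        (-1) ^ n * fact n * (if n = 0 then 0 else wick (n - 1) \<xi> 1) * exp (- \<xi>\<^sup>2 / 2) + (-1) ^ n * fact n * wick n \<xi> 1 * (exp (- \<xi>\<^sup>2 / 2) * (- \<xi>))) (at \<xi>)"
      proof -
        have e: "((\<lambda>\<xi>. exp (- \<xi>\<^sup>2 / 2)) has_real_derivative exp (- \<xi>\<^sup>2 / 2) * (- \<xi>)) (at \<xi>)"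
          by (auto intro!: derivative_eq_intros)
        show ?thesis
          using DERIV_mult[OF DERIV_cmult[OF DERIV_wick[of n 1 \<xi>], of "(-1) ^ n * fact n"] e] by (simp only: mult_ac add_ac)
      qed
      also have "(-1) ^ n * fact n * (if n = 0 then 0 else wick (n - 1) \<xi> 1) * exp (- \<xi>\<^sup>2 / 2) + (-1) ^ n * fact n * wick n \<xi> 1 * (exp (- \<xi>\<^sup>2 / 2) * (- \<xi>))
        = (-1) ^ Suc n * fact n * exp (- \<xi>\<^sup>2 / 2) * (\<xi> * wick n \<xi> 1 - (if n = 0 then 0 else 1 * wick (n - 1) \<xi> 1))"
        by (simp add: algebra_simps)
      also have "\<dots> = (-1) ^ Suc n * fact (Suc n) * wick (Suc n) \<xi> 1 * exp (- \<xi>\<^sup>2 / 2)"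
        unfolding wick_Suc[symmetric] by (simp only: fact_Suc mult_ac of_nat_mult of_nat_fact)
      finally show "((\<lambda>\<xi>. (-1) ^ n * fact n * wick n \<xi> 1 * exp (- \<xi>\<^sup>2 / 2)) has_real_derivative
        (-1) ^ Suc n * fact (Suc n) * wick (Suc n) \<xi> 1 * exp (- \<xi>\<^sup>2 / 2)) (at \<xi>)" .
    qed
    then show ?case using Suc by (simp only: funpow.simps o_apply)
  qed simp
  then have "hermite n \<xi> = (-1) ^ n / sqrt (fact n) * exp (\<xi>\<^sup>2 / 2) * ((-1) ^ n * fact n * wick n \<xi> 1 * exp (- \<xi>\<^sup>2 / 2))"
    unfolding hermite_def by simp
  also have "\<dots> = ((-1) ^ n * (-1) ^ n) * (fact n / sqrt (fact n)) * wick n \<xi> 1 * (exp (\<xi>\<^sup>2 / 2) * exp (- \<xi>\<^sup>2 / 2))" by simp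
  also have "\<dots> = sqrt (fact n) * wick n \<xi> 1"
    by (simp add: exp_add[symmetric] real_div_sqrt power_add[symmetric] flip: power_mult_distrib)
  finally show ?thesis .
qed

lemma wick_scaled_hermite:
  assumes "\<rho> > 0"
  shows "sqrt (fact n) * \<rho> ^ n * hermite n (inverse \<rho> * X) = fact n * wick n X (\<rho>\<^sup>2)"
proof -
  have "sqrt (fact n) * \<rho> ^ n * hermite n (inverse \<rho> * X) = fact n * (\<rho> ^ n * wick n (inverse \<rho> * X) 1)"
    unfolding hermite_wick by simp
  also have "\<rho> ^ n * wick n (inverse \<rho> * X) 1 = wick n X (\<rho>\<^sup>2)"
    using wick_homogeneous[of n \<rho> "inverse \<rho> * X" 1] assms by (simp add: mult.assoc[symmetric])
  finally show ?thesis .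
qed

text \<open>Once the lower coefficients agree, division by a^n and the limit a \<rightarrow> 0
  isolate the next one. It is used to read the moments of \<open>wpow\<close> off those of
  \<open>wexp\<close>.\<close>

lemma powser_unique:
  fixes c d :: "nat \<Rightarrow> real"
  assumes c: "\<And>a. (\<lambda>n. c n * a ^ n) sums f a" and d: "\<And>a. (\<lambda>n. d n * a ^ n) sums f a"
  shows "c n = d n"
proof -
  define e where "e = (\<lambda>n. c n - d n)"
  have e: "(\<lambda>n. e n * a ^ n) sums 0" for a
    using sums_diff[OF c[of a] d[of a]] unfolding e_def by (simp add: left_diff_distrib)
  have "e n = 0"
  proof (induction n rule: less_induct)
    case (less n)
    have "((\<lambda>a. 0) \<longlongrightarrow> e (0 + n)) (at (0::real))"
    proof (rule powser_limit_0_strong[of 1 "\<lambda>k. e (k + n)"])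
      fix a :: real assume a: "a \<noteq> 0"
      have "(\<lambda>k. e (k + n) * a ^ (k + n)) sums (0 - (\<Sum>i<n. e i * a ^ i))"
        using e[of a] by (subst sums_iff_shift) simp
      then have "(\<lambda>k. (e (k + n) * a ^ k) * a ^ n) sums (0 * a ^ n)" using less by (simp add: power_add mult_ac)
      then show "(\<lambda>k. e (k + n) * a ^ k) sums 0" using a by (subst (asm) sums_mult2_iff) auto
    qed simp
    then show ?case by (simp add: tendsto_const_iff)
  qed
  then show ?thesis unfolding e_def by simp
qed

section \<open>Wick exponentials of the truncated field\<close>

definition cov :: "(int \<times> int) set \<Rightarrow> real \<times> real \<Rightarrow> real \<times> real \<Rightarrow> real" where
  "cov J x y = (\<Sum>k\<in>J. basis_e k x * basis_e k y / bracket2 k)"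

definition fld :: "(int \<times> int) set \<Rightarrow> distribution \<Rightarrow> real \<times> real \<Rightarrow> real" where
  "fld J z x = (\<Sum>k\<in>J. z k * basis_e k x)"

definition wexp :: "(int \<times> int) set \<Rightarrow> real \<Rightarrow> distribution \<Rightarrow> real \<times> real \<Rightarrow> real" where
  "wexp J a z x = exp (a * fld J z x - a\<^sup>2 * cov J x x / 2)"

text \<open>Unlike the Wick power this carries the factor 1 / n!, so that \<open>wexp\<close> is
  simply the power series in a with coefficients \<open>wpow\<close>.\<close>

definition wpow :: "(int \<times> int) set \<Rightarrow> nat \<Rightarrow> distribution \<Rightarrow> real \<times> real \<Rightarrow> real" where
  "wpow J n z x = wick n (fld J z x) (cov J x x)"

definition cov_bound :: "(int \<times> int) set \<Rightarrow> real" where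
  "cov_bound J = (\<Sum>k\<in>J. 1 / bracket2 k)"

definition fld_bound :: "(int \<times> int) set \<Rightarrow> distribution \<Rightarrow> real" where
  "fld_bound J z = (\<Sum>k\<in>J. \<bar>z k\<bar>)"

text \<open>A majorant of the exponential and of all partial sums of its Wick series, uniform in x.
  It supplies the domination in z for Fubini and dominated convergence.\<close>

definition dom_exp :: "(int \<times> int) set \<Rightarrow> real \<Rightarrow> distribution \<Rightarrow> real" where
  "dom_exp J a z = exp (\<bar>a\<bar> * fld_bound J z + a\<^sup>2 * cov_bound J / 2)"

lemma abs_cov_le: "\<bar>cov J x y\<bar> \<le> cov_bound J"
  unfolding cov_def cov_bound_def
proof (rule order_trans[OF sum_abs sum_mono])
  fix k
  have "\<bar>basis_e k x * basis_e k y\<bar> \<le> 1" unfolding abs_mult by (intro mult_le_one abs_basis_e_le) simp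
  then show "\<bar>basis_e k x * basis_e k y / bracket2 k\<bar> \<le> 1 / bracket2 k"
    using bracket2_pos[of k] by (simp add: abs_mult divide_right_mono)
qed

lemma cov_commute: "cov J x y = cov J y x"
  unfolding cov_def by (simp add: mult.commute)

lemma abs_fld_le: "\<bar>fld J z x\<bar> \<le> fld_bound J z"
  unfolding fld_def fld_bound_def
  by (rule order_trans[OF sum_abs sum_mono]) (simp add: abs_mult mult_left_le abs_basis_e_le)

lemma wick_dom: "exp (\<bar>a\<bar> * \<bar>fld J z x\<bar> + a\<^sup>2 * \<bar>cov J x x\<bar> / 2) \<le> dom_exp J a z"
  unfolding dom_exp_def exp_le_cancel_iff
  by (intro add_mono mult_left_mono divide_right_mono abs_fld_le abs_cov_le) auto

lemma wexp_le: "wexp J a z x \<le> dom_exp J a z"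
proof -
  have "a * fld J z x \<le> \<bar>a\<bar> * \<bar>fld J z x\<bar>" by (simp flip: abs_mult)
  moreover have "- (a\<^sup>2 * cov J x x / 2) \<le> a\<^sup>2 * \<bar>cov J x x\<bar> / 2"
    using mult_left_mono[of "- cov J x x" "\<bar>cov J x x\<bar>" "a\<^sup>2"] by simp
  ultimately have "wexp J a z x \<le> exp (\<bar>a\<bar> * \<bar>fld J z x\<bar> + a\<^sup>2 * \<bar>cov J x x\<bar> / 2)"
    unfolding wexp_def by simp
  then show ?thesis using wick_dom[of a J z x] by simp
qed

lemma wexp_pos: "wexp J a z x > 0"
  unfolding wexp_def by simp

lemma wpow_term_le: "\<bar>a ^ n * wpow J n z x\<bar> \<le> dom_exp J a z"
  unfolding wpow_def by (rule order_trans[OF abs_wick_term_le wick_dom])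

lemma wpow_sum_le: "\<bar>\<Sum>n<m. a ^ n * wpow J n z x\<bar> \<le> dom_exp J a z"
  unfolding wpow_def by (rule order_trans[OF sum_abs order_trans[OF abs_wick_sum_le wick_dom]])

lemma wpow_sums: "(\<lambda>n. a ^ n * wpow J n z x) sums wexp J a z x"
  unfolding wpow_def wexp_def by (rule wick_sums)

lemma cov_nonneg: "cov J x x \<ge> 0"
  unfolding cov_def using bracket2_pos by (intro sum_nonneg) (simp add: less_imp_le)

lemma measurable_cov [measurable]: "(\<lambda>p. cov J (fst p) (snd p)) \<in> borel_measurable (torus \<Otimes>\<^sub>M torus)"
  unfolding cov_def by measurable

lemma measurable_cov_diag [measurable]: "(\<lambda>x. cov J x x) \<in> borel_measurable torus"
  unfolding cov_def by measurable

lemma measurable_wick: "f \<in> borel_measurable N \<Longrightarrow> h \<in> borel_measurable N \<Longrightarrow> (\<lambda>x. wick n (f x) (h x)) \<in> borel_measurable N"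
  unfolding wick_def gauss_coeff_def
  by (intro borel_measurable_sum borel_measurable_times borel_measurable_divide borel_measurable_power borel_measurable_const
      measurable_If borel_measurable_uminus) auto

lemma measurable_fld_torus [measurable]: "fld J z \<in> borel_measurable torus"
  unfolding fld_def[abs_def] by measurable

lemma measurable_wexp_torus [measurable]: "wexp J a z \<in> borel_measurable torus"
  unfolding wexp_def[abs_def] by measurable

lemma measurable_wpow_torus [measurable]: "wpow J n z \<in> borel_measurable torus"
  unfolding wpow_def[abs_def] by (intro measurable_wick) measurable

context gaussian_free_field
begin

lemma measurable_fld_bound [measurable]: "fld_bound J \<in> borel_measurable M"
  unfolding fld_bound_def[abs_def] by measurable

lemma measurable_fld_pair [measurable]: "(\<lambda>p. fld J (fst p) (snd p)) \<in> borel_measurable (M \<Otimes>\<^sub>M torus)"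
  unfolding fld_def by measurable

lemma measurable_wexp_pair [measurable]: "(\<lambda>p. wexp J a (fst p) (snd p)) \<in> borel_measurable (M \<Otimes>\<^sub>M torus)"
  unfolding wexp_def by measurable

lemma measurable_wpow_pair [measurable]: "(\<lambda>p. wpow J n (fst p) (snd p)) \<in> borel_measurable (M \<Otimes>\<^sub>M torus)"
  unfolding wpow_def by (intro measurable_wick) measurable

lemma measurable_fld [measurable]: "(\<lambda>z. fld J z x) \<in> borel_measurable M"
  unfolding fld_def by measurable

lemma measurable_wexp [measurable]: "(\<lambda>z. wexp J a z x) \<in> borel_measurable M"
  unfolding wexp_def by measurable

lemma measurable_wpow [measurable]: "(\<lambda>z. wpow J n z x) \<in> borel_measurable M"
  unfolding wpow_def by (intro measurable_wick) measurable

text \<open>With d = c card J the exponential is at most exp (d |z k|) for the largest coordinate,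
  hence at most the sum of the two-sided exponentials of all coordinates. Only one-dimensional laws
  enter.\<close>

lemma integrable_exp_fld_bound:
  assumes J: "finite J" and c: "c \<ge> 0"
  shows "integrable M (\<lambda>z. exp (c * fld_bound J z))"
proof (cases "J = {}")
  case True
  then show ?thesis unfolding fld_bound_def by simp
next
  case False
  define d where "d = c * real (card J)"
  have iexp: "integrable M (\<lambda>z. exp (b * z k))" for b k
    using expectation_exp_lin(1)[of "{k}" "\<lambda>_. b"] unfolding lin_def by simp
  have bound: "exp (c * fld_bound J z) \<le> (\<Sum>k\<in>J. exp (d * z k) + exp ((- d) * z k))" for z
  proof -
    obtain k where k: "k \<in> J" "\<And>j. j \<in> J \<Longrightarrow> \<bar>z j\<bar> \<le> \<bar>z k\<bar>"
      using obtains_MAX[OF J False, of "\<lambda>k. \<bar>z k\<bar>"] J by (metis Max_ge finite_imageI image_eqI)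
    have "fld_bound J z \<le> real (card J) * \<bar>z k\<bar>" unfolding fld_bound_def by (rule sum_bounded_above) (rule k)
    then have "c * fld_bound J z \<le> d * \<bar>z k\<bar>" unfolding d_def using c by (simp add: mult_left_mono mult.assoc)
    then have "exp (c * fld_bound J z) \<le> exp (d * \<bar>z k\<bar>)" by simp
    also have "\<dots> \<le> exp (d * z k) + exp ((- d) * z k)" by (cases "z k \<ge> 0") auto
    also have "\<dots> \<le> (\<Sum>k\<in>J. exp (d * z k) + exp ((- d) * z k))"
      using J k(1) by (intro member_le_sum) (auto intro: add_nonneg_nonneg)
    finally show ?thesis .
  qed
  show ?thesis
  proof (rule Bochner_Integration.integrable_bound)
    show "integrable M (\<lambda>z. \<Sum>k\<in>J. exp (d * z k) + exp ((- d) * z k))"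
      by (intro Bochner_Integration.integrable_sum Bochner_Integration.integrable_add iexp)
    show "AE z in M. norm (exp (c * fld_bound J z)) \<le> norm (\<Sum>k\<in>J. exp (d * z k) + exp ((- d) * z k))"
      using bound by (intro AE_I2) (smt (verit) real_norm_def exp_ge_zero)
  qed measurable
qed

lemma integrable_dom_exp_mult:
  assumes J: "finite J"
  shows "integrable M (\<lambda>z. dom_exp J a z * dom_exp J b z)"
proof -
  have "dom_exp J a z * dom_exp J b z = exp (a\<^sup>2 * cov_bound J / 2 + b\<^sup>2 * cov_bound J / 2) * exp ((\<bar>a\<bar> + \<bar>b\<bar>) * fld_bound J z)" for z
    unfolding dom_exp_def by (simp add: exp_add[symmetric] algebra_simps)
  then show ?thesis using integrable_exp_fld_bound[OF J, of "\<bar>a\<bar> + \<bar>b\<bar>"] by simp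
qed

text \<open>The product is the exponential of one linear functional; the diagonal variances cancel
  against the Wick normalisation and only the cross covariance survives.\<close>

lemma expectation_wexp_mult:
  assumes J: "finite J"
  shows "(\<integral>z. wexp J a z x * wexp J b z y \<partial>M) = exp (a * b * cov J x y)"
proof -
  define t where "t = (\<lambda>k. a * basis_e k x + b * basis_e k y)"
  have l: "lin J t z = a * fld J z x + b * fld J z y" for z
    unfolding lin_def t_def fld_def by (simp add: sum_distrib_left sum.distrib[symmetric] algebra_simps)
  have v: "lin_var J t = a\<^sup>2 * cov J x x + 2 * (a * b) * cov J x y + b\<^sup>2 * cov J y y"
    unfolding lin_var_def t_def cov_def sum_distrib_left sum.distrib[symmetric]
    by (intro sum.cong refl) (simp add: power2_eq_square add_divide_distrib algebra_simps)
  have "wexp J a z x * wexp J b z y = exp (- a\<^sup>2 * cov J x x / 2 - b\<^sup>2 * cov J y y / 2) * exp (lin J t z)" for z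
    unfolding wexp_def l by (simp add: exp_add[symmetric] algebra_simps)
  then have "(\<integral>z. wexp J a z x * wexp J b z y \<partial>M) = exp (- a\<^sup>2 * cov J x x / 2 - b\<^sup>2 * cov J y y / 2) * exp (lin_var J t / 2)"
    using expectation_exp_lin[OF J] by simp
  also have "\<dots> = exp (a * b * cov J x y)" unfolding v by (simp add: exp_add[symmetric] field_simps)
  finally show ?thesis .
qed

lemma integrable_dominated_mult:
  assumes J: "finite J" and [measurable]: "X \<in> borel_measurable M" "Y \<in> borel_measurable M"
    and X: "\<And>z. \<bar>X z\<bar> \<le> C * dom_exp J a z" and Y: "\<And>z. \<bar>Y z\<bar> \<le> D * dom_exp J b z"
  shows "integrable M (\<lambda>z. X z * Y z)"
proof (rule Bochner_Integration.integrable_bound)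
  show "integrable M (\<lambda>z. (C * D) * (dom_exp J a z * dom_exp J b z))" using integrable_dom_exp_mult[OF J] by simp
  show "AE z in M. norm (X z * Y z) \<le> norm ((C * D) * (dom_exp J a z * dom_exp J b z))"
  proof (intro AE_I2)
    fix z
    have "\<bar>X z\<bar> * \<bar>Y z\<bar> \<le> (C * dom_exp J a z) * (D * dom_exp J b z)"
      using X[of z] Y[of z] by (intro mult_mono) auto
    also have "\<dots> \<le> norm ((C * D) * (dom_exp J a z * dom_exp J b z))" by (simp add: mult_ac)
    finally show "norm (X z * Y z) \<le> norm ((C * D) * (dom_exp J a z * dom_exp J b z))" by (simp add: abs_mult)
  qed
qed measurable

text \<open>Domination by \<open>dom_exp\<close> allows integration term by term, so the moments of
  \<open>wpow\<close> against Y are the Taylor coefficients in a of the moment of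
  \<open>wexp\<close>.\<close>

lemma expectation_wpow_series:
  assumes J: "finite J" and [measurable]: "Y \<in> borel_measurable M" and Y: "\<And>z. \<bar>Y z\<bar> \<le> C * dom_exp J b z"
  shows "(\<lambda>n. (\<integral>z. wpow J n z x * Y z \<partial>M) * a ^ n) sums (\<integral>z. wexp J a z x * Y z \<partial>M)"
proof -
  have i1: "integrable M (\<lambda>z. wpow J n z x * Y z)" for n
    by (rule integrable_dominated_mult[OF J _ _ _ Y, of _ 1 1]) (use wpow_term_le[of 1 n] in auto)
  have "(\<lambda>m. \<integral>z. (\<Sum>n<m. a ^ n * wpow J n z x) * Y z \<partial>M) \<longlonglongrightarrow> (\<integral>z. wexp J a z x * Y z \<partial>M)"
  proof (rule integral_dominated_convergence)
    show "integrable M (\<lambda>z. dom_exp J a z * \<bar>Y z\<bar>)"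
      by (rule integrable_dominated_mult[OF J _ _ _ _, of _ _ 1 a C b]) (use Y in \<open>auto simp: dom_exp_def\<close>)
    show "AE z in M. (\<lambda>m. (\<Sum>n<m. a ^ n * wpow J n z x) * Y z) \<longlonglongrightarrow> wexp J a z x * Y z"
      using wpow_sums by (intro AE_I2 tendsto_mult_right) (simp add: sums_def)
    show "AE z in M. norm ((\<Sum>n<m. a ^ n * wpow J n z x) * Y z) \<le> dom_exp J a z * \<bar>Y z\<bar>" for m
      unfolding real_norm_def abs_mult by (intro AE_I2 mult_right_mono wpow_sum_le) auto
  qed measurable
  moreover have "(\<integral>z. (\<Sum>n<m. a ^ n * wpow J n z x) * Y z \<partial>M) = (\<Sum>n<m. (\<integral>z. wpow J n z x * Y z \<partial>M) * a ^ n)" for m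
  proof -
    have "(\<integral>z. (\<Sum>n<m. a ^ n * wpow J n z x) * Y z \<partial>M) = (\<integral>z. (\<Sum>n<m. a ^ n * (wpow J n z x * Y z)) \<partial>M)"
      by (simp add: sum_distrib_right mult.assoc)
    also have "\<dots> = (\<Sum>n<m. a ^ n * (\<integral>z. wpow J n z x * Y z \<partial>M))" using i1 by simp
    finally show ?thesis by (simp add: mult.commute)
  qed
  ultimately show ?thesis unfolding sums_def by simp
qed

lemma expectation_wpow_wexp:
  assumes J: "finite J"
  shows "(\<integral>z. wpow J n z x * wexp J b z y \<partial>M) = (b * cov J x y) ^ n / fact n"
proof (rule powser_unique)
  fix a
  have "(\<lambda>n. (\<integral>z. wpow J n z x * wexp J b z y \<partial>M) * a ^ n) sums (\<integral>z. wexp J a z x * wexp J b z y \<partial>M)"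
    by (rule expectation_wpow_series[OF J, of _ 1 b]) (use wexp_le[of J b] wexp_pos[of J b] in \<open>auto simp: abs_of_pos\<close>)
  then show "(\<lambda>n. (\<integral>z. wpow J n z x * wexp J b z y \<partial>M) * a ^ n) sums exp (a * b * cov J x y)"
    unfolding expectation_wexp_mult[OF J] .
  show "(\<lambda>n. (b * cov J x y) ^ n / fact n * a ^ n) sums exp (a * b * cov J x y)"
    using exp_converges[of "a * b * cov J x y"] by (simp add: power_mult_distrib divide_inverse mult_ac)
qed

text \<open>The mixed moment is expanded in b as well: \<open>(b * cov J x y) ^ n / fact n\<close>
  is a single monomial in b, and this is the orthogonality of different orders.\<close>

lemma expectation_wpow_wpow:
  assumes J: "finite J"
  shows "(\<integral>z. wpow J n z x * wpow J m z y \<partial>M) = (if m = n then cov J x y ^ n / fact n else 0)"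
proof -
  have "(\<integral>z. wpow J m z y * wpow J n z x \<partial>M) = (if m = n then cov J x y ^ n / fact n else 0)"
  proof (rule powser_unique[where c = "\<lambda>m. \<integral>z. wpow J m z y * wpow J n z x \<partial>M" and d = "\<lambda>m. if m = n then cov J x y ^ n / fact n else 0"])
    fix b
    have "(\<lambda>m. (\<integral>z. wpow J m z y * wpow J n z x \<partial>M) * b ^ m) sums (\<integral>z. wexp J b z y * wpow J n z x \<partial>M)"
      by (rule expectation_wpow_series[OF J, of _ 1 1]) (use wpow_term_le[of 1 n J] in auto)
    then show "(\<lambda>m. (\<integral>z. wpow J m z y * wpow J n z x \<partial>M) * b ^ m) sums ((b * cov J x y) ^ n / fact n)"
      using expectation_wpow_wexp[OF J, of n x b y] by (simp add: mult.commute)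
    have "(\<lambda>m. if m = n then (b * cov J x y) ^ n / fact n else 0) sums ((b * cov J x y) ^ n / fact n)" by (rule sums_single)
    then show "(\<lambda>m. (if m = n then cov J x y ^ n / fact n else 0) * b ^ m) sums ((b * cov J x y) ^ n / fact n)"
      by (rule sums_cong[THEN iffD1, rotated]) (auto simp: power_mult_distrib)
  qed
  then show ?thesis by (simp add: mult.commute)
qed

definition remainder :: "(int \<times> int) set \<Rightarrow> nat \<Rightarrow> real \<Rightarrow> distribution \<Rightarrow> real \<times> real \<Rightarrow> real" where
  "remainder J m a z x = wexp J a z x - (\<Sum>n<m. a ^ n * wpow J n z x)"

lemma abs_remainder_le: "\<bar>remainder J m a z x\<bar> \<le> 2 * dom_exp J a z"
  unfolding remainder_def using wpow_sum_le[of a J z x m] wexp_le[of J a z x] wexp_pos[of J a z x] by linarith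

text \<open>By orthogonality the two cross terms and the product of the partial sums all equal the
  same truncated series; counted minus twice and plus once, they leave the tail of the
  exponential.\<close>

lemma expectation_remainder_mult:
  assumes J: "finite J"
  shows "(\<integral>z. remainder J m a z x * remainder J m a z y \<partial>M) = exp (a\<^sup>2 * cov J x y) - (\<Sum>n<m. (a\<^sup>2 * cov J x y) ^ n / fact n)"
proof -
  have iee: "integrable M (\<lambda>z. wexp J a z x * wexp J a z y)"
    by (rule integrable_dominated_mult[OF J, of _ _ 1 a 1 a]) (auto simp: abs_of_pos wexp_pos wexp_le)
  have ipe: "integrable M (\<lambda>z. wpow J n z x * wexp J a z y)" for n x y
    by (rule integrable_dominated_mult[OF J, of _ _ 1 1 1 a]) (use wpow_term_le[of 1 n J] in \<open>auto simp: abs_of_pos wexp_pos wexp_le\<close>)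
  have ipp: "integrable M (\<lambda>z. wpow J n z x * wpow J l z y)" for n l x y
    by (rule integrable_dominated_mult[OF J, of _ _ 1 1 1 1]) (use wpow_term_le[of 1 _ J] in auto)
  have "remainder J m a z x * remainder J m a z y = wexp J a z x * wexp J a z y - (\<Sum>n<m. a ^ n * (wpow J n z x * wexp J a z y))
     - (\<Sum>n<m. a ^ n * (wpow J n z y * wexp J a z x)) + (\<Sum>n<m. \<Sum>l<m. (a ^ n * a ^ l) * (wpow J n z x * wpow J l z y))" for z
  proof -
    have "(\<Sum>n<m. a ^ n * wpow J n z x) * (\<Sum>n<m. a ^ n * wpow J n z y) = (\<Sum>n<m. \<Sum>l<m. (a ^ n * a ^ l) * (wpow J n z x * wpow J l z y))"
      unfolding sum_product by (simp add: mult_ac)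
    moreover have "(\<Sum>n<m. a ^ n * wpow J n z x) * wexp J a z y = (\<Sum>n<m. a ^ n * (wpow J n z x * wexp J a z y))" for x y
      by (simp add: sum_distrib_right mult.assoc)
    ultimately show ?thesis unfolding remainder_def by (simp add: left_diff_distrib right_diff_distrib mult.commute[of "wexp J a z x" "sum _ _"])
  qed
  then have "(\<integral>z. remainder J m a z x * remainder J m a z y \<partial>M) = (\<integral>z. wexp J a z x * wexp J a z y \<partial>M) - (\<Sum>n<m. a ^ n * (\<integral>z. wpow J n z x * wexp J a z y \<partial>M))
     - (\<Sum>n<m. a ^ n * (\<integral>z. wpow J n z y * wexp J a z x \<partial>M)) + (\<Sum>n<m. \<Sum>l<m. (a ^ n * a ^ l) * (\<integral>z. wpow J n z x * wpow J l z y \<partial>M))"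
    using iee ipe ipp by simp
  also have "\<dots> = exp (a\<^sup>2 * cov J x y) - (\<Sum>n<m. a ^ n * ((a * cov J x y) ^ n / fact n)) - (\<Sum>n<m. a ^ n * ((a * cov J x y) ^ n / fact n))
     + (\<Sum>n<m. (a ^ n * a ^ n) * (cov J x y ^ n / fact n))"
    unfolding expectation_wexp_mult[OF J] expectation_wpow_wexp[OF J] expectation_wpow_wpow[OF J]
    by (simp add: cov_commute[of J y x] power2_eq_square if_distrib[of "\<lambda>u. _ * u"] cong: if_cong)
  also have "\<dots> = exp (a\<^sup>2 * cov J x y) - (\<Sum>n<m. (a\<^sup>2 * cov J x y) ^ n / fact n)"
    by (simp add: power_mult_distrib power2_eq_square mult_ac flip: sum_subtractf)
  finally show ?thesis .
qed

end

section \<open>Second moments as quadratic forms of the covariance\<close>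

abbreviation torus2 :: "((real \<times> real) \<times> real \<times> real) measure" where
  "torus2 \<equiv> torus \<Otimes>\<^sub>M torus"

interpretation torus2: finite_measure torus2
  by (rule finite_measure_pair_measure) (rule finite_measure_torus)+

interpretation torus_pair: pair_sigma_finite torus torus
  by standard

lemma (in pair_sigma_finite) integrable_mult_pair:
  fixes f :: "'a \<Rightarrow> real" and g :: "'b \<Rightarrow> real"
  assumes f: "integrable M1 f" and g: "integrable M2 g"
  shows "integrable (M1 \<Otimes>\<^sub>M M2) (\<lambda>p. f (fst p) * g (snd p))"
    "(\<integral>p. f (fst p) * g (snd p) \<partial>(M1 \<Otimes>\<^sub>M M2)) = (\<integral>x. f x \<partial>M1) * (\<integral>y. g y \<partial>M2)"
proof -
  have [measurable]: "f \<in> borel_measurable M1" "g \<in> borel_measurable M2" using f g by auto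
  have i: "integrable (M1 \<Otimes>\<^sub>M M2) (\<lambda>(x, y). f x * g y)"
  proof (rule Fubini_integrable)
    have "integrable M1 (\<lambda>x. \<bar>f x\<bar> * (\<integral>y. \<bar>g y\<bar> \<partial>M2))" using f by (intro integrable_mult_left integrable_abs)
    then show "integrable M1 (\<lambda>x. \<integral>y. norm (case (x, y) of (x, y) \<Rightarrow> f x * g y) \<partial>M2)"
      by (simp add: abs_mult)
    show "AE x in M1. integrable M2 (\<lambda>y. case (x, y) of (x, y) \<Rightarrow> f x * g y)" using g by simp
  qed measurable
  then show "integrable (M1 \<Otimes>\<^sub>M M2) (\<lambda>p. f (fst p) * g (snd p))" by (simp add: case_prod_unfold)
  have "(\<integral>p. f (fst p) * g (snd p) \<partial>(M1 \<Otimes>\<^sub>M M2)) = (\<integral>x. \<integral>y. f x * g y \<partial>M2 \<partial>M1)"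
    using integral_fst'[OF i] by (simp add: case_prod_unfold)
  then show "(\<integral>p. f (fst p) * g (snd p) \<partial>(M1 \<Otimes>\<^sub>M M2)) = (\<integral>x. f x \<partial>M1) * (\<integral>y. g y \<partial>M2)" by simp
qed

lemma integrable_mult_bounded:
  fixes f h :: "'a \<Rightarrow> real"
  assumes f: "integrable N f" and [measurable]: "h \<in> borel_measurable N" and B: "\<And>x. x \<in> space N \<Longrightarrow> \<bar>h x\<bar> \<le> B"
  shows "integrable N (\<lambda>x. f x * h x)"
proof (rule Bochner_Integration.integrable_bound)
  show "integrable N (\<lambda>x. B * f x)" using f by simp
  show "AE x in N. norm (f x * h x) \<le> norm (B * f x)"
  proof (intro AE_I2)
    fix x assume "x \<in> space N"
    from B[OF this] have "\<bar>h x\<bar> \<le> \<bar>B\<bar>" by simp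
    then show "norm (f x * h x) \<le> norm (B * f x)" by (simp add: abs_mult mult.commute[of "\<bar>B\<bar>"] mult_left_mono)
  qed
qed (use f in measurable)

context gaussian_free_field
begin

text \<open>The square of the integral is a double integral over the torus, and the expectation
  moves inside by Fubini, with the square of the majorant of A times |g(x)| |g(y)| as integrable
  bound.\<close>

lemma second_moment:
  assumes J: "finite J" and [measurable]: "(\<lambda>p. A (fst p) (snd p)) \<in> borel_measurable (M \<Otimes>\<^sub>M torus)"
    and A: "\<And>z x. \<bar>A z x\<bar> \<le> C * dom_exp J a z" and g: "integrable torus g"
  shows "integrable M (\<lambda>z. (\<integral>x. A z x * g x \<partial>torus)\<^sup>2)"
    "(\<integral>z. (\<integral>x. A z x * g x \<partial>torus)\<^sup>2 \<partial>M) = (\<integral>p. g (fst p) * g (snd p) * (\<integral>z. A z (fst p) * A z (snd p) \<partial>M) \<partial>torus2)"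
proof -
  have [measurable]: "g \<in> borel_measurable torus" using g by simp
  interpret MT: pair_sigma_finite M torus2 by standard
  have Az: "(\<lambda>x. A z x) \<in> borel_measurable torus" if "z \<in> space M" for z
    using measurable_compose[OF measurable_Pair1'[OF that] assms(2)] by simp
  have sq: "(\<integral>x. A z x * g x \<partial>torus)\<^sup>2 = (\<integral>p. (A z (fst p) * g (fst p)) * (A z (snd p) * g (snd p)) \<partial>torus2)" if "z \<in> space M" for z
  proof -
    have "integrable torus (\<lambda>x. g x * A z x)"
      by (rule integrable_mult_bounded[OF g Az[OF that] A])
    then have "integrable torus (\<lambda>x. A z x * g x)" by (simp add: mult.commute)
    from torus_pair.integrable_mult_pair(2)[OF this this] show ?thesis by (simp add: power2_eq_square)
  qed
  define \<Psi> where "\<Psi> = (\<lambda>z p. (A z (fst p) * g (fst p)) * (A z (snd p) * g (snd p)))"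
  have meas1: "(\<lambda>q. A (fst q) (fst (snd q))) \<in> borel_measurable (M \<Otimes>\<^sub>M torus2)"
    using measurable_compose[OF _ assms(2), of "\<lambda>q. (fst q, fst (snd q))" "M \<Otimes>\<^sub>M torus2"] by simp
  have meas2: "(\<lambda>q. A (fst q) (snd (snd q))) \<in> borel_measurable (M \<Otimes>\<^sub>M torus2)"
    using measurable_compose[OF _ assms(2), of "\<lambda>q. (fst q, snd (snd q))" "M \<Otimes>\<^sub>M torus2"] by simp
  have int\<Psi>: "integrable (M \<Otimes>\<^sub>M torus2) (\<lambda>(z, p). \<Psi> z p)"
  proof (rule Bochner_Integration.integrable_bound)
    have "integrable torus (\<lambda>x. \<bar>g x\<bar>)" using g by simp
    then have "integrable torus2 (\<lambda>p. \<bar>g (fst p)\<bar> * \<bar>g (snd p)\<bar>)" by (intro torus_pair.integrable_mult_pair(1))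
    moreover have "integrable M (\<lambda>z. C\<^sup>2 * (dom_exp J a z * dom_exp J a z))" using integrable_dom_exp_mult[OF J] by simp
    ultimately show "integrable (M \<Otimes>\<^sub>M torus2) (\<lambda>q. (C\<^sup>2 * (dom_exp J a (fst q) * dom_exp J a (fst q))) * (\<bar>g (fst (snd q))\<bar> * \<bar>g (snd (snd q))\<bar>))"
      by (intro MT.integrable_mult_pair(1))
    show "(\<lambda>(z, p). \<Psi> z p) \<in> borel_measurable (M \<Otimes>\<^sub>M torus2)"
      unfolding \<Psi>_def case_prod_unfold using meas1 meas2 by measurable
    show "AE q in M \<Otimes>\<^sub>M torus2. norm (case q of (z, p) \<Rightarrow> \<Psi> z p) \<le> norm ((C\<^sup>2 * (dom_exp J a (fst q) * dom_exp J a (fst q))) * (\<bar>g (fst (snd q))\<bar> * \<bar>g (snd (snd q))\<bar>))"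
    proof (intro AE_I2, clarify)
      fix z x1 x2 y1 y2
      have "\<bar>A z (x1, x2)\<bar> * \<bar>A z (y1, y2)\<bar> \<le> (C * dom_exp J a z) * (C * dom_exp J a z)"
        using A[of z "(x1, x2)"] A[of z "(y1, y2)"] by (intro mult_mono) auto
      then have "(\<bar>A z (x1, x2)\<bar> * \<bar>A z (y1, y2)\<bar>) * (\<bar>g (x1, x2)\<bar> * \<bar>g (y1, y2)\<bar>) \<le> ((C * dom_exp J a z) * (C * dom_exp J a z)) * (\<bar>g (x1, x2)\<bar> * \<bar>g (y1, y2)\<bar>)"
        by (rule mult_right_mono) simp
      also have "\<dots> \<le> \<bar>((C * dom_exp J a z) * (C * dom_exp J a z)) * (\<bar>g (x1, x2)\<bar> * \<bar>g (y1, y2)\<bar>)\<bar>" by (rule abs_ge_self)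
      finally show "norm (\<Psi> z ((x1, x2), y1, y2)) \<le> norm ((C\<^sup>2 * (dom_exp J a (fst (z, (x1, x2), y1, y2)) * dom_exp J a (fst (z, (x1, x2), y1, y2)))) * (\<bar>g (fst (snd (z, (x1, x2), y1, y2)))\<bar> * \<bar>g (snd (snd (z, (x1, x2), y1, y2)))\<bar>))"
        unfolding \<Psi>_def by (simp add: abs_mult power2_eq_square mult_ac)
    qed
  qed
  have "integrable M (\<lambda>z. \<integral>p. \<Psi> z p \<partial>torus2)" using MT.integrable_fst'[OF int\<Psi>] by simp
  then show "integrable M (\<lambda>z. (\<integral>x. A z x * g x \<partial>torus)\<^sup>2)"
    by (rule Bochner_Integration.integrable_cong[THEN iffD1, rotated 2]) (auto simp: sq \<Psi>_def)
  have "(\<integral>z. (\<integral>x. A z x * g x \<partial>torus)\<^sup>2 \<partial>M) = (\<integral>z. (\<integral>p. \<Psi> z p \<partial>torus2) \<partial>M)"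
    by (intro Bochner_Integration.integral_cong) (auto simp: sq \<Psi>_def)
  also have "\<dots> = (\<integral>p. (\<integral>z. \<Psi> z p \<partial>M) \<partial>torus2)" by (rule MT.Fubini_integral[OF int\<Psi>, symmetric])
  also have "\<dots> = (\<integral>p. g (fst p) * g (snd p) * (\<integral>z. A z (fst p) * A z (snd p) \<partial>M) \<partial>torus2)"
  proof (intro Bochner_Integration.integral_cong refl)
    fix p
    have "\<Psi> z p = g (fst p) * g (snd p) * (A z (fst p) * A z (snd p))" for z unfolding \<Psi>_def by simp
    then show "(\<integral>z. \<Psi> z p \<partial>M) = g (fst p) * g (snd p) * (\<integral>z. A z (fst p) * A z (snd p) \<partial>M)" by simp
  qed
  finally show "(\<integral>z. (\<integral>x. A z x * g x \<partial>torus)\<^sup>2 \<partial>M) = (\<integral>p. g (fst p) * g (snd p) * (\<integral>z. A z (fst p) * A z (snd p) \<partial>M) \<partial>torus2)" .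
qed

end

definition cov_form :: "(int \<times> int) set \<Rightarrow> (real \<times> real \<Rightarrow> real) \<Rightarrow> nat \<Rightarrow> real" where
  "cov_form J g n = (\<integral>p. g (fst p) * g (snd p) * cov J (fst p) (snd p) ^ n \<partial>torus2)"

lemma integrable_cov_form:
  fixes g :: "real \<times> real \<Rightarrow> real" and h :: "(real \<times> real) \<times> real \<times> real \<Rightarrow> real"
  assumes g: "integrable torus g" and [measurable]: "h \<in> borel_measurable torus2" and B: "\<And>p. \<bar>h p\<bar> \<le> B"
  shows "integrable torus2 (\<lambda>p. g (fst p) * g (snd p) * h p)"
  by (rule integrable_mult_bounded[OF torus_pair.integrable_mult_pair(1)[OF g g] _ B]) auto

lemma abs_cov_power_le: "\<bar>cov J x y ^ n\<bar> \<le> cov_bound J ^ n"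
  unfolding power_abs by (intro power_mono abs_cov_le) simp

text \<open>Schur's product theorem for powers: \<open>cov\<close> is a nonnegative combination of
  rank-one kernels, so one factor is absorbed into the test function as
  \<open>g * basis_e k\<close>, and the induction runs over all g.\<close>

lemma cov_form_nonneg:
  assumes J: "finite J" and g: "integrable torus g"
  shows "cov_form J g n \<ge> 0"
  using g
proof (induction n arbitrary: g)
  case 0
  then show ?case unfolding cov_form_def using torus_pair.integrable_mult_pair(2)[OF 0 0] by simp
next
  case (Suc n)
  have ge: "integrable torus (\<lambda>x. g x * basis_e k x)" for k
    by (rule integrable_mult_bounded[OF Suc.prems borel_measurable_basis_e abs_basis_e_le])
  have i: "integrable torus2 (\<lambda>p. (g (fst p) * basis_e k (fst p)) * (g (snd p) * basis_e k (snd p)) * cov J (fst p) (snd p) ^ n)" for k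
    by (rule integrable_cov_form[OF ge _ abs_cov_power_le]) simp
  have "g (fst p) * g (snd p) * cov J (fst p) (snd p) ^ Suc n
     = (\<Sum>k\<in>J. (1 / bracket2 k) * ((g (fst p) * basis_e k (fst p)) * (g (snd p) * basis_e k (snd p)) * cov J (fst p) (snd p) ^ n))" for p
  proof -
    have "cov J (fst p) (snd p) ^ Suc n = (\<Sum>k\<in>J. basis_e k (fst p) * basis_e k (snd p) / bracket2 k) * cov J (fst p) (snd p) ^ n"
      unfolding power_Suc cov_def[of J "fst p" "snd p"] ..
    then show ?thesis by (simp add: sum_distrib_left sum_distrib_right mult_ac)
  qed
  then have "cov_form J g (Suc n) = (\<Sum>k\<in>J. (1 / bracket2 k) * cov_form J (\<lambda>x. g x * basis_e k x) n)"
    unfolding cov_form_def using i by simp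
  also have "\<dots> \<ge> 0" using Suc.IH[OF ge] bracket2_pos by (intro sum_nonneg mult_nonneg_nonneg) (auto simp: less_imp_le)
  finally show ?case .
qed

lemma cov_form_sums:
  assumes J: "finite J" and g: "integrable torus g"
  shows "(\<lambda>n. c ^ n / fact n * cov_form J g n) sums (\<integral>p. g (fst p) * g (snd p) * exp (c * cov J (fst p) (snd p)) \<partial>torus2)"
proof -
  have [measurable]: "g \<in> borel_measurable torus" using g by simp
  have B0: "cov_bound J \<ge> 0" using abs_cov_le[of J undefined undefined] by linarith
  have bound: "\<bar>\<Sum>n<m. (c * cov J x y) ^ n / fact n\<bar> \<le> exp (\<bar>c\<bar> * cov_bound J)" for m x y
  proof -
    have "\<bar>\<Sum>n<m. (c * cov J x y) ^ n / fact n\<bar> \<le> (\<Sum>n<m. (\<bar>c\<bar> * cov_bound J) ^ n / fact n)"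
    proof (rule order_trans[OF sum_abs sum_mono])
      fix n
      have "\<bar>c * cov J x y\<bar> ^ n \<le> (\<bar>c\<bar> * cov_bound J) ^ n"
        unfolding abs_mult by (intro power_mono mult_left_mono abs_cov_le) auto
      then show "\<bar>(c * cov J x y) ^ n / fact n\<bar> \<le> (\<bar>c\<bar> * cov_bound J) ^ n / fact n" by (simp add: power_abs divide_right_mono)
    qed
    also have "\<dots> \<le> exp (\<bar>c\<bar> * cov_bound J)"
    proof -
      have s: "(\<lambda>n. (\<bar>c\<bar> * cov_bound J) ^ n / fact n) sums exp (\<bar>c\<bar> * cov_bound J)"
        using exp_converges[of "\<bar>c\<bar> * cov_bound J"] by (simp add: divide_real_def mult.commute)
      show ?thesis using sum_le_suminf[OF sums_summable[OF s], of "{..<m}"] sums_unique[OF s] B0 by simp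
    qed
    finally show ?thesis .
  qed
  have "(\<lambda>m. \<integral>p. g (fst p) * g (snd p) * (\<Sum>n<m. (c * cov J (fst p) (snd p)) ^ n / fact n) \<partial>torus2) \<longlonglongrightarrow>
     (\<integral>p. g (fst p) * g (snd p) * exp (c * cov J (fst p) (snd p)) \<partial>torus2)"
  proof (rule integral_dominated_convergence)
    have "integrable torus2 (\<lambda>p. g (fst p) * g (snd p))" by (rule torus_pair.integrable_mult_pair(1)[OF g g])
    then show "integrable torus2 (\<lambda>p. \<bar>g (fst p) * g (snd p)\<bar> * exp (\<bar>c\<bar> * cov_bound J))"
      by (intro integrable_mult_left integrable_abs)
    show "AE p in torus2. (\<lambda>m. g (fst p) * g (snd p) * (\<Sum>n<m. (c * cov J (fst p) (snd p)) ^ n / fact n)) \<longlonglongrightarrow> g (fst p) * g (snd p) * exp (c * cov J (fst p) (snd p))"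
    proof (intro AE_I2 tendsto_mult_left)
      fix p
      show "(\<lambda>m. \<Sum>n<m. (c * cov J (fst p) (snd p)) ^ n / fact n) \<longlonglongrightarrow> exp (c * cov J (fst p) (snd p))"
        using exp_converges[of "c * cov J (fst p) (snd p)"] by (simp add: sums_def divide_real_def mult.commute)
    qed
    show "AE p in torus2. norm (g (fst p) * g (snd p) * (\<Sum>n<m. (c * cov J (fst p) (snd p)) ^ n / fact n)) \<le> \<bar>g (fst p) * g (snd p)\<bar> * exp (\<bar>c\<bar> * cov_bound J)" for m
      unfolding real_norm_def abs_mult[of "g _ * g _"] by (intro AE_I2 mult_left_mono bound) simp
  qed measurable
  moreover have "(\<integral>p. g (fst p) * g (snd p) * (\<Sum>n<m. (c * cov J (fst p) (snd p)) ^ n / fact n) \<partial>torus2) = (\<Sum>n<m. c ^ n / fact n * cov_form J g n)" for m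
  proof -
    have i: "integrable torus2 (\<lambda>p. g (fst p) * g (snd p) * cov J (fst p) (snd p) ^ n)" for n
      by (rule integrable_cov_form[OF g _ abs_cov_power_le]) simp
    have "(\<integral>p. g (fst p) * g (snd p) * (\<Sum>n<m. (c * cov J (fst p) (snd p)) ^ n / fact n) \<partial>torus2)
       = (\<integral>p. (\<Sum>n<m. c ^ n / fact n * (g (fst p) * g (snd p) * cov J (fst p) (snd p) ^ n)) \<partial>torus2)"
      by (simp add: sum_distrib_left power_mult_distrib mult_ac)
    then show ?thesis unfolding cov_form_def using i by simp
  qed
  ultimately show ?thesis unfolding sums_def by simp
qed

context gaussian_free_field
begin

lemma wexp_second_moment:
  assumes J: "finite J" and g: "integrable torus g"
  shows "integrable M (\<lambda>z. (\<integral>x. wexp J a z x * g x \<partial>torus)\<^sup>2)"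
    "(\<integral>z. (\<integral>x. wexp J a z x * g x \<partial>torus)\<^sup>2 \<partial>M) = (\<integral>p. g (fst p) * g (snd p) * exp (a\<^sup>2 * cov J (fst p) (snd p)) \<partial>torus2)"
  using second_moment[OF J measurable_wexp_pair _ g, where C = 1 and a = a] wexp_le wexp_pos
  by (auto simp: abs_of_pos expectation_wexp_mult[OF J] power2_eq_square)

lemma measurable_remainder_pair [measurable]: "(\<lambda>p. remainder J m a (fst p) (snd p)) \<in> borel_measurable (M \<Otimes>\<^sub>M torus)"
  unfolding remainder_def by measurable

text \<open>The second moment of the tail is a series with nonnegative terms by
  \<open>cov_form_nonneg\<close>; from order m on, each term is at most (a^2 / b^2)^m times the
  corresponding term for b.\<close>

lemma remainder_second_moment_le:
  assumes J: "finite J" and g: "integrable torus g" and ab: "\<bar>a\<bar> \<le> \<bar>b\<bar>" "b \<noteq> 0"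
  shows "integrable M (\<lambda>z. (\<integral>x. remainder J m a z x * g x \<partial>torus)\<^sup>2)"
    "(\<integral>z. (\<integral>x. remainder J m a z x * g x \<partial>torus)\<^sup>2 \<partial>M) \<le> (a\<^sup>2 / b\<^sup>2) ^ m * (\<integral>z. (\<integral>x. wexp J b z x * g x \<partial>torus)\<^sup>2 \<partial>M)"
proof -
  note sm = second_moment[OF J measurable_remainder_pair abs_remainder_le g, of m a]
  show "integrable M (\<lambda>z. (\<integral>x. remainder J m a z x * g x \<partial>torus)\<^sup>2)" by (rule sm(1))
  have [measurable]: "g \<in> borel_measurable torus" using g by simp
  define t where "t = (\<lambda>n. (a\<^sup>2) ^ n / fact n * cov_form J g n)"
  define s where "s = (\<lambda>n. (b\<^sup>2) ^ n / fact n * cov_form J g n)"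
  have t: "t sums (\<integral>p. g (fst p) * g (snd p) * exp (a\<^sup>2 * cov J (fst p) (snd p)) \<partial>torus2)" unfolding t_def by (rule cov_form_sums[OF J g])
  have s: "s sums (\<integral>p. g (fst p) * g (snd p) * exp (b\<^sup>2 * cov J (fst p) (snd p)) \<partial>torus2)" unfolding s_def by (rule cov_form_sums[OF J g])
  have s0: "s n \<ge> 0" for n unfolding s_def using cov_form_nonneg[OF J g] by simp
  have i1: "integrable torus2 (\<lambda>p. g (fst p) * g (snd p) * exp (a\<^sup>2 * cov J (fst p) (snd p)))"
  proof (rule integrable_cov_form[OF g])
    fix p
    have "a\<^sup>2 * cov J (fst p) (snd p) \<le> a\<^sup>2 * cov_bound J"
      using abs_cov_le[of J "fst p" "snd p"] by (intro mult_left_mono) auto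
    then show "\<bar>exp (a\<^sup>2 * cov J (fst p) (snd p))\<bar> \<le> exp (a\<^sup>2 * cov_bound J)" by simp
  qed measurable
  have i2: "integrable torus2 (\<lambda>p. g (fst p) * g (snd p) * cov J (fst p) (snd p) ^ n)" for n
    by (rule integrable_cov_form[OF g _ abs_cov_power_le]) simp
  have "(\<integral>z. (\<integral>x. remainder J m a z x * g x \<partial>torus)\<^sup>2 \<partial>M)
     = (\<integral>p. g (fst p) * g (snd p) * (exp (a\<^sup>2 * cov J (fst p) (snd p)) - (\<Sum>n<m. (a\<^sup>2 * cov J (fst p) (snd p)) ^ n / fact n)) \<partial>torus2)"
    unfolding sm(2) expectation_remainder_mult[OF J] ..
  also have "\<dots> = (\<integral>p. g (fst p) * g (snd p) * exp (a\<^sup>2 * cov J (fst p) (snd p)) - (\<Sum>n<m. (a\<^sup>2) ^ n / fact n * (g (fst p) * g (snd p) * cov J (fst p) (snd p) ^ n)) \<partial>torus2)"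
    by (simp add: right_diff_distrib sum_distrib_left power_mult_distrib mult_ac)
  also have "\<dots> = (\<integral>p. g (fst p) * g (snd p) * exp (a\<^sup>2 * cov J (fst p) (snd p)) \<partial>torus2) - (\<Sum>n<m. t n)"
    unfolding t_def cov_form_def using i1 i2 by (subst Bochner_Integration.integral_diff) auto
  also have "\<dots> = (\<Sum>n. t (n + m))"
    using sums_split_initial_segment[OF t, of m] sums_unique by blast
  also have "\<dots> \<le> (\<Sum>n. (a\<^sup>2 / b\<^sup>2) ^ m * s (n + m))"
  proof (rule suminf_le)
    show "summable (\<lambda>n. t (n + m))" using sums_summable[OF t] by (rule summable_ignore_initial_segment)
    show "summable (\<lambda>n. (a\<^sup>2 / b\<^sup>2) ^ m * s (n + m))" using summable_ignore_initial_segment[OF sums_summable[OF s]] by (rule summable_mult)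
    fix n
    have "a\<^sup>2 \<le> b\<^sup>2" using ab by (simp add: abs_le_square_iff)
    then have "(a\<^sup>2) ^ n \<le> (b\<^sup>2) ^ n" by (rule power_mono) simp
    then have "(a\<^sup>2) ^ n * (a\<^sup>2) ^ m \<le> (b\<^sup>2) ^ n * (a\<^sup>2) ^ m" by (intro mult_right_mono) auto
    also have "\<dots> = (a\<^sup>2 / b\<^sup>2) ^ m * (b\<^sup>2) ^ (n + m)" using ab by (simp add: power_divide power_add)
    finally have "(a\<^sup>2) ^ (n + m) \<le> (a\<^sup>2 / b\<^sup>2) ^ m * (b\<^sup>2) ^ (n + m)" by (simp only: power_add)
    then have "(a\<^sup>2) ^ (n + m) * (cov_form J g (n + m) / fact (n + m)) \<le> (a\<^sup>2 / b\<^sup>2) ^ m * (b\<^sup>2) ^ (n + m) * (cov_form J g (n + m) / fact (n + m))"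
      using cov_form_nonneg[OF J g, of "n + m"] by (intro mult_right_mono) auto
    then show "t (n + m) \<le> (a\<^sup>2 / b\<^sup>2) ^ m * s (n + m)" unfolding t_def s_def by (simp add: mult_ac)
  qed
  also have "\<dots> = (a\<^sup>2 / b\<^sup>2) ^ m * (\<Sum>n. s (n + m))"
    using summable_ignore_initial_segment[OF sums_summable[OF s]] by (rule suminf_mult)
  also have "\<dots> \<le> (a\<^sup>2 / b\<^sup>2) ^ m * (\<Sum>n. s n)"
    using suminf_split_initial_segment[OF sums_summable[OF s], of m] sum_nonneg[of "{..<m}" s] s0 by (intro mult_left_mono) auto
  also have "(\<Sum>n. s n) = (\<integral>z. (\<integral>x. wexp J b z x * g x \<partial>torus)\<^sup>2 \<partial>M)"
    unfolding wexp_second_moment[OF J g] using sums_unique[OF s] by simp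
  finally show "(\<integral>z. (\<integral>x. remainder J m a z x * g x \<partial>torus)\<^sup>2 \<partial>M) \<le> (a\<^sup>2 / b\<^sup>2) ^ m * (\<integral>z. (\<integral>x. wexp J b z x * g x \<partial>torus)\<^sup>2 \<partial>M)" .
qed

end

section \<open>Uniform bounds for the truncated covariance\<close>

text \<open>Adding the terms of k and - k makes the real basis translation invariant. At k = 0 the
  same term counts twice, which fits its smaller amplitude.\<close>

lemma basis_pair_sum: "basis_e k x * basis_e k y + basis_e (- k) x * basis_e (- k) y = cos (dot k (x - y)) / (2 * pi\<^sup>2)"
proof -
  have d: "dot k (x - y) = dot k x - dot k y" unfolding dot_def by (simp add: algebra_simps)
  have sq: "(sqrt 2 * pi) * (sqrt 2 * pi) = 2 * pi\<^sup>2" by (simp add: power2_eq_square)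

  consider "k = (0, 0)" | "k \<noteq> (0, 0)" "k \<in> Z2_plus" "- k \<notin> Z2_plus" | "k \<noteq> (0, 0)" "k \<notin> Z2_plus" "- k \<in> Z2_plus"
    using Z2_plus_cases(1)[of k] Z2_plus_cases(2)[of k] Z2_plus_cases(3) by metis
  then show ?thesis
  proof cases
    case 1
    then show ?thesis by (simp add: basis_e_def dot_def power2_eq_square)
  next
    case 2
    then have "- k \<noteq> (0, 0)" by (cases k) auto
    then have "basis_e k x * basis_e k y + basis_e (- k) x * basis_e (- k) y = (cos (dot k x) * cos (dot k y) + sin (dot k x) * sin (dot k y)) / (2 * pi\<^sup>2)"
      unfolding sq[symmetric] using 2 by (simp add: basis_e_def dot_minus add_divide_distrib)
    then show ?thesis unfolding d cos_diff .
  next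
    case 3
    then have "- k \<noteq> (0, 0)" by (cases k) auto
    then have "basis_e k x * basis_e k y + basis_e (- k) x * basis_e (- k) y = (cos (dot k x) * cos (dot k y) + sin (dot k x) * sin (dot k y)) / (2 * pi\<^sup>2)"
      unfolding sq[symmetric] using 3 by (simp add: basis_e_def dot_minus add_divide_distrib)
    then show ?thesis unfolding d cos_diff .
  qed
qed

lemma weighted_basis_sum:
  assumes sym: "uminus ` J = J" and w: "\<And>k. w (- k) = w k"
  shows "(\<Sum>k\<in>J. w k * (basis_e k x * basis_e k y)) = (\<Sum>k\<in>J. w k * cos (dot k (x - y))) / (4 * pi\<^sup>2)"
proof -
  have "(\<Sum>k\<in>J. w k * (basis_e k x * basis_e k y)) = (\<Sum>k\<in>uminus ` J. w k * (basis_e k x * basis_e k y))" unfolding sym ..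
  also have "\<dots> = (\<Sum>k\<in>J. w k * (basis_e (- k) x * basis_e (- k) y))"
    by (subst sum.reindex) (auto simp: w inj_on_def)
  finally have "2 * (\<Sum>k\<in>J. w k * (basis_e k x * basis_e k y)) = (\<Sum>k\<in>J. w k * (basis_e k x * basis_e k y)) + (\<Sum>k\<in>J. w k * (basis_e (- k) x * basis_e (- k) y))"
    by simp
  also have "\<dots> = (\<Sum>k\<in>J. w k * (cos (dot k (x - y)) / (2 * pi\<^sup>2)))"
    unfolding basis_pair_sum[symmetric] by (simp add: sum.distrib[symmetric] distrib_left)
  also have "\<dots> = (\<Sum>k\<in>J. w k * cos (dot k (x - y))) / (2 * pi\<^sup>2)" by (simp add: sum_divide_distrib)
  finally show ?thesis by simp
qed

section \<open>Symmetric cutoffs and the pointwise covariance bound\<close>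

lemma bracket2_minus: "bracket2 (- k) = bracket2 k"
  unfolding bracket2_def by simp

lemma uminus_lattice_box: "uminus ` lattice_box m = lattice_box m"
proof -
  have "uminus ` lattice_box m \<subseteq> lattice_box m" for m unfolding lattice_box_def by auto
  moreover have "lattice_box m \<subseteq> uminus ` lattice_box m"
  proof
    fix k assume "k \<in> lattice_box m"
    then have "- k \<in> lattice_box m" unfolding lattice_box_def by (cases k) auto
    then show "k \<in> uminus ` lattice_box m" by (intro image_eqI[of _ _ "- k"]) auto
  qed
  ultimately show ?thesis by blast
qed

text \<open>What the estimates use of a cutoff: symmetry, and lattice boxes inside and outside of
  comparable size. The constants depend on \<kappa> but not on N. The term m + 1 allows the inner
  box to be a single point.\<close>

definition admissible :: "real \<Rightarrow> (int \<times> int) set \<Rightarrow> bool" where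
  "admissible \<kappa> J \<longleftrightarrow> uminus ` J = J \<and> (\<exists>m n. lattice_box m \<subseteq> J \<and> J \<subseteq> lattice_box n \<and> real n \<le> \<kappa> * (real m + 1))"

lemma admissible_finite: "admissible \<kappa> J \<Longrightarrow> finite J"
proof -
  assume "admissible \<kappa> J"
  then obtain n where "J \<subseteq> lattice_box n" unfolding admissible_def by auto
  then show "finite J" by (rule finite_subset) simp
qed

text \<open>The error terms of \<open>box_cos_sum_bound\<close> and \<open>annulus_sum_le\<close>,
  divided by the normalisation 4 pi^2.\<close>

definition cov_const :: "real \<Rightarrow> real" where
  "cov_const \<kappa> = (7 + 5 * pi + 2 * pi * ln 2 + (8 + 4 * pi * (1 + ln \<kappa>))) / (4 * pi\<^sup>2)"

lemma box_cos_sum_bound':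
  assumes s: "sin (fst t / 2) \<noteq> 0 \<and> u = \<bar>sin (fst t / 2)\<bar> \<or> sin (snd t / 2) \<noteq> 0 \<and> u = \<bar>sin (snd t / 2)\<bar>"
  shows "\<bar>\<Sum>k\<in>lattice_box m. cos (dot k t) / bracket2 k\<bar> \<le> 2 * pi * ln (1 / u) + (7 + 5 * pi + 2 * pi * ln 2)"
  using s
proof
  assume "sin (fst t / 2) \<noteq> 0 \<and> u = \<bar>sin (fst t / 2)\<bar>"
  then show ?thesis using box_cos_sum_bound[of "fst t" "snd t" m] by simp
next
  assume *: "sin (snd t / 2) \<noteq> 0 \<and> u = \<bar>sin (snd t / 2)\<bar>"
  have "(\<Sum>k\<in>lattice_box m. cos (dot k t) / bracket2 k) = (\<Sum>k\<in>lattice_box m. cos (dot k (snd t, fst t)) / bracket2 k)"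
    by (rule sum.reindex_bij_witness[of _ prod.swap prod.swap]) (auto simp: lattice_box_def bracket2_def dot_def add_ac)
  then show ?thesis using box_cos_sum_bound[of "snd t" "fst t" m] * by simp
qed

text \<open>Cancellation is used only in the inner box, where the summation is explicit; the other
  modes lie in an annulus, and their cosines are bounded by 1. The shape of \<Lambda> thus costs a
  constant. An upper bound on \<open>cov\<close> suffices because it enters through an
  exponential.\<close>

lemma cov_le:
  assumes adm: "admissible \<kappa> J" and \<kappa>: "\<kappa> \<ge> 1"
    and s: "sin ((fst x - fst y) / 2) \<noteq> 0 \<and> u = \<bar>sin ((fst x - fst y) / 2)\<bar> \<or> sin ((snd x - snd y) / 2) \<noteq> 0 \<and> u = \<bar>sin ((snd x - snd y) / 2)\<bar>"
  shows "cov J x y \<le> ln (1 / u) / (2 * pi) + cov_const \<kappa>"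
proof -
  obtain m n where J: "uminus ` J = J" "lattice_box m \<subseteq> J" "J \<subseteq> lattice_box n" "real n \<le> \<kappa> * (real m + 1)"
    using adm unfolding admissible_def by blast
  have fin: "finite J" using adm by (rule admissible_finite)
  let ?f = "\<lambda>k. cos (dot k (x - y)) / bracket2 k"
  have "cov J x y = (\<Sum>k\<in>J. (1 / bracket2 k) * (basis_e k x * basis_e k y))" unfolding cov_def by simp
  also have "\<dots> = (\<Sum>k\<in>J. ?f k) / (4 * pi\<^sup>2)"
    by (subst weighted_basis_sum[OF J(1)]) (auto simp: bracket2_minus)
  also have "(\<Sum>k\<in>J. ?f k) = (\<Sum>k\<in>lattice_box m. ?f k) + (\<Sum>k\<in>J - lattice_box m. ?f k)"
    using J fin by (subst sum.subset_diff[of "lattice_box m" J]) auto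
  also have "(\<Sum>k\<in>J - lattice_box m. ?f k) \<le> (\<Sum>k\<in>J - lattice_box m. 1 / bracket2 k)"
    using bracket2_pos by (intro sum_mono divide_right_mono) (auto simp: less_imp_le)
  also have "\<dots> \<le> (\<Sum>k\<in>lattice_box n - lattice_box m. 1 / bracket2 k)"
    using J bracket2_pos by (intro sum_mono2) (auto simp: less_imp_le)
  also have "\<dots> \<le> 8 + 4 * pi * (1 + ln \<kappa>)" by (rule annulus_sum_le[OF J(4) \<kappa>])
  also have "(\<Sum>k\<in>lattice_box m. ?f k) \<le> 2 * pi * ln (1 / u) + (7 + 5 * pi + 2 * pi * ln 2)"
    using box_cos_sum_bound'[of "x - y" u m] s by (simp add: abs_le_iff)
  finally have "cov J x y \<le> (2 * pi * ln (1 / u) + (7 + 5 * pi + 2 * pi * ln 2) + (8 + 4 * pi * (1 + ln \<kappa>))) / (4 * pi\<^sup>2)"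
    by (simp add: divide_right_mono)
  also have "\<dots> = ln (1 / u) / (2 * pi) + cov_const \<kappa>"
    unfolding cov_const_def by (simp add: add_divide_distrib power2_eq_square)
  finally show ?thesis .
qed

definition sinpow :: "real \<Rightarrow> real \<Rightarrow> real" where
  "sinpow c t = \<bar>sin (t / 2)\<bar> powr (- c)"

text \<open>The bounds by the two coordinates are averaged. Either one alone would give exponent 2
  \<theta> in one variable, integrable only for \<theta> < 1 / 2; the average gives \<theta> in
  both, integrable for \<theta> < 1, that is for b^2 < 4 pi.\<close>

lemma exp_cov_le:
  assumes adm: "admissible \<kappa> J" and \<kappa>: "\<kappa> \<ge> 1"
    and s: "sin ((fst x - fst y) / 2) \<noteq> 0" "sin ((snd x - snd y) / 2) \<noteq> 0" and \<theta>: "\<theta> = b\<^sup>2 / (4 * pi)"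
  shows "exp (b\<^sup>2 * cov J x y) \<le> exp (b\<^sup>2 * cov_const \<kappa>) * (sinpow \<theta> (fst x - fst y) * sinpow \<theta> (snd x - snd y))"
proof -
  have e: "sinpow \<theta> t = exp (\<theta> * ln (1 / \<bar>sin (t / 2)\<bar>))" if "sin (t / 2) \<noteq> 0" for t
    unfolding sinpow_def powr_def using that by (simp add: ln_div)
  have le: "b\<^sup>2 * cov J x y \<le> b\<^sup>2 * (ln (1 / u) / (2 * pi) + cov_const \<kappa>)"
    if "u = \<bar>sin ((fst x - fst y) / 2)\<bar> \<or> u = \<bar>sin ((snd x - snd y) / 2)\<bar>" for u
    using cov_le[OF adm \<kappa>, of x y u] s that by (intro mult_left_mono) auto
  have \<theta>2: "b\<^sup>2 * (r / (2 * pi) + c) = 2 * \<theta> * r + b\<^sup>2 * c" for r c unfolding \<theta> by (simp add: field_simps)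
  have "b\<^sup>2 * cov J x y \<le> b\<^sup>2 * cov_const \<kappa> + (\<theta> * ln (1 / \<bar>sin ((fst x - fst y) / 2)\<bar>) + \<theta> * ln (1 / \<bar>sin ((snd x - snd y) / 2)\<bar>))"
    using le[of "\<bar>sin ((fst x - fst y) / 2)\<bar>"] le[of "\<bar>sin ((snd x - snd y) / 2)\<bar>"] unfolding \<theta>2 by (simp add: field_simps)
  then show ?thesis unfolding e[OF s(1)] e[OF s(2)] exp_add[symmetric] by simp
qed

text \<open>A ball around 0 inside \<Lambda> contains the inner box, a bound on \<Lambda> gives the
  outer one, and both scale with N.\<close>

lemma cutoff_admissible:
  assumes "cutoff_set \<Lambda>"
  shows "\<exists>\<kappa>\<ge>1. \<forall>N. admissible \<kappa> {k. (of_int (fst k), of_int (snd k)) \<in> dilate N \<Lambda>}"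
proof -
  have comp: "compact \<Lambda>" and sym: "\<Lambda> = uminus ` \<Lambda>" and int: "0 \<in> interior \<Lambda>" using assms unfolding cutoff_set_def by auto
  obtain r where r: "r > 0" "ball 0 r \<subseteq> \<Lambda>" using int mem_interior by blast
  obtain B where B: "\<And>x. x \<in> \<Lambda> \<Longrightarrow> norm x \<le> B" using compact_imp_bounded[OF comp] unfolding bounded_iff by blast
  define R where "R = nat \<lceil>B\<rceil>"
  have BR: "B \<le> real R" unfolding R_def by (rule of_nat_ceiling)
  have R: "\<bar>fst x\<bar> \<le> real R" "\<bar>snd x\<bar> \<le> real R" if "x \<in> \<Lambda>" for x
    using norm_fst_le[of "fst x" "snd x"] norm_snd_le[of "snd x" "fst x"] B[OF that] BR by auto
  define \<kappa> where "\<kappa> = max 1 (real R / (r / 2))"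
  have "admissible \<kappa> {k. (of_int (fst k), of_int (snd k)) \<in> dilate N \<Lambda>}" for N
  proof -
    let ?J = "{k :: int \<times> int. (of_int (fst k) :: real, of_int (snd k) :: real) \<in> dilate N \<Lambda>}"
    \<comment> \<open>Half the radius, so that the corners of the square stay inside the
      ball.\<close>
    define m where "m = nat \<lfloor>r / 2 * real N\<rfloor>"
    have m: "real m \<le> r / 2 * real N" "r / 2 * real N \<le> real m + 1"     proof -
      have "0 \<le> r / 2 * real N" using r by simp
      then show "real m \<le> r / 2 * real N" "r / 2 * real N \<le> real m + 1" unfolding m_def by linarith+
    qed
    have neg: "- k \<in> ?J" if kJ: "k \<in> ?J" for k
    proof -
      obtain x where x: "x \<in> \<Lambda>" "(real_of_int (fst k), real_of_int (snd k)) = real N *\<^sub>R x" using kJ unfolding dilate_def by blast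
      have "- x \<in> uminus ` \<Lambda>" using x(1) by (rule imageI)
      then have "- x \<in> \<Lambda>" using sym by simp
      moreover have "(real_of_int (fst (- k)), real_of_int (snd (- k))) = real N *\<^sub>R (- x)" using x(2) by (simp add: prod_eq_iff)
      ultimately show ?thesis unfolding dilate_def by blast
    qed
    have "uminus ` ?J = ?J"
    proof
      show "uminus ` ?J \<subseteq> ?J" using neg by blast
      show "?J \<subseteq> uminus ` ?J"
      proof
        fix k assume "k \<in> ?J"
        from neg[OF this] show "k \<in> uminus ` ?J" by (intro image_eqI[of _ _ "- k"]) auto
      qed
    qed
    moreover have "lattice_box m \<subseteq> ?J"
    proof
      fix k assume k: "k \<in> lattice_box m"
      have k1: "\<bar>real_of_int (fst k)\<bar> \<le> r / 2 * real N" "\<bar>real_of_int (snd k)\<bar> \<le> r / 2 * real N"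
        using k m unfolding lattice_box_def by auto
      show "k \<in> ?J"
      proof (cases "N = 0")
        \<comment> \<open>The dilate by 0 is the origin alone, and the inner box is a single point
          as well.\<close>
        case True
        then have "fst k = 0" "snd k = 0" using k1 by auto
        moreover have "0 \<in> \<Lambda>" using int interior_subset by blast
        ultimately show ?thesis unfolding dilate_def using True by (auto simp: zero_prod_def)
      next
        case False
        define x where "x = (real_of_int (fst k) / real N, real_of_int (snd k) / real N)"
        have "\<bar>fst x\<bar> \<le> r / 2" "\<bar>snd x\<bar> \<le> r / 2" unfolding x_def using k1 False by (simp_all add: divide_le_eq)
        then have "\<bar>fst x\<bar>\<^sup>2 \<le> (r / 2)\<^sup>2" "\<bar>snd x\<bar>\<^sup>2 \<le> (r / 2)\<^sup>2"
          using power_mono[OF _ abs_ge_zero, of "fst x" "r / 2" 2] power_mono[OF _ abs_ge_zero, of "snd x" "r / 2" 2] by blast+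
        then have "(fst x)\<^sup>2 \<le> (r / 2)\<^sup>2" "(snd x)\<^sup>2 \<le> (r / 2)\<^sup>2" unfolding power2_abs .
        then have "(fst x)\<^sup>2 + (snd x)\<^sup>2 \<le> 2 * (r / 2)\<^sup>2" by linarith
        also have "\<dots> < r\<^sup>2" using r by (simp add: power_divide)
        finally have "norm x < r" using r by (subst norm_prod_def, intro real_less_lsqrt) auto
        then have "x \<in> \<Lambda>" using r by auto
        moreover have "(real_of_int (fst k), real_of_int (snd k)) = real N *\<^sub>R x" unfolding x_def using False by simp
        ultimately show ?thesis unfolding dilate_def by blast
      qed
    qed
    moreover have "?J \<subseteq> lattice_box (R * N)"
    proof
      fix k assume "k \<in> ?J"
      then obtain x where x: "x \<in> \<Lambda>" "(real_of_int (fst k), real_of_int (snd k)) = real N *\<^sub>R x" unfolding dilate_def by blast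
      have "\<bar>real_of_int (fst k)\<bar> \<le> real (R * N)" "\<bar>real_of_int (snd k)\<bar> \<le> real (R * N)"
      proof -
        have "real_of_int (fst k) = real N * fst x" "real_of_int (snd k) = real N * snd x" using x(2) by (auto simp: prod_eq_iff)
        then show "\<bar>real_of_int (fst k)\<bar> \<le> real (R * N)" "\<bar>real_of_int (snd k)\<bar> \<le> real (R * N)"
          using mult_left_mono[OF R(1)[OF x(1)], of "real N"] mult_left_mono[OF R(2)[OF x(1)], of "real N"]
          by (simp_all add: abs_mult mult.commute)
      qed
      then have "\<bar>fst k\<bar> \<le> int (R * N)" "\<bar>snd k\<bar> \<le> int (R * N)" by linarith+
      then show "k \<in> lattice_box (R * N)" unfolding lattice_box_def by (cases k) auto
    qed
    moreover have "real (R * N) \<le> \<kappa> * (real m + 1)"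
    proof -
      have "real (R * N) = real R / (r / 2) * (r / 2 * real N)" using r by simp
      also have "\<dots> \<le> \<kappa> * (real m + 1)" unfolding \<kappa>_def using m r by (intro mult_mono) auto
      finally show ?thesis .
    qed
    ultimately show ?thesis unfolding admissible_def by blast
  qed
  moreover have "\<kappa> \<ge> 1" unfolding \<kappa>_def by simp
  ultimately show ?thesis by blast
qed

section \<open>Product weights dominating the Sobolev weight\<close>

lemma decay_sum_le:
  assumes "0 < \<beta>" "\<beta> < 1"
  shows "(\<Sum>k=1..<Suc L. (1 + real k) powr (- \<beta>)) \<le> (1 + real L) powr (1 - \<beta>) / (1 - \<beta>)"
proof (induction L)
  case 0
  then show ?case using assms by simp
next
  case (Suc L)
  have "\<exists>z. 1 + real L < z \<and> z < 1 + real (Suc L) \<and> (1 + real (Suc L)) powr (1 - \<beta>) - (1 + real L) powr (1 - \<beta>) = (1 + real (Suc L) - (1 + real L)) * ((1 - \<beta>) * z powr (- \<beta>))"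
  proof (rule MVT2)
    fix y assume "1 + real L \<le> y"
    then have "y > 0" by linarith
    then have "((\<lambda>y. y powr (1 - \<beta>)) has_real_derivative (1 - \<beta>) * y powr (1 - \<beta> - 1)) (at y)" by (rule has_real_derivative_powr)
    then show "((\<lambda>y. y powr (1 - \<beta>)) has_real_derivative (1 - \<beta>) * y powr (- \<beta>)) (at y)" by simp
  qed simp
  then obtain z where z: "1 + real L < z" "z < 1 + real (Suc L)" "(1 + real (Suc L)) powr (1 - \<beta>) - (1 + real L) powr (1 - \<beta>) = (1 - \<beta>) * z powr (- \<beta>)" by auto
  have "(1 + real (Suc L)) powr (- \<beta>) \<le> z powr (- \<beta>)" using z assms by (intro powr_mono2') auto
  also have "\<dots> = ((1 + real (Suc L)) powr (1 - \<beta>) - (1 + real L) powr (1 - \<beta>)) / (1 - \<beta>)" unfolding z(3) using assms by simp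
  finally show ?case using Suc by (simp add: diff_divide_distrib)
qed

definition decay :: "real \<Rightarrow> int \<Rightarrow> real" where
  "decay \<beta> l = (1 + \<bar>real_of_int l\<bar>) powr (- \<beta>)"

text \<open>Again a split at L of order 1 / \<sigma>: low frequencies add up to the order L^(1 -
  \<beta>), Abel summation bounds the rest by L^(- \<beta>) / \<sigma>, and both are of order
  \<sigma>^(\<beta> - 1).\<close>

lemma decay_kernel_bound:
  assumes \<beta>: "0 < \<beta>" "\<beta> < 1" and s: "sin (t / 2) \<noteq> 0"
  shows "\<bar>\<Sum>l\<in>{- int m..int m}. cos (of_int l * t) * decay \<beta> l\<bar> \<le> (3 + 6 / (1 - \<beta>)) * sinpow (1 - \<beta>) t"
proof -
  define \<sigma> where "\<sigma> = \<bar>sin (t / 2)\<bar>"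
  have \<sigma>: "0 < \<sigma>" "\<sigma> \<le> 1" using s unfolding \<sigma>_def by auto
  define L where "L = nat \<lceil>1 / \<sigma>\<rceil>"
  have L1: "1 / \<sigma> \<le> real L" unfolding L_def by (simp add: of_nat_ceiling)
  have L2: "1 + real L \<le> 3 / \<sigma>"
  proof -
    have "real L \<le> 1 / \<sigma> + 1" unfolding L_def using \<sigma> by (simp add: of_nat_nat)
    then have "1 + real L \<le> 1 / \<sigma> + 2" by simp
    also have "\<dots> \<le> 3 / \<sigma>" using \<sigma> by (simp add: field_simps)
    finally show ?thesis .
  qed
  define D where "D = (\<lambda>k::nat. decay \<beta> (int k))"
  have D: "D k = (1 + real k) powr (- \<beta>)" for k unfolding D_def decay_def by simp
  have Dd: "D (Suc k) \<le> D k" for k unfolding D using \<beta> by (intro powr_mono2') auto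
  have S: "\<sigma> powr (\<beta> - 1) = sinpow (1 - \<beta>) t" unfolding sinpow_def \<sigma>_def by simp
  have "(\<Sum>l\<in>{- int m..int m}. cos (of_int l * t + 0) * decay \<beta> l) = cos 0 * (decay \<beta> 0 + 2 * (\<Sum>k=1..<Suc m. decay \<beta> (int k) * cos (real k * t)))"
    by (rule cos_interval_sum) (simp add: decay_def)
  then have "\<bar>\<Sum>l\<in>{- int m..int m}. cos (of_int l * t) * decay \<beta> l\<bar> = \<bar>1 + 2 * (\<Sum>k=1..<Suc m. D k * cos (real k * t))\<bar>"
    unfolding D_def by (simp add: decay_def)
  also have "\<dots> \<le> 1 + 2 * ((\<Sum>k=1..<Suc L. D k) + D (Suc L) * (1 / \<sigma>))"
  proof -
    have "0 \<le> D k" for k unfolding D by simp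
    moreover have "\<bar>S\<bar> \<le> T \<Longrightarrow> \<bar>1 + 2 * S\<bar> \<le> 1 + 2 * T" for S T :: real by linarith
    ultimately show ?thesis using cos_sum_split_bound[of t D m L, OF s Dd] unfolding \<sigma>_def[symmetric] by blast
  qed
  also have "(\<Sum>k=1..<Suc L. D k) \<le> 3 / (1 - \<beta>) * \<sigma> powr (\<beta> - 1)"
  proof -
    have "(\<Sum>k=1..<Suc L. D k) \<le> (1 + real L) powr (1 - \<beta>) / (1 - \<beta>)" unfolding D by (rule decay_sum_le[OF \<beta>])
    also have "\<dots> \<le> (3 / \<sigma>) powr (1 - \<beta>) / (1 - \<beta>)" using \<beta> L2 by (intro divide_right_mono powr_mono2) auto
    also have "(3 / \<sigma>) powr (1 - \<beta>) = 3 powr (1 - \<beta>) * \<sigma> powr (\<beta> - 1)"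
    proof -
      have "\<sigma> powr (\<beta> - 1) = inverse (\<sigma> powr (1 - \<beta>))" using powr_minus[of \<sigma> "1 - \<beta>"] by simp
      moreover have "(3 / \<sigma>) powr (1 - \<beta>) = 3 powr (1 - \<beta>) / \<sigma> powr (1 - \<beta>)" using \<sigma> by (intro powr_divide)
      ultimately show ?thesis by (simp only: divide_real_def)
    qed
    also have "3 powr (1 - \<beta>) * \<sigma> powr (\<beta> - 1) / (1 - \<beta>) \<le> 3 * \<sigma> powr (\<beta> - 1) / (1 - \<beta>)"
    proof -
      have "3 powr (1 - \<beta>) \<le> (3::real) powr 1" using \<beta> by (intro powr_mono) auto
      then show ?thesis using \<beta> by (intro divide_right_mono mult_right_mono) auto
    qed
    finally show ?thesis by simp
  qed
  also have "D (Suc L) * (1 / \<sigma>) \<le> \<sigma> powr (\<beta> - 1)"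
  proof -
    have "D (Suc L) \<le> (1 / \<sigma>) powr (- \<beta>)" unfolding D using \<beta> \<sigma> L1 by (intro powr_mono2') auto
    also have "\<dots> = (\<sigma> powr (- 1)) powr (- \<beta>)" using \<sigma> by (simp add: powr_minus_divide)
    also have "\<dots> = \<sigma> powr \<beta>" unfolding powr_powr by simp
    finally have "D (Suc L) * (1 / \<sigma>) \<le> \<sigma> powr \<beta> * (1 / \<sigma>)" using \<sigma> by (intro mult_right_mono) auto
    also have "\<dots> = \<sigma> powr (\<beta> - 1)" using \<sigma> by (simp add: powr_diff)
    finally show ?thesis .
  qed
  also have "1 + 2 * (3 / (1 - \<beta>) * \<sigma> powr (\<beta> - 1) + \<sigma> powr (\<beta> - 1)) \<le> (3 + 6 / (1 - \<beta>)) * \<sigma> powr (\<beta> - 1)"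
  proof -
    have "1 powr (\<beta> - 1) \<le> \<sigma> powr (\<beta> - 1)" using \<sigma> \<beta> by (intro powr_mono2') auto
    then show ?thesis by (simp add: algebra_simps)
  qed
  finally show ?thesis unfolding S by simp
qed

text \<open>By 1 + a^2 + b^2 \<ge> (1 + a) (1 + b) / 2 the weight is dominated by a product, so that
  the two-dimensional kernel will factor.\<close>

lemma bracket2_decay: "bracket2 k powr (- \<beta>) \<le> 2 * (decay \<beta> (fst k) * decay \<beta> (snd k))" if "0 < \<beta>" "\<beta> < 1"
proof -
  define a b where "a = \<bar>real_of_int (fst k)\<bar>" and "b = \<bar>real_of_int (snd k)\<bar>"
  have ab: "a \<ge> 0" "b \<ge> 0" unfolding a_def b_def by auto

  have le: "(1 + a) * (1 + b) / 2 \<le> 1 + a\<^sup>2 + b\<^sup>2"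
  proof -
    have "0 \<le> (a - b)\<^sup>2 + (1 - a)\<^sup>2 + (1 - b)\<^sup>2" by simp
    then have "a + b + a * b \<le> 1 + a * a + b * b" by (simp add: power2_eq_square algebra_simps)
    moreover have "0 \<le> a * a" "0 \<le> b * b" by auto
    moreover have "(1 + a) * (1 + b) = 1 + a + b + a * b" by (simp add: algebra_simps)
    ultimately show ?thesis unfolding power2_eq_square by linarith
  qed
  have "bracket2 k powr (- \<beta>) = (1 + a\<^sup>2 + b\<^sup>2) powr (- \<beta>)" unfolding bracket2_def a_def b_def by simp
  also have "\<dots> \<le> ((1 + a) * (1 + b) / 2) powr (- \<beta>)" using le ab that by (intro powr_mono2') auto
  also have "\<dots> = 2 powr \<beta> * ((1 + a) powr (- \<beta>) * (1 + b) powr (- \<beta>))"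
  proof -
    have "((1 + a) * (1 + b) / 2) powr (- \<beta>) = ((1 + a) powr (- \<beta>) * (1 + b) powr (- \<beta>)) / 2 powr (- \<beta>)"
      using ab by (simp add: powr_divide powr_mult)
    then show ?thesis by (simp add: powr_minus_divide)
  qed
  also have "\<dots> \<le> 2 powr 1 * ((1 + a) powr (- \<beta>) * (1 + b) powr (- \<beta>))" using that by (intro mult_right_mono powr_mono) auto
  finally show ?thesis unfolding decay_def a_def b_def by simp
qed

section \<open>Integrability of the sine singularities\<close>

lemma sin_half_lower_bound:
  assumes "\<bar>u\<bar> \<le> pi"
  shows "\<bar>u\<bar> / pi \<le> \<bar>sin (u / 2)\<bar>"
proof -
  define v where "v = \<bar>u\<bar> / 2"
  have v: "0 \<le> v" "v \<le> pi / 2" using assms unfolding v_def by auto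
  \<comment> \<open>Concavity on [0, pi / 2] puts the sine above its chord.\<close>
  have conc: "concave_on {0..pi / 2} sin"
    by (rule f''_le0_imp_concave[where f' = cos and f'' = "\<lambda>x. - sin x"]) (auto intro!: derivative_eq_intros sin_ge_zero)
  define l where "l = v / (pi / 2)"
  have l: "0 \<le> l" "l \<le> 1" using v unfolding l_def by auto
  have "(1 - l) * sin 0 + l * sin (pi / 2) \<le> sin ((1 - l) *\<^sub>R 0 + l *\<^sub>R (pi / 2))"
    by (rule concave_onD[OF conc]) (use l in auto)
  then have "l \<le> sin v" unfolding l_def by simp
  moreover have "\<bar>sin (u / 2)\<bar> = sin v"
  proof (cases "u \<ge> 0")
    case True
    then show ?thesis unfolding v_def using sin_ge_zero[of "u / 2"] assms by (auto simp: abs_if)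
  next
    case False
    then have "sin (- u / 2) \<ge> 0" using assms by (intro sin_ge_zero) auto
    then show ?thesis unfolding v_def using False by (auto simp: abs_if)
  qed
  ultimately show ?thesis unfolding l_def v_def by (simp add: field_simps)
qed

lemma sinpow_nonneg: "sinpow c t \<ge> 0"
  unfolding sinpow_def by simp

lemma measurable_sinpow [measurable]: "sinpow c \<in> borel_measurable borel"
proof -
  have "(\<lambda>t::real. sin (t / 2)) \<in> borel_measurable borel" by (intro borel_measurable_continuous_onI continuous_intros) simp
  then show ?thesis unfolding sinpow_def[abs_def] by measurable
qed

text \<open>The singularity has period 2 pi, so for |u| < 2 pi it is governed by the nearest of the
  points 0, 2 pi and - 2 pi; the sum of the three translated powers covers all cases.\<close>

lemma sinpow_le:
  assumes c: "c \<ge> 0" and u: "\<bar>u\<bar> < 2 * pi"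
  shows "sinpow c u \<le> pi powr c * (\<bar>u\<bar> powr (- c) + \<bar>u - 2 * pi\<bar> powr (- c) + \<bar>u + 2 * pi\<bar> powr (- c))"
proof -
  have main: "sinpow c u \<le> pi powr c * \<bar>v\<bar> powr (- c)" if v: "\<bar>v\<bar> \<le> pi" "\<bar>sin (u / 2)\<bar> = \<bar>sin (v / 2)\<bar>" for v
  proof (cases "v = 0")
    case True
    then show ?thesis using v unfolding sinpow_def by simp
  next
    case False
    have "sinpow c u \<le> (\<bar>v\<bar> / pi) powr (- c)"
      unfolding sinpow_def v(2) using sin_half_lower_bound[OF v(1)] False c by (intro powr_mono2') auto
    also have "\<dots> = pi powr c * \<bar>v\<bar> powr (- c)" by (simp add: powr_divide powr_minus_divide)
    finally show ?thesis .
  qed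
  have nn: "0 \<le> pi powr c * \<bar>w\<bar> powr (- c)" for w by simp
  consider "\<bar>u\<bar> \<le> pi" | "u > pi" | "u < - pi" by linarith
  then show ?thesis
  proof cases
    case 1
    then show ?thesis using main[of u] nn[of "u - 2 * pi"] nn[of "u + 2 * pi"] unfolding distrib_left by linarith
  next
    case 2
    have e: "(u - 2 * pi) / 2 = u / 2 - pi" by (simp add: diff_divide_distrib)
    have "\<bar>sin (u / 2)\<bar> = \<bar>sin ((u - 2 * pi) / 2)\<bar>" unfolding e by (simp add: sin_diff)
    moreover have "\<bar>u - 2 * pi\<bar> \<le> pi" using 2 u by auto
    ultimately show ?thesis using main[of "u - 2 * pi"] nn[of u] nn[of "u + 2 * pi"] unfolding distrib_left by linarith
  next
    case 3
    have e: "(u + 2 * pi) / 2 = u / 2 + pi" by (simp add: add_divide_distrib)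
    have "\<bar>sin (u / 2)\<bar> = \<bar>sin ((u + 2 * pi) / 2)\<bar>" unfolding e by (simp add: sin_add)
    moreover have "\<bar>u + 2 * pi\<bar> \<le> pi" using 3 u by auto
    ultimately show ?thesis using main[of "u + 2 * pi"] nn[of u] nn[of "u - 2 * pi"] unfolding distrib_left by linarith
  qed
qed

lemma nn_integral_abs_powr_finite:
  assumes c: "c < 1" and R: "R \<ge> 0"
  shows "(\<integral>\<^sup>+x\<in>{-R..R}. ennreal (\<bar>x\<bar> powr (- c)) \<partial>lborel) < \<infinity>"
proof -
  have hi: "((\<lambda>x. x powr (- c)) has_integral (R powr (- c + 1) / (- c + 1))) {0..R}"
    using c R by (intro has_integral_powr_from_0) auto
  have "(\<integral>\<^sup>+x. ennreal (indicator {0..R} x * x powr (- c)) \<partial>lborel) = ennreal (R powr (- c + 1) / (- c + 1))"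
    using hi by (intro nn_integral_has_integral_lebesgue) auto
  also have "(\<integral>\<^sup>+x. ennreal (indicator {0..R} x * x powr (- c)) \<partial>lborel) = (\<integral>\<^sup>+x\<in>{0..R}. ennreal (\<bar>x\<bar> powr (- c)) \<partial>lborel)"
    by (intro nn_integral_cong) (auto simp: indicator_def)
  finally have pos: "(\<integral>\<^sup>+x\<in>{0..R}. ennreal (\<bar>x\<bar> powr (- c)) \<partial>lborel) < \<infinity>" by simp
  have "(\<integral>\<^sup>+x\<in>{-R..0}. ennreal (\<bar>x\<bar> powr (- c)) \<partial>lborel) = (\<integral>\<^sup>+x\<in>{0..R}. ennreal (\<bar>x\<bar> powr (- c)) \<partial>lborel)"
    by (subst nn_integral_real_affine[of _ "-1" 0]) (auto simp: indicator_def intro!: nn_integral_cong)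
  then have neg: "(\<integral>\<^sup>+x\<in>{-R..0}. ennreal (\<bar>x\<bar> powr (- c)) \<partial>lborel) < \<infinity>" using pos by simp
  have "(\<integral>\<^sup>+x\<in>{-R..R}. ennreal (\<bar>x\<bar> powr (- c)) \<partial>lborel) \<le> (\<integral>\<^sup>+x. ennreal (\<bar>x\<bar> powr (- c)) * indicator {-R..0} x + ennreal (\<bar>x\<bar> powr (- c)) * indicator {0..R} x \<partial>lborel)"
    by (intro nn_integral_mono) (auto simp: indicator_def)
  also have "\<dots> = (\<integral>\<^sup>+x\<in>{-R..0}. ennreal (\<bar>x\<bar> powr (- c)) \<partial>lborel) + (\<integral>\<^sup>+x\<in>{0..R}. ennreal (\<bar>x\<bar> powr (- c)) \<partial>lborel)"
    by (rule nn_integral_add) auto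
  also have "\<dots> < \<infinity>" using pos neg by simp
  finally show ?thesis .
qed

lemma circle_sinpow_bound:
  assumes c: "0 \<le> c" "c < 1"
  shows "\<exists>K\<ge>0. \<forall>y\<in>circle_set. (\<integral>\<^sup>+x\<in>circle_set. ennreal (sinpow c (y - x)) \<partial>lborel) \<le> ennreal K"
proof -
  \<comment> \<open>Translates by at most 4 pi of a period of length 2 pi stay in the interval of
    radius 6 pi.\<close>
  define I where "I = (\<integral>\<^sup>+x\<in>{- 6 * pi..6 * pi}. ennreal (\<bar>x\<bar> powr (- c)) \<partial>lborel)"
  have I: "I < \<infinity>" unfolding I_def using nn_integral_abs_powr_finite[OF c(2), of "6 * pi"] by simp
  have shift: "(\<integral>\<^sup>+x\<in>circle_set. ennreal (\<bar>a - x\<bar> powr (- c)) \<partial>lborel) \<le> I" if "\<bar>a\<bar> \<le> 4 * pi" for a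
  proof -
    have "(\<integral>\<^sup>+x\<in>circle_set. ennreal (\<bar>a - x\<bar> powr (- c)) \<partial>lborel) = (\<integral>\<^sup>+x. ennreal (\<bar>a - (a + 1 * x)\<bar> powr (- c)) * indicator circle_set (a + 1 * x) \<partial>lborel)"
      by (subst nn_integral_real_affine[of _ 1 a]) auto
    also have "\<dots> \<le> I" unfolding I_def using that by (intro nn_integral_mono) (auto simp: indicator_def)
    finally show ?thesis .
  qed
  have "(\<integral>\<^sup>+x\<in>circle_set. ennreal (sinpow c (y - x)) \<partial>lborel) \<le> ennreal (pi powr c) * (I + I + I)" if y: "y \<in> circle_set" for y
  proof -
    have "(\<integral>\<^sup>+x\<in>circle_set. ennreal (sinpow c (y - x)) \<partial>lborel) \<le> (\<integral>\<^sup>+x. ennreal (pi powr c) *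
       (ennreal (\<bar>y - x\<bar> powr (- c)) * indicator circle_set x + ennreal (\<bar>(y - 2 * pi) - x\<bar> powr (- c)) * indicator circle_set x + ennreal (\<bar>(y + 2 * pi) - x\<bar> powr (- c)) * indicator circle_set x) \<partial>lborel)"
    proof (rule nn_integral_mono)
      fix x
      show "ennreal (sinpow c (y - x)) * indicator circle_set x \<le> ennreal (pi powr c) *
       (ennreal (\<bar>y - x\<bar> powr (- c)) * indicator circle_set x + ennreal (\<bar>(y - 2 * pi) - x\<bar> powr (- c)) * indicator circle_set x + ennreal (\<bar>(y + 2 * pi) - x\<bar> powr (- c)) * indicator circle_set x)"
      proof (cases "x \<in> circle_set")
        case True
        then have "\<bar>y - x\<bar> < 2 * pi" using y by auto
        moreover have "(y - 2 * pi) - x = (y - x) - 2 * pi" "(y + 2 * pi) - x = (y - x) + 2 * pi" by simp_all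
        ultimately show ?thesis using True ennreal_leI[OF sinpow_le[OF c(1), of "y - x"]]
          by (simp only: indicator_simps mult_1_right) (simp add: ennreal_mult)
      qed simp
    qed
    also have "\<dots> = ennreal (pi powr c) * ((\<integral>\<^sup>+x\<in>circle_set. ennreal (\<bar>y - x\<bar> powr (- c)) \<partial>lborel)
       + (\<integral>\<^sup>+x\<in>circle_set. ennreal (\<bar>(y - 2 * pi) - x\<bar> powr (- c)) \<partial>lborel) + (\<integral>\<^sup>+x\<in>circle_set. ennreal (\<bar>(y + 2 * pi) - x\<bar> powr (- c)) \<partial>lborel))"
      by (simp add: nn_integral_cmult nn_integral_add)
    also have "\<dots> \<le> ennreal (pi powr c) * (I + I + I)"
      using y by (intro mult_left_mono add_mono shift) (auto simp: abs_if)
    finally show ?thesis .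
  qed
  moreover have "ennreal (pi powr c) * (I + I + I) = ennreal (enn2real (ennreal (pi powr c) * (I + I + I)))"
    using I by (intro ennreal_enn2real[symmetric]) (simp add: ennreal_mult_less_top)
  ultimately show ?thesis by (intro exI[of _ "enn2real (ennreal (pi powr c) * (I + I + I))"]) simp
qed

lemma torus_sinpow_bound:
  assumes c: "0 \<le> c" "c < 1"
  shows "\<exists>K\<ge>0. \<forall>x\<in>space torus. (\<integral>\<^sup>+y. ennreal (sinpow c (fst x - fst y) * sinpow c (snd x - snd y)) \<partial>torus) \<le> ennreal K"
proof -
  obtain K where K: "K \<ge> 0" "\<And>y. y \<in> circle_set \<Longrightarrow> (\<integral>\<^sup>+x\<in>circle_set. ennreal (sinpow c (y - x)) \<partial>lborel) \<le> ennreal K"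
    using circle_sinpow_bound[OF c] by blast
  have "(\<integral>\<^sup>+y. ennreal (sinpow c (fst x - fst y) * sinpow c (snd x - snd y)) \<partial>torus) \<le> ennreal (K * K)" if x: "x \<in> space torus" for x
  proof -
    have "(\<integral>\<^sup>+y. ennreal (sinpow c (fst x - fst y) * sinpow c (snd x - snd y)) \<partial>torus) = (\<integral>\<^sup>+y. ennreal (sinpow c (fst x - fst y)) * ennreal (sinpow c (snd x - snd y)) \<partial>torus)"
      by (simp add: ennreal_mult sinpow_nonneg)
    also have "\<dots> = (\<integral>\<^sup>+t\<in>circle_set. ennreal (sinpow c (fst x - t)) \<partial>lborel) * (\<integral>\<^sup>+t\<in>circle_set. ennreal (sinpow c (snd x - t)) \<partial>lborel)"
      by (rule nn_integral_torus_product) auto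
    also have "\<dots> \<le> ennreal K * ennreal K" using x by (intro mult_mono K) auto
    finally show ?thesis using K by (simp add: ennreal_mult)
  qed
  then show ?thesis using K by (intro exI[of _ "K * K"]) auto
qed

text \<open>Inside the fundamental domain the half differences lie strictly between - pi and pi, so
  a sine vanishes only where two coordinates coincide; such y fill two null lines.\<close>

lemma AE_torus_off_diagonal:
  assumes x: "x \<in> space torus"
  shows "AE y in torus. sin ((fst x - fst y) / 2) \<noteq> 0 \<and> sin ((snd x - snd y) / 2) \<noteq> 0"
proof -
  have "(\<integral>\<^sup>+y. indicator {fst x} (fst y) * 1 \<partial>torus) = (\<integral>\<^sup>+t\<in>circle_set. indicator {fst x} t \<partial>lborel) * (\<integral>\<^sup>+t\<in>circle_set. 1 \<partial>lborel)"
    by (rule nn_integral_torus_product) auto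
  also have "(\<integral>\<^sup>+t\<in>circle_set. indicator {fst x} t \<partial>lborel) = 0"
  proof -
    have "(\<integral>\<^sup>+t\<in>circle_set. indicator {fst x} t \<partial>lborel) \<le> (\<integral>\<^sup>+t. indicator {fst x} t \<partial>lborel)" by (intro nn_integral_mono) (auto simp: indicator_def)
    also have "\<dots> = 0" by simp
    finally show ?thesis by simp
  qed
  finally have "(\<integral>\<^sup>+y. indicator {fst x} (fst y) \<partial>torus) = 0" by simp
  then have 1: "AE y in torus. indicator {fst x} (fst y) = (0::ennreal)" by (subst (asm) nn_integral_0_iff_AE) auto
  have "(\<integral>\<^sup>+y. 1 * indicator {snd x} (snd y) \<partial>torus) = (\<integral>\<^sup>+t\<in>circle_set. 1 \<partial>lborel) * (\<integral>\<^sup>+t\<in>circle_set. indicator {snd x} t \<partial>lborel)"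
    by (rule nn_integral_torus_product) auto
  also have "(\<integral>\<^sup>+t\<in>circle_set. indicator {snd x} t \<partial>lborel) = 0"
  proof -
    have "(\<integral>\<^sup>+t\<in>circle_set. indicator {snd x} t \<partial>lborel) \<le> (\<integral>\<^sup>+t. indicator {snd x} t \<partial>lborel)" by (intro nn_integral_mono) (auto simp: indicator_def)
    also have "\<dots> = 0" by simp
    finally show ?thesis by simp
  qed
  finally have "(\<integral>\<^sup>+y. indicator {snd x} (snd y) \<partial>torus) = 0" by simp
  then have 2: "AE y in torus. indicator {snd x} (snd y) = (0::ennreal)" by (subst (asm) nn_integral_0_iff_AE) auto
  have nz: "sin ((a - b) / 2) \<noteq> 0" if "a \<in> circle_set" "b \<in> circle_set" "a \<noteq> b" for a b :: real
  proof
    assume s: "sin ((a - b) / 2) = 0"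
    have "0 \<le> a" "a < 2 * pi" "0 \<le> b" "b < 2 * pi" using that by simp_all
    then have "- pi < (a - b) / 2" "(a - b) / 2 < pi" by (simp_all add: field_simps)
    then have "(a - b) / 2 = 0" using s by (rule sin_eq_0_pi)
    then show False using \<open>a \<noteq> b\<close> by simp
  qed
  show ?thesis using 1 2 AE_space
  proof eventually_elim
    case (elim y)
    have "fst y \<noteq> fst x" "snd y \<noteq> snd x" using elim(1,2) by (simp_all add: indicator_eq_0_iff)
    moreover have "fst x \<in> circle_set" "snd x \<in> circle_set" "fst y \<in> circle_set" "snd y \<in> circle_set"
      using x elim(3) unfolding space_torus mem_Times_iff by blast+
    ultimately show ?case using nz[of "fst x" "fst y"] nz[of "snd x" "snd y"] by metis
  qed
qed

text \<open>The total exponent c is shared: b^2 / (4 pi) is spent on the covariance and the rest is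
  left to a further kernel. The scalar estimate leaves nothing, the Sobolev estimate leaves 1 -
  \<beta>.\<close>

lemma exp_cov_kernel_bound:
  assumes c: "0 \<le> c" "c < 1" and \<kappa>: "\<kappa> \<ge> 1" and \<theta>: "b\<^sup>2 / (4 * pi) \<le> c"
  shows "\<exists>C\<ge>0. \<forall>J. admissible \<kappa> J \<longrightarrow> (\<forall>x\<in>space torus. (\<integral>\<^sup>+y. ennreal (exp (b\<^sup>2 * cov J x y) *
      (sinpow (c - b\<^sup>2 / (4 * pi)) (fst x - fst y) * sinpow (c - b\<^sup>2 / (4 * pi)) (snd x - snd y))) \<partial>torus) \<le> ennreal C)"
proof -
  define \<theta>' where "\<theta>' = b\<^sup>2 / (4 * pi)"
  obtain K where K: "K \<ge> 0" "\<And>x. x \<in> space torus \<Longrightarrow> (\<integral>\<^sup>+y. ennreal (sinpow c (fst x - fst y) * sinpow c (snd x - snd y)) \<partial>torus) \<le> ennreal K"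
    using torus_sinpow_bound[OF c] by blast
  define E where "E = exp (b\<^sup>2 * cov_const \<kappa>)"
  have spl: "sinpow \<theta>' t * sinpow (c - \<theta>') t = sinpow c t" for t
    unfolding sinpow_def by (simp add: powr_add[symmetric])
  have "(\<integral>\<^sup>+y. ennreal (exp (b\<^sup>2 * cov J x y) * (sinpow (c - \<theta>') (fst x - fst y) * sinpow (c - \<theta>') (snd x - snd y))) \<partial>torus) \<le> ennreal (E * K)"
    if adm: "admissible \<kappa> J" and x: "x \<in> space torus" for J x
  proof -
    have "(\<integral>\<^sup>+y. ennreal (exp (b\<^sup>2 * cov J x y) * (sinpow (c - \<theta>') (fst x - fst y) * sinpow (c - \<theta>') (snd x - snd y))) \<partial>torus)
       \<le> (\<integral>\<^sup>+y. ennreal E * ennreal (sinpow c (fst x - fst y) * sinpow c (snd x - snd y)) \<partial>torus)"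
    proof (rule nn_integral_mono_AE)
      show "AE y in torus. ennreal (exp (b\<^sup>2 * cov J x y) * (sinpow (c - \<theta>') (fst x - fst y) * sinpow (c - \<theta>') (snd x - snd y)))
        \<le> ennreal E * ennreal (sinpow c (fst x - fst y) * sinpow c (snd x - snd y))"
        using AE_torus_off_diagonal[OF x]
      proof eventually_elim
        case (elim y)
        have "exp (b\<^sup>2 * cov J x y) * (sinpow (c - \<theta>') (fst x - fst y) * sinpow (c - \<theta>') (snd x - snd y))
          \<le> (E * (sinpow \<theta>' (fst x - fst y) * sinpow \<theta>' (snd x - snd y))) * (sinpow (c - \<theta>') (fst x - fst y) * sinpow (c - \<theta>') (snd x - snd y))"
          unfolding E_def
          by (rule mult_right_mono[OF exp_cov_le[OF adm \<kappa> conjunct1[OF elim] conjunct2[OF elim] \<theta>'_def]])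
             (intro mult_nonneg_nonneg sinpow_nonneg)
        also have "\<dots> = E * (sinpow c (fst x - fst y) * sinpow c (snd x - snd y))" unfolding spl[symmetric] by (simp only: mult_ac)
        finally show ?case by (simp add: E_def ennreal_mult'[symmetric] ennreal_leI)
      qed
    qed
    also have "\<dots> = ennreal E * (\<integral>\<^sup>+y. ennreal (sinpow c (fst x - fst y) * sinpow c (snd x - snd y)) \<partial>torus)"
      by (rule nn_integral_cmult) measurable
    also have "\<dots> \<le> ennreal E * ennreal K" by (intro mult_left_mono K x) simp
    finally show ?thesis using K by (simp add: E_def ennreal_mult)
  qed
  then show ?thesis unfolding \<theta>'_def[symmetric] using K by (intro exI[of _ "E * K"]) (auto simp: E_def)
qed

section \<open>Second moment bounds uniform in the cutoff\<close>

lemma integral_le_nn_integral: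
  fixes f :: "'a \<Rightarrow> real"
  assumes "f \<in> borel_measurable N" "(\<integral>\<^sup>+x. ennreal \<bar>f x\<bar> \<partial>N) \<le> ennreal C" "C \<ge> 0"
  shows "(\<integral>x. f x \<partial>N) \<le> C"
proof -
  have "integrable N f" unfolding integrable_iff_bounded using assms by (auto simp: less_top[symmetric] top_unique)
  then have "ennreal (\<integral>x. \<bar>f x\<bar> \<partial>N) \<le> ennreal C" using assms by (subst nn_integral_eq_integral[symmetric]) auto
  then have "(\<integral>x. \<bar>f x\<bar> \<partial>N) \<le> C" using assms by simp
  moreover have "(\<integral>x. f x \<partial>N) \<le> (\<integral>x. \<bar>f x\<bar> \<partial>N)" using \<open>integrable N f\<close> by (intro integral_mono) auto
  ultimately show ?thesis by linarith
qed

text \<open>Schur's test: |g(x) g(y)| \<le> (g(x)^2 + g(y)^2) / 2, the kernel is symmetric and its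
  row integrals are bounded by C, so the form is at most C times the squared L^2 norm of g.\<close>

lemma scalar_uniform_bound:
  assumes g: "g \<in> L2_torus" and b: "b\<^sup>2 < 4 * pi" and \<kappa>: "\<kappa> \<ge> 1"
  shows "\<exists>C\<ge>0. \<forall>J. admissible \<kappa> J \<longrightarrow> (\<integral>p. g (fst p) * g (snd p) * exp (b\<^sup>2 * cov J (fst p) (snd p)) \<partial>torus2) \<le> C"
proof -
  define c where "c = b\<^sup>2 / (4 * pi)"
  have c: "0 \<le> c" "c < 1" unfolding c_def using b by auto
  obtain C where C: "C \<ge> 0" "\<And>J x. admissible \<kappa> J \<Longrightarrow> x \<in> space torus \<Longrightarrow> (\<integral>\<^sup>+y. ennreal (exp (b\<^sup>2 * cov J x y) * (sinpow 0 (fst x - fst y) * sinpow 0 (snd x - snd y))) \<partial>torus) \<le> ennreal C"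
    using exp_cov_kernel_bound[OF c \<kappa>, of b] unfolding c_def[symmetric] diff_self by blast
  have gm [measurable]: "g \<in> borel_measurable torus" and g2: "integrable torus (\<lambda>x. (g x)\<^sup>2)" using g unfolding L2_torus_def by auto
  define G where "G = (\<integral>x. (g x)\<^sup>2 \<partial>torus)"
  have G: "(\<integral>\<^sup>+x. ennreal ((g x)\<^sup>2) \<partial>torus) = ennreal G" "G \<ge> 0" unfolding G_def using g2 by (auto intro: nn_integral_eq_integral)
  have "(\<integral>p. g (fst p) * g (snd p) * exp (b\<^sup>2 * cov J (fst p) (snd p)) \<partial>torus2) \<le> G * C" if adm: "admissible \<kappa> J" for J
  proof (rule integral_le_nn_integral)
    \<comment> \<open>With no exponent left the further factors are \<open>sinpow 0\<close>, which
      is 1 off the diagonal lines but 0 where the sine vanishes, because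
      \<open>0 powr 0 = 0\<close>; hence the comparison holds almost everywhere.\<close>
    have K: "(\<integral>\<^sup>+y. ennreal (exp (b\<^sup>2 * cov J x y)) \<partial>torus) \<le> ennreal C" if x: "x \<in> space torus" for x
    proof -
      have "(\<integral>\<^sup>+y. ennreal (exp (b\<^sup>2 * cov J x y)) \<partial>torus) \<le> (\<integral>\<^sup>+y. ennreal (exp (b\<^sup>2 * cov J x y) * (sinpow 0 (fst x - fst y) * sinpow 0 (snd x - snd y))) \<partial>torus)"
      proof (rule nn_integral_mono_AE)
        show "AE y in torus. ennreal (exp (b\<^sup>2 * cov J x y)) \<le> ennreal (exp (b\<^sup>2 * cov J x y) * (sinpow 0 (fst x - fst y) * sinpow 0 (snd x - snd y)))"
          using AE_torus_off_diagonal[OF x]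
        proof eventually_elim
          case (elim y)
          have "sinpow 0 (fst x - fst y) = 1" "sinpow 0 (snd x - snd y) = 1"
            unfolding sinpow_def using elim by (simp_all only: powr_zero_eq_one minus_zero abs_eq_0 simp_thms if_False)
          then show ?case by (simp only: mult_1_right order_refl)
        qed
      qed
      also have "\<dots> \<le> ennreal C" by (rule C(2)[OF adm x])
      finally show ?thesis .
    qed
    let ?e = "\<lambda>p. ennreal (exp (b\<^sup>2 * cov J (fst p) (snd p)))"
    have gg: "\<bar>u * v\<bar> \<le> u\<^sup>2 / 2 + v\<^sup>2 / 2" for u v :: real
      using sum_squares_bound[of "\<bar>u\<bar>" "\<bar>v\<bar>"] by (simp add: abs_mult)
    have "(\<integral>\<^sup>+p. ennreal \<bar>g (fst p) * g (snd p) * exp (b\<^sup>2 * cov J (fst p) (snd p))\<bar> \<partial>torus2)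
      \<le> (\<integral>\<^sup>+p. ennreal ((g (fst p))\<^sup>2 / 2) * ?e p + ennreal ((g (snd p))\<^sup>2 / 2) * ?e p \<partial>torus2)"
    proof (rule nn_integral_mono)
      fix p :: "(real \<times> real) \<times> real \<times> real"
      have le: "\<bar>g (fst p) * g (snd p) * exp (b\<^sup>2 * cov J (fst p) (snd p))\<bar> \<le> ((g (fst p))\<^sup>2 / 2 + (g (snd p))\<^sup>2 / 2) * exp (b\<^sup>2 * cov J (fst p) (snd p))"
        unfolding abs_mult[of "_ * _"] using gg by (simp add: mult_right_mono)
      show "ennreal \<bar>g (fst p) * g (snd p) * exp (b\<^sup>2 * cov J (fst p) (snd p))\<bar> \<le> ennreal ((g (fst p))\<^sup>2 / 2) * ?e p + ennreal ((g (snd p))\<^sup>2 / 2) * ?e p"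
      proof -
        have "ennreal ((A + B) * E) = ennreal A * ennreal E + ennreal B * ennreal E" if "A \<ge> 0" "B \<ge> 0" "E \<ge> 0" for A B E :: real
          using that by (simp add: ennreal_mult distrib_right)
        from this[of "(g (fst p))\<^sup>2 / 2" "(g (snd p))\<^sup>2 / 2" "exp (b\<^sup>2 * cov J (fst p) (snd p))"]
        show ?thesis using ennreal_leI[OF le] by simp
      qed
    qed
    also have "\<dots> = (\<integral>\<^sup>+p. ennreal ((g (fst p))\<^sup>2 / 2) * ?e p \<partial>torus2) + (\<integral>\<^sup>+p. ennreal ((g (snd p))\<^sup>2 / 2) * ?e p \<partial>torus2)"
      by (rule nn_integral_add) measurable
    also have "(\<integral>\<^sup>+p. ennreal ((g (fst p))\<^sup>2 / 2) * ?e p \<partial>torus2) = (\<integral>\<^sup>+x. \<integral>\<^sup>+y. ennreal ((g x)\<^sup>2 / 2) * ?e (x, y) \<partial>torus \<partial>torus)"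
      by (subst torus.nn_integral_fst[symmetric]) auto
    also have "(\<integral>\<^sup>+p. ennreal ((g (snd p))\<^sup>2 / 2) * ?e p \<partial>torus2) = (\<integral>\<^sup>+y. \<integral>\<^sup>+x. ennreal ((g y)\<^sup>2 / 2) * ?e (x, y) \<partial>torus \<partial>torus)"
      by (subst torus_pair.nn_integral_snd[symmetric]) auto
    also have "(\<integral>\<^sup>+y. \<integral>\<^sup>+x. ennreal ((g y)\<^sup>2 / 2) * ?e (x, y) \<partial>torus \<partial>torus) = (\<integral>\<^sup>+x. \<integral>\<^sup>+y. ennreal ((g x)\<^sup>2 / 2) * ?e (x, y) \<partial>torus \<partial>torus)"
      by (simp add: cov_commute)
    also have "(\<integral>\<^sup>+x. \<integral>\<^sup>+y. ennreal ((g x)\<^sup>2 / 2) * ?e (x, y) \<partial>torus \<partial>torus) \<le> (\<integral>\<^sup>+x. ennreal ((g x)\<^sup>2 / 2) * ennreal C \<partial>torus)"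
    proof (rule nn_integral_mono)
      fix x assume x: "x \<in> space torus"
      have [measurable]: "(\<lambda>y. cov J x y) \<in> borel_measurable torus" unfolding cov_def by measurable
      have "(\<integral>\<^sup>+y. ennreal ((g x)\<^sup>2 / 2) * ?e (x, y) \<partial>torus) = ennreal ((g x)\<^sup>2 / 2) * (\<integral>\<^sup>+y. ennreal (exp (b\<^sup>2 * cov J x y)) \<partial>torus)"
        by (simp add: nn_integral_cmult)
      also have "\<dots> \<le> ennreal ((g x)\<^sup>2 / 2) * ennreal C" by (intro mult_left_mono K x) simp
      finally show "(\<integral>\<^sup>+y. ennreal ((g x)\<^sup>2 / 2) * ?e (x, y) \<partial>torus) \<le> ennreal ((g x)\<^sup>2 / 2) * ennreal C" .
    qed
    also have "\<dots> = ennreal (G / 2 * C)"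
    proof -
      have "(\<integral>\<^sup>+x. ennreal ((g x)\<^sup>2 / 2) * ennreal C \<partial>torus) = (\<integral>\<^sup>+x. ennreal ((g x)\<^sup>2) * ennreal (C / 2) \<partial>torus)"
        using C(1) by (intro nn_integral_cong) (simp add: ennreal_mult'[symmetric])
      also have "\<dots> = ennreal G * ennreal (C / 2)" by (subst nn_integral_multc) (auto simp: G)
      finally show ?thesis using G C(1) by (simp add: ennreal_mult'[symmetric])
    qed
    finally have "(\<integral>\<^sup>+p. ennreal \<bar>g (fst p) * g (snd p) * exp (b\<^sup>2 * cov J (fst p) (snd p))\<bar> \<partial>torus2) \<le> ennreal (G / 2 * C) + ennreal (G / 2 * C)"
      by (simp add: add_mono)
    also have "\<dots> = ennreal (G * C)" using G(2) C(1) by (subst ennreal_plus[symmetric]) auto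
    finally show "(\<integral>\<^sup>+p. ennreal \<bar>g (fst p) * g (snd p) * exp (b\<^sup>2 * cov J (fst p) (snd p))\<bar> \<partial>torus2) \<le> ennreal (G * C)" .
  qed (use G C in auto)
  then show ?thesis using G C by (intro exI[of _ "G * C"]) auto
qed

text \<open>Weights and box both factor, and summation over symmetric intervals removes the mixed
  sine terms, so the kernel is a product of two one-dimensional ones.\<close>

lemma decay_kernel_product:
  "(\<Sum>l\<in>lattice_box m. (decay \<beta> (fst l) * decay \<beta> (snd l)) * (basis_e l x * basis_e l y))
    = (\<Sum>l\<in>{- int m..int m}. cos (of_int l * (fst x - fst y)) * decay \<beta> l) * (\<Sum>l\<in>{- int m..int m}. cos (of_int l * (snd x - snd y)) * decay \<beta> l) / (4 * pi\<^sup>2)"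
proof -
  define K where "K = (\<lambda>t. \<Sum>l\<in>{- int m..int m}. cos (of_int l * t) * decay \<beta> l)"
  have ev: "decay \<beta> (- l) = decay \<beta> l" for l unfolding decay_def by simp
  have row: "(\<Sum>l\<in>{- int m..int m}. cos (of_int l * t + c) * decay \<beta> l) = cos c * K t" for t c
    using cos_interval_sum[of "decay \<beta>", OF ev] cos_interval_sum[where b = 0 and D = "decay \<beta>", OF ev] unfolding K_def by simp
  have "(\<Sum>l\<in>lattice_box m. (decay \<beta> (fst l) * decay \<beta> (snd l)) * (basis_e l x * basis_e l y)) = (\<Sum>l\<in>lattice_box m. (decay \<beta> (fst l) * decay \<beta> (snd l)) * cos (dot l (x - y))) / (4 * pi\<^sup>2)"
    by (rule weighted_basis_sum[OF uminus_lattice_box]) (simp add: ev)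
  also have "(\<Sum>l\<in>lattice_box m. (decay \<beta> (fst l) * decay \<beta> (snd l)) * cos (dot l (x - y)))
     = (\<Sum>j\<in>{- int m..int m}. \<Sum>i\<in>{- int m..int m}. decay \<beta> j * (cos (of_int i * (fst x - fst y) + of_int j * (snd x - snd y)) * decay \<beta> i))"
    unfolding lattice_box_def by (subst sum.swap, subst sum.cartesian_product) (auto intro!: sum.cong simp: dot_def mult_ac)
  also have "\<dots> = K (fst x - fst y) * K (snd x - snd y)"
  proof -
    have "(\<Sum>j\<in>{- int m..int m}. \<Sum>i\<in>{- int m..int m}. decay \<beta> j * (cos (of_int i * (fst x - fst y) + of_int j * (snd x - snd y)) * decay \<beta> i))
       = (\<Sum>j\<in>{- int m..int m}. K (fst x - fst y) * (cos (of_int j * (snd x - snd y)) * decay \<beta> j))"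
      unfolding sum_distrib_left[symmetric] row unfolding sum_distrib_left by (intro sum.cong refl) (simp only: mult_ac)
    then show ?thesis unfolding sum_distrib_left[symmetric] K_def .
  qed
  finally show ?thesis unfolding K_def .
qed

lemma finite_subset_lattice_box: "finite S \<Longrightarrow> \<exists>m. S \<subseteq> lattice_box m"
proof (induction S rule: finite_induct)
  case (insert k S)
  then obtain m where m: "S \<subseteq> lattice_box m" by blast
  define n where "n = max m (nat (max \<bar>fst k\<bar> \<bar>snd k\<bar>))"
  have "lattice_box m \<subseteq> lattice_box n" unfolding lattice_box_def n_def by (intro Sigma_mono) auto
  moreover have "k \<in> lattice_box n" unfolding lattice_box_def n_def mem_Times_iff atLeastAtMost_iff by linarith
  ultimately show ?case using m by blast
qed simp

text \<open>The weighted sum of second moments is one integral against the kernel of the weight.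
  Replacing the weight by products of exponent \<beta> bounds this kernel by singularities of
  exponent 1 - \<beta> in each variable, which add to those of the covariance.\<close>

lemma sobolev_uniform_bound:
  assumes \<alpha>: "0 < \<alpha>" "\<alpha> \<le> 1" and b: "b\<^sup>2 < 4 * pi * \<alpha>" and \<kappa>: "\<kappa> \<ge> 1"
  shows "\<exists>C\<ge>0. \<forall>J S. admissible \<kappa> J \<longrightarrow> finite S \<longrightarrow>
    (\<Sum>l\<in>S. sob_weight (- \<alpha>) l * (\<integral>p. basis_e l (fst p) * basis_e l (snd p) * exp (b\<^sup>2 * cov J (fst p) (snd p)) \<partial>torus2)) \<le> C"
proof -
  define \<theta> where "\<theta> = b\<^sup>2 / (4 * pi)"
  have \<theta>: "0 \<le> \<theta>" "\<theta> < \<alpha>" unfolding \<theta>_def using b by (auto simp: field_simps)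
  \<comment> \<open>Strictly between \<theta> and \<alpha>: \<beta> < \<alpha> makes the new weight
    dominate, \<theta> < \<beta> keeps the total exponent \<theta> + 1 - \<beta> below 1, and
    \<beta> < 1 holds even for \<alpha> = 1.\<close>
  define \<beta> where "\<beta> = (\<theta> + \<alpha>) / 2"
  have \<beta>: "0 < \<beta>" "\<beta> < 1" "\<beta> < \<alpha>" "\<theta> < \<beta>" unfolding \<beta>_def using \<theta> \<alpha> by auto
  define c where "c = \<theta> + (1 - \<beta>)"
  have c: "0 \<le> c" "c < 1" "\<theta> \<le> c" unfolding c_def using \<beta> \<theta> by auto
  obtain C where C: "C \<ge> 0" "\<And>J x. admissible \<kappa> J \<Longrightarrow> x \<in> space torus \<Longrightarrow> (\<integral>\<^sup>+y. ennreal (exp (b\<^sup>2 * cov J x y) * (sinpow (1 - \<beta>) (fst x - fst y) * sinpow (1 - \<beta>) (snd x - snd y))) \<partial>torus) \<le> ennreal C"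
  proof -
    have eq: "c - \<theta> = 1 - \<beta>" unfolding c_def by simp
    show ?thesis using that exp_cov_kernel_bound[OF c(1,2) \<kappa>, of b] c(3) unfolding \<theta>_def[symmetric] eq by blast
  qed
  define A where "A = (3 + 6 / (1 - \<beta>))\<^sup>2 / (4 * pi\<^sup>2)"
  have A: "A \<ge> 0" unfolding A_def by simp
  have main: "(\<Sum>l\<in>S. sob_weight (- \<alpha>) l * (\<integral>p. basis_e l (fst p) * basis_e l (snd p) * exp (b\<^sup>2 * cov J (fst p) (snd p)) \<partial>torus2)) \<le> 2 * (A * C * (4 * pi\<^sup>2))"
    if adm: "admissible \<kappa> J" and S: "finite S" for J S
  proof -
    have J: "finite J" using adm by (rule admissible_finite)
    define T where "T = (\<lambda>l. \<integral>p. basis_e l (fst p) * basis_e l (snd p) * exp (b\<^sup>2 * cov J (fst p) (snd p)) \<partial>torus2)"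
    have ie: "integrable torus (basis_e l)" for l using basis_in_L2_torus by (rule L2_torus_integrable)
    \<comment> \<open>Nonnegativity lets both the weights and the index set be enlarged.\<close>
    have T0: "T l \<ge> 0" for l
    proof -
      have s: "(\<lambda>n. (b\<^sup>2) ^ n / fact n * cov_form J (basis_e l) n) sums T l" unfolding T_def by (rule cov_form_sums[OF J ie])
      show ?thesis using sums_unique[OF s] suminf_nonneg[OF sums_summable[OF s]] cov_form_nonneg[OF J ie] by simp
    qed
    have iT: "integrable torus2 (\<lambda>p. basis_e l (fst p) * basis_e l (snd p) * exp (b\<^sup>2 * cov J (fst p) (snd p)))" for l
    proof (rule integrable_cov_form[OF ie])
      fix p
      have "b\<^sup>2 * cov J (fst p) (snd p) \<le> b\<^sup>2 * cov_bound J"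
        using abs_cov_le[of J "fst p" "snd p"] by (intro mult_left_mono) auto
      then show "\<bar>exp (b\<^sup>2 * cov J (fst p) (snd p))\<bar> \<le> exp (b\<^sup>2 * cov_bound J)" by simp
    qed measurable
    obtain m where m: "S \<subseteq> lattice_box m" using finite_subset_lattice_box[OF S] by blast
    have w: "sob_weight (- \<alpha>) l \<le> 2 * (decay \<beta> (fst l) * decay \<beta> (snd l))" for l
    proof -
      have "sob_weight (- \<alpha>) l \<le> bracket2 l powr (- \<beta>)" unfolding sob_weight_def using bracket2_ge1[of l] \<beta> by (intro powr_mono) auto
      then show ?thesis using bracket2_decay[OF \<beta>(1,2), of l] by linarith
    qed
    have "(\<Sum>l\<in>S. sob_weight (- \<alpha>) l * T l) \<le> (\<Sum>l\<in>S. 2 * (decay \<beta> (fst l) * decay \<beta> (snd l)) * T l)"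
      by (intro sum_mono mult_right_mono w T0)
    also have "\<dots> \<le> (\<Sum>l\<in>lattice_box m. 2 * (decay \<beta> (fst l) * decay \<beta> (snd l)) * T l)"
      using m T0 by (intro sum_mono2) (auto simp: decay_def)
    also have "\<dots> = 2 * (\<integral>p. (\<Sum>l\<in>lattice_box m. (decay \<beta> (fst l) * decay \<beta> (snd l)) * (basis_e l (fst p) * basis_e l (snd p) * exp (b\<^sup>2 * cov J (fst p) (snd p)))) \<partial>torus2)"
    proof -
      have "(\<integral>p. (\<Sum>l\<in>lattice_box m. (decay \<beta> (fst l) * decay \<beta> (snd l)) * (basis_e l (fst p) * basis_e l (snd p) * exp (b\<^sup>2 * cov J (fst p) (snd p)))) \<partial>torus2)
        = (\<Sum>l\<in>lattice_box m. (decay \<beta> (fst l) * decay \<beta> (snd l)) * T l)"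
        unfolding T_def by (subst Bochner_Integration.integral_sum) (use iT in \<open>simp_all del: mult.assoc\<close>)
      then show ?thesis by (simp only: sum_distrib_left mult.assoc)
    qed
    also have "(\<integral>p. (\<Sum>l\<in>lattice_box m. (decay \<beta> (fst l) * decay \<beta> (snd l)) * (basis_e l (fst p) * basis_e l (snd p) * exp (b\<^sup>2 * cov J (fst p) (snd p)))) \<partial>torus2) \<le> A * C * (4 * pi\<^sup>2)"
    proof (rule integral_le_nn_integral)
      define H where "H = (\<lambda>p. \<Sum>l\<in>lattice_box m. (decay \<beta> (fst l) * decay \<beta> (snd l)) * (basis_e l (fst p) * basis_e l (snd p) * exp (b\<^sup>2 * cov J (fst p) (snd p))))"
      have [measurable]: "H \<in> borel_measurable torus2" unfolding H_def by measurable
      have Hle: "\<bar>H (x, y)\<bar> \<le> A * (exp (b\<^sup>2 * cov J x y) * (sinpow (1 - \<beta>) (fst x - fst y) * sinpow (1 - \<beta>) (snd x - snd y)))"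
        if "sin ((fst x - fst y) / 2) \<noteq> 0" "sin ((snd x - snd y) / 2) \<noteq> 0" for x y
      proof -
        define K where "K = (\<lambda>t. \<Sum>l\<in>{- int m..int m}. cos (of_int l * t) * decay \<beta> l)"
        have Kle: "\<bar>K t\<bar> \<le> (3 + 6 / (1 - \<beta>)) * sinpow (1 - \<beta>) t" if "sin (t / 2) \<noteq> 0" for t
          unfolding K_def by (rule decay_kernel_bound[OF \<beta>(1,2) that])
        have "H (x, y) = (\<Sum>l\<in>lattice_box m. (decay \<beta> (fst l) * decay \<beta> (snd l)) * (basis_e l x * basis_e l y)) * exp (b\<^sup>2 * cov J x y)"
          unfolding H_def sum_distrib_right fst_conv snd_conv by (simp only: mult.assoc)
        also have "\<dots> = K (fst x - fst y) * K (snd x - snd y) / (4 * pi\<^sup>2) * exp (b\<^sup>2 * cov J x y)" unfolding K_def by (simp only: decay_kernel_product)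
        also have "\<bar>\<dots>\<bar> = \<bar>K (fst x - fst y)\<bar> * \<bar>K (snd x - snd y)\<bar> / (4 * pi\<^sup>2) * exp (b\<^sup>2 * cov J x y)" by (simp add: abs_mult)
        also have "\<dots> \<le> ((3 + 6 / (1 - \<beta>)) * sinpow (1 - \<beta>) (fst x - fst y)) * ((3 + 6 / (1 - \<beta>)) * sinpow (1 - \<beta>) (snd x - snd y)) / (4 * pi\<^sup>2) * exp (b\<^sup>2 * cov J x y)"
        proof -
          have gen: "k1 * k2 / d * e \<le> c1 * c2 / d * e" if "k1 \<le> c1" "k2 \<le> c2" "0 \<le> k1" "0 \<le> k2" "0 \<le> e" "0 < d" for k1 k2 c1 c2 d e :: real
          proof -
            have "k1 * k2 \<le> c1 * c2" using that by (intro mult_mono) linarith+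
            then have "k1 * k2 / d \<le> c1 * c2 / d" using that by (intro divide_right_mono) auto
            then show ?thesis using that by (intro mult_right_mono) auto
          qed
          show ?thesis
            by (rule gen[OF Kle[OF that(1)] Kle[OF that(2)]]) simp_all
        qed
        also have "\<dots> = A * (exp (b\<^sup>2 * cov J x y) * (sinpow (1 - \<beta>) (fst x - fst y) * sinpow (1 - \<beta>) (snd x - snd y)))"
          unfolding A_def power2_eq_square[of "3 + 6 / (1 - \<beta>)"] by (simp add: mult_ac)
        finally show ?thesis .
      qed
      have "(\<integral>\<^sup>+p. ennreal \<bar>H p\<bar> \<partial>torus2) = (\<integral>\<^sup>+x. \<integral>\<^sup>+y. ennreal \<bar>H (x, y)\<bar> \<partial>torus \<partial>torus)"
        by (subst torus.nn_integral_fst) auto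
      also have "\<dots> \<le> (\<integral>\<^sup>+x. ennreal (A * C) \<partial>torus)"
      proof (rule nn_integral_mono)
        fix x assume x: "x \<in> space torus"
        have [measurable]: "(\<lambda>y. cov J x y) \<in> borel_measurable torus" unfolding cov_def by measurable
        have "(\<integral>\<^sup>+y. ennreal \<bar>H (x, y)\<bar> \<partial>torus) \<le> (\<integral>\<^sup>+y. ennreal A * ennreal (exp (b\<^sup>2 * cov J x y) * (sinpow (1 - \<beta>) (fst x - fst y) * sinpow (1 - \<beta>) (snd x - snd y))) \<partial>torus)"
        proof (rule nn_integral_mono_AE)
          show "AE y in torus. ennreal \<bar>H (x, y)\<bar> \<le> ennreal A * ennreal (exp (b\<^sup>2 * cov J x y) * (sinpow (1 - \<beta>) (fst x - fst y) * sinpow (1 - \<beta>) (snd x - snd y)))"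
            using AE_torus_off_diagonal[OF x]
          proof eventually_elim
            case (elim y)
            have "ennreal \<bar>H (x, y)\<bar> \<le> ennreal (A * (exp (b\<^sup>2 * cov J x y) * (sinpow (1 - \<beta>) (fst x - fst y) * sinpow (1 - \<beta>) (snd x - snd y))))"
              by (rule ennreal_leI[OF Hle[OF conjunct1[OF elim] conjunct2[OF elim]]])
            then show ?case using A by (simp only: ennreal_mult')
          qed
        qed
        also have "\<dots> = ennreal A * (\<integral>\<^sup>+y. ennreal (exp (b\<^sup>2 * cov J x y) * (sinpow (1 - \<beta>) (fst x - fst y) * sinpow (1 - \<beta>) (snd x - snd y))) \<partial>torus)"
          by (rule nn_integral_cmult) measurable
        also have "\<dots> \<le> ennreal A * ennreal C" by (intro mult_left_mono C adm x) simp
        finally show "(\<integral>\<^sup>+y. ennreal \<bar>H (x, y)\<bar> \<partial>torus) \<le> ennreal (A * C)" using A C by (simp add: ennreal_mult)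
      qed
      also have "\<dots> = ennreal (A * C * (4 * pi\<^sup>2))"
        using A C by (simp add: emeasure_torus ennreal_mult'[symmetric] del: space_torus)
      finally show "(\<integral>\<^sup>+p. ennreal \<bar>\<Sum>l\<in>lattice_box m. (decay \<beta> (fst l) * decay \<beta> (snd l)) * (basis_e l (fst p) * basis_e l (snd p) * exp (b\<^sup>2 * cov J (fst p) (snd p)))\<bar> \<partial>torus2) \<le> ennreal (A * C * (4 * pi\<^sup>2))"
        unfolding H_def .
    qed (use A C in auto)
    finally show ?thesis unfolding T_def by simp
  qed
  show ?thesis using main A C by (intro exI[of _ "2 * (A * C * (4 * pi\<^sup>2))"]) auto
qed

section \<open>Hypercontractivity\<close>

definition bounded_fun :: "(real \<times> real \<Rightarrow> real) \<Rightarrow> bool" where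
  "bounded_fun \<phi> \<longleftrightarrow> \<phi> \<in> borel_measurable torus \<and> (\<exists>B. \<forall>x. \<bar>\<phi> x\<bar> \<le> B)"

lemma bounded_fun_measurable: "bounded_fun \<phi> \<Longrightarrow> \<phi> \<in> borel_measurable torus"
  unfolding bounded_fun_def by simp

lemma bounded_funE:
  assumes "bounded_fun \<phi>"
  obtains B where "B \<ge> 0" "\<And>x. \<bar>\<phi> x\<bar> \<le> B"
proof -
  obtain B where B: "\<And>x. \<bar>\<phi> x\<bar> \<le> B" using assms unfolding bounded_fun_def by blast
  moreover have "B \<ge> 0" using B[of undefined] by linarith
  ultimately show ?thesis using that by blast
qed

lemma bounded_funI: "\<phi> \<in> borel_measurable torus \<Longrightarrow> (\<And>x. \<bar>\<phi> x\<bar> \<le> B) \<Longrightarrow> bounded_fun \<phi>"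
  unfolding bounded_fun_def by blast

lemma bounded_fun_const: "bounded_fun (\<lambda>x. c)"
  by (rule bounded_funI[of _ "\<bar>c\<bar>"]) auto

lemma bounded_fun_mult:
  assumes "bounded_fun \<phi>" "bounded_fun \<psi>"
  shows "bounded_fun (\<lambda>x. \<phi> x * \<psi> x)"
proof -
  obtain B where B: "B \<ge> 0" "\<And>x. \<bar>\<phi> x\<bar> \<le> B" using assms(1) by (rule bounded_funE) blast
  obtain C where C: "C \<ge> 0" "\<And>x. \<bar>\<psi> x\<bar> \<le> C" using assms(2) by (rule bounded_funE) blast
  note [measurable] = assms[THEN bounded_fun_measurable]
  show ?thesis by (rule bounded_funI[of _ "B * C"]) (use B C in \<open>auto simp: abs_mult intro!: mult_mono\<close>)
qed

lemma bounded_fun_add: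
  assumes "bounded_fun \<phi>" "bounded_fun \<psi>"
  shows "bounded_fun (\<lambda>x. \<phi> x + \<psi> x)"
proof -
  obtain B where B: "B \<ge> 0" "\<And>x. \<bar>\<phi> x\<bar> \<le> B" using assms(1) by (rule bounded_funE) blast
  obtain C where C: "C \<ge> 0" "\<And>x. \<bar>\<psi> x\<bar> \<le> C" using assms(2) by (rule bounded_funE) blast
  note [measurable] = assms[THEN bounded_fun_measurable]
  show ?thesis
  proof (rule bounded_funI[of _ "B + C"])
    show "\<bar>\<phi> x + \<psi> x\<bar> \<le> B + C" for x using B(2)[of x] C(2)[of x] by linarith
  qed measurable
qed

lemma bounded_fun_power: "bounded_fun \<phi> \<Longrightarrow> bounded_fun (\<lambda>x. \<phi> x ^ n)"
  by (induction n) (auto intro: bounded_fun_const bounded_fun_mult)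

definition kform :: "((real \<times> real) \<times> real \<times> real \<Rightarrow> real) \<Rightarrow> (real \<times> real \<Rightarrow> real) \<Rightarrow> (real \<times> real \<Rightarrow> real) \<Rightarrow> real" where
  "kform K \<phi> \<psi> = (\<integral>p. K p * (\<phi> (fst p) * \<psi> (snd p)) \<partial>torus2)"

text \<open>A positive kernel stands for a Hilbert seminorm with
  \<open>kform K \<phi> \<phi>\<close> as its square. Kernels rather than vectors are used because
  the inductions absorb each coin or coordinate into K.\<close>

definition psd :: "((real \<times> real) \<times> real \<times> real \<Rightarrow> real) \<Rightarrow> bool" where
  "psd K \<longleftrightarrow> integrable torus2 K \<and> (\<forall>\<phi>. bounded_fun \<phi> \<longrightarrow> kform K \<phi> \<phi> \<ge> 0)"

lemma psd_integrable: "psd K \<Longrightarrow> integrable torus2 K"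
  unfolding psd_def by simp

lemma psd_nonneg: "psd K \<Longrightarrow> bounded_fun \<phi> \<Longrightarrow> kform K \<phi> \<phi> \<ge> 0"
  unfolding psd_def by simp

lemma kform_integrable:
  assumes K: "integrable torus2 K" and \<phi>: "bounded_fun \<phi>" and \<psi>: "bounded_fun \<psi>"
  shows "integrable torus2 (\<lambda>p. K p * (\<phi> (fst p) * \<psi> (snd p)))"
proof -
  obtain B where B: "B \<ge> 0" "\<And>x. \<bar>\<phi> x\<bar> \<le> B" using \<phi> by (rule bounded_funE) blast
  obtain C where C: "C \<ge> 0" "\<And>x. \<bar>\<psi> x\<bar> \<le> C" using \<psi> by (rule bounded_funE) blast
  note [measurable] = \<phi>[THEN bounded_fun_measurable] \<psi>[THEN bounded_fun_measurable]
  show ?thesis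
    by (rule integrable_mult_bounded[OF K, of _ "B * C"]) (use B C in \<open>auto simp: abs_mult intro!: mult_mono\<close>)
qed

text \<open>Discriminant of the nonnegative quadratic polynomial in t given by the form at \<phi> +
  t \<psi>. For a kernel that is not assumed symmetric the two mixed forms appear as a sum.\<close>

lemma psd_Cauchy_Schwarz:
  assumes K: "psd K" and \<phi>: "bounded_fun \<phi>" and \<psi>: "bounded_fun \<psi>"
  shows "(kform K \<phi> \<psi> + kform K \<psi> \<phi>)\<^sup>2 \<le> 4 * kform K \<phi> \<phi> * kform K \<psi> \<psi>"
proof -
  define U V W where "U = kform K \<phi> \<phi>" and "V = kform K \<psi> \<psi>" and "W = kform K \<phi> \<psi> + kform K \<psi> \<phi>"
  note int = kform_integrable[OF psd_integrable[OF K]]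
  have quad: "0 \<le> U + t * W + t\<^sup>2 * V" for t
  proof -
    have "bounded_fun (\<lambda>x. \<phi> x + t * \<psi> x)" by (intro bounded_fun_add bounded_fun_mult bounded_fun_const \<phi> \<psi>)
    then have "0 \<le> kform K (\<lambda>x. \<phi> x + t * \<psi> x) (\<lambda>x. \<phi> x + t * \<psi> x)" by (rule psd_nonneg[OF K])
    also have "\<dots> = (\<integral>p. K p * (\<phi> (fst p) * \<phi> (snd p)) + t * (K p * (\<phi> (fst p) * \<psi> (snd p))) + t * (K p * (\<psi> (fst p) * \<phi> (snd p))) + t\<^sup>2 * (K p * (\<psi> (fst p) * \<psi> (snd p))) \<partial>torus2)"
      unfolding kform_def by (simp add: algebra_simps power2_eq_square)
    also have "\<dots> = U + t * W + t\<^sup>2 * V"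
      unfolding U_def V_def W_def kform_def using int[OF \<phi> \<phi>] int[OF \<phi> \<psi>] int[OF \<psi> \<phi>] int[OF \<psi> \<psi>] by (simp add: distrib_left)
    finally show ?thesis .
  qed
  have U: "U \<ge> 0" and V: "V \<ge> 0" unfolding U_def V_def using psd_nonneg[OF K] \<phi> \<psi> by auto
  have "W\<^sup>2 \<le> 4 * U * V"
  proof (cases "V = 0")
    case True
    have "W = 0"
    proof (rule ccontr)
      assume "W \<noteq> 0"
      then have "U + (- (U + 1) / W) * W + (- (U + 1) / W)\<^sup>2 * V = -1" using True by simp
      then show False using quad[of "- (U + 1) / W"] by simp
    qed
    then show ?thesis using True by simp
  next
    case False
    then have V: "V > 0" using V by simp
    have "0 \<le> U + (- W / (2 * V)) * W + (- W / (2 * V))\<^sup>2 * V" by (rule quad)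
    also have "\<dots> = U - W\<^sup>2 / (4 * V)" using V by (simp add: field_simps power2_eq_square)
    finally show ?thesis using V by (simp add: field_simps)
  qed
  then show ?thesis unfolding U_def V_def W_def .
qed

lemma kform_tensor: "kform (\<lambda>p. K p * (\<eta> (fst p) * \<eta> (snd p))) \<phi> \<psi> = kform K (\<lambda>x. \<eta> x * \<phi> x) (\<lambda>x. \<eta> x * \<psi> x)"
  unfolding kform_def by (simp add: mult_ac)

lemma psd_tensor:
  assumes K: "psd K" and \<eta>: "bounded_fun \<eta>"
  shows "psd (\<lambda>p. K p * (\<eta> (fst p) * \<eta> (snd p)))"
  unfolding psd_def kform_tensor
  using kform_integrable[OF psd_integrable[OF K] \<eta> \<eta>] psd_nonneg[OF K] bounded_fun_mult[OF \<eta>] by blast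

lemma kform_one_plus:
  assumes K: "integrable torus2 K" and u: "bounded_fun u" and \<phi>: "bounded_fun \<phi>"
  shows "kform (\<lambda>p. K p * (1 + c * (u (fst p) * u (snd p)))) \<phi> \<phi> = kform K \<phi> \<phi> + c * kform K (\<lambda>x. u x * \<phi> x) (\<lambda>x. u x * \<phi> x)"
proof -
  have "kform (\<lambda>p. K p * (1 + c * (u (fst p) * u (snd p)))) \<phi> \<phi>
     = (\<integral>p. K p * (\<phi> (fst p) * \<phi> (snd p)) + c * (K p * ((u (fst p) * \<phi> (fst p)) * (u (snd p) * \<phi> (snd p)))) \<partial>torus2)"
    unfolding kform_def by (simp add: algebra_simps)
  then show ?thesis unfolding kform_def
    using kform_integrable[OF K \<phi> \<phi>] kform_integrable[OF K bounded_fun_mult[OF u \<phi>] bounded_fun_mult[OF u \<phi>]] by simp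
qed

lemma psd_one_plus:
  assumes K: "psd K" and u: "bounded_fun u" and c: "c \<ge> 0"
  shows "psd (\<lambda>p. K p * (1 + c * (u (fst p) * u (snd p))))"
  unfolding psd_def
proof (intro conjI allI impI)
  have "integrable torus2 (\<lambda>p. K p + c * (K p * (u (fst p) * u (snd p))))"
    using psd_integrable[OF K] kform_integrable[OF psd_integrable[OF K] u u] by simp
  then show "integrable torus2 (\<lambda>p. K p * (1 + c * (u (fst p) * u (snd p))))" by (simp add: algebra_simps)
  fix \<phi> assume \<phi>: "bounded_fun \<phi>"
  show "0 \<le> kform (\<lambda>p. K p * (1 + c * (u (fst p) * u (snd p)))) \<phi> \<phi>"
    unfolding kform_one_plus[OF psd_integrable[OF K] u \<phi>] using psd_nonneg[OF K \<phi>] psd_nonneg[OF K bounded_fun_mult[OF u \<phi>]] c by simp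
qed

lemma psd_one_plus_power:
  assumes K: "psd K" and u: "bounded_fun u" and c: "c \<ge> 0"
  shows "psd (\<lambda>p. K p * (1 + c * (u (fst p) * u (snd p))) ^ n)"
proof (induction n)
  case (Suc n)
  from psd_one_plus[OF Suc u c] show ?case by (simp add: mult_ac)
qed (use K in simp)

text \<open>This is \<open>two_point_inequality_Gram\<close> for the vectors \<phi> and u \<phi>.
  The right side is again a form in \<phi>, for the kernel multiplied by 1 + (2 q - 1) u(x) u(y),
  which makes the inequality iterable.\<close>

lemma kform_two_point:
  assumes K: "psd K" and u: "bounded_fun u" and \<phi>: "bounded_fun \<phi>" and q: "q \<ge> 1"
  shows "(kform K (\<lambda>x. \<phi> x * (1 + u x)) (\<lambda>x. \<phi> x * (1 + u x)) powr q + kform K (\<lambda>x. \<phi> x * (1 - u x)) (\<lambda>x. \<phi> x * (1 - u x)) powr q) / 2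
     \<le> kform (\<lambda>p. K p * (1 + (2 * q - 1) * (u (fst p) * u (snd p)))) \<phi> \<phi> powr q"
proof -
  define \<psi> where "\<psi> = (\<lambda>x. u x * \<phi> x)"
  have \<psi>: "bounded_fun \<psi>" unfolding \<psi>_def by (rule bounded_fun_mult[OF u \<phi>])
  define U V W where "U = kform K \<phi> \<phi>" and "V = kform K \<psi> \<psi>" and "W = kform K \<phi> \<psi> + kform K \<psi> \<phi>"
  note int = kform_integrable[OF psd_integrable[OF K]]
  have exp: "kform K (\<lambda>x. \<phi> x * (1 + e * u x)) (\<lambda>x. \<phi> x * (1 + e * u x)) = U + e * W + e\<^sup>2 * V" for e
  proof -
    have "kform K (\<lambda>x. \<phi> x * (1 + e * u x)) (\<lambda>x. \<phi> x * (1 + e * u x)) = (\<integral>p. K p * (\<phi> (fst p) * \<phi> (snd p)) + e * (K p * (\<phi> (fst p) * \<psi> (snd p))) + e * (K p * (\<psi> (fst p) * \<phi> (snd p))) + e\<^sup>2 * (K p * (\<psi> (fst p) * \<psi> (snd p))) \<partial>torus2)"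
      unfolding kform_def \<psi>_def by (simp add: algebra_simps power2_eq_square)
    also have "\<dots> = U + e * W + e\<^sup>2 * V"
      unfolding U_def V_def W_def kform_def using int[OF \<phi> \<phi>] int[OF \<phi> \<psi>] int[OF \<psi> \<phi>] int[OF \<psi> \<psi>] by (simp add: distrib_left)
    finally show ?thesis .
  qed
  have "kform K (\<lambda>x. \<phi> x * (1 + u x)) (\<lambda>x. \<phi> x * (1 + u x)) = U + W + V" using exp[of 1] by simp
  moreover have "kform K (\<lambda>x. \<phi> x * (1 - u x)) (\<lambda>x. \<phi> x * (1 - u x)) = U - W + V" using exp[of "-1"] by simp
  moreover have "kform (\<lambda>p. K p * (1 + (2 * q - 1) * (u (fst p) * u (snd p)))) \<phi> \<phi> = U + (2 * q - 1) * V"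
    unfolding kform_one_plus[OF psd_integrable[OF K] u \<phi>] U_def V_def \<psi>_def ..
  moreover have "W\<^sup>2 \<le> 4 * U * V" unfolding U_def V_def W_def by (rule psd_Cauchy_Schwarz[OF K \<phi> \<psi>])
  moreover have "U \<ge> 0" "V \<ge> 0" unfolding U_def V_def using psd_nonneg[OF K] \<phi> \<psi> by auto
  ultimately show ?thesis using two_point_inequality_Gram[OF q, of U V W] by simp
qed

section \<open>Tensorisation over fair coins\<close>

definition coin_mean :: "nat \<Rightarrow> (nat \<Rightarrow> real) \<Rightarrow> real" where
  "coin_mean m f = (\<Sum>k\<le>m. real (m choose k) * f k) / 2 ^ m"

lemma coin_mean_Suc: "coin_mean (Suc m) f = (coin_mean m f + coin_mean m (\<lambda>k. f (Suc k))) / 2"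
proof -
  have "(\<Sum>k\<le>Suc m. real (Suc m choose k) * f k) = f 0 + (\<Sum>k\<le>m. real (Suc m choose Suc k) * f (Suc k))"
    unfolding sum.atMost_Suc_shift by simp
  also have "\<dots> = (f 0 + (\<Sum>k\<le>m. real (m choose Suc k) * f (Suc k))) + (\<Sum>k\<le>m. real (m choose k) * f (Suc k))"
    by (simp add: distrib_right sum.distrib)
  also have "f 0 + (\<Sum>k\<le>m. real (m choose Suc k) * f (Suc k)) = (\<Sum>k\<le>Suc m. real (m choose k) * f k)"
    unfolding sum.atMost_Suc_shift by simp
  also have "\<dots> = (\<Sum>k\<le>m. real (m choose k) * f k)" by simp
  finally show ?thesis unfolding coin_mean_def by (simp add: add_divide_distrib)
qed

lemma coin_mean_mono: "(\<And>k. k \<le> m \<Longrightarrow> f k \<le> g k) \<Longrightarrow> coin_mean m f \<le> coin_mean m g"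
  unfolding coin_mean_def by (intro divide_right_mono sum_mono mult_left_mono) auto

lemma coin_mean_cong: "(\<And>k. k \<le> m \<Longrightarrow> f k = g k) \<Longrightarrow> coin_mean m f = coin_mean m g"
  unfolding coin_mean_def by (intro arg_cong[where f = "\<lambda>u. u / 2 ^ m"] sum.cong) auto

lemma expectation_binomial_coin_mean: "measure_pmf.expectation (binomial_pmf m (1 / 2)) f = coin_mean m f"
proof -
  have "(real (m choose h) * (1 / 2) ^ h * (1 - 1 / 2) ^ (m - h)) *\<^sub>R y = real (m choose h) * y / 2 ^ m" if "h \<le> m" for h and y :: real
  proof -
    have "(1 / 2 :: real) ^ h * (1 - 1 / 2) ^ (m - h) = (1 / 2) ^ m" using that by (simp flip: power_add)
    then have "(real (m choose h) * (1 / 2) ^ h * (1 - 1 / 2) ^ (m - h)) *\<^sub>R y = real (m choose h) * (1 / 2) ^ m * y" by (simp only: mult.assoc real_scaleR_def)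
    then show ?thesis by (simp add: power_one_over)
  qed
  then show ?thesis unfolding coin_mean_def sum_divide_distrib
    by (subst expectation_binomial_pmf') (auto intro!: sum.cong simp del: real_scaleR_def)
qed

text \<open>Each coin is resolved by \<open>kform_two_point\<close> and leaves its factor in the
  kernel; the induction therefore quantifies over all positive kernels.\<close>

lemma coin_hypercontractive:
  assumes K: "psd K" and u: "bounded_fun u" and q: "q \<ge> 1"
  shows "coin_mean m (\<lambda>h. kform K (\<lambda>x. (1 + u x) ^ h * (1 - u x) ^ (m - h)) (\<lambda>x. (1 + u x) ^ h * (1 - u x) ^ (m - h)) powr q)
     \<le> (\<integral>p. K p * (1 + (2 * q - 1) * (u (fst p) * u (snd p))) ^ m \<partial>torus2) powr q"
  using K
proof (induction m arbitrary: K)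
  case 0
  then show ?case unfolding coin_mean_def kform_def by simp
next
  case (Suc m)
  define K' where "K' = (\<lambda>p. K p * (1 + (2 * q - 1) * (u (fst p) * u (snd p))))"
  have K': "psd K'" unfolding K'_def by (rule psd_one_plus[OF Suc.prems u]) (use q in simp)
  define A where "A = (\<lambda>h x. (1 + u x) ^ h * (1 - u x) ^ (m - h))"
  define f where "f = (\<lambda>h. kform K (\<lambda>x. (1 + u x) ^ h * (1 - u x) ^ (Suc m - h)) (\<lambda>x. (1 + u x) ^ h * (1 - u x) ^ (Suc m - h)) powr q)"
  have bu: "bounded_fun (\<lambda>x. 1 + u x)" "bounded_fun (\<lambda>x. 1 - u x)"
    using bounded_fun_add[OF bounded_fun_const[of 1] u] bounded_fun_add[OF bounded_fun_const[of 1] bounded_fun_mult[OF bounded_fun_const[of "-1"] u]] by simp_all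
  have A: "bounded_fun (A h)" for h unfolding A_def by (intro bounded_fun_mult bounded_fun_power bu)
  have "coin_mean (Suc m) f = coin_mean m (\<lambda>h. (f (Suc h) + f h) / 2)"
    unfolding coin_mean_Suc unfolding coin_mean_def by (simp add: sum.distrib[symmetric] distrib_left add_divide_distrib sum_divide_distrib add.commute mult.commute[of 2])
  also have "\<dots> \<le> coin_mean m (\<lambda>h. kform K' (A h) (A h) powr q)"
  proof (rule coin_mean_mono)
    fix h assume h: "h \<le> m"
    have e1: "f (Suc h) = kform K (\<lambda>x. A h x * (1 + u x)) (\<lambda>x. A h x * (1 + u x)) powr q"
      unfolding f_def A_def by (simp add: mult_ac)
    have e2: "f h = kform K (\<lambda>x. A h x * (1 - u x)) (\<lambda>x. A h x * (1 - u x)) powr q"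
      unfolding f_def A_def using h by (simp add: Suc_diff_le mult_ac)
    show "(f (Suc h) + f h) / 2 \<le> kform K' (A h) (A h) powr q"
      unfolding e1 e2 K'_def by (rule kform_two_point[OF Suc.prems u A q])
  qed
  also have "\<dots> \<le> (\<integral>p. K' p * (1 + (2 * q - 1) * (u (fst p) * u (snd p))) ^ m \<partial>torus2) powr q"
    unfolding A_def by (rule Suc.IH[OF K'])
  also have "(\<integral>p. K' p * (1 + (2 * q - 1) * (u (fst p) * u (snd p))) ^ m \<partial>torus2) = (\<integral>p. K p * (1 + (2 * q - 1) * (u (fst p) * u (snd p))) ^ Suc m \<partial>torus2)"
    unfolding K'_def by (simp add: mult.assoc)
  finally show ?case unfolding f_def .
qed

section \<open>From coins to the Gaussian\<close>

definition coin_law :: "nat \<Rightarrow> real measure" where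
  "coin_law m = distr (measure_pmf (binomial_pmf m (1 / 2))) borel (\<lambda>h. (2 * real h - real m) / sqrt (real m))"

lemma real_distribution_coin_law: "real_distribution (coin_law m)"
  unfolding coin_law_def by (rule prob_space.real_distribution_distr[OF prob_space_measure_pmf]) simp

lemma char_coin_law: "char (coin_law m) t = complex_of_real (cos (t / sqrt (real m)) ^ m)"
proof -
  define \<theta> where "\<theta> = t / sqrt (real m)"
  have "char (coin_law m) t = (CLINT h|binomial_pmf m (1 / 2). iexp (t * ((2 * real h - real m) / sqrt (real m))))"
    unfolding char_def coin_law_def by (subst integral_distr) auto
  also have "\<dots> = (\<Sum>k\<le>m. (real (m choose k) * (1 / 2) ^ k * (1 - 1 / 2) ^ (m - k)) *\<^sub>R iexp (t * ((2 * real k - real m) / sqrt (real m))))"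
    by (subst expectation_binomial_pmf') auto
  also have "\<dots> = (\<Sum>k\<le>m. of_nat (m choose k) * (iexp \<theta> / 2) ^ k * (iexp (- \<theta>) / 2) ^ (m - k))"
  proof (intro sum.cong refl)
    fix k assume k: "k \<in> {..m}"
    have "t * ((2 * real k - real m) / sqrt (real m)) = real k * \<theta> + real (m - k) * (- \<theta>)"
      using k unfolding \<theta>_def by (simp add: of_nat_diff algebra_simps diff_divide_distrib)
    then have "iexp (t * ((2 * real k - real m) / sqrt (real m))) = iexp \<theta> ^ k * iexp (- \<theta>) ^ (m - k)"
      by (simp only: of_real_add of_real_mult distrib_left exp_add of_real_of_nat_eq exp_of_nat_mult[symmetric] mult.left_commute[of \<i>])
    then show "(real (m choose k) * (1 / 2) ^ k * (1 - 1 / 2) ^ (m - k)) *\<^sub>R iexp (t * ((2 * real k - real m) / sqrt (real m))) = of_nat (m choose k) * (iexp \<theta> / 2) ^ k * (iexp (- \<theta>) / 2) ^ (m - k)"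
      by (simp add: scaleR_conv_of_real power_divide)
  qed
  also have "\<dots> = (iexp \<theta> / 2 + iexp (- \<theta>) / 2) ^ m" by (rule binomial_ring[symmetric])
  also have "iexp \<theta> / 2 + iexp (- \<theta>) / 2 = complex_of_real (cos \<theta>)"
    by (simp add: cis_conv_exp[symmetric] complex_eq_iff flip: of_real_minus)
  finally show ?thesis unfolding \<theta>_def by simp
qed

text \<open>With x = t / sqrt m the logarithm of the power is t^2 ln (cos x) / x^2, and this
  quotient tends to - 1 / 2 at 0.\<close>

lemma cos_power_tendsto: "(\<lambda>m. cos (t / sqrt (real m)) ^ m) \<longlonglongrightarrow> exp (- t\<^sup>2 / 2)"
proof (cases "t = 0")
  case True then show ?thesis by simp
next
  case False
  have lim: "((\<lambda>x::real. ln (cos x) / x\<^sup>2) \<longlongrightarrow> - 1 / 2) (at 0)" by real_asymp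
  have x0: "filterlim (\<lambda>m. t / sqrt (real m)) (at 0) sequentially"
  proof (rule filterlim_atI)
    show "(\<lambda>m. t / sqrt (real m)) \<longlonglongrightarrow> 0" by real_asymp
    show "\<forall>\<^sub>F m in sequentially. t / sqrt (real m) \<noteq> 0" using eventually_gt_at_top[of 0] by eventually_elim (use False in simp)
  qed
  have "(\<lambda>m. exp (t\<^sup>2 * (ln (cos (t / sqrt (real m))) / (t / sqrt (real m))\<^sup>2))) \<longlonglongrightarrow> exp (t\<^sup>2 * (- 1 / 2))"
    by (intro tendsto_intros filterlim_compose[OF lim x0])
  moreover have "\<forall>\<^sub>F m in sequentially. exp (t\<^sup>2 * (ln (cos (t / sqrt (real m))) / (t / sqrt (real m))\<^sup>2)) = cos (t / sqrt (real m)) ^ m"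
  proof -
    have "((\<lambda>x::real. cos x) \<longlongrightarrow> 1) (at 0)" by real_asymp
    then have "(\<lambda>m. cos (t / sqrt (real m))) \<longlonglongrightarrow> 1" using x0 by (rule filterlim_compose)
    then have "\<forall>\<^sub>F m in sequentially. cos (t / sqrt (real m)) > 0" by (rule order_tendstoD) simp
    then show ?thesis using eventually_gt_at_top[of 0]
    proof eventually_elim
      case (elim m)
      have "t\<^sup>2 * (ln (cos (t / sqrt (real m))) / (t / sqrt (real m))\<^sup>2) = real m * ln (cos (t / sqrt (real m)))"
        using False elim by (simp add: power_divide)
      then have "exp (t\<^sup>2 * (ln (cos (t / sqrt (real m))) / (t / sqrt (real m))\<^sup>2)) = exp (real m * ln (cos (t / sqrt (real m))))" by (simp only:)
      also have "\<dots> = cos (t / sqrt (real m)) ^ m" using elim by (simp add: exp_of_nat_mult)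
      finally show ?case .
    qed
  qed
  ultimately show ?thesis using Lim_transform_eventually[of _ "exp (t\<^sup>2 * (- 1 / 2))" sequentially] by simp
qed

text \<open>Levy's continuity theorem applied to the powers of cosines. The shift k lets the
  sequence start where \<open>coin_factor\<close> is under control.\<close>

lemma coin_law_weak_conv: "weak_conv_m (\<lambda>n. coin_law (n + k)) std_normal_distribution"
proof (rule levy_continuity)
  show "real_distribution (coin_law (n + k))" for n by (rule real_distribution_coin_law)
  show "real_distribution std_normal_distribution" by (rule real_dist_normal_dist)
  show "(\<lambda>n. char (coin_law (n + k)) t) \<longlonglongrightarrow> char std_normal_distribution t" for t
    unfolding char_coin_law char_std_normal_distribution
    by (intro tendsto_of_real LIMSEQ_ignore_initial_segment cos_power_tendsto)
qed

text \<open>The product of m coin factors as a function of the normalised number s of heads minus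
  tails. Real exponents give it a meaning for every s, not only at the lattice values.\<close>

definition coin_factor :: "nat \<Rightarrow> real \<Rightarrow> real \<Rightarrow> real" where
  "coin_factor m v s = (1 + v / sqrt (real m)) powr ((real m + sqrt (real m) * s) / 2) * (1 - v / sqrt (real m)) powr ((real m - sqrt (real m) * s) / 2)"

text \<open>The dependence on m is isolated in two quotients of x = v / sqrt m, whose limits at 0
  are - 1 and 2; hence the limit exp (v s - v^2 / 2).\<close>

lemma coin_factor_exp:
  assumes m: "m > 0" and v: "\<bar>v\<bar> / sqrt (real m) \<le> 1 / 2" and v0: "v \<noteq> 0"
  defines "x \<equiv> v / sqrt (real m)"
  shows "coin_factor m v s = exp (v\<^sup>2 / 2 * (ln (1 - x\<^sup>2) / x\<^sup>2) + s * v / 2 * ((ln (1 + x) - ln (1 - x)) / x))"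
proof -
  have x: "\<bar>x\<bar> \<le> 1 / 2" unfolding x_def using v by simp
  have x0: "x \<noteq> 0" unfolding x_def using v0 m by simp
  define r where "r = sqrt (real m)"
  have r: "r > 0" "real m = r * r" unfolding r_def using m by auto
  have vx: "v = r * x" unfolding x_def r_def[symmetric] using r by simp
  have pos: "1 + x > 0" "1 - x > 0" using x by auto
  have l: "ln (1 - x\<^sup>2) = ln (1 + x) + ln (1 - x)"
  proof -
    have "1 - x\<^sup>2 = (1 + x) * (1 - x)" by (simp add: power2_eq_square algebra_simps)
    then show ?thesis using pos ln_mult[of "1 + x" "1 - x"] by simp
  qed
  have "coin_factor m v s = exp ((real m + r * s) / 2 * ln (1 + x)) * exp ((real m - r * s) / 2 * ln (1 - x))"
  proof -
    have xr: "v / r = x" unfolding x_def r_def ..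
    show ?thesis unfolding coin_factor_def r_def[symmetric] xr powr_def using pos by simp
  qed
  also have "\<dots> = exp ((real m + r * s) / 2 * ln (1 + x) + (real m - r * s) / 2 * ln (1 - x))" by (simp only: exp_add)
  also have "(real m + r * s) / 2 * ln (1 + x) + (real m - r * s) / 2 * ln (1 - x) = v\<^sup>2 / 2 * (ln (1 - x\<^sup>2) / x\<^sup>2) + s * v / 2 * ((ln (1 + x) - ln (1 - x)) / x)"
    unfolding l unfolding vx r(2) using x0 by (simp add: field_simps power2_eq_square)
  finally show ?thesis .
qed

text \<open>The part quadratic in v is nonpositive, and |ln (1 + y)| \<le> 2 |y| for |y| \<le> 1 / 2
  bounds the other. The bound is uniform in m and serves as domination.\<close>

lemma coin_factor_le:
  assumes m: "m > 0" and v: "\<bar>v\<bar> / sqrt (real m) \<le> 1 / 2"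
  shows "\<bar>coin_factor m v s\<bar> \<le> exp (2 * \<bar>v\<bar> * \<bar>s\<bar>)"
proof (cases "v = 0")
  case True
  then show ?thesis using m unfolding coin_factor_def by simp
next
  case False
  define x where "x = v / sqrt (real m)"
  have x: "\<bar>x\<bar> \<le> 1 / 2" unfolding x_def using v by simp
  have x0: "x \<noteq> 0" unfolding x_def using False m by simp
  have neg: "ln (1 - x\<^sup>2) / x\<^sup>2 \<le> 0"
  proof -
    have "x\<^sup>2 \<le> (1 / 2)\<^sup>2" using power_mono[OF x, of 2] by simp
    then have "1 - x\<^sup>2 > 0" by (simp add: power2_eq_square)
    then have "ln (1 - x\<^sup>2) \<le> (1 - x\<^sup>2) - 1" by (rule ln_le_minus_one)
    then have "ln (1 - x\<^sup>2) \<le> 0" using zero_le_power2[of x] by linarith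
    then show ?thesis by (simp add: divide_nonpos_nonneg)
  qed
  have L: "\<bar>ln (1 + y)\<bar> \<le> 2 * \<bar>y\<bar>" if "\<bar>y\<bar> \<le> 1 / 2" for y :: real
  proof -
    have "\<bar>y\<bar> * \<bar>y\<bar> \<le> \<bar>y\<bar> * (1 / 2)" using that by (intro mult_left_mono) auto
    then have "2 * y\<^sup>2 \<le> \<bar>y\<bar>" by (simp add: power2_eq_square)
    then show ?thesis using abs_ln_one_plus_x_minus_x_bound[OF that] by linarith
  qed
  have D: "\<bar>(ln (1 + x) - ln (1 - x)) / x\<bar> \<le> 4"
  proof -
    have "\<bar>ln (1 + x) - ln (1 - x)\<bar> \<le> 4 * \<bar>x\<bar>" using L[of x] L[of "- x"] x by simp
    then show ?thesis using x0 by (simp add: abs_divide divide_le_eq)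
  qed
  have "v\<^sup>2 / 2 * (ln (1 - x\<^sup>2) / x\<^sup>2) \<le> 0" using neg by (intro mult_nonneg_nonpos) auto
  moreover have "s * v / 2 * ((ln (1 + x) - ln (1 - x)) / x) \<le> 2 * \<bar>v\<bar> * \<bar>s\<bar>"
  proof -
    have "s * v / 2 * ((ln (1 + x) - ln (1 - x)) / x) \<le> \<bar>s * v / 2\<bar> * \<bar>(ln (1 + x) - ln (1 - x)) / x\<bar>"
      unfolding abs_mult[symmetric] by (rule abs_ge_self)
    also have "\<dots> \<le> \<bar>s * v / 2\<bar> * 4" using D by (intro mult_left_mono) auto
    finally show ?thesis by (simp add: abs_mult mult_ac)
  qed
  ultimately show ?thesis using coin_factor_exp[OF m v False, of s] unfolding x_def[symmetric] by simp
qed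

lemma coin_factor_tendsto:
  assumes s: "s' \<longlonglongrightarrow> s"
  shows "(\<lambda>n. coin_factor (n + k) v (s' n)) \<longlonglongrightarrow> exp (v * s - v\<^sup>2 / 2)"
proof (cases "v = 0")
  case True
  have "\<forall>\<^sub>F n in sequentially. coin_factor (n + k) v (s' n) = 1"
    using eventually_gt_at_top[of 0] by eventually_elim (use True in \<open>simp add: coin_factor_def\<close>)
  then have "(\<lambda>n. coin_factor (n + k) v (s' n)) \<longlonglongrightarrow> 1" by (rule tendsto_eventually)
  then show ?thesis using True by simp
next
  case False
  have l1: "((\<lambda>x::real. ln (1 - x\<^sup>2) / x\<^sup>2) \<longlongrightarrow> - 1) (at 0)" by real_asymp
  have l2: "((\<lambda>x::real. (ln (1 + x) - ln (1 - x)) / x) \<longlongrightarrow> 2) (at 0)" by real_asymp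
  define x where "x = (\<lambda>n. v / sqrt (real (n + k)))"
  have lim0: "x \<longlonglongrightarrow> 0" unfolding x_def by real_asymp
  have x0: "filterlim x (at 0) sequentially"
  proof (rule filterlim_atI[OF lim0])
    show "\<forall>\<^sub>F n in sequentially. x n \<noteq> 0" using eventually_gt_at_top[of 0] unfolding x_def by eventually_elim (use False in simp)
  qed
  have "(\<lambda>n. exp (v\<^sup>2 / 2 * (ln (1 - (x n)\<^sup>2) / (x n)\<^sup>2) + s' n * v / 2 * ((ln (1 + x n) - ln (1 - x n)) / x n))) \<longlonglongrightarrow> exp (v\<^sup>2 / 2 * (- 1) + s * v / 2 * 2)"
    by (intro tendsto_intros filterlim_compose[OF l1 x0] filterlim_compose[OF l2 x0] s) simp
  moreover have "\<forall>\<^sub>F n in sequentially. exp (v\<^sup>2 / 2 * (ln (1 - (x n)\<^sup>2) / (x n)\<^sup>2) + s' n * v / 2 * ((ln (1 + x n) - ln (1 - x n)) / x n)) = coin_factor (n + k) v (s' n)"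
  proof -
    have "\<forall>\<^sub>F n in sequentially. \<bar>x n\<bar> < 1 / 2"
      using tendstoD[OF lim0, of "1 / 2"] by simp
    then show ?thesis using eventually_gt_at_top[of 0]
    proof eventually_elim
      case (elim n)
      have "coin_factor (n + k) v (s' n) = exp (v\<^sup>2 / 2 * (ln (1 - (v / sqrt (real (n + k)))\<^sup>2) / (v / sqrt (real (n + k)))\<^sup>2) + s' n * v / 2 * ((ln (1 + v / sqrt (real (n + k))) - ln (1 - v / sqrt (real (n + k)))) / (v / sqrt (real (n + k)))))"
        by (rule coin_factor_exp) (use elim False in \<open>auto simp: x_def abs_divide\<close>)
      then show ?case unfolding x_def by (simp only:)
    qed
  qed
  ultimately have "(\<lambda>n. coin_factor (n + k) v (s' n)) \<longlonglongrightarrow> exp (v\<^sup>2 / 2 * (- 1) + s * v / 2 * 2)" by (rule Lim_transform_eventually)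
  then show ?thesis by (simp add: mult.commute)
qed

lemma coin_factor_discrete:
  assumes m: "m > 0" and v: "\<bar>v\<bar> / sqrt (real m) \<le> 1 / 2" and h: "h \<le> m"
  shows "coin_factor m v ((2 * real h - real m) / sqrt (real m)) = (1 + v / sqrt (real m)) ^ h * (1 - v / sqrt (real m)) ^ (m - h)"
proof -
  define x where "x = v / sqrt (real m)"
  have "\<bar>x\<bar> \<le> 1 / 2" unfolding x_def using v by simp
  then have pos: "1 + x > 0" "1 - x > 0" by auto
  have e: "(real m + sqrt (real m) * ((2 * real h - real m) / sqrt (real m))) / 2 = real h"
    "(real m - sqrt (real m) * ((2 * real h - real m) / sqrt (real m))) / 2 = real (m - h)"
    using m h by (auto simp: of_nat_diff)
  show ?thesis unfolding coin_factor_def e x_def[symmetric] using pos by (simp add: powr_realpow)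
qed

lemma one_plus_power_bound: "m > 0 \<Longrightarrow> \<bar>(1 + w / real m) ^ m\<bar> \<le> exp \<bar>w\<bar>" for w :: real
proof -
  assume m: "m > 0"
  have "\<bar>1 + w / real m\<bar> \<le> 1 + \<bar>w\<bar> / real m" by (rule order_trans[OF abs_triangle_ineq]) (simp add: abs_divide)
  also have "\<dots> \<le> exp (\<bar>w\<bar> / real m)" by (rule exp_ge_add_one_self)
  finally have "\<bar>1 + w / real m\<bar> ^ m \<le> exp (\<bar>w\<bar> / real m) ^ m" by (intro power_mono) auto
  also have "\<dots> = exp \<bar>w\<bar>" using m by (simp add: exp_of_nat_mult[symmetric])
  finally show ?thesis by (simp add: power_abs)
qed

lemma kernel_exp_limit:
  assumes K: "integrable torus2 K" and v: "bounded_fun v" and k: "k > 0"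
  shows "(\<lambda>n. \<integral>p. K p * (1 + c * (v (fst p) * v (snd p)) / real (n + k)) ^ (n + k) \<partial>torus2) \<longlonglongrightarrow> (\<integral>p. K p * exp (c * (v (fst p) * v (snd p))) \<partial>torus2)"
    "integrable torus2 (\<lambda>p. K p * exp (c * (v (fst p) * v (snd p))))"
proof -
  obtain B where B: "B \<ge> 0" "\<And>x. \<bar>v x\<bar> \<le> B" using v by (rule bounded_funE) blast
  note [measurable] = v[THEN bounded_fun_measurable]
  have Km [measurable]: "K \<in> borel_measurable torus2" using K by simp
  have w: "\<bar>c * (v x * v y)\<bar> \<le> \<bar>c\<bar> * (B * B)" for x y
    unfolding abs_mult using B by (intro mult_left_mono mult_mono) auto
  show "integrable torus2 (\<lambda>p. K p * exp (c * (v (fst p) * v (snd p))))"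
  proof (rule integrable_mult_bounded[OF K])
    fix p show "\<bar>exp (c * (v (fst p) * v (snd p)))\<bar> \<le> exp (\<bar>c\<bar> * (B * B))" using w[of "fst p" "snd p"] by (simp add: abs_le_iff)
  qed measurable
  show "(\<lambda>n. \<integral>p. K p * (1 + c * (v (fst p) * v (snd p)) / real (n + k)) ^ (n + k) \<partial>torus2) \<longlonglongrightarrow> (\<integral>p. K p * exp (c * (v (fst p) * v (snd p))) \<partial>torus2)"
  proof (rule integral_dominated_convergence)
    show "integrable torus2 (\<lambda>p. \<bar>K p\<bar> * exp (\<bar>c\<bar> * (B * B)))" using K by (intro integrable_mult_left integrable_abs)
    show "AE p in torus2. (\<lambda>n. K p * (1 + c * (v (fst p) * v (snd p)) / real (n + k)) ^ (n + k)) \<longlonglongrightarrow> K p * exp (c * (v (fst p) * v (snd p)))"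
      using LIMSEQ_ignore_initial_segment[OF tendsto_exp_limit_sequentially] by (intro AE_I2 tendsto_mult_left)
    show "AE p in torus2. norm (K p * (1 + c * (v (fst p) * v (snd p)) / real (n + k)) ^ (n + k)) \<le> \<bar>K p\<bar> * exp (\<bar>c\<bar> * (B * B))" for n
    proof (intro AE_I2)
      fix p
      have "\<bar>(1 + c * (v (fst p) * v (snd p)) / real (n + k)) ^ (n + k)\<bar> \<le> exp \<bar>c * (v (fst p) * v (snd p))\<bar>" using k by (intro one_plus_power_bound) simp
      also have "\<dots> \<le> exp (\<bar>c\<bar> * (B * B))" using w by simp
      finally show "norm (K p * (1 + c * (v (fst p) * v (snd p)) / real (n + k)) ^ (n + k)) \<le> \<bar>K p\<bar> * exp (\<bar>c\<bar> * (B * B))"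
        unfolding real_norm_def abs_mult[of "K p"] by (rule mult_left_mono) simp
    qed
  qed measurable
qed

text \<open>The exponential kernel is the limit of the m-fold factors 1 + c v(x) v(y) / m, which
  preserve positivity.\<close>

lemma psd_exp:
  assumes K: "psd K" and v: "bounded_fun v" and c: "c \<ge> 0"
  shows "psd (\<lambda>p. K p * exp (c * (v (fst p) * v (snd p))))"
  unfolding psd_def
proof (intro conjI allI impI)
  show "integrable torus2 (\<lambda>p. K p * exp (c * (v (fst p) * v (snd p))))" by (rule kernel_exp_limit(2)[OF psd_integrable[OF K] v zero_less_one])
  fix \<phi> assume \<phi>: "bounded_fun \<phi>"
  define K' where "K' = (\<lambda>p. K p * (\<phi> (fst p) * \<phi> (snd p)))"
  have K': "psd K'" unfolding K'_def by (rule psd_tensor[OF K \<phi>])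
  have "0 \<le> (\<integral>p. K' p * exp (c * (v (fst p) * v (snd p))) \<partial>torus2)"
  proof (rule tendsto_lowerbound[OF kernel_exp_limit(1)[OF psd_integrable[OF K'] v zero_less_one]])
    show "\<forall>\<^sub>F n in sequentially. 0 \<le> (\<integral>p. K' p * (1 + c * (v (fst p) * v (snd p)) / real (n + 1)) ^ (n + 1) \<partial>torus2)"
    proof (intro always_eventually allI)
      fix n
      have "psd (\<lambda>p. K' p * (1 + c / real (n + 1) * (v (fst p) * v (snd p))) ^ (n + 1))"
        by (rule psd_one_plus_power[OF K' v]) (use c in simp)
      from psd_nonneg[OF this bounded_fun_const[of 1]]
      show "0 \<le> (\<integral>p. K' p * (1 + c * (v (fst p) * v (snd p)) / real (n + 1)) ^ (n + 1) \<partial>torus2)" unfolding kform_def by simp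
    qed
  qed simp
  then show "0 \<le> kform (\<lambda>p. K p * exp (c * (v (fst p) * v (snd p)))) \<phi> \<phi>" unfolding kform_def K'_def by (simp add: mult_ac)
qed

text \<open>The Wick exponential of a standard normal variable s with coefficient v.\<close>

definition gfactor :: "real \<Rightarrow> real \<Rightarrow> real" where
  "gfactor v s = exp (v * s - v\<^sup>2 / 2)"

lemma bounded_fun_gfactor:
  assumes "bounded_fun v"
  shows "bounded_fun (\<lambda>x. gfactor (v x) s)"
proof -
  obtain B where B: "B \<ge> 0" "\<And>x. \<bar>v x\<bar> \<le> B" using assms by (rule bounded_funE) blast
  note [measurable] = assms[THEN bounded_fun_measurable]
  show ?thesis
  proof (rule bounded_funI)
    fix x
    have "v x * s \<le> \<bar>v x\<bar> * \<bar>s\<bar>" by (simp flip: abs_mult)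
    also have "\<dots> \<le> B * \<bar>s\<bar>" using B by (intro mult_right_mono) auto
    finally have "v x * s - (v x)\<^sup>2 / 2 \<le> B * \<bar>s\<bar>" using zero_le_power2[of "v x"] by linarith
    then show "\<bar>gfactor (v x) s\<bar> \<le> exp (B * \<bar>s\<bar>)" unfolding gfactor_def by simp
  qed (unfold gfactor_def, measurable)
qed

text \<open>Skorohod's representation turns the central limit theorem into pointwise convergence,
  and Fatou's lemma passes the q-th power moments to the limit. On the right the powers of 1 + (2 q
  - 1) v(x) v(y) / m converge to the exponential.\<close>

lemma gaussian_hypercontractive_1d:
  assumes K: "psd K" and v: "bounded_fun v" and q: "q \<ge> 1"
  shows "(\<integral>\<^sup>+s. ennreal (kform K (\<lambda>x. gfactor (v x) s) (\<lambda>x. gfactor (v x) s) powr q) \<partial>std_normal_distribution)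
     \<le> ennreal ((\<integral>p. K p * exp ((2 * q - 1) * (v (fst p) * v (snd p))) \<partial>torus2) powr q)"
proof -
  obtain B where B: "B \<ge> 0" "\<And>x. \<bar>v x\<bar> \<le> B" using v by (rule bounded_funE) blast
  note vm [measurable] = v[THEN bounded_fun_measurable]
  have Ki: "integrable torus2 K" by (rule psd_integrable[OF K])
  have Km [measurable]: "K \<in> borel_measurable torus2" using Ki by simp
  \<comment> \<open>From k coins on, |v| / sqrt m \<le> 1 / 2, the range in which
    \<open>coin_factor\<close> is controlled.\<close>
  define k where "k = nat \<lceil>4 * B\<^sup>2\<rceil> + 1"
  have k: "k > 0" "4 * B\<^sup>2 \<le> real k" unfolding k_def using of_nat_ceiling[of "4 * B\<^sup>2"] by (auto, linarith)
  have small: "\<bar>v x\<bar> / sqrt (real (n + k)) \<le> 1 / 2" for n x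
  proof -
    have "2 * B = sqrt (4 * B\<^sup>2)" using B by (simp add: real_sqrt_mult)
    also have "\<dots> \<le> sqrt (real (n + k))" using k by (intro real_sqrt_le_mono) auto
    finally have "2 * \<bar>v x\<bar> \<le> sqrt (real (n + k))" using B(2)[of x] by linarith
    then show ?thesis using k by (simp add: field_simps)
  qed
  have rd: "real_distribution (coin_law (n + k))" for n by (rule real_distribution_coin_law)
  obtain \<Omega> :: "real measure" and Yn Y where \<Omega>: "prob_space \<Omega>" "\<And>n. Yn n \<in> measurable \<Omega> borel" "\<And>n. distr \<Omega> borel (Yn n) = coin_law (n + k)"
    "Y \<in> measurable \<Omega> lborel" "distr \<Omega> borel Y = std_normal_distribution" "\<And>x. x \<in> space \<Omega> \<Longrightarrow> (\<lambda>n. Yn n x) \<longlonglongrightarrow> Y x"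
    using Skorohod[OF rd real_dist_normal_dist coin_law_weak_conv] by blast
  note [measurable] = \<Omega>(2)
  have Ym [measurable]: "Y \<in> borel_measurable \<Omega>" using \<Omega>(4) by simp
  define F where "F = (\<lambda>n s. kform K (\<lambda>x. coin_factor (n + k) (v x) s) (\<lambda>x. coin_factor (n + k) (v x) s))"
  define G where "G = (\<lambda>s. kform K (\<lambda>x. gfactor (v x) s) (\<lambda>x. gfactor (v x) s))"
  have [measurable]: "F n \<in> borel_measurable borel" for n
    unfolding F_def kform_def coin_factor_def by (rule torus2.borel_measurable_lebesgue_integral) measurable
  have [measurable]: "G \<in> borel_measurable borel"
    unfolding G_def kform_def gfactor_def by (rule torus2.borel_measurable_lebesgue_integral) measurable
  have bcf: "bounded_fun (\<lambda>x. coin_factor (n + k) (v x) s)" for n s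
  proof (rule bounded_funI)
    fix x
    have "\<bar>coin_factor (n + k) (v x) s\<bar> \<le> exp (2 * \<bar>v x\<bar> * \<bar>s\<bar>)" by (rule coin_factor_le[OF _ small]) (use k in simp)
    also have "\<dots> \<le> exp (2 * B * \<bar>s\<bar>)" using B(2)[of x] by (simp add: mult_right_mono)
    finally show "\<bar>coin_factor (n + k) (v x) s\<bar> \<le> exp (2 * B * \<bar>s\<bar>)" .
  qed (unfold coin_factor_def, measurable)
  \<comment> \<open>Convergence is needed along moving arguments, since the Skorohod variables
    change with n.\<close>
  have Fconv: "(\<lambda>n. F n (s' n)) \<longlonglongrightarrow> G s" if s: "s' \<longlonglongrightarrow> s" for s' s
  proof -
    have "Bseq s'" using s by (meson convergentI convergent_imp_Bseq)
    then obtain S where S: "S > 0" "\<And>n. \<bar>s' n\<bar> \<le> S" unfolding Bseq_def by auto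
    have cf: "\<bar>coin_factor (n + k) (v x) (s' n)\<bar> \<le> exp (2 * B * S)" for n x
    proof -
      have "\<bar>coin_factor (n + k) (v x) (s' n)\<bar> \<le> exp (2 * \<bar>v x\<bar> * \<bar>s' n\<bar>)" by (rule coin_factor_le[OF _ small]) (use k in simp)
      also have "\<dots> \<le> exp (2 * B * S)" using mult_mono[OF B(2)[of x] S(2)[of n] B(1)] by simp
      finally show ?thesis .
    qed
    show ?thesis unfolding F_def G_def kform_def
    proof (rule integral_dominated_convergence)
      show "integrable torus2 (\<lambda>p. \<bar>K p\<bar> * (exp (2 * B * S) * exp (2 * B * S)))" using Ki by (intro integrable_mult_left integrable_abs)
      show "AE p in torus2. (\<lambda>n. K p * (coin_factor (n + k) (v (fst p)) (s' n) * coin_factor (n + k) (v (snd p)) (s' n))) \<longlonglongrightarrow> K p * (gfactor (v (fst p)) s * gfactor (v (snd p)) s)"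
        unfolding gfactor_def by (intro AE_I2 tendsto_mult tendsto_const coin_factor_tendsto s)
      show "AE p in torus2. norm (K p * (coin_factor (n + k) (v (fst p)) (s' n) * coin_factor (n + k) (v (snd p)) (s' n))) \<le> \<bar>K p\<bar> * (exp (2 * B * S) * exp (2 * B * S))" for n
        unfolding real_norm_def abs_mult by (intro AE_I2 mult_left_mono mult_mono cf) auto
    qed (unfold coin_factor_def gfactor_def, measurable)
  qed
  have G0: "G s \<ge> 0" for s unfolding G_def by (rule psd_nonneg[OF K bounded_fun_gfactor[OF v]])
  have F0: "F n s \<ge> 0" for n s unfolding F_def by (rule psd_nonneg[OF K bcf])
  define R where "R = (\<lambda>n. (\<integral>p. K p * (1 + (2 * q - 1) * (v (fst p) * v (snd p)) / real (n + k)) ^ (n + k) \<partial>torus2) powr q)"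
  have step: "(\<integral>\<^sup>+\<omega>. ennreal (F n (Yn n \<omega>) powr q) \<partial>\<Omega>) \<le> ennreal (R n)" for n
  proof -
    define m where "m = n + k"
    have m: "m > 0" unfolding m_def using k by simp
    have smallm: "\<bar>v x\<bar> / sqrt (real m) \<le> 1 / 2" for x unfolding m_def by (rule small)
    define \<pi> where "\<pi> = (\<lambda>h. (2 * real h - real m) / sqrt (real m))"
    define u where "u = (\<lambda>x. v x / sqrt (real m))"
    have u: "bounded_fun u" unfolding u_def using bounded_fun_mult[OF v bounded_fun_const[of "1 / sqrt (real m)"]] by simp
    have law: "coin_law (n + k) = distr (measure_pmf (binomial_pmf m (1 / 2))) borel \<pi>"
      unfolding coin_law_def \<pi>_def m_def ..
    have "(\<integral>\<^sup>+\<omega>. ennreal (F n (Yn n \<omega>) powr q) \<partial>\<Omega>) = (\<integral>\<^sup>+s. ennreal (F n s powr q) \<partial>distr \<Omega> borel (Yn n))"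
      by (subst nn_integral_distr) auto
    also have "\<dots> = (\<integral>\<^sup>+h. ennreal (F n (\<pi> h) powr q) \<partial>binomial_pmf m (1 / 2))"
      unfolding \<Omega>(3) law by (subst nn_integral_distr) auto
    also have "\<dots> = ennreal (measure_pmf.expectation (binomial_pmf m (1 / 2)) (\<lambda>h. F n (\<pi> h) powr q))"
      by (intro nn_integral_eq_integral integrable_binomial_pmf) auto
    finally have int: "(\<integral>\<^sup>+\<omega>. ennreal (F n (Yn n \<omega>) powr q) \<partial>\<Omega>) = ennreal (measure_pmf.expectation (binomial_pmf m (1 / 2)) (\<lambda>h. F n (\<pi> h) powr q))" .
    have "measure_pmf.expectation (binomial_pmf m (1 / 2)) (\<lambda>h. F n (\<pi> h) powr q) = coin_mean m (\<lambda>h. F n (\<pi> h) powr q)"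
      by (rule expectation_binomial_coin_mean)
    also have "\<dots> = coin_mean m (\<lambda>h. kform K (\<lambda>x. (1 + u x) ^ h * (1 - u x) ^ (m - h)) (\<lambda>x. (1 + u x) ^ h * (1 - u x) ^ (m - h)) powr q)"
    proof (rule coin_mean_cong)
      fix h assume h: "h \<le> m"
      define A where "A = (\<lambda>x. (1 + u x) ^ h * (1 - u x) ^ (m - h))"
      have A: "coin_factor (n + k) (v x) (\<pi> h) = A x" for x
        using coin_factor_discrete[OF m smallm h, of x] unfolding A_def \<pi>_def u_def m_def by simp
      have "F n (\<pi> h) = kform K A A" unfolding F_def by (simp only: A)
      then show "F n (\<pi> h) powr q = kform K (\<lambda>x. (1 + u x) ^ h * (1 - u x) ^ (m - h)) (\<lambda>x. (1 + u x) ^ h * (1 - u x) ^ (m - h)) powr q"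
        unfolding A_def by (simp only:)
    qed
    also have "\<dots> \<le> (\<integral>p. K p * (1 + (2 * q - 1) * (u (fst p) * u (snd p))) ^ m \<partial>torus2) powr q"
      by (rule coin_hypercontractive[OF K u q])
    also have "\<dots> = R n"
    proof -
      have "u x * u y = v x * v y / real m" for x y
        unfolding u_def by simp
      then have "(2 * q - 1) * (u (fst p) * u (snd p)) = (2 * q - 1) * (v (fst p) * v (snd p)) / real m" for p
        by (simp only: times_divide_eq_right)
      then show ?thesis unfolding R_def m_def[symmetric] by (simp only:)
    qed
    finally show ?thesis unfolding int by (rule ennreal_leI)
  qed
  have R: "R \<longlonglongrightarrow> (\<integral>p. K p * exp ((2 * q - 1) * (v (fst p) * v (snd p))) \<partial>torus2) powr q"
  proof -
    have "0 \<le> (\<integral>p. K p * (1 + (2 * q - 1) * (v (fst p) * v (snd p)) / real (n + k)) ^ (n + k) \<partial>torus2)" for n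
    proof -
      have "psd (\<lambda>p. K p * (1 + (2 * q - 1) / real (n + k) * (v (fst p) * v (snd p))) ^ (n + k))"
        by (rule psd_one_plus_power[OF K v]) (use q in simp)
      from psd_nonneg[OF this bounded_fun_const[of 1]] show ?thesis unfolding kform_def by simp
    qed
    then show ?thesis unfolding R_def using q by (intro tendsto_powr' kernel_exp_limit(1)[OF Ki v k(1)] tendsto_const) auto
  qed
  have "(\<integral>\<^sup>+s. ennreal (G s powr q) \<partial>std_normal_distribution) = (\<integral>\<^sup>+\<omega>. ennreal (G (Y \<omega>) powr q) \<partial>\<Omega>)"
    unfolding \<Omega>(5)[symmetric] by (subst nn_integral_distr) auto
  also have "\<dots> = (\<integral>\<^sup>+\<omega>. liminf (\<lambda>n. ennreal (F n (Yn n \<omega>) powr q)) \<partial>\<Omega>)"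
  proof (rule nn_integral_cong)
    fix \<omega> assume "\<omega> \<in> space \<Omega>"
    then have "(\<lambda>n. F n (Yn n \<omega>)) \<longlonglongrightarrow> G (Y \<omega>)" by (intro Fconv \<Omega>(6))
    then have "(\<lambda>n. ennreal (F n (Yn n \<omega>) powr q)) \<longlonglongrightarrow> ennreal (G (Y \<omega>) powr q)"
      using q F0 by (intro tendsto_ennrealI tendsto_powr') auto
    then show "ennreal (G (Y \<omega>) powr q) = liminf (\<lambda>n. ennreal (F n (Yn n \<omega>) powr q))"
      by (intro lim_imp_Liminf[symmetric]) auto
  qed
  also have "\<dots> \<le> liminf (\<lambda>n. \<integral>\<^sup>+\<omega>. ennreal (F n (Yn n \<omega>) powr q) \<partial>\<Omega>)" by (rule nn_integral_liminf) measurable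
  also have "\<dots> \<le> liminf (\<lambda>n. ennreal (R n))" by (intro Liminf_mono always_eventually allI step)
  also have "\<dots> = ennreal ((\<integral>p. K p * exp ((2 * q - 1) * (v (fst p) * v (snd p))) \<partial>torus2) powr q)"
    by (intro lim_imp_Liminf tendsto_ennrealI R) simp
  finally show ?thesis unfolding G_def .
qed

text \<open>Fubini over the coordinates: the factors of the other coordinates are absorbed into the
  kernel, the one-dimensional inequality integrates out coordinate i, and the exponential factor
  that it leaves enters the kernel for the induction.\<close>

lemma gaussian_hypercontractive:
  fixes v :: "int \<times> int \<Rightarrow> real \<times> real \<Rightarrow> real"
  assumes J: "finite J" and K: "psd K" and v: "\<And>j. bounded_fun (v j)" and q: "q \<ge> 1"
  shows "(\<integral>\<^sup>+\<xi>. ennreal (kform K (\<lambda>x. \<Prod>j\<in>J. gfactor (v j x) (\<xi> j)) (\<lambda>x. \<Prod>j\<in>J. gfactor (v j x) (\<xi> j)) powr q) \<partial>PiM J (\<lambda>_. std_normal_distribution))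
     \<le> ennreal ((\<integral>p. K p * exp ((2 * q - 1) * (\<Sum>j\<in>J. v j (fst p) * v j (snd p))) \<partial>torus2) powr q)"
  using J K
proof (induction J arbitrary: K rule: finite_induct)
  case empty
  then show ?case unfolding kform_def by (simp add: PiM_empty)
next
  case (insert i J)
  interpret N: real_distribution std_normal_distribution by (rule real_dist_normal_dist)
  interpret product_sigma_finite "\<lambda>_ :: int \<times> int. std_normal_distribution" by standard
  note [measurable] = v[THEN bounded_fun_measurable]
  have Km [measurable]: "K \<in> borel_measurable torus2" using psd_integrable[OF insert.prems] by simp
  have bp: "bounded_fun (\<lambda>x. \<Prod>j\<in>J. gfactor (v j x) (\<xi> j))" for \<xi>
    using insert.hyps(1)
  proof (induction J rule: finite_induct)
    case empty
    show ?case by (simp add: bounded_fun_const)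
  next
    case (insert j F)
    show ?case unfolding prod.insert[OF insert.hyps] by (intro bounded_fun_mult bounded_fun_gfactor v insert.IH)
  qed
  define K' where "K' = (\<lambda>p. K p * exp ((2 * q - 1) * (v i (fst p) * v i (snd p))))"
  have K': "psd K'" unfolding K'_def by (rule psd_exp[OF insert.prems v]) (use q in simp)
  let ?N = "PiM J (\<lambda>_ :: int \<times> int. std_normal_distribution)"
  let ?f = "\<lambda>\<xi>. ennreal (kform K (\<lambda>x. \<Prod>j\<in>insert i J. gfactor (v j x) (\<xi> j)) (\<lambda>x. \<Prod>j\<in>insert i J. gfactor (v j x) (\<xi> j)) powr q)"
  have "(\<lambda>\<xi>. kform K (\<lambda>x. \<Prod>j\<in>insert i J. gfactor (v j x) (\<xi> j)) (\<lambda>x. \<Prod>j\<in>insert i J. gfactor (v j x) (\<xi> j))) \<in> borel_measurable (PiM (insert i J) (\<lambda>_. std_normal_distribution))"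
    unfolding kform_def gfactor_def by (rule torus2.borel_measurable_lebesgue_integral) measurable
  then have fm: "?f \<in> borel_measurable (PiM (insert i J) (\<lambda>_. std_normal_distribution))" by measurable
  have "(\<integral>\<^sup>+\<xi>. ?f \<xi> \<partial>PiM (insert i J) (\<lambda>_. std_normal_distribution)) = (\<integral>\<^sup>+\<xi>. (\<integral>\<^sup>+s. ?f (\<xi>(i := s)) \<partial>std_normal_distribution) \<partial>?N)"
    by (rule product_nn_integral_insert[OF insert.hyps fm])
  also have "\<dots> \<le> (\<integral>\<^sup>+\<xi>. ennreal (kform K' (\<lambda>x. \<Prod>j\<in>J. gfactor (v j x) (\<xi> j)) (\<lambda>x. \<Prod>j\<in>J. gfactor (v j x) (\<xi> j)) powr q) \<partial>?N)"
  proof (rule nn_integral_mono)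
    fix \<xi> :: "int \<times> int \<Rightarrow> real"
    define P where "P = (\<lambda>x. \<Prod>j\<in>J. gfactor (v j x) (\<xi> j))"
    have P: "bounded_fun P" unfolding P_def by (rule bp)
    have upd: "(\<Prod>j\<in>insert i J. gfactor (v j x) ((\<xi>(i := s)) j)) = P x * gfactor (v i x) s" for x s
    proof -
      have "(\<Prod>j\<in>J. gfactor (v j x) ((\<xi>(i := s)) j)) = P x" unfolding P_def using insert.hyps by (intro prod.cong) auto
      then show ?thesis using insert.hyps by (simp add: mult.commute)
    qed
    have "(\<integral>\<^sup>+s. ?f (\<xi>(i := s)) \<partial>std_normal_distribution) = (\<integral>\<^sup>+s. ennreal (kform (\<lambda>p. K p * (P (fst p) * P (snd p))) (\<lambda>x. gfactor (v i x) s) (\<lambda>x. gfactor (v i x) s) powr q) \<partial>std_normal_distribution)"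
      unfolding upd kform_tensor ..
    also have "\<dots> \<le> ennreal ((\<integral>p. (K p * (P (fst p) * P (snd p))) * exp ((2 * q - 1) * (v i (fst p) * v i (snd p))) \<partial>torus2) powr q)"
      by (rule gaussian_hypercontractive_1d[OF psd_tensor[OF insert.prems P] v q])
    also have "\<dots> = ennreal (kform K' P P powr q)" unfolding kform_def K'_def by (simp add: mult_ac)
    finally show "(\<integral>\<^sup>+s. ?f (\<xi>(i := s)) \<partial>std_normal_distribution) \<le> ennreal (kform K' (\<lambda>x. \<Prod>j\<in>J. gfactor (v j x) (\<xi> j)) (\<lambda>x. \<Prod>j\<in>J. gfactor (v j x) (\<xi> j)) powr q)"
      unfolding P_def .
  qed
  also have "\<dots> \<le> ennreal ((\<integral>p. K' p * exp ((2 * q - 1) * (\<Sum>j\<in>J. v j (fst p) * v j (snd p))) \<partial>torus2) powr q)"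
    by (rule insert.IH[OF K'])
  also have "(\<integral>p. K' p * exp ((2 * q - 1) * (\<Sum>j\<in>J. v j (fst p) * v j (snd p))) \<partial>torus2) = (\<integral>p. K p * exp ((2 * q - 1) * (\<Sum>j\<in>insert i J. v j (fst p) * v j (snd p))) \<partial>torus2)"
    unfolding K'_def using insert.hyps by (simp add: distrib_left exp_add mult.assoc)
  finally show ?case .
qed

context gaussian_free_field
begin

text \<open>For p = 2 q the factor 2 q - 1 = p - 1 multiplies a^2, which is the passage from a to a
  sqrt (p - 1). A finite S gives the norm an integrable kernel; the limit over S is taken
  later.\<close>

lemma wexp_hypercontractive:
  assumes J: "finite J" and S: "finite S" and g: "\<And>l. integrable torus (g l)" and w: "\<And>l. w l \<ge> 0" and q: "q \<ge> 1"
  shows "(\<integral>\<^sup>+z. ennreal ((\<Sum>l\<in>S. w l * (\<integral>x. wexp J a z x * g l x \<partial>torus)\<^sup>2) powr q) \<partial>M)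
     \<le> ennreal ((\<Sum>l\<in>S. w l * (\<integral>p. g l (fst p) * g l (snd p) * exp ((2 * q - 1) * a\<^sup>2 * cov J (fst p) (snd p)) \<partial>torus2)) powr q)"
proof -
  define K where "K = (\<lambda>p. \<Sum>l\<in>S. w l * (g l (fst p) * g l (snd p)))"
  have gi: "integrable torus2 (\<lambda>p. g l (fst p) * g l (snd p))" for l by (rule torus_pair.integrable_mult_pair(1)[OF g g])
  have gm [measurable]: "g l \<in> borel_measurable torus" for l using g by simp
  have Ki: "integrable torus2 K" unfolding K_def using gi by simp
  have kf: "kform K \<phi> \<phi> = (\<Sum>l\<in>S. w l * (\<integral>x. \<phi> x * g l x \<partial>torus)\<^sup>2)" if \<phi>: "bounded_fun \<phi>" for \<phi>
  proof -
    obtain B where B: "B \<ge> 0" "\<And>x. \<bar>\<phi> x\<bar> \<le> B" using \<phi> by (rule bounded_funE) blast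
    have i: "integrable torus (\<lambda>x. \<phi> x * g l x)" for l
      using integrable_mult_bounded[OF g bounded_fun_measurable[OF \<phi>] B(2), of l] by (simp add: mult.commute)
    have "kform K \<phi> \<phi> = (\<integral>p. (\<Sum>l\<in>S. w l * ((\<phi> (fst p) * g l (fst p)) * (\<phi> (snd p) * g l (snd p)))) \<partial>torus2)"
      unfolding kform_def K_def sum_distrib_right by (intro Bochner_Integration.integral_cong sum.cong refl) simp
    also have "\<dots> = (\<Sum>l\<in>S. w l * (\<integral>x. \<phi> x * g l x \<partial>torus)\<^sup>2)"
      using torus_pair.integrable_mult_pair[OF i i] by (simp add: power2_eq_square)
    finally show ?thesis .
  qed
  have K: "psd K" unfolding psd_def using Ki w by (auto simp: kf intro!: sum_nonneg)
  \<comment> \<open>Coefficient of the normalised coordinate j in a times the field. The variance in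
    \<open>wexp\<close> splits in the same way, so \<open>wexp\<close> is a product of values of
    \<open>gfactor\<close>.\<close>
  define v where "v = (\<lambda>j x. a * basis_e j x / sqrt (bracket2 j))"
  have v: "bounded_fun (v j)" for j
    unfolding v_def
    using bounded_fun_mult[OF bounded_funI[OF borel_measurable_basis_e abs_basis_e_le] bounded_fun_const[of "a / sqrt (bracket2 j)"], of j]
    by (simp add: mult.commute)
  note [measurable] = v[THEN bounded_fun_measurable]
  have wexp: "wexp J a z x = (\<Prod>j\<in>J. gfactor (v j x) (std_coord j z))" for z x
  proof -
    have "v j x * std_coord j z - (v j x)\<^sup>2 / 2 = a * (z j * basis_e j x) - a\<^sup>2 / 2 * (basis_e j x * basis_e j x / bracket2 j)" for j
      using bracket2_pos[of j] unfolding v_def std_coord_def by (simp add: power_divide power_mult_distrib) (simp add: power2_eq_square)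
    then have "(\<Prod>j\<in>J. gfactor (v j x) (std_coord j z)) = exp (\<Sum>j\<in>J. a * (z j * basis_e j x) - a\<^sup>2 / 2 * (basis_e j x * basis_e j x / bracket2 j))"
      unfolding gfactor_def using J by (simp add: exp_sum)
    also have "(\<Sum>j\<in>J. a * (z j * basis_e j x) - a\<^sup>2 / 2 * (basis_e j x * basis_e j x / bracket2 j)) = a * fld J z x - a\<^sup>2 / 2 * cov J x x"
      unfolding fld_def cov_def by (simp add: sum_subtractf sum_distrib_left)
    finally show ?thesis unfolding wexp_def by simp
  qed
  have bw: "bounded_fun (wexp J a z)" for z
    by (rule bounded_funI[where B="dom_exp J a z", OF measurable_wexp_torus]) (simp add: abs_of_pos wexp_pos wexp_le)
  have fm: "(\<lambda>\<xi>. kform K (\<lambda>x. \<Prod>j\<in>J. gfactor (v j x) (\<xi> j)) (\<lambda>x. \<Prod>j\<in>J. gfactor (v j x) (\<xi> j))) \<in> borel_measurable (PiM J (\<lambda>_. borel))"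
  proof -
    have [measurable]: "K \<in> borel_measurable torus2" using Ki by simp
    show ?thesis unfolding kform_def gfactor_def by (rule torus2.borel_measurable_lebesgue_integral) measurable
  qed
  have "(\<integral>\<^sup>+z. ennreal ((\<Sum>l\<in>S. w l * (\<integral>x. wexp J a z x * g l x \<partial>torus)\<^sup>2) powr q) \<partial>M) = (\<integral>\<^sup>+z. ennreal (kform K (wexp J a z) (wexp J a z) powr q) \<partial>M)"
    unfolding kf[OF bw] ..
  also have "\<dots> = (\<integral>\<^sup>+z. ennreal (kform K (\<lambda>x. \<Prod>j\<in>J. gfactor (v j x) ((\<lambda>k\<in>J. std_coord k z) j)) (\<lambda>x. \<Prod>j\<in>J. gfactor (v j x) ((\<lambda>k\<in>J. std_coord k z) j)) powr q) \<partial>M)"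
    unfolding wexp by (simp cong: prod.cong)
  also have "\<dots> = (\<integral>\<^sup>+\<xi>. ennreal (kform K (\<lambda>x. \<Prod>j\<in>J. gfactor (v j x) (\<xi> j)) (\<lambda>x. \<Prod>j\<in>J. gfactor (v j x) (\<xi> j)) powr q) \<partial>distr M (PiM J (\<lambda>_. borel)) (\<lambda>z. \<lambda>k\<in>J. std_coord k z))"
    using fm by (subst nn_integral_distr) auto
  also have "\<dots> \<le> ennreal ((\<integral>p. K p * exp ((2 * q - 1) * (\<Sum>j\<in>J. v j (fst p) * v j (snd p))) \<partial>torus2) powr q)"
    unfolding distr_std_coords[OF J] by (rule gaussian_hypercontractive[OF J K v q])
  also have "(\<integral>p. K p * exp ((2 * q - 1) * (\<Sum>j\<in>J. v j (fst p) * v j (snd p))) \<partial>torus2) = (\<Sum>l\<in>S. w l * (\<integral>p. g l (fst p) * g l (snd p) * exp ((2 * q - 1) * a\<^sup>2 * cov J (fst p) (snd p)) \<partial>torus2))"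
  proof -
    have vv: "(\<Sum>j\<in>J. v j x * v j y) = a\<^sup>2 * cov J x y" for x y
    proof -
      have "v j x * v j y = a\<^sup>2 * (basis_e j x * basis_e j y / bracket2 j)" for j
        using bracket2_pos[of j] unfolding v_def by (simp add: power2_eq_square)
      then show ?thesis unfolding cov_def by (simp add: sum_distrib_left)
    qed
    define E where "E = (\<lambda>p. exp ((2 * q - 1) * a\<^sup>2 * cov J (fst p) (snd p)))"
    have "integrable torus2 (\<lambda>p. g l (fst p) * g l (snd p) * E p)" for l
    proof (rule integrable_cov_form[OF g])
      fix p
      have "(2 * q - 1) * a\<^sup>2 * cov J (fst p) (snd p) \<le> (2 * q - 1) * a\<^sup>2 * cov_bound J"
        using abs_cov_le[of J "fst p" "snd p"] q by (intro mult_left_mono) auto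
      then show "\<bar>E p\<bar> \<le> exp ((2 * q - 1) * a\<^sup>2 * cov_bound J)" unfolding E_def by simp
    qed (unfold E_def, measurable)
    then have "(\<integral>p. (\<Sum>l\<in>S. w l * (g l (fst p) * g l (snd p) * E p)) \<partial>torus2) = (\<Sum>l\<in>S. w l * (\<integral>p. g l (fst p) * g l (snd p) * E p \<partial>torus2))" by simp
    moreover have "K p * exp ((2 * q - 1) * (\<Sum>j\<in>J. v j (fst p) * v j (snd p))) = (\<Sum>l\<in>S. w l * (g l (fst p) * g l (snd p) * E p))" for p
      unfolding K_def vv E_def by (simp add: sum_distrib_right mult.assoc)
    ultimately show ?thesis unfolding E_def by simp
  qed
  finally show ?thesis .
qed

end

section \<open>Convergence of the Wick series\<close>

text \<open>Interchange of two limits: the error \<open>B m\<close> is uniform in N, and the other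
  error vanishes in N for each fixed m.\<close>

lemma ennreal_tendsto_0_of_approx:
  fixes f :: "nat \<Rightarrow> ennreal"
  assumes le: "\<And>m N. f N \<le> A m N + B m" and A: "\<And>m. A m \<longlonglongrightarrow> 0" and B: "B \<longlonglongrightarrow> 0"
  shows "f \<longlonglongrightarrow> 0"
proof (rule order_tendstoI)
  fix e :: ennreal assume "0 < e"
  then obtain y where y: "0 < y" "y < e" using dense by blast
  then obtain r where "r \<ge> 0" "y = ennreal r" by (cases y) auto
  with y have r: "r > 0" "ennreal r < e" by auto
  have "\<forall>\<^sub>F m in sequentially. B m < ennreal (r / 2)" using B r by (intro order_tendstoD) auto
  then obtain m where m: "B m < ennreal (r / 2)" by (auto simp: eventually_sequentially)
  have "\<forall>\<^sub>F N in sequentially. A m N < ennreal (r / 2)" using A r by (intro order_tendstoD) auto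
  then show "\<forall>\<^sub>F N in sequentially. f N < e"
  proof eventually_elim
    case (elim N)
    have "f N \<le> A m N + B m" by (rule le)
    also have "\<dots> \<le> ennreal (r / 2) + ennreal (r / 2)" using elim m by (intro add_mono) auto
    also have "\<dots> = ennreal r" using r by (subst ennreal_plus[symmetric]) auto
    finally show ?case using r by simp
  qed
qed simp

context gaussian_free_field
begin

definition msq :: "(int \<times> int \<Rightarrow> real) \<Rightarrow> (distribution \<Rightarrow> distribution) \<Rightarrow> ennreal" where
  "msq w F = (\<integral>\<^sup>+z. wnorm2 w (F z) \<partial>M)"

definition coord_meas :: "(distribution \<Rightarrow> distribution) \<Rightarrow> bool" where
  "coord_meas F \<longleftrightarrow> (\<forall>k. (\<lambda>z. F z k) \<in> borel_measurable M)"

lemma coord_measI: "(\<And>k. (\<lambda>z. F z k) \<in> borel_measurable M) \<Longrightarrow> coord_meas F"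
  unfolding coord_meas_def by blast

lemma coord_measD: "coord_meas F \<Longrightarrow> (\<lambda>z. F z k) \<in> borel_measurable M"
  unfolding coord_meas_def by blast

lemma coord_meas_diff: "coord_meas F \<Longrightarrow> coord_meas G \<Longrightarrow> coord_meas (\<lambda>z k. F z k - G z k)"
  by (rule coord_measI, rule borel_measurable_diff) (rule coord_measD, assumption)+

lemma coord_meas_sum: "(\<And>n. coord_meas (F n)) \<Longrightarrow> coord_meas (\<lambda>z k. \<Sum>n<m. c n * F n z k)"
  by (rule coord_measI, intro borel_measurable_sum borel_measurable_times borel_measurable_const) (rule coord_measD)

lemma coord_meas_wnorm2: "coord_meas F \<Longrightarrow> (\<lambda>z. wnorm2 w (F z)) \<in> borel_measurable M"
  by (intro borel_measurable_wnorm2 coord_measD)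

lemma msq_triangle:
  assumes w: "\<And>k. w k \<ge> 0" and F: "coord_meas F" and G: "coord_meas G" and H: "coord_meas H"
  shows "msq w (\<lambda>z k. F z k - H z k) \<le> 2 * msq w (\<lambda>z k. F z k - G z k) + 2 * msq w (\<lambda>z k. G z k - H z k)"
proof -
  note [measurable] = coord_meas_wnorm2[OF coord_meas_diff[OF F G]] coord_meas_wnorm2[OF coord_meas_diff[OF G H]]
  have "msq w (\<lambda>z k. F z k - H z k) \<le> (\<integral>\<^sup>+z. 2 * wnorm2 w (\<lambda>k. F z k - G z k) + 2 * wnorm2 w (\<lambda>k. G z k - H z k) \<partial>M)"
    unfolding msq_def
  proof (rule nn_integral_mono)
    fix z
    show "wnorm2 w (\<lambda>k. F z k - H z k) \<le> 2 * wnorm2 w (\<lambda>k. F z k - G z k) + 2 * wnorm2 w (\<lambda>k. G z k - H z k)"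
      using wnorm2_add_le[of w "\<lambda>k. F z k - G z k" "\<lambda>k. G z k - H z k", OF w] by simp
  qed
  also have "\<dots> = 2 * msq w (\<lambda>z k. F z k - G z k) + 2 * msq w (\<lambda>z k. G z k - H z k)"
    unfolding msq_def by (simp add: nn_integral_add nn_integral_cmult)
  finally show ?thesis .
qed

lemma msq_add_scale_le:
  assumes w: "\<And>k. w k \<ge> 0" and F: "coord_meas F" and G: "coord_meas G"
  shows "msq w (\<lambda>z k. F z k + c * G z k) \<le> 2 * msq w F + 2 * (ennreal (c\<^sup>2) * msq w G)"
proof -
  note [measurable] = coord_meas_wnorm2[OF F] coord_meas_wnorm2[OF G]
  have "msq w (\<lambda>z k. F z k + c * G z k) \<le> (\<integral>\<^sup>+z. 2 * wnorm2 w (F z) + 2 * (ennreal (c\<^sup>2) * wnorm2 w (G z)) \<partial>M)"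
    unfolding msq_def
  proof (rule nn_integral_mono)
    fix z
    show "wnorm2 w (\<lambda>k. F z k + c * G z k) \<le> 2 * wnorm2 w (F z) + 2 * (ennreal (c\<^sup>2) * wnorm2 w (G z))"
      using wnorm2_add_le[of w "F z" "\<lambda>k. c * G z k", OF w] by (simp only: wnorm2_scale)
  qed
  also have "\<dots> = 2 * msq w F + 2 * (ennreal (c\<^sup>2) * msq w G)"
    unfolding msq_def by (simp add: nn_integral_add nn_integral_cmult)
  finally show ?thesis .
qed

lemma msq_commute: "msq w (\<lambda>z k. F z k - G z k) = msq w (\<lambda>z k. G z k - F z k)"
  unfolding msq_def by (subst wnorm2_minus_commute) simp

lemma msq_coords:
  assumes w: "\<And>k. w k \<ge> 0" and F: "coord_meas F"
  shows "msq w F = (\<integral>\<^sup>+k. ennreal (w k) * (\<integral>\<^sup>+z. ennreal ((F z k)\<^sup>2) \<partial>M) \<partial>count_space UNIV)"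
proof -
  note [measurable] = coord_measD[OF F]
  have "msq w F = (\<Sum>n. \<integral>\<^sup>+z. ennreal (w (lattice_point n) * (F z (lattice_point n))\<^sup>2) \<partial>M)"
    unfolding msq_def wnorm2_def nn_integral_lattice by (rule nn_integral_suminf) measurable
  also have "\<dots> = (\<Sum>n. ennreal (w (lattice_point n)) * (\<integral>\<^sup>+z. ennreal ((F z (lattice_point n))\<^sup>2) \<partial>M))"
    using w by (simp add: ennreal_mult nn_integral_cmult)
  finally show ?thesis unfolding nn_integral_lattice .
qed

definition ecoef :: "(int \<times> int) set \<Rightarrow> real \<Rightarrow> (int \<times> int \<Rightarrow> real \<times> real \<Rightarrow> real) \<Rightarrow> distribution \<Rightarrow> distribution" where
  "ecoef J a g z k = (\<integral>x. wexp J a z x * g k x \<partial>torus)"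

text \<open>\<open>fact n\<close> restores the normalisation of the Wick power, so these are
  coefficients of the truncated Wick power itself.\<close>

definition pcoef :: "(int \<times> int) set \<Rightarrow> nat \<Rightarrow> (int \<times> int \<Rightarrow> real \<times> real \<Rightarrow> real) \<Rightarrow> distribution \<Rightarrow> distribution" where
  "pcoef J n g z k = (\<integral>x. (fact n * wpow J n z x) * g k x \<partial>torus)"

lemma coord_meas_ecoef:
  assumes g: "\<And>k. integrable torus (g k)"
  shows "coord_meas (ecoef J a g)"
  unfolding coord_meas_def ecoef_def
proof
  fix k
  have [measurable]: "g k \<in> borel_measurable torus" using g by simp
  show "(\<lambda>z. \<integral>x. wexp J a z x * g k x \<partial>torus) \<in> borel_measurable M"
    by (rule torus.borel_measurable_lebesgue_integral) (simp add: case_prod_unfold)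
qed

lemma coord_meas_pcoef:
  assumes g: "\<And>k. integrable torus (g k)"
  shows "coord_meas (pcoef J n g)"
  unfolding coord_meas_def pcoef_def
proof
  fix k
  have [measurable]: "g k \<in> borel_measurable torus" using g by simp
  show "(\<lambda>z. \<integral>x. (fact n * wpow J n z x) * g k x \<partial>torus) \<in> borel_measurable M"
    by (rule torus.borel_measurable_lebesgue_integral) (simp add: case_prod_unfold)
qed

lemma wpow_integrable:
  assumes g: "integrable torus g"
  shows "integrable torus (\<lambda>x. wpow J n z x * g x)" "integrable torus (\<lambda>x. wexp J a z x * g x)"
proof -
  have "integrable torus (\<lambda>x. g x * wpow J n z x)"
  proof (rule integrable_mult_bounded[OF g measurable_wpow_torus])
    show "\<bar>wpow J n z x\<bar> \<le> dom_exp J 1 z" for x using wpow_term_le[of 1 n J z x] by simp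
  qed
  then show "integrable torus (\<lambda>x. wpow J n z x * g x)" by (simp add: mult.commute)
  have "integrable torus (\<lambda>x. g x * wexp J a z x)"
  proof (rule integrable_mult_bounded[OF g measurable_wexp_torus])
    show "\<bar>wexp J a z x\<bar> \<le> dom_exp J a z" for x using wexp_le[of J a z x] wexp_pos[of J a z x] by simp
  qed
  then show "integrable torus (\<lambda>x. wexp J a z x * g x)" by (simp add: mult.commute)
qed

lemma ecoef_remainder:
  assumes g: "\<And>k. integrable torus (g k)"
  shows "ecoef J a g z k - (\<Sum>n<m. a ^ n / fact n * pcoef J n g z k) = (\<integral>x. remainder J m a z x * g k x \<partial>torus)"
proof -
  have p: "a ^ n / fact n * pcoef J n g z k = a ^ n * (\<integral>x. wpow J n z x * g k x \<partial>torus)" for n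
  proof -
    have "pcoef J n g z k = fact n * (\<integral>x. wpow J n z x * g k x \<partial>torus)" unfolding pcoef_def mult.assoc by simp
    then show ?thesis by simp
  qed
  have "(\<integral>x. remainder J m a z x * g k x \<partial>torus) = (\<integral>x. wexp J a z x * g k x - (\<Sum>n<m. a ^ n * (wpow J n z x * g k x)) \<partial>torus)"
    unfolding remainder_def by (simp only: left_diff_distrib sum_distrib_right mult.assoc)
  also have "\<dots> = (\<integral>x. wexp J a z x * g k x \<partial>torus) - (\<Sum>n<m. a ^ n * (\<integral>x. wpow J n z x * g k x \<partial>torus))"
    using wpow_integrable[OF g] by simp
  finally show ?thesis unfolding p ecoef_def by simp
qed

lemma ecoef_second_moment:
  assumes J: "finite J" and g: "\<And>k. integrable torus (g k)"
  shows "(\<integral>\<^sup>+z. ennreal ((ecoef J a g z k)\<^sup>2) \<partial>M) = ennreal (\<integral>p. g k (fst p) * g k (snd p) * exp (a\<^sup>2 * cov J (fst p) (snd p)) \<partial>torus2)"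
  unfolding ecoef_def using wexp_second_moment[OF J g, of a k] by (subst nn_integral_eq_integral) auto

text \<open>The scalar tail estimate holds for each test function with the same factor, so it passes
  to the weighted sum over k by Tonelli.\<close>

lemma msq_remainder_le:
  assumes J: "finite J" and g: "\<And>k. integrable torus (g k)" and w: "\<And>k. w k \<ge> 0" and ab: "\<bar>a\<bar> \<le> \<bar>b\<bar>" "b \<noteq> 0"
  shows "msq w (\<lambda>z k. ecoef J a g z k - (\<Sum>n<m. a ^ n / fact n * pcoef J n g z k)) \<le> ennreal ((a\<^sup>2 / b\<^sup>2) ^ m) * msq w (ecoef J b g)"
proof -
  let ?R = "\<lambda>z k. ecoef J a g z k - (\<Sum>n<m. a ^ n / fact n * pcoef J n g z k)"
  have cm: "coord_meas ?R"
    by (intro coord_meas_diff coord_meas_ecoef coord_meas_sum coord_meas_pcoef g)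
  have le: "(\<integral>\<^sup>+z. ennreal ((?R z k)\<^sup>2) \<partial>M) \<le> ennreal ((a\<^sup>2 / b\<^sup>2) ^ m) * (\<integral>\<^sup>+z. ennreal ((ecoef J b g z k)\<^sup>2) \<partial>M)" for k
  proof -
    note r = remainder_second_moment_le[OF J g ab, of m k]
    have "(\<integral>\<^sup>+z. ennreal ((?R z k)\<^sup>2) \<partial>M) = ennreal (\<integral>z. (\<integral>x. remainder J m a z x * g k x \<partial>torus)\<^sup>2 \<partial>M)"
      unfolding ecoef_remainder[OF g] using r(1) by (intro nn_integral_eq_integral) auto
    also have "\<dots> \<le> ennreal ((a\<^sup>2 / b\<^sup>2) ^ m * (\<integral>z. (\<integral>x. wexp J b z x * g k x \<partial>torus)\<^sup>2 \<partial>M))" by (rule ennreal_leI[OF r(2)])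
    also have "\<dots> = ennreal ((a\<^sup>2 / b\<^sup>2) ^ m) * ennreal (\<integral>z. (\<integral>x. wexp J b z x * g k x \<partial>torus)\<^sup>2 \<partial>M)" by (rule ennreal_mult') simp
    also have "ennreal (\<integral>z. (\<integral>x. wexp J b z x * g k x \<partial>torus)\<^sup>2 \<partial>M) = (\<integral>\<^sup>+z. ennreal ((ecoef J b g z k)\<^sup>2) \<partial>M)"
      unfolding ecoef_def using wexp_second_moment(1)[OF J g] by (intro nn_integral_eq_integral[symmetric]) auto
    finally show ?thesis .
  qed
  have "msq w ?R \<le> (\<integral>\<^sup>+k. ennreal ((a\<^sup>2 / b\<^sup>2) ^ m) * (ennreal (w k) * (\<integral>\<^sup>+z. ennreal ((ecoef J b g z k)\<^sup>2) \<partial>M)) \<partial>count_space UNIV)"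
    unfolding msq_coords[OF w cm]
  proof (rule nn_integral_mono)
    fix k
    show "ennreal (w k) * (\<integral>\<^sup>+z. ennreal ((?R z k)\<^sup>2) \<partial>M) \<le> ennreal ((a\<^sup>2 / b\<^sup>2) ^ m) * (ennreal (w k) * (\<integral>\<^sup>+z. ennreal ((ecoef J b g z k)\<^sup>2) \<partial>M))"
      using mult_left_mono[OF le[of k], of "ennreal (w k)"] by (simp only: mult.left_commute zero_le)
  qed
  also have "\<dots> = ennreal ((a\<^sup>2 / b\<^sup>2) ^ m) * msq w (ecoef J b g)"
    unfolding msq_coords[OF w coord_meas_ecoef[OF g]] by (rule nn_integral_cmult) simp
  finally show ?thesis .
qed

text \<open>\<open>J N\<close> are the lattice points of the \<open>N\<close>-th cutoff, \<open>g\<close> is the family of test functions (the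
  basis for the first part of the theorem, a constant family for the second) and \<open>\<Phi>\<close> are the Wick powers
  tested against \<open>g\<close>.\<close>

definition wick_data :: "(nat \<Rightarrow> (int \<times> int) set) \<Rightarrow> (int \<times> int \<Rightarrow> real \<times> real \<Rightarrow> real) \<Rightarrow> (int \<times> int \<Rightarrow> real) \<Rightarrow> real \<Rightarrow>
    (nat \<Rightarrow> distribution \<Rightarrow> distribution) \<Rightarrow> bool" where
  "wick_data J g w b0 \<Phi> \<longleftrightarrow> (\<forall>N. finite (J N)) \<and> (\<forall>k. integrable torus (g k)) \<and> (\<forall>k. w k \<ge> 0) \<and> (\<forall>n. coord_meas (\<Phi> n)) \<and>
     (\<forall>n. (\<lambda>N. msq w (\<lambda>z k. pcoef (J N) n g z k - \<Phi> n z k)) \<longlonglongrightarrow> 0) \<and>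
     (\<forall>b. \<bar>b\<bar> < b0 \<longrightarrow> (\<exists>C\<ge>0. \<forall>N. msq w (ecoef (J N) b g) \<le> ennreal C))"

definition wick_sum :: "(nat \<Rightarrow> distribution \<Rightarrow> distribution) \<Rightarrow> real \<Rightarrow> nat \<Rightarrow> distribution \<Rightarrow> distribution" where
  "wick_sum \<Phi> a m z k = (\<Sum>n<m. a ^ n / fact n * \<Phi> n z k)"

lemma wick_sum_approx:
  assumes data: "wick_data J g w b0 \<Phi>"
  shows "(\<lambda>N. msq w (\<lambda>z k. wick_sum (\<lambda>n. pcoef (J N) n g) a m z k - wick_sum \<Phi> a m z k)) \<longlonglongrightarrow> 0"
proof (induction m)
  case 0
  then show ?case unfolding wick_sum_def msq_def by simp
next
  case (Suc m)
  have w: "\<And>k. w k \<ge> 0" and g: "\<And>k. integrable torus (g k)" and \<Phi>: "\<And>n. coord_meas (\<Phi> n)"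
    and lim: "(\<lambda>N. msq w (\<lambda>z k. pcoef (J N) m g z k - \<Phi> m z k)) \<longlonglongrightarrow> 0" using data unfolding wick_data_def by auto
  define c where "c = a ^ m / fact m"
  have cm: "coord_meas (wick_sum \<Phi> a m)" "coord_meas (wick_sum (\<lambda>n. pcoef (J N) n g) a m)" for N
    unfolding wick_sum_def[abs_def] by (intro coord_meas_sum \<Phi> coord_meas_pcoef g)+
  have bound: "msq w (\<lambda>z k. wick_sum (\<lambda>n. pcoef (J N) n g) a (Suc m) z k - wick_sum \<Phi> a (Suc m) z k)
     \<le> 2 * msq w (\<lambda>z k. wick_sum (\<lambda>n. pcoef (J N) n g) a m z k - wick_sum \<Phi> a m z k) + 2 * (ennreal (c\<^sup>2) * msq w (\<lambda>z k. pcoef (J N) m g z k - \<Phi> m z k))" for N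
  proof -
    let ?D = "\<lambda>z k. wick_sum (\<lambda>n. pcoef (J N) n g) a m z k - wick_sum \<Phi> a m z k"
    let ?E = "\<lambda>z k. pcoef (J N) m g z k - \<Phi> m z k"
    have "(\<lambda>z k. wick_sum (\<lambda>n. pcoef (J N) n g) a (Suc m) z k - wick_sum \<Phi> a (Suc m) z k) = (\<lambda>z k. ?D z k + c * ?E z k)"
      unfolding wick_sum_def c_def by (auto simp: algebra_simps)
    then show ?thesis
      using msq_add_scale_le[OF w coord_meas_diff[OF cm(2) cm(1)] coord_meas_diff[OF coord_meas_pcoef[OF g] \<Phi>]] by (simp only:)
  qed
  have "(\<lambda>N. 2 * msq w (\<lambda>z k. wick_sum (\<lambda>n. pcoef (J N) n g) a m z k - wick_sum \<Phi> a m z k) + 2 * (ennreal (c\<^sup>2) * msq w (\<lambda>z k. pcoef (J N) m g z k - \<Phi> m z k))) \<longlonglongrightarrow> 2 * 0 + 2 * (ennreal (c\<^sup>2) * 0)"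
    by (intro tendsto_add ennreal_tendsto_cmult Suc.IH lim) auto
  then have "(\<lambda>N. 2 * msq w (\<lambda>z k. wick_sum (\<lambda>n. pcoef (J N) n g) a m z k - wick_sum \<Phi> a m z k) + 2 * (ennreal (c\<^sup>2) * msq w (\<lambda>z k. pcoef (J N) m g z k - \<Phi> m z k))) \<longlonglongrightarrow> 0" by simp
  then show ?case by (rule tendsto_sandwich[OF _ _ tendsto_const, rotated 2]) (auto intro: always_eventually bound)
qed

text \<open>The partial sum is compared with the truncated exponential through the truncated partial
  sum: one error is the approximation of finitely many Wick powers, the other a geometric tail,
  bounded by means of a parameter b between |a| and \<open>b0\<close>.\<close>

lemma wick_sum_ecoef_bound:
  assumes data: "wick_data J g w b0 \<Phi>" and a: "\<bar>a\<bar> < b0"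
  shows "\<exists>\<sigma> C. 0 < \<sigma> \<and> \<sigma> < 1 \<and> C \<ge> 0 \<and> (\<forall>m N. msq w (\<lambda>z k. wick_sum \<Phi> a m z k - ecoef (J N) a g z k)
      \<le> 2 * msq w (\<lambda>z k. wick_sum (\<lambda>n. pcoef (J N) n g) a m z k - wick_sum \<Phi> a m z k) + ennreal (C * \<sigma> ^ (4 * m)))"
proof -
  have J: "\<And>N. finite (J N)" and w: "\<And>k. w k \<ge> 0" and g: "\<And>k. integrable torus (g k)" and \<Phi>: "\<And>n. coord_meas (\<Phi> n)" using data unfolding wick_data_def by auto
  define b where "b = (\<bar>a\<bar> + b0) / 2"
  have b: "\<bar>a\<bar> < b" "b < b0" "b > 0" using a unfolding b_def by auto
  obtain C where C: "C \<ge> 0" "\<And>N. msq w (ecoef (J N) b g) \<le> ennreal C" using data b unfolding wick_data_def by (metis abs_of_pos)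
  define \<rho> where "\<rho> = a\<^sup>2 / b\<^sup>2"
  have \<rho>: "0 \<le> \<rho>" "\<rho> < 1"
  proof -
    have "\<bar>a\<bar>\<^sup>2 < b\<^sup>2" using b by (intro power_strict_mono) auto
    then show "0 \<le> \<rho>" "\<rho> < 1" unfolding \<rho>_def using b by (auto simp: divide_less_eq)
  qed
  \<comment> \<open>A fourth root, so that half of the decay can later be spent on a weight in a
    summation; the average with 1 keeps \<sigma> positive when a = 0.\<close>
  define \<sigma> where "\<sigma> = ((1 + \<rho>) / 2) powr (1 / 4)"
  have \<sigma>: "0 < \<sigma>" "\<sigma> < 1" "\<sigma> ^ 4 = (1 + \<rho>) / 2"
  proof -
    show "0 < \<sigma>" unfolding \<sigma>_def using \<rho> by simp
    show "\<sigma> < 1" unfolding \<sigma>_def using \<rho> powr_less_mono2[of "1 / 4" "(1 + \<rho>) / 2" 1] by simp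
    have "\<sigma> ^ 4 = \<sigma> powr 4" using \<open>0 < \<sigma>\<close> by simp
    also have "\<dots> = (1 + \<rho>) / 2" unfolding \<sigma>_def powr_powr using \<rho> by simp
    finally show "\<sigma> ^ 4 = (1 + \<rho>) / 2" .
  qed
  have \<rho>\<sigma>: "\<rho> ^ m \<le> \<sigma> ^ (4 * m)" for m
  proof -
    have "\<rho> ^ m \<le> (\<sigma> ^ 4) ^ m" using \<rho> \<sigma>(3) by (intro power_mono) auto
    then show ?thesis by (simp add: power_mult)
  qed
  have "msq w (\<lambda>z k. wick_sum \<Phi> a m z k - ecoef (J N) a g z k)
      \<le> 2 * msq w (\<lambda>z k. wick_sum (\<lambda>n. pcoef (J N) n g) a m z k - wick_sum \<Phi> a m z k) + ennreal (2 * C * \<sigma> ^ (4 * m))" for m N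
  proof -
    let ?P = "wick_sum (\<lambda>n. pcoef (J N) n g) a m"
    have cm: "coord_meas (wick_sum \<Phi> a m)" "coord_meas ?P"
      unfolding wick_sum_def[abs_def] by (intro coord_meas_sum \<Phi> coord_meas_pcoef g)+
    have "msq w (\<lambda>z k. wick_sum \<Phi> a m z k - ecoef (J N) a g z k) \<le> 2 * msq w (\<lambda>z k. wick_sum \<Phi> a m z k - ?P z k) + 2 * msq w (\<lambda>z k. ?P z k - ecoef (J N) a g z k)"
      by (rule msq_triangle[OF w cm(1) cm(2) coord_meas_ecoef[OF g]])
    also have "msq w (\<lambda>z k. wick_sum \<Phi> a m z k - ?P z k) = msq w (\<lambda>z k. ?P z k - wick_sum \<Phi> a m z k)" by (rule msq_commute)
    also have "msq w (\<lambda>z k. ?P z k - ecoef (J N) a g z k) = msq w (\<lambda>z k. ecoef (J N) a g z k - ?P z k)" by (rule msq_commute)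
    also have "\<dots> \<le> ennreal (\<rho> ^ m) * msq w (ecoef (J N) b g)"
      unfolding wick_sum_def \<rho>_def using b by (intro msq_remainder_le J g w) auto
    also have "\<dots> \<le> ennreal (\<sigma> ^ (4 * m)) * ennreal C"
      using \<rho>\<sigma> C by (intro mult_mono ennreal_leI) auto
    also have "2 * (ennreal (\<sigma> ^ (4 * m)) * ennreal C) = ennreal (2 * C * \<sigma> ^ (4 * m))"
    proof -
      have "ennreal (2 * C * \<sigma> ^ (4 * m)) = ennreal (2 * (\<sigma> ^ (4 * m) * C))" by (simp only: mult_ac)
      also have "\<dots> = 2 * (ennreal (\<sigma> ^ (4 * m)) * ennreal C)" using C \<sigma> by (simp add: ennreal_mult)
      finally show ?thesis by simp
    qed
    finally show ?thesis by (simp add: mult_left_mono add_left_mono)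
  qed
  then show ?thesis using \<sigma> C by (intro exI[of _ \<sigma>] exI[of _ "2 * C"]) auto
qed

text \<open>The truncated exponential serves as a common middle point of two partial sums. The
  approximation errors vanish as N grows, while the geometric bound does not depend on N.\<close>

lemma wick_sum_Cauchy:
  assumes data: "wick_data J g w b0 \<Phi>" and a: "\<bar>a\<bar> < b0"
  shows "\<exists>\<sigma> C. 0 < \<sigma> \<and> \<sigma> < 1 \<and> C \<ge> 0 \<and> (\<forall>m l. m \<le> l \<longrightarrow> msq w (\<lambda>z k. wick_sum \<Phi> a m z k - wick_sum \<Phi> a l z k) \<le> ennreal (C * \<sigma> ^ (4 * m)))"
proof -
  have w: "\<And>k. w k \<ge> 0" and g: "\<And>k. integrable torus (g k)" and \<Phi>: "\<And>n. coord_meas (\<Phi> n)" using data unfolding wick_data_def by auto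
  obtain \<sigma> C where \<sigma>: "0 < \<sigma>" "\<sigma> < 1" "C \<ge> 0" and bd: "\<And>m N. msq w (\<lambda>z k. wick_sum \<Phi> a m z k - ecoef (J N) a g z k)
      \<le> 2 * msq w (\<lambda>z k. wick_sum (\<lambda>n. pcoef (J N) n g) a m z k - wick_sum \<Phi> a m z k) + ennreal (C * \<sigma> ^ (4 * m))"
    using wick_sum_ecoef_bound[OF data a] by blast
  define q where "q = (\<lambda>m N. msq w (\<lambda>z k. wick_sum (\<lambda>n. pcoef (J N) n g) a m z k - wick_sum \<Phi> a m z k))"
  have q: "q m \<longlonglongrightarrow> 0" for m unfolding q_def by (rule wick_sum_approx[OF data])
  have cm: "coord_meas (wick_sum \<Phi> a m)" for m unfolding wick_sum_def[abs_def] by (intro coord_meas_sum \<Phi>)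
  have "msq w (\<lambda>z k. wick_sum \<Phi> a m z k - wick_sum \<Phi> a l z k) \<le> ennreal (4 * C * \<sigma> ^ (4 * m))" if ml: "m \<le> l" for m l
  proof -
    have "\<sigma> ^ (4 * l) \<le> \<sigma> ^ (4 * m)" using \<sigma> ml by (intro power_decreasing) auto
    then have C: "ennreal (C * \<sigma> ^ (4 * l)) \<le> ennreal (C * \<sigma> ^ (4 * m))" using \<sigma> by (intro ennreal_leI mult_left_mono) auto
    have le: "msq w (\<lambda>z k. wick_sum \<Phi> a m z k - wick_sum \<Phi> a l z k) \<le> 2 * (2 * q m N + ennreal (C * \<sigma> ^ (4 * m))) + 2 * (2 * q l N + ennreal (C * \<sigma> ^ (4 * m)))" for N
    proof -
      have "msq w (\<lambda>z k. wick_sum \<Phi> a m z k - wick_sum \<Phi> a l z k) \<le> 2 * msq w (\<lambda>z k. wick_sum \<Phi> a m z k - ecoef (J N) a g z k) + 2 * msq w (\<lambda>z k. ecoef (J N) a g z k - wick_sum \<Phi> a l z k)"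
        by (rule msq_triangle[OF w cm coord_meas_ecoef[OF g] cm])
      also have "msq w (\<lambda>z k. ecoef (J N) a g z k - wick_sum \<Phi> a l z k) = msq w (\<lambda>z k. wick_sum \<Phi> a l z k - ecoef (J N) a g z k)" by (rule msq_commute)
      also have "2 * msq w (\<lambda>z k. wick_sum \<Phi> a m z k - ecoef (J N) a g z k) + 2 * msq w (\<lambda>z k. wick_sum \<Phi> a l z k - ecoef (J N) a g z k)
         \<le> 2 * (2 * q m N + ennreal (C * \<sigma> ^ (4 * m))) + 2 * (2 * q l N + ennreal (C * \<sigma> ^ (4 * m)))"
        unfolding q_def by (intro add_mono mult_left_mono order_trans[OF bd] order_refl C) auto
      finally show ?thesis .
    qed
    have "(\<lambda>N. 2 * (2 * q m N + ennreal (C * \<sigma> ^ (4 * m))) + 2 * (2 * q l N + ennreal (C * \<sigma> ^ (4 * m)))) \<longlonglongrightarrow> 2 * (2 * 0 + ennreal (C * \<sigma> ^ (4 * m))) + 2 * (2 * 0 + ennreal (C * \<sigma> ^ (4 * m)))"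
      by (intro tendsto_add ennreal_tendsto_cmult q tendsto_const) auto
    then have "msq w (\<lambda>z k. wick_sum \<Phi> a m z k - wick_sum \<Phi> a l z k) \<le> 2 * (2 * 0 + ennreal (C * \<sigma> ^ (4 * m))) + 2 * (2 * 0 + ennreal (C * \<sigma> ^ (4 * m)))"
      by (rule LIMSEQ_le_const) (intro exI[of _ 0] allI impI le)
    also have "\<dots> = ennreal (4 * C * \<sigma> ^ (4 * m))"
    proof -
      have e: "2 * ennreal y + 2 * ennreal y = ennreal (4 * y)" if "y \<ge> 0" for y
      proof -
        have "2 * ennreal y = ennreal (2 * y)" using that by (simp add: ennreal_mult)
        then show ?thesis using that by (simp add: ennreal_plus[symmetric] del: ennreal_plus)
      qed
      show ?thesis using e[of "C * \<sigma> ^ (4 * m)"] \<sigma> by (simp add: mult.assoc)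
    qed
    finally show ?thesis .
  qed
  then show ?thesis using \<sigma> by (intro exI[of _ \<sigma>] exI[of _ "4 * C"]) auto
qed

text \<open>The partial sum of order m is close to W, and close to the truncated exponential
  uniformly in N up to a term that vanishes for fixed m; \<open>ennreal_tendsto_0_of_approx\<close>
  concludes.\<close>

lemma ecoef_tendsto:
  assumes data: "wick_data J g w b0 \<Phi>" and a: "\<bar>a\<bar> < b0" and W: "coord_meas W"
    and lim: "(\<lambda>m. msq w (\<lambda>z k. wick_sum \<Phi> a m z k - W z k)) \<longlonglongrightarrow> 0"
  shows "(\<lambda>N. msq w (\<lambda>z k. ecoef (J N) a g z k - W z k)) \<longlonglongrightarrow> 0"
proof -
  have w: "\<And>k. w k \<ge> 0" and g: "\<And>k. integrable torus (g k)" and \<Phi>: "\<And>n. coord_meas (\<Phi> n)" using data unfolding wick_data_def by auto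
  obtain \<sigma> C where \<sigma>: "0 < \<sigma>" "\<sigma> < 1" "C \<ge> 0" and bd: "\<And>m N. msq w (\<lambda>z k. wick_sum \<Phi> a m z k - ecoef (J N) a g z k)
      \<le> 2 * msq w (\<lambda>z k. wick_sum (\<lambda>n. pcoef (J N) n g) a m z k - wick_sum \<Phi> a m z k) + ennreal (C * \<sigma> ^ (4 * m))"
    using wick_sum_ecoef_bound[OF data a] by blast
  define q where "q = (\<lambda>m N. msq w (\<lambda>z k. wick_sum (\<lambda>n. pcoef (J N) n g) a m z k - wick_sum \<Phi> a m z k))"
  have q: "q m \<longlonglongrightarrow> 0" for m unfolding q_def by (rule wick_sum_approx[OF data])
  have cm: "coord_meas (wick_sum \<Phi> a m)" for m unfolding wick_sum_def[abs_def] by (intro coord_meas_sum \<Phi>)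
  show ?thesis
  proof (rule ennreal_tendsto_0_of_approx)
    fix m N
    have "msq w (\<lambda>z k. ecoef (J N) a g z k - W z k) \<le> 2 * msq w (\<lambda>z k. ecoef (J N) a g z k - wick_sum \<Phi> a m z k) + 2 * msq w (\<lambda>z k. wick_sum \<Phi> a m z k - W z k)"
      by (rule msq_triangle[OF w coord_meas_ecoef[OF g] cm W])
    also have "msq w (\<lambda>z k. ecoef (J N) a g z k - wick_sum \<Phi> a m z k) = msq w (\<lambda>z k. wick_sum \<Phi> a m z k - ecoef (J N) a g z k)" by (rule msq_commute)
    also have "2 * msq w (\<lambda>z k. wick_sum \<Phi> a m z k - ecoef (J N) a g z k) \<le> 2 * (2 * q m N + ennreal (C * \<sigma> ^ (4 * m)))"
      unfolding q_def by (intro mult_left_mono bd) auto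
    finally show "msq w (\<lambda>z k. ecoef (J N) a g z k - W z k) \<le> 2 * (2 * q m N) + (2 * ennreal (C * \<sigma> ^ (4 * m)) + 2 * msq w (\<lambda>z k. wick_sum \<Phi> a m z k - W z k))"
      by (simp add: distrib_left add.assoc add_right_mono)
  next
    fix m
    have "(\<lambda>N. 2 * (2 * q m N)) \<longlonglongrightarrow> 2 * (2 * 0)" by (intro ennreal_tendsto_cmult q) auto
    then show "(\<lambda>N. 2 * (2 * q m N)) \<longlonglongrightarrow> 0" by simp
  next
    have "(\<lambda>m. \<sigma> ^ (4 * m)) \<longlonglongrightarrow> 0"
    proof -
      have "(\<lambda>m. (\<sigma> ^ 4) ^ m) \<longlonglongrightarrow> 0" using \<sigma> by (intro LIMSEQ_power_zero) (auto simp: power_less_one_iff)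
      then show ?thesis by (simp add: power_mult)
    qed
    then have "(\<lambda>m. ennreal (C * \<sigma> ^ (4 * m))) \<longlonglongrightarrow> ennreal (C * 0)" by (intro tendsto_ennrealI tendsto_mult_left)
    then have "(\<lambda>m. 2 * ennreal (C * \<sigma> ^ (4 * m)) + 2 * msq w (\<lambda>z k. wick_sum \<Phi> a m z k - W z k)) \<longlonglongrightarrow> 2 * ennreal (C * 0) + 2 * 0"
      by (intro tendsto_add ennreal_tendsto_cmult lim) auto
    then show "(\<lambda>m. 2 * ennreal (C * \<sigma> ^ (4 * m)) + 2 * msq w (\<lambda>z k. wick_sum \<Phi> a m z k - W z k)) \<longlonglongrightarrow> 0" by simp
  qed
qed

text \<open>A Riesz-Fischer argument in coordinates: the geometrically Cauchy partial sums converge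
  almost surely in every coordinate of positive weight, and Fatou's lemma gives convergence in mean
  square.\<close>

lemma wick_sum_limit_exists:
  assumes data: "wick_data J g w b0 \<Phi>" and a: "\<bar>a\<bar> < b0" and fin: "\<And>m. msq w (wick_sum \<Phi> a m) < \<infinity>"
  shows "\<exists>W. coord_meas W \<and> (\<forall>z. wnorm2 w (W z) < \<infinity>) \<and> (\<lambda>m. msq w (\<lambda>z k. wick_sum \<Phi> a m z k - W z k)) \<longlonglongrightarrow> 0"
proof -
  have w: "\<And>k. w k \<ge> 0" and \<Phi>: "\<And>n. coord_meas (\<Phi> n)" using data unfolding wick_data_def by auto
  define S where "S = wick_sum \<Phi> a"
  have cm: "coord_meas (S m)" for m unfolding S_def wick_sum_def[abs_def] by (intro coord_meas_sum \<Phi>)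
  note Sm [measurable] = coord_measD[OF cm]
  obtain \<sigma> C where \<sigma>: "0 < \<sigma>" "\<sigma> < 1" "C \<ge> 0" and Cau: "\<And>m l. m \<le> l \<Longrightarrow> msq w (\<lambda>z k. S m z k - S l z k) \<le> ennreal (C * \<sigma> ^ (4 * m))"
    using wick_sum_Cauchy[OF data a] unfolding S_def by blast
  \<comment> \<open>In mean these increments decay like \<sigma>^(4 m), so even with the weight
    \<sigma>^(- 2 m) their sum is integrable. Its almost sure finiteness bounds the m-th increment
    by D \<sigma>^(2 m).\<close>
  define d where "d = (\<lambda>m z. wnorm2 w (\<lambda>k. S m z k - S (Suc m) z k))"
  have dm [measurable]: "d m \<in> borel_measurable M" for m unfolding d_def by (rule coord_meas_wnorm2[OF coord_meas_diff[OF cm cm]])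
  have "(\<integral>\<^sup>+z. (\<Sum>m. ennreal (inverse \<sigma> ^ (2 * m)) * d m z) \<partial>M) = (\<Sum>m. \<integral>\<^sup>+z. ennreal (inverse \<sigma> ^ (2 * m)) * d m z \<partial>M)"
    by (rule nn_integral_suminf) measurable
  also have "\<dots> \<le> (\<Sum>m. ennreal (C * (\<sigma>\<^sup>2) ^ m))"
  proof (intro suminf_le summableI)
    fix m
    have "(\<integral>\<^sup>+z. ennreal (inverse \<sigma> ^ (2 * m)) * d m z \<partial>M) = ennreal (inverse \<sigma> ^ (2 * m)) * msq w (\<lambda>z k. S m z k - S (Suc m) z k)"
      using nn_integral_cmult[OF dm[of m], of "ennreal (inverse \<sigma> ^ (2 * m))"] unfolding msq_def d_def .
    also have "\<dots> \<le> ennreal (inverse \<sigma> ^ (2 * m)) * ennreal (C * \<sigma> ^ (4 * m))" by (intro mult_left_mono Cau) auto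
    also have "\<dots> = ennreal (C * (\<sigma>\<^sup>2) ^ m)"
    proof -
      have "4 * m = 2 * m + 2 * m" by simp
      then have "inverse \<sigma> ^ (2 * m) * (C * \<sigma> ^ (4 * m)) = C * (inverse \<sigma> * \<sigma>) ^ (2 * m) * \<sigma> ^ (2 * m)"
        by (simp only: power_add power_mult_distrib mult_ac)
      also have "\<dots> = C * (\<sigma>\<^sup>2) ^ m" using \<sigma> by (simp add: power_mult)
      finally show ?thesis using \<sigma> by (simp add: ennreal_mult'[symmetric])
    qed
    finally show "(\<integral>\<^sup>+z. ennreal (inverse \<sigma> ^ (2 * m)) * d m z \<partial>M) \<le> ennreal (C * (\<sigma>\<^sup>2) ^ m)" .
  qed
  also have "\<dots> < \<infinity>"
  proof -
    have "summable (\<lambda>m. C * (\<sigma>\<^sup>2) ^ m)" using \<sigma> by (intro summable_mult summable_geometric) (auto simp: power_less_one_iff abs_square_less_1)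
    then have "(\<Sum>m. ennreal (C * (\<sigma>\<^sup>2) ^ m)) = ennreal (\<Sum>m. C * (\<sigma>\<^sup>2) ^ m)" using \<sigma> by (intro suminf_ennreal2) auto
    then show ?thesis by simp
  qed
  finally have "AE z in M. (\<Sum>m. ennreal (inverse \<sigma> ^ (2 * m)) * d m z) \<noteq> \<infinity>" by (intro nn_integral_noteq_infinite) (auto simp: less_top)
  then have conv: "AE z in M. \<forall>k. w k > 0 \<longrightarrow> convergent (\<lambda>m. S m z k)"
  proof eventually_elim
    case (elim z)
    define D where "D = enn2real (\<Sum>m. ennreal (inverse \<sigma> ^ (2 * m)) * d m z)"
    have D: "ennreal (inverse \<sigma> ^ (2 * m)) * d m z \<le> ennreal D" for m
    proof -
      have "ennreal (inverse \<sigma> ^ (2 * m)) * d m z \<le> (\<Sum>m. ennreal (inverse \<sigma> ^ (2 * m)) * d m z)"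
        using sum_le_suminf[OF summableI, of "{m}" "\<lambda>m. ennreal (inverse \<sigma> ^ (2 * m)) * d m z"] by simp
      then show ?thesis unfolding D_def using elim by (simp add: ennreal_enn2real less_top)
    qed
    show ?case
    proof (intro allI impI)
      fix k assume wk: "w k > 0"
      have step: "norm (S (Suc m) z k - S m z k) \<le> sqrt (D / w k) * \<sigma> ^ m" for m
      proof -
        have "ennreal (inverse \<sigma> ^ (2 * m)) * ennreal (w k * (S m z k - S (Suc m) z k)\<^sup>2) \<le> ennreal (inverse \<sigma> ^ (2 * m)) * d m z"
          unfolding d_def using wnorm2_ge[of "{k}" w "\<lambda>k. S m z k - S (Suc m) z k"] w by (intro mult_left_mono) auto
        also note D[of m]
        finally have "ennreal (inverse \<sigma> ^ (2 * m) * (w k * (S m z k - S (Suc m) z k)\<^sup>2)) \<le> ennreal D"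
          using \<sigma> by (simp add: ennreal_mult')
        then have le: "inverse \<sigma> ^ (2 * m) * (w k * (S m z k - S (Suc m) z k)\<^sup>2) \<le> D" unfolding D_def by (subst (asm) ennreal_le_iff) auto
        have "(S m z k - S (Suc m) z k)\<^sup>2 = (inverse \<sigma> ^ (2 * m) * (w k * (S m z k - S (Suc m) z k)\<^sup>2)) * (\<sigma> ^ (2 * m) / w k)"
        proof -
          have "inverse \<sigma> ^ (2 * m) * \<sigma> ^ (2 * m) = 1" using \<sigma> by (simp flip: power_mult_distrib)
          moreover have "(P * (w k * y)) * (Q / w k) = P * Q * y" for P Q y using wk by simp
          ultimately show ?thesis by (simp only: mult_1)
        qed
        also have "\<dots> \<le> D * (\<sigma> ^ (2 * m) / w k)" using le \<sigma> wk by (intro mult_right_mono) auto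
        also have "\<dots> = D / w k * (\<sigma> ^ m)\<^sup>2" by (simp add: power_mult[symmetric] mult.commute)
        finally have "sqrt ((S m z k - S (Suc m) z k)\<^sup>2) \<le> sqrt (D / w k * (\<sigma> ^ m)\<^sup>2)" by (rule real_sqrt_le_mono)
        also have "\<dots> = sqrt (D / w k) * \<sigma> ^ m" unfolding real_sqrt_mult using \<sigma> by simp
        finally show ?thesis by (simp add: abs_minus_commute)
      qed
      have "summable (\<lambda>m. S (Suc m) z k - S m z k)"
      proof (rule summable_comparison_test')
        show "summable (\<lambda>m. sqrt (D / w k) * \<sigma> ^ m)" using \<sigma> by (intro summable_mult summable_geometric) simp
      qed (rule step)
      then have "convergent (\<lambda>m. \<Sum>n<m. S (Suc n) z k - S n z k)" unfolding summable_iff_convergent .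
      moreover have "(\<Sum>n<m. S (Suc n) z k - S n z k) = S m z k - S 0 z k" for m
        by (rule sum_lessThan_telescope[of "\<lambda>m. S m z k"])
      ultimately have "convergent (\<lambda>m. S m z k - S 0 z k)" by (simp only:)
      then show "convergent (\<lambda>m. S m z k)" unfolding convergent_diff_const_right_iff .
    qed
  qed
  \<comment> \<open>\<open>lim\<close> is total, which keeps V measurable also where the partial
    sums do not converge.\<close>
  define V where "V = (\<lambda>z k. lim (\<lambda>m. S m z k))"
  have Vm: "coord_meas V" unfolding coord_meas_def V_def by (intro allI borel_measurable_lim_metric Sm)
  note [measurable] = coord_measD[OF Vm]
  have VAE: "AE z in M. \<forall>k. w k > 0 \<longrightarrow> (\<lambda>m. S m z k) \<longlonglongrightarrow> V z k"
    using conv unfolding V_def convergent_LIMSEQ_iff .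
  have bound: "msq w (\<lambda>z k. S m z k - V z k) \<le> ennreal (C * \<sigma> ^ (4 * m))" for m
  proof -
    note [measurable] = coord_meas_wnorm2[OF coord_meas_diff[OF cm cm]]
    have "msq w (\<lambda>z k. S m z k - V z k) \<le> (\<integral>\<^sup>+z. liminf (\<lambda>l. wnorm2 w (\<lambda>k. S m z k - S l z k)) \<partial>M)"
      unfolding msq_def
    proof (rule nn_integral_mono_AE)
      show "AE z in M. wnorm2 w (\<lambda>k. S m z k - V z k) \<le> liminf (\<lambda>l. wnorm2 w (\<lambda>k. S m z k - S l z k))"
        using VAE
      proof eventually_elim
        case (elim z)
        have lk: "(\<lambda>l. ennreal (w k * (S m z k - S l z k)\<^sup>2)) \<longlonglongrightarrow> ennreal (w k * (S m z k - V z k)\<^sup>2)" for k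
        proof (cases "w k > 0")
          case True
          from elim[rule_format, OF this] show ?thesis
            by (intro tendsto_ennrealI tendsto_mult_left tendsto_power tendsto_diff tendsto_const)
        next
          case False
          then have "w k = 0" using w[of k] by simp
          then show ?thesis by simp
        qed
        have "wnorm2 w (\<lambda>k. S m z k - V z k) = (\<integral>\<^sup>+k. liminf (\<lambda>l. ennreal (w k * (S m z k - S l z k)\<^sup>2)) \<partial>count_space UNIV)"
          unfolding wnorm2_def by (intro nn_integral_cong lim_imp_Liminf[symmetric] sequentially_bot lk)
        also have "\<dots> \<le> liminf (\<lambda>l. wnorm2 w (\<lambda>k. S m z k - S l z k))"
          unfolding wnorm2_def by (rule nn_integral_liminf) simp
        finally show ?case .
      qed
    qed
    also have "\<dots> \<le> liminf (\<lambda>l. msq w (\<lambda>z k. S m z k - S l z k))" unfolding msq_def by (rule nn_integral_liminf) measurable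
    also have "\<dots> \<le> ennreal (C * \<sigma> ^ (4 * m))"
      by (rule Liminf_le) (auto intro!: eventually_sequentiallyI[of m] Cau)
    finally show ?thesis .
  qed
  \<comment> \<open>Values of infinite norm, which occur on a null set only, are replaced by 0,
    because finiteness is demanded at every point.\<close>
  define W where "W = (\<lambda>z k. if wnorm2 w (V z) < \<infinity> then V z k else 0)"
  have [measurable]: "(\<lambda>z. wnorm2 w (V z)) \<in> borel_measurable M" by (rule coord_meas_wnorm2[OF Vm])
  have Wm: "coord_meas W" unfolding coord_meas_def W_def by measurable
  have Wfin: "wnorm2 w (W z) < \<infinity>" for z
    by (cases "wnorm2 w (V z) < \<infinity>") (auto simp: W_def[abs_def])
  have "msq w V \<le> 2 * msq w (S 0) + 2 * msq w (\<lambda>z k. S 0 z k - V z k)"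
  proof -
    have z: "coord_meas (\<lambda>z k. 0)" unfolding coord_meas_def by simp
    have "msq w (\<lambda>z k. V z k - 0) \<le> 2 * msq w (\<lambda>z k. V z k - S 0 z k) + 2 * msq w (\<lambda>z k. S 0 z k - 0)"
      by (rule msq_triangle[OF w Vm cm z])
    then show ?thesis by (simp add: msq_commute[of w V] add.commute)
  qed
  also have "\<dots> < \<infinity>" using fin[of 0] bound[of 0] unfolding S_def by (auto simp: ennreal_mult_less_top intro: le_less_trans)
  finally have "AE z in M. wnorm2 w (V z) \<noteq> \<infinity>" unfolding msq_def by (intro nn_integral_noteq_infinite) (auto simp: less_top)
  then have eq: "msq w (\<lambda>z k. S m z k - W z k) = msq w (\<lambda>z k. S m z k - V z k)" for m
    unfolding msq_def by (intro nn_integral_cong_AE) (auto simp: W_def less_top[symmetric] elim!: eventually_mono)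
  have "(\<lambda>m. C * \<sigma> ^ (4 * m)) \<longlonglongrightarrow> C * 0"
  proof (intro tendsto_mult_left)
    have "(\<lambda>m. (\<sigma> ^ 4) ^ m) \<longlonglongrightarrow> 0" using \<sigma> by (intro LIMSEQ_power_zero) (auto simp: power_less_one_iff)
    then show "(\<lambda>m. \<sigma> ^ (4 * m)) \<longlonglongrightarrow> 0" by (simp add: power_mult)
  qed
  then have "(\<lambda>m. ennreal (C * \<sigma> ^ (4 * m))) \<longlonglongrightarrow> ennreal (C * 0)" by (intro tendsto_ennrealI)
  then have "(\<lambda>m. ennreal (C * \<sigma> ^ (4 * m))) \<longlonglongrightarrow> 0" by simp
  then have "(\<lambda>m. msq w (\<lambda>z k. S m z k - W z k)) \<longlonglongrightarrow> 0"
    unfolding eq by (rule tendsto_sandwich[OF _ _ tendsto_const, rotated 2]) (auto intro: always_eventually bound)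
  then show ?thesis using Wm Wfin unfolding S_def by blast
qed

end

section \<open>Almost sure subsequences and the dual pairing\<close>

lemma tendsto_enn2real_0: "(f \<longlongrightarrow> 0) F \<Longrightarrow> ((\<lambda>x. enn2real (f x)) \<longlongrightarrow> 0) F"
  using tendsto_enn2real[of f 0 F] by simp

text \<open>Truncation at 1 makes the functions integrable without affecting their convergence to
  0.\<close>

lemma (in finite_measure) nn_integral_tendsto_0_AE_subseq:
  fixes f :: "nat \<Rightarrow> 'a \<Rightarrow> ennreal"
  assumes f [measurable]: "\<And>n. f n \<in> borel_measurable M" and lim: "(\<lambda>n. \<integral>\<^sup>+x. f n x \<partial>M) \<longlonglongrightarrow> 0"
  shows "\<exists>r::nat \<Rightarrow> nat. strict_mono r \<and> (AE x in M. (\<lambda>n. f (r n) x) \<longlonglongrightarrow> 0)"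
proof -
  define h where "h = (\<lambda>n x. enn2real (min 1 (f n x)))"
  have h1: "0 \<le> h n x" "h n x \<le> 1" for n x
    unfolding h_def using enn2real_mono[of "min 1 (f n x)" 1] by auto
  have eh: "ennreal (h n x) = min 1 (f n x)" for n x
    unfolding h_def by (intro ennreal_enn2real) (simp add: min_less_iff_disj)
  have hm [measurable]: "h n \<in> borel_measurable M" for n unfolding h_def by measurable
  have hi: "integrable M (h n)" for n
    by (rule integrable_const_bound[of _ 1]) (use h1 in auto)
  have "(\<lambda>n. \<integral>\<^sup>+x. ennreal (h n x) \<partial>M) \<longlonglongrightarrow> 0"
    by (rule tendsto_sandwich[OF _ _ tendsto_const lim]) (auto intro!: always_eventually nn_integral_mono simp: eh)
  then have "(\<lambda>n. enn2real (\<integral>\<^sup>+x. ennreal (h n x) \<partial>M)) \<longlonglongrightarrow> 0" by (rule tendsto_enn2real_0)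
  moreover have "enn2real (\<integral>\<^sup>+x. ennreal (h n x) \<partial>M) = (\<integral>x. norm (h n x) \<partial>M)" for n
    using h1 by (subst integral_eq_nn_integral) auto
  ultimately have "(\<lambda>n. \<integral>x. norm (h n x) \<partial>M) \<longlonglongrightarrow> 0" by simp
  from tendsto_L1_AE_subseq[OF hi this] obtain r :: "nat \<Rightarrow> nat"
    where r: "strict_mono r" "AE x in M. (\<lambda>n. h (r n) x) \<longlonglongrightarrow> 0" by blast
  have "AE x in M. (\<lambda>n. f (r n) x) \<longlonglongrightarrow> 0" using r(2)
  proof eventually_elim
    case (elim x)
    then have "(\<lambda>n. ennreal (h (r n) x)) \<longlonglongrightarrow> ennreal 0" by (rule tendsto_ennrealI)
    then have m: "(\<lambda>n. min 1 (f (r n) x)) \<longlonglongrightarrow> 0" by (simp only: eh ennreal_0)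
    then have "\<forall>\<^sub>F n in sequentially. min 1 (f (r n) x) < 1" by (rule order_tendstoD) simp
    then have "\<forall>\<^sub>F n in sequentially. min 1 (f (r n) x) = f (r n) x"
      by eventually_elim (auto simp: min_def split: if_splits)
    then show ?case by (rule Lim_transform_eventually[OF m])
  qed
  then show ?thesis using r(1) by blast
qed

lemma enn2real_powr_half_tendsto_0_iff:
  assumes fin: "\<And>N. x N < \<infinity>"
  shows "(\<lambda>N. enn2real (x N) powr (1 / 2)) \<longlonglongrightarrow> 0 \<longleftrightarrow> x \<longlonglongrightarrow> 0"
proof
  assume "(\<lambda>N. enn2real (x N) powr (1 / 2)) \<longlonglongrightarrow> 0"
  then have "(\<lambda>N. (enn2real (x N) powr (1 / 2))\<^sup>2) \<longlonglongrightarrow> 0\<^sup>2" by (rule tendsto_power)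
  then have "(\<lambda>N. enn2real (x N)) \<longlonglongrightarrow> 0" by (simp add: powr_half_sqrt)
  then have "(\<lambda>N. ennreal (enn2real (x N))) \<longlonglongrightarrow> ennreal 0" by (rule tendsto_ennrealI)
  then show "x \<longlonglongrightarrow> 0" using fin by (simp add: ennreal_enn2real)
next
  assume "x \<longlonglongrightarrow> 0"
  then have "(\<lambda>N. enn2real (x N)) \<longlonglongrightarrow> 0" by (rule tendsto_enn2real_0)
  then have "(\<lambda>N. sqrt (enn2real (x N))) \<longlonglongrightarrow> sqrt 0" by (rule tendsto_real_sqrt)
  then show "(\<lambda>N. enn2real (x N) powr (1 / 2)) \<longlonglongrightarrow> 0" by (simp add: powr_half_sqrt)
qed

lemma wnorm2_indicator: "wnorm2 (indicator {(0, 0)}) u = ennreal ((u (0, 0))\<^sup>2)"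
proof -
  have "wnorm2 (indicator {(0, 0)}) u = (\<integral>\<^sup>+(k :: int \<times> int). ennreal ((u (0, 0))\<^sup>2) * indicator {(0, 0)} k \<partial>count_space UNIV)"
    unfolding wnorm2_def by (rule nn_integral_cong) (simp add: indicator_def split: if_splits)
  then show ?thesis by (simp add: nn_integral_cmult_indicator)
qed

text \<open>The weights of opposite exponents cancel in each product, so Cauchy-Schwarz on finite
  sets gives a bound that also yields absolute summability.\<close>

lemma pairing_bound:
  assumes u: "u \<in> sobolev (- \<alpha>)" and v: "v \<in> sobolev \<alpha>"
  shows "(\<lambda>k. u k * v k) summable_on UNIV" "\<bar>pairing u v\<bar> \<le> sobolev_norm (- \<alpha>) u * sobolev_norm \<alpha> v"
proof -
  have fin: "(\<Sum>k\<in>S. \<bar>u k * v k\<bar>) \<le> sobolev_norm (- \<alpha>) u * sobolev_norm \<alpha> v" if S: "finite S" for S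
  proof -
    have part: "(\<Sum>k\<in>S. (sqrt (sob_weight s k) * \<bar>y k\<bar>)\<^sup>2) \<le> (sobolev_norm s y)\<^sup>2" if y: "y \<in> sobolev s" for s y
    proof -
      have "ennreal (\<Sum>k\<in>S. sob_weight s k * (y k)\<^sup>2) \<le> ennreal ((sobolev_norm s y)\<^sup>2)"
        unfolding sobolev_norm_wnorm2[OF y] by (rule wnorm2_ge[OF S sob_weight_nonneg])
      then show ?thesis by (simp add: power_mult_distrib sob_weight_nonneg)
    qed
    have "(\<Sum>k\<in>S. \<bar>u k * v k\<bar>) = (\<Sum>k\<in>S. (sqrt (sob_weight (- \<alpha>) k) * \<bar>u k\<bar>) * (sqrt (sob_weight \<alpha> k) * \<bar>v k\<bar>))"
    proof (rule sum.cong[OF refl])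
      fix k
      have "sqrt (sob_weight (- \<alpha>) k) * sqrt (sob_weight \<alpha> k) = 1"
        unfolding real_sqrt_mult[symmetric] sob_weight_def powr_add[symmetric] using bracket2_pos[of k] by simp
      then have "\<bar>u k * v k\<bar> = (sqrt (sob_weight (- \<alpha>) k) * sqrt (sob_weight \<alpha> k)) * (\<bar>u k\<bar> * \<bar>v k\<bar>)" by (simp add: abs_mult)
      then show "\<bar>u k * v k\<bar> = (sqrt (sob_weight (- \<alpha>) k) * \<bar>u k\<bar>) * (sqrt (sob_weight \<alpha> k) * \<bar>v k\<bar>)" by (simp only: mult_ac)
    qed
    also have "\<dots> \<le> sqrt ((\<Sum>k\<in>S. (sqrt (sob_weight (- \<alpha>) k) * \<bar>u k\<bar>)\<^sup>2) * (\<Sum>k\<in>S. (sqrt (sob_weight \<alpha> k) * \<bar>v k\<bar>)\<^sup>2))"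
      by (rule real_le_rsqrt[OF Cauchy_Schwarz_ineq_sum])
    also have "\<dots> \<le> sqrt ((sobolev_norm (- \<alpha>) u)\<^sup>2 * (sobolev_norm \<alpha> v)\<^sup>2)"
      by (intro real_sqrt_le_mono mult_mono part u v sum_nonneg) auto
    also have "\<dots> = sobolev_norm (- \<alpha>) u * sobolev_norm \<alpha> v" by (simp add: real_sqrt_mult sobolev_norm_nonneg)
    finally show ?thesis .
  qed
  have abs: "(\<lambda>k. \<bar>u k * v k\<bar>) summable_on UNIV"
    by (rule nonneg_bdd_above_summable_on) (auto intro!: bdd_aboveI2 fin)
  then show "(\<lambda>k. u k * v k) summable_on UNIV" using abs_summable_summable[of "\<lambda>k. u k * v k" UNIV] by simp
  have "\<bar>pairing u v\<bar> \<le> (\<Sum>\<^sub>\<infinity>k. \<bar>u k * v k\<bar>)"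
    unfolding pairing_def using norm_infsum_bound[of "\<lambda>k. u k * v k" UNIV] abs by simp
  also have "\<dots> \<le> sobolev_norm (- \<alpha>) u * sobolev_norm \<alpha> v"
    by (rule infsum_le_finite_sums[OF abs]) (rule fin)
  finally show "\<bar>pairing u v\<bar> \<le> sobolev_norm (- \<alpha>) u * sobolev_norm \<alpha> v" .
qed

lemma pairing_add_scale:
  assumes u: "u \<in> sobolev (- \<alpha>)" and u': "u' \<in> sobolev (- \<alpha>)" and v: "v \<in> sobolev \<alpha>"
  shows "pairing (\<lambda>k. u k + c * u' k) v = pairing u v + c * pairing u' v"
proof -
  have "pairing (\<lambda>k. u k + c * u' k) v = (\<Sum>\<^sub>\<infinity>k. u k * v k + c * (u' k * v k))"
    unfolding pairing_def by (simp add: distrib_right mult.assoc)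
  also have "\<dots> = (\<Sum>\<^sub>\<infinity>k. u k * v k) + (\<Sum>\<^sub>\<infinity>k. c * (u' k * v k))"
    by (intro infsum_add summable_on_cmult_right pairing_bound(1)[OF u v] pairing_bound(1)[OF u' v])
  finally show ?thesis unfolding pairing_def by (simp add: infsum_cmult_right')
qed

lemma pairing_sum:
  fixes u :: "nat \<Rightarrow> distribution"
  assumes u: "\<And>n. u n \<in> sobolev (- \<alpha>)" and v: "v \<in> sobolev \<alpha>"
  shows "pairing (\<lambda>k. \<Sum>n<m. c n * u n k) v = (\<Sum>n<m. c n * pairing (u n) v)"
proof (induction m)
  case 0
  show ?case unfolding pairing_def by simp
next
  case (Suc m)
  have "(\<lambda>k. \<Sum>n<m. c n * u n k) \<in> sobolev (- \<alpha>)" by (intro sobolev_sum sobolev_scale u)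
  from pairing_add_scale[OF this u[of m] v, of "c m"] show ?case using Suc.IH by simp
qed

text \<open>Induction along the three-term recursion, since field and diagonal covariance are
  trigonometric polynomials and the class is closed under products.\<close>

lemma trig_polynomial_wpow:
  assumes J: "finite J"
  shows "trig_polynomial (wpow J n z)"
proof -
  have f: "trig_polynomial (fld J z)"
    unfolding fld_def[abs_def] by (intro trig_polynomial_sum[OF J] trig_polynomial_scale trig_polynomial_basis)
  have c: "trig_polynomial (\<lambda>x. cov J x x)"
  proof -
    have "(\<lambda>x. cov J x x) = (\<lambda>x. \<Sum>k\<in>J. (1 / bracket2 k) * (basis_e k x * basis_e k x))" unfolding cov_def by simp
    moreover have "trig_polynomial \<dots>"
      by (intro trig_polynomial_sum[OF J] trig_polynomial_scale trig_polynomial_mult trig_polynomial_basis)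
    ultimately show ?thesis by (simp only:)
  qed
  show ?thesis
  proof (induction n rule: less_induct)
    case (less n)
    show ?case
    proof (cases n)
      case 0
      then have "wpow J n z = (\<lambda>x. 1)" unfolding wpow_def[abs_def] by simp
      then show ?thesis by (simp add: trig_polynomial_const)
    next
      case (Suc m)
      let ?r = "if m = 0 then 0 else (-1 :: real)"
      have "wick n \<xi> v = (1 / real n) * (\<xi> * wick m \<xi> v + ?r * (v * wick (m - 1) \<xi> v))" for \<xi> v
        using wick_Suc[of m \<xi> v] Suc by (auto simp: field_simps)
      then have "wpow J n z = (\<lambda>x. (1 / real n) * (fld J z x * wpow J m z x + ?r * (cov J x x * wpow J (m - 1) z x)))"
        unfolding wpow_def[abs_def] by (intro ext)
      moreover have "trig_polynomial (\<lambda>x. (1 / real n) * (fld J z x * wpow J m z x + ?r * (cov J x x * wpow J (m - 1) z x)))"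
        by (intro trig_polynomial_scale trig_polynomial_add trig_polynomial_mult f c less) (use Suc in auto)
      ultimately show ?thesis by simp
    qed
  qed
qed

section \<open>Moment bounds and identities for limits\<close>

context gaussian_free_field
begin

lemma msq_add_scale_finite:
  assumes "\<And>k. w k \<ge> 0" "coord_meas F" "coord_meas G" "msq w F < \<infinity>" "msq w G < \<infinity>"
  shows "msq w (\<lambda>z k. F z k + c * G z k) < \<infinity>"
  using assms(4,5) by (intro le_less_trans[OF msq_add_scale_le[OF assms(1-3)]]) (auto simp: ennreal_mult_less_top)

lemma msq_diff_finite:
  assumes "\<And>k. w k \<ge> 0" "coord_meas F" "coord_meas G" "msq w F < \<infinity>" "msq w G < \<infinity>"
  shows "msq w (\<lambda>z k. F z k - G z k) < \<infinity>"
  using msq_add_scale_finite[OF assms, of "-1"] by simp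

lemma coord_meas_wick_sum: "(\<And>n. coord_meas (\<Phi> n)) \<Longrightarrow> coord_meas (wick_sum \<Phi> a m)"
  unfolding wick_sum_def[abs_def] by (rule coord_meas_sum)

lemma msq_wick_sum_finite:
  assumes w: "\<And>k. w k \<ge> 0" and \<Phi>: "\<And>n. coord_meas (\<Phi> n)" and fin: "\<And>n. msq w (\<Phi> n) < \<infinity>"
  shows "msq w (wick_sum \<Phi> a m) < \<infinity>"
proof (induction m)
  case 0
  have "wick_sum \<Phi> a 0 = (\<lambda>z k. 0)" unfolding wick_sum_def[abs_def] by simp
  then show ?case unfolding msq_def by simp
next
  case (Suc m)
  have "wick_sum \<Phi> a (Suc m) = (\<lambda>z k. wick_sum \<Phi> a m z k + a ^ m / fact m * \<Phi> m z k)"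
    unfolding wick_sum_def[abs_def] by simp
  then show ?case using msq_add_scale_finite[OF w coord_meas_wick_sum[OF \<Phi>] \<Phi> Suc.IH fin] by (simp only:)
qed

text \<open>The factor \<open>w k\<close> in the conclusion covers the coordinates of weight zero,
  on which the norm gives no information.\<close>

lemma wnorm2_limit_coord:
  assumes w: "\<And>k. w k \<ge> 0" and lim: "(\<lambda>n. wnorm2 w (\<lambda>k. u n k - v k)) \<longlonglongrightarrow> 0"
  shows "(\<lambda>n. w k * (u n k)\<^sup>2) \<longlonglongrightarrow> w k * (v k)\<^sup>2"
proof (cases "w k = 0")
  case False
  then have wk: "w k > 0" using w[of k] by simp
  have "(\<lambda>n. ennreal (w k * (u n k - v k)\<^sup>2)) \<longlonglongrightarrow> 0"
  proof (rule tendsto_sandwich[OF _ _ tendsto_const lim])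
    show "\<forall>\<^sub>F n in sequentially. ennreal (w k * (u n k - v k)\<^sup>2) \<le> wnorm2 w (\<lambda>k. u n k - v k)"
      using wnorm2_ge[of "{k}" w, OF _ w] by (intro always_eventually allI) simp
  qed simp
  then have "(\<lambda>n. enn2real (ennreal (w k * (u n k - v k)\<^sup>2))) \<longlonglongrightarrow> 0" by (rule tendsto_enn2real_0)
  then have "(\<lambda>n. w k * (u n k - v k)\<^sup>2) \<longlonglongrightarrow> 0" using wk by simp
  then have "(\<lambda>n. sqrt (w k * (u n k - v k)\<^sup>2 / w k)) \<longlonglongrightarrow> sqrt (0 / w k)" using wk by (intro tendsto_real_sqrt tendsto_divide tendsto_const) auto
  then have "(\<lambda>n. \<bar>u n k - v k\<bar>) \<longlonglongrightarrow> 0" using wk by simp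
  then have "(\<lambda>n. u n k) \<longlonglongrightarrow> v k" by (simp add: tendsto_rabs_zero_iff LIM_zero_iff)
  then show ?thesis by (intro tendsto_mult_left tendsto_power)
qed simp

text \<open>The second moment at b = a sqrt (2 q - 1) is bounded uniformly in N. Hypercontractivity
  turns this into a bound on the q-th power of finite partial norms at a. Fatou's lemma is then
  applied twice: along an almost surely convergent subsequence of cutoffs, and along growing finite
  index sets.\<close>

lemma wick_sum_limit_Lp:
  assumes data: "wick_data J g w b0 \<Phi>" and W: "coord_meas W"
    and lim: "(\<lambda>m. msq w (\<lambda>z k. wick_sum \<Phi> a m z k - W z k)) \<longlonglongrightarrow> 0"
    and q: "q \<ge> 1" and a: "\<bar>a\<bar> * sqrt (2 * q - 1) < b0" and fin: "\<And>z. z \<in> space M \<Longrightarrow> wnorm2 w (W z) < \<infinity>"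
  shows "(\<integral>\<^sup>+z. ennreal (enn2real (wnorm2 w (W z)) powr q) \<partial>M) < \<infinity>"
proof -
  have J: "\<And>N. finite (J N)" and w: "\<And>k. w k \<ge> 0" and g: "\<And>k. integrable torus (g k)" and \<Phi>: "\<And>n. coord_meas (\<Phi> n)"
    using data unfolding wick_data_def by auto
  note [measurable] = coord_measD[OF W] coord_measD[OF coord_meas_ecoef[OF g]]
  define b where "b = a * sqrt (2 * q - 1)"
  have b: "\<bar>b\<bar> < b0" "b\<^sup>2 = (2 * q - 1) * a\<^sup>2" unfolding b_def using a q by (auto simp: abs_mult power_mult_distrib)
  have "\<bar>a\<bar> * 1 \<le> \<bar>a\<bar> * sqrt (2 * q - 1)" using q by (intro mult_left_mono) auto
  then have a0: "\<bar>a\<bar> < b0" using a by simp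
  obtain C where C: "C \<ge> 0" "\<And>N. msq w (ecoef (J N) b g) \<le> ennreal C" using data b(1) unfolding wick_data_def by blast
  have hyp: "(\<integral>\<^sup>+z. ennreal ((\<Sum>k\<in>S. w k * (ecoef (J N) a g z k)\<^sup>2) powr q) \<partial>M) \<le> ennreal (C powr q)" if S: "finite S" for S N
  proof -
    let ?I = "\<lambda>l. \<integral>p. g l (fst p) * g l (snd p) * exp ((2 * q - 1) * a\<^sup>2 * cov (J N) (fst p) (snd p)) \<partial>torus2"
    note mom = wexp_second_moment[OF J g, where a = b, unfolded b(2)]
    have I: "(\<Sum>l\<in>S. w l * ?I l) = (\<integral>z. (\<Sum>l\<in>S. w l * (ecoef (J N) b g z l)\<^sup>2) \<partial>M)"
      unfolding ecoef_def using mom by simp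
    have "ennreal (\<Sum>l\<in>S. w l * ?I l) = (\<integral>\<^sup>+z. ennreal (\<Sum>l\<in>S. w l * (ecoef (J N) b g z l)\<^sup>2) \<partial>M)"
      unfolding I unfolding ecoef_def using mom w by (intro nn_integral_eq_integral[symmetric]) (auto intro!: sum_nonneg)
    also have "\<dots> \<le> msq w (ecoef (J N) b g)" unfolding msq_def by (intro nn_integral_mono wnorm2_ge S w)
    also note C(2)
    finally have le: "(\<Sum>l\<in>S. w l * ?I l) \<le> C" using C(1) by simp
    have nonneg: "0 \<le> (\<Sum>l\<in>S. w l * ?I l)" unfolding I using w by (intro integral_nonneg_AE AE_I2 sum_nonneg) auto
    have "(\<integral>\<^sup>+z. ennreal ((\<Sum>k\<in>S. w k * (ecoef (J N) a g z k)\<^sup>2) powr q) \<partial>M) \<le> ennreal ((\<Sum>l\<in>S. w l * ?I l) powr q)"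
      unfolding ecoef_def by (rule wexp_hypercontractive[OF J S g w q])
    also have "\<dots> \<le> ennreal (C powr q)" using le nonneg q by (intro ennreal_leI powr_mono2) auto
    finally show ?thesis .
  qed
  have elim': "(\<lambda>N. msq w (\<lambda>z k. ecoef (J N) a g z k - W z k)) \<longlonglongrightarrow> 0" by (rule ecoef_tendsto[OF data a0 W lim])
  have cmE: "coord_meas (\<lambda>z k. ecoef (J N) a g z k - W z k)" for N by (rule coord_meas_diff[OF coord_meas_ecoef[OF g] W])
  from nn_integral_tendsto_0_AE_subseq[OF coord_meas_wnorm2[OF cmE] elim'[unfolded msq_def]]
  obtain r :: "nat \<Rightarrow> nat" where r: "AE z in M. (\<lambda>n. wnorm2 w (\<lambda>k. ecoef (J (r n)) a g z k - W z k)) \<longlonglongrightarrow> 0" by blast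
  have part: "(\<integral>\<^sup>+z. ennreal ((\<Sum>k\<in>S. w k * (W z k)\<^sup>2) powr q) \<partial>M) \<le> ennreal (C powr q)" if S: "finite S" for S
  proof -
    have "(\<integral>\<^sup>+z. ennreal ((\<Sum>k\<in>S. w k * (W z k)\<^sup>2) powr q) \<partial>M) \<le> (\<integral>\<^sup>+z. liminf (\<lambda>n. ennreal ((\<Sum>k\<in>S. w k * (ecoef (J (r n)) a g z k)\<^sup>2) powr q)) \<partial>M)"
    proof (rule nn_integral_mono_AE)
      show "AE z in M. ennreal ((\<Sum>k\<in>S. w k * (W z k)\<^sup>2) powr q) \<le> liminf (\<lambda>n. ennreal ((\<Sum>k\<in>S. w k * (ecoef (J (r n)) a g z k)\<^sup>2) powr q))"
        using r
      proof eventually_elim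
        case (elim z)
        have "(\<lambda>n. \<Sum>k\<in>S. w k * (ecoef (J (r n)) a g z k)\<^sup>2) \<longlonglongrightarrow> (\<Sum>k\<in>S. w k * (W z k)\<^sup>2)"
          by (intro tendsto_sum wnorm2_limit_coord[OF w elim])
        then have "(\<lambda>n. ennreal ((\<Sum>k\<in>S. w k * (ecoef (J (r n)) a g z k)\<^sup>2) powr q)) \<longlonglongrightarrow> ennreal ((\<Sum>k\<in>S. w k * (W z k)\<^sup>2) powr q)"
          using w q by (intro tendsto_ennrealI tendsto_powr' tendsto_const) (auto intro!: always_eventually sum_nonneg)
        then show ?case by (intro eq_refl lim_imp_Liminf[symmetric] sequentially_bot)
      qed
    qed
    also have "\<dots> \<le> liminf (\<lambda>n. \<integral>\<^sup>+z. ennreal ((\<Sum>k\<in>S. w k * (ecoef (J (r n)) a g z k)\<^sup>2) powr q) \<partial>M)"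
      by (rule nn_integral_liminf) measurable
    also have "\<dots> \<le> ennreal (C powr q)" by (rule Liminf_le) (auto intro!: always_eventually hyp[OF S])
    finally show ?thesis .
  qed
  let ?S = "\<lambda>n z. \<Sum>k\<in>lattice_point ` {..<n}. w k * (W z k)\<^sup>2"
  have "(\<integral>\<^sup>+z. ennreal (enn2real (wnorm2 w (W z)) powr q) \<partial>M) \<le> (\<integral>\<^sup>+z. liminf (\<lambda>n. ennreal (?S n z powr q)) \<partial>M)"
  proof (rule nn_integral_mono)
    fix z assume "z \<in> space M"
    then have f: "wnorm2 w (W z) < \<infinity>" by (rule fin)
    have S: "(\<Sum>k\<in>lattice_point ` {..<n}. ennreal (w k * (W z k)\<^sup>2)) = ennreal (?S n z)" for n
      using w by (intro sum_ennreal) auto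
    have "(\<lambda>n. ennreal (?S n z)) \<longlonglongrightarrow> (SUP n. ennreal (?S n z))"
      by (rule LIMSEQ_SUP) (auto intro!: monoI ennreal_leI sum_mono2 mult_nonneg_nonneg w)
    then have "(\<lambda>n. ennreal (?S n z)) \<longlonglongrightarrow> wnorm2 w (W z)" unfolding wnorm2_SUP S .
    then have "(\<lambda>n. enn2real (ennreal (?S n z))) \<longlonglongrightarrow> enn2real (wnorm2 w (W z))" using f by (intro tendsto_enn2real) (auto simp: ennreal_enn2real)
    moreover have "enn2real (ennreal (?S n z)) = ?S n z" for n using w by (intro enn2real_ennreal sum_nonneg) auto
    ultimately have "(\<lambda>n. ?S n z) \<longlonglongrightarrow> enn2real (wnorm2 w (W z))" by (simp only:)
    then have "(\<lambda>n. ennreal (?S n z powr q)) \<longlonglongrightarrow> ennreal (enn2real (wnorm2 w (W z)) powr q)"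
      using q by (intro tendsto_ennrealI tendsto_powr' tendsto_const) (auto intro!: always_eventually sum_nonneg mult_nonneg_nonneg w)
    then show "ennreal (enn2real (wnorm2 w (W z)) powr q) \<le> liminf (\<lambda>n. ennreal (?S n z powr q))" by (intro eq_refl lim_imp_Liminf[symmetric] sequentially_bot)
  qed
  also have "\<dots> \<le> liminf (\<lambda>n. \<integral>\<^sup>+z. ennreal (?S n z powr q) \<partial>M)" by (rule nn_integral_liminf) measurable
  also have "\<dots> \<le> ennreal (C powr q)" by (rule Liminf_le) (auto intro!: always_eventually part)
  finally show ?thesis by (auto intro: le_less_trans)
qed

text \<open>Both sides converge almost surely along a common subsequence, the pairing by continuity,
  so the identity survives in the limit. It is applied to the cutoffs of one Wick power and then to
  the partial sums of the series.\<close>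

lemma pairing_limit:
  assumes F: "\<And>N. coord_meas (F N)" and G: "coord_meas G" and v: "v \<in> sobolev \<alpha>"
    and Fs: "\<And>N z. z \<in> space M \<Longrightarrow> F N z \<in> sobolev (- \<alpha>)" and Gs: "\<And>z. z \<in> space M \<Longrightarrow> G z \<in> sobolev (- \<alpha>)"
    and FG: "(\<lambda>N. msq (sob_weight (- \<alpha>)) (\<lambda>z k. F N z k - G z k)) \<longlonglongrightarrow> 0"
    and f [measurable]: "\<And>N. f N \<in> borel_measurable M" "h \<in> borel_measurable M"
    and fh: "(\<lambda>N. \<integral>\<^sup>+z. ennreal ((f N z - h z)\<^sup>2) \<partial>M) \<longlonglongrightarrow> 0"
    and eq: "\<And>N. AE z in M. f N z = pairing (F N z) v"
  shows "AE z in M. h z = pairing (G z) v"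
proof -
  obtain r :: "nat \<Rightarrow> nat" where r: "strict_mono r" "AE z in M. (\<lambda>n. wnorm2 (sob_weight (- \<alpha>)) (\<lambda>k. F (r n) z k - G z k)) \<longlonglongrightarrow> 0"
    using nn_integral_tendsto_0_AE_subseq[OF coord_meas_wnorm2[OF coord_meas_diff[OF F G]] FG[unfolded msq_def]] by blast
  have "(\<lambda>n. \<integral>\<^sup>+z. ennreal ((f (r n) z - h z)\<^sup>2) \<partial>M) \<longlonglongrightarrow> 0"
    using LIMSEQ_subseq_LIMSEQ[OF fh r(1)] by (simp add: comp_def)
  then obtain s :: "nat \<Rightarrow> nat" where s: "strict_mono s" "AE z in M. (\<lambda>n. ennreal ((f (r (s n)) z - h z)\<^sup>2)) \<longlonglongrightarrow> 0"
    using nn_integral_tendsto_0_AE_subseq[of "\<lambda>n z. ennreal ((f (r n) z - h z)\<^sup>2)"] by auto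
  have eq': "AE z in M. \<forall>N. f N z = pairing (F N z) v" unfolding AE_all_countable using eq by blast
  show ?thesis using r(2) s(2) eq' AE_space
  proof eventually_elim
    case (elim z)
    have d: "(\<lambda>k. F N z k - G z k) \<in> sobolev (- \<alpha>)" for N using Fs Gs elim(4) by (intro sobolev_diff) auto
    have "(\<lambda>n. ennreal ((sobolev_norm (- \<alpha>) (\<lambda>k. F (r (s n)) z k - G z k))\<^sup>2)) \<longlonglongrightarrow> 0"
      unfolding sobolev_norm_wnorm2[OF d] using LIMSEQ_subseq_LIMSEQ[OF elim(1) s(1)] by (simp add: comp_def)
    then have "(\<lambda>n. enn2real (ennreal ((sobolev_norm (- \<alpha>) (\<lambda>k. F (r (s n)) z k - G z k))\<^sup>2))) \<longlonglongrightarrow> 0" by (rule tendsto_enn2real_0)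
    then have "(\<lambda>n. sqrt ((sobolev_norm (- \<alpha>) (\<lambda>k. F (r (s n)) z k - G z k))\<^sup>2)) \<longlonglongrightarrow> sqrt 0" by (intro tendsto_real_sqrt) simp
    then have n0: "(\<lambda>n. sobolev_norm (- \<alpha>) (\<lambda>k. F (r (s n)) z k - G z k)) \<longlonglongrightarrow> 0" by (simp add: sobolev_norm_nonneg)
    have "(\<lambda>n. pairing (F (r (s n)) z) v - pairing (G z) v) \<longlonglongrightarrow> 0"
    proof (rule Lim_null_comparison)
      have "norm (pairing (F (r (s n)) z) v - pairing (G z) v) \<le> sobolev_norm (- \<alpha>) (\<lambda>k. F (r (s n)) z k - G z k) * sobolev_norm \<alpha> v" for n
        using pairing_bound(2)[OF d v] pairing_add_scale[OF Fs[OF elim(4)] Gs[OF elim(4)] v, of _ "-1"] by simp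
      then show "\<forall>\<^sub>F n in sequentially. norm (pairing (F (r (s n)) z) v - pairing (G z) v) \<le> sobolev_norm (- \<alpha>) (\<lambda>k. F (r (s n)) z k - G z k) * sobolev_norm \<alpha> v"
        by (intro always_eventually allI)
      show "(\<lambda>n. sobolev_norm (- \<alpha>) (\<lambda>k. F (r (s n)) z k - G z k) * sobolev_norm \<alpha> v) \<longlonglongrightarrow> 0"
        using tendsto_mult_right[OF n0, of "sobolev_norm \<alpha> v"] by simp
    qed
    then have l1: "(\<lambda>n. f (r (s n)) z) \<longlonglongrightarrow> pairing (G z) v" using elim(3) by (simp add: LIM_zero_iff)
    have "(\<lambda>n. enn2real (ennreal ((f (r (s n)) z - h z)\<^sup>2))) \<longlonglongrightarrow> 0" using elim(2) by (rule tendsto_enn2real_0)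
    then have "(\<lambda>n. sqrt ((f (r (s n)) z - h z)\<^sup>2)) \<longlonglongrightarrow> sqrt 0" by (intro tendsto_real_sqrt) simp
    then have "(\<lambda>n. f (r (s n)) z) \<longlonglongrightarrow> h z" by (simp add: tendsto_rabs_zero_iff LIM_zero_iff)
    then show ?case using l1 LIMSEQ_unique by blast
  qed
qed

end

section \<open>Wick exponentials\<close>

abbreviation cutoff_points :: "(real \<times> real) set \<Rightarrow> (int \<times> int) set" where
  "cutoff_points \<Lambda> \<equiv> {k. (of_int (fst k), of_int (snd k)) \<in> \<Lambda>}"

text \<open>Positivity lets the Hermite form, which divides by \<open>rho\<close>, be rewritten
  through \<open>wick\<close>.\<close>

lemma cov_pos: "finite J \<Longrightarrow> (0, 0) \<in> J \<Longrightarrow> cov J x x > 0"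
  unfolding cov_def
proof (rule sum_pos2)
  show "0 < basis_e (0, 0) x * basis_e (0, 0) x / bracket2 (0, 0)" unfolding basis_e_def bracket2_def by simp
qed (auto simp: less_imp_le[OF bracket2_pos])

lemma zero_mem_admissible: "admissible \<kappa> J \<Longrightarrow> (0, 0) \<in> J"
  unfolding admissible_def lattice_box_def by auto

lemma sobolev_norm_powr:
  assumes "u \<in> sobolev s"
  shows "sobolev_norm s u powr p = enn2real (wnorm2 (sob_weight s) u) powr (p / 2)"
proof -
  have "sobolev_norm s u = enn2real (wnorm2 (sob_weight s) u) powr (1 / 2)"
    unfolding sobolev_norm_sqrt[OF assms] by (simp add: powr_half_sqrt)
  then show ?thesis by (simp add: powr_powr)
qed

text \<open>For s \<le> 0 the weight is at most 1, and Bessel's inequality bounds all finite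
  sums.\<close>

lemma fourier_coeffs_sobolev:
  assumes f: "f \<in> L2_torus" and s: "s \<le> 0"
  shows "fourier_coeffs f \<in> sobolev s"
proof -
  have "(\<Sum>k\<in>S. sob_weight s k * (fourier_coeffs f k)\<^sup>2) \<le> inner_H f f" if S: "finite S" for S
  proof -
    have "sob_weight s k \<le> 1" for k
      unfolding sob_weight_def using powr_mono[OF s bracket2_ge1[of k]] bracket2_pos[of k] by simp
    then have "(\<Sum>k\<in>S. sob_weight s k * (fourier_coeffs f k)\<^sup>2) \<le> (\<Sum>k\<in>S. 1 * (fourier_coeffs f k)\<^sup>2)"
      by (intro sum_mono mult_right_mono) auto
    then show ?thesis using Bessel_inequality[OF f S] by simp
  qed
  then have "wnorm2 (sob_weight s) (fourier_coeffs f) \<le> ennreal (inner_H f f)" by (rule wnorm2_le[OF _ sob_weight_nonneg])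
  then show ?thesis unfolding sobolev_iff by (auto intro: le_less_trans)
qed

context gaussian_free_field
begin

lemma rho_eq:
  assumes J: "finite (cutoff_points \<Lambda>)"
  shows "rho M \<Lambda> x = sqrt (cov (cutoff_points \<Lambda>) x x)"
proof -
  \<comment> \<open>The first Wick power is the field itself, so its variance is an instance of the
    orthogonality relation.\<close>
  have "wpow (cutoff_points \<Lambda>) 1 z x = cutoff_proj \<Lambda> z x" for z
    using wick_Suc[of 0 "fld (cutoff_points \<Lambda>) z x"] unfolding wpow_def cutoff_proj_def fld_def by simp
  then have "(\<integral>z. (cutoff_proj \<Lambda> z x)\<^sup>2 \<partial>M) = cov (cutoff_points \<Lambda>) x x"
    using expectation_wpow_wpow[OF J, of 1 x 1 x] by (simp add: power2_eq_square)
  then show ?thesis unfolding rho_def by simp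
qed

lemma exp_cutoff_eq:
  assumes J: "finite (cutoff_points \<Lambda>)"
  shows "exp_cutoff M \<Lambda> a z x = wexp (cutoff_points \<Lambda>) a z x"
  unfolding exp_cutoff_def wexp_def rho_eq[OF J] cutoff_proj_def fld_def
  by (simp add: power_mult_distrib cov_nonneg)

lemma wick_cutoff_eq:
  assumes J: "finite (cutoff_points \<Lambda>)" and 0: "(0, 0) \<in> cutoff_points \<Lambda>"
  shows "wick_cutoff M n \<Lambda> z x = fact n * wpow (cutoff_points \<Lambda>) n z x"
proof -
  have "sqrt (cov (cutoff_points \<Lambda>) x x) > 0" using cov_pos[OF J 0] by simp
  from wick_scaled_hermite[OF this] show ?thesis
    unfolding wick_cutoff_def rho_eq[OF J] wpow_def fld_def cutoff_proj_def by (simp add: cov_nonneg)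
qed

lemma Lp_iff: "f \<in> Lp M p \<longleftrightarrow> f \<in> borel_measurable M \<and> (\<integral>\<^sup>+z. ennreal (\<bar>f z\<bar> powr p) \<partial>M) < \<infinity>"
  unfolding Lp_def by (auto simp: integrable_iff_bounded)

lemma Lp_sobolev_iff:
  "F \<in> Lp_sobolev M p s \<longleftrightarrow> coord_meas F \<and> (\<forall>z\<in>space M. F z \<in> sobolev s) \<and>
     (\<integral>\<^sup>+z. ennreal (enn2real (wnorm2 (sob_weight s) (F z)) powr (p / 2)) \<partial>M) < \<infinity>"
proof -
  have m: "F \<in> M \<rightarrow>\<^sub>M sobolev_borel s \<longleftrightarrow> coord_meas F \<and> (\<forall>z\<in>space M. F z \<in> sobolev s)"
    using measurable_sobolev_borelD[of F M s] measurable_sobolev_borelI[of F M s] coord_measD[of F] coord_measI[of F] by blast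
  have "integrable M (\<lambda>z. sobolev_norm s (F z) powr p) \<longleftrightarrow> (\<integral>\<^sup>+z. ennreal (enn2real (wnorm2 (sob_weight s) (F z)) powr (p / 2)) \<partial>M) < \<infinity>"
    if F: "coord_meas F" and s: "\<forall>z\<in>space M. F z \<in> sobolev s"
  proof -
    note [measurable] = coord_meas_wnorm2[OF F]
    have "integrable M (\<lambda>z. sobolev_norm s (F z) powr p) \<longleftrightarrow> integrable M (\<lambda>z. enn2real (wnorm2 (sob_weight s) (F z)) powr (p / 2))"
      using s by (intro Bochner_Integration.integrable_cong refl sobolev_norm_powr) blast
    then show ?thesis by (simp add: integrable_iff_bounded)
  qed
  then show ?thesis unfolding Lp_sobolev_def using m by blast
qed

lemma Lp_sobolev_2_iff:
  "F \<in> Lp_sobolev M 2 s \<longleftrightarrow> coord_meas F \<and> (\<forall>z\<in>space M. F z \<in> sobolev s) \<and> msq (sob_weight s) F < \<infinity>"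
proof -
  have "(\<integral>\<^sup>+z. ennreal (enn2real (wnorm2 (sob_weight s) (F z)) powr (2 / 2)) \<partial>M) = msq (sob_weight s) F"
    if "\<forall>z\<in>space M. F z \<in> sobolev s"
    unfolding msq_def using that by (intro nn_integral_cong) (auto simp: sobolev_iff ennreal_enn2real)
  then show ?thesis unfolding Lp_sobolev_iff by auto
qed

lemma tendsto_Lp_sobolev_2_iff:
  "tendsto_Lp_sobolev M 2 s F G \<longleftrightarrow> (\<forall>N. F N \<in> Lp_sobolev M 2 s) \<and> G \<in> Lp_sobolev M 2 s \<and>
     (\<lambda>N. msq (sob_weight s) (\<lambda>z k. F N z k - G z k)) \<longlonglongrightarrow> 0"
proof -
  have "(\<lambda>N. (\<integral>z. sobolev_dist s (F N z) (G z) powr 2 \<partial>M) powr (1 / 2)) \<longlonglongrightarrow> 0 \<longleftrightarrow>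
      (\<lambda>N. msq (sob_weight s) (\<lambda>z k. F N z k - G z k)) \<longlonglongrightarrow> 0"
    if F: "\<forall>N. F N \<in> Lp_sobolev M 2 s" and G: "G \<in> Lp_sobolev M 2 s"
  proof -
    have F': "coord_meas (F N)" "\<And>z. z \<in> space M \<Longrightarrow> F N z \<in> sobolev s" "msq (sob_weight s) (F N) < \<infinity>" for N
      using F unfolding Lp_sobolev_2_iff by auto
    have G': "coord_meas G" "\<And>z. z \<in> space M \<Longrightarrow> G z \<in> sobolev s" "msq (sob_weight s) G < \<infinity>"
      using G unfolding Lp_sobolev_2_iff by auto
    have fin: "msq (sob_weight s) (\<lambda>z k. F N z k - G z k) < \<infinity>" for N
      by (rule msq_diff_finite[OF sob_weight_nonneg F'(1) G'(1) F'(3) G'(3)])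
    have "(\<integral>z. sobolev_dist s (F N z) (G z) powr 2 \<partial>M) = enn2real (msq (sob_weight s) (\<lambda>z k. F N z k - G z k))" for N
    proof -
      have d: "(\<lambda>k. F N z k - G z k) \<in> sobolev s" if "z \<in> space M" for z by (rule sobolev_diff[OF F'(2)[OF that] G'(2)[OF that]])
      have "(\<integral>z. sobolev_dist s (F N z) (G z) powr 2 \<partial>M) = (\<integral>z. enn2real (wnorm2 (sob_weight s) (\<lambda>k. F N z k - G z k)) \<partial>M)"
        unfolding sobolev_dist_def using d by (intro Bochner_Integration.integral_cong refl) (simp add: sobolev_norm_powr)
      also have "\<dots> = enn2real (\<integral>\<^sup>+z. ennreal (enn2real (wnorm2 (sob_weight s) (\<lambda>k. F N z k - G z k))) \<partial>M)"
        using coord_meas_wnorm2[OF coord_meas_diff[OF F'(1) G'(1)], of "sob_weight s" N] by (intro integral_eq_nn_integral) auto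
      also have "(\<integral>\<^sup>+z. ennreal (enn2real (wnorm2 (sob_weight s) (\<lambda>k. F N z k - G z k))) \<partial>M) = msq (sob_weight s) (\<lambda>z k. F N z k - G z k)"
        unfolding msq_def using d by (intro nn_integral_cong) (auto simp: sobolev_iff ennreal_enn2real)
      finally show ?thesis .
    qed
    then show ?thesis using enn2real_powr_half_tendsto_0_iff[of "\<lambda>N. msq (sob_weight s) (\<lambda>z k. F N z k - G z k)", OF fin] by simp
  qed
  then show ?thesis unfolding tendsto_Lp_sobolev_def by blast
qed

text \<open>A random variable is regarded as a family constant in k, of which only the origin is
  weighted; scalar statements then become instances of those on \<open>msq\<close>.\<close>

abbreviation origin_weight :: "int \<times> int \<Rightarrow> real" where
  "origin_weight \<equiv> indicator {(0, 0)}"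

lemma msq_origin_weight: "msq origin_weight F = (\<integral>\<^sup>+z. ennreal ((F z (0, 0))\<^sup>2) \<partial>M)"
  unfolding msq_def wnorm2_indicator ..

lemma coord_meas_const: "(\<lambda>z. f z) \<in> borel_measurable M \<Longrightarrow> coord_meas (\<lambda>z k. f z)"
  by (rule coord_measI)

lemma Lp_2_iff: "f \<in> Lp M 2 \<longleftrightarrow> f \<in> borel_measurable M \<and> msq origin_weight (\<lambda>z k. f z) < \<infinity>"
  unfolding Lp_iff msq_origin_weight by simp

lemma tendsto_Lp_2_iff:
  "tendsto_Lp M 2 f h \<longleftrightarrow> (\<forall>N. f N \<in> Lp M 2) \<and> h \<in> Lp M 2 \<and>
     (\<lambda>N. msq origin_weight (\<lambda>z k. f N z - h z)) \<longlonglongrightarrow> 0"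
proof -
  have "(\<lambda>N. (\<integral>z. \<bar>f N z - h z\<bar> powr 2 \<partial>M) powr (1 / 2)) \<longlonglongrightarrow> 0 \<longleftrightarrow>
      (\<lambda>N. msq origin_weight (\<lambda>z k. f N z - h z)) \<longlonglongrightarrow> 0"
    if f: "\<forall>N. f N \<in> Lp M 2" and h: "h \<in> Lp M 2"
  proof -
    have f': "f N \<in> borel_measurable M" "msq origin_weight (\<lambda>z k. f N z) < \<infinity>" for N using f unfolding Lp_2_iff by auto
    have h': "h \<in> borel_measurable M" "msq origin_weight (\<lambda>z k. h z) < \<infinity>" using h unfolding Lp_2_iff by auto
    note [measurable] = f'(1) h'(1)
    have fin: "msq origin_weight (\<lambda>z k. f N z - h z) < \<infinity>" for N
      by (rule msq_diff_finite[OF _ coord_meas_const[OF f'(1)] coord_meas_const[OF h'(1)] f'(2) h'(2)]) simp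
    have "(\<integral>z. \<bar>f N z - h z\<bar> powr 2 \<partial>M) = enn2real (msq origin_weight (\<lambda>z k. f N z - h z))" for N
      unfolding msq_origin_weight by (subst integral_eq_nn_integral) auto
    then show ?thesis using enn2real_powr_half_tendsto_0_iff[of "\<lambda>N. msq origin_weight (\<lambda>z k. f N z - h z)", OF fin] by simp
  qed
  then show ?thesis unfolding tendsto_Lp_def by blast
qed

lemma msq_limit_finite:
  assumes w: "\<And>k. w k \<ge> 0" and F: "\<And>m. coord_meas (F m)" "\<And>m. msq w (F m) < \<infinity>" and G: "coord_meas G"
    and lim: "(\<lambda>m. msq w (\<lambda>z k. F m z k - G z k)) \<longlonglongrightarrow> 0"
  shows "msq w G < \<infinity>"
proof -
  have "\<forall>\<^sub>F m in sequentially. msq w (\<lambda>z k. F m z k - G z k) < \<infinity>" using lim by (rule order_tendstoD) simp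
  then obtain m where m: "msq w (\<lambda>z k. F m z k - G z k) < \<infinity>" by (auto simp: eventually_sequentially)
  from msq_add_scale_finite[OF w F(1) coord_meas_diff[OF F(1) G] F(2) this, of m "-1"] show ?thesis by simp
qed

lemma wick_power_tendsto:
  assumes "is_wick_power M n F" "cutoff_set \<Lambda>" "\<alpha> > 0"
  shows "tendsto_Lp_sobolev M 2 (- \<alpha>) (\<lambda>N z. fourier_coeffs (wick_cutoff M n (dilate N \<Lambda>) z)) F"
  using assms unfolding is_wick_power_def by auto

lemma wick_power_at_tendsto:
  assumes "is_wick_power_at M n g f" "cutoff_set \<Lambda>"
  shows "tendsto_Lp M 2 (\<lambda>N z. inner_H (wick_cutoff M n (dilate N \<Lambda>) z) g) f"
  using assms unfolding is_wick_power_at_def by auto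

lemma sobolev_wick_data:
  assumes \<alpha>: "0 < \<alpha>" "\<alpha> \<le> 1" and \<Lambda>: "cutoff_set \<Lambda>" and \<Phi>: "\<And>n. is_wick_power M n (\<Phi> n)"
  shows "wick_data (\<lambda>N. cutoff_points (dilate N \<Lambda>)) basis_e (sob_weight (- \<alpha>)) (sqrt (4 * pi * \<alpha>)) \<Phi>"
proof -
  obtain \<kappa> where \<kappa>: "\<kappa> \<ge> 1" "\<And>N. admissible \<kappa> (cutoff_points (dilate N \<Lambda>))" using cutoff_admissible[OF \<Lambda>] by blast
  note J = admissible_finite[OF \<kappa>(2)]
  have e: "integrable torus (basis_e k)" for k by (rule L2_torus_integrable[OF basis_in_L2_torus])
  note t = wick_power_tendsto[OF \<Phi> \<Lambda> \<alpha>(1)]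
  have p: "fourier_coeffs (wick_cutoff M n (dilate N \<Lambda>) z) k = pcoef (cutoff_points (dilate N \<Lambda>)) n basis_e z k" for n N z k
    unfolding fourier_coeffs_def inner_H_def pcoef_def wick_cutoff_eq[OF J zero_mem_admissible[OF \<kappa>(2)]] ..
  have "\<exists>C\<ge>0. \<forall>N. msq (sob_weight (- \<alpha>)) (ecoef (cutoff_points (dilate N \<Lambda>)) b basis_e) \<le> ennreal C" if b: "\<bar>b\<bar> < sqrt (4 * pi * \<alpha>)" for b
  proof -
    have "\<bar>b\<bar>\<^sup>2 < (sqrt (4 * pi * \<alpha>))\<^sup>2" using b by (intro power_strict_mono) auto
    then have "b\<^sup>2 < 4 * pi * \<alpha>" using \<alpha> by simp
    from sobolev_uniform_bound[OF \<alpha> this \<kappa>(1)] obtain C where C: "C \<ge> 0" and le: "\<And>J S. admissible \<kappa> J \<Longrightarrow> finite S \<Longrightarrow>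
        (\<Sum>l\<in>S. sob_weight (- \<alpha>) l * (\<integral>p. basis_e l (fst p) * basis_e l (snd p) * exp (b\<^sup>2 * cov J (fst p) (snd p)) \<partial>torus2)) \<le> C" by blast
    have "msq (sob_weight (- \<alpha>)) (ecoef (cutoff_points (dilate N \<Lambda>)) b basis_e) \<le> ennreal C" for N
    proof -
      define I where "I = (\<lambda>l. \<integral>p. basis_e l (fst p) * basis_e l (snd p) * exp (b\<^sup>2 * cov (cutoff_points (dilate N \<Lambda>)) (fst p) (snd p)) \<partial>torus2)"
      have I: "I l \<ge> 0" for l unfolding I_def wexp_second_moment(2)[OF J e, symmetric] by simp
      have "msq (sob_weight (- \<alpha>)) (ecoef (cutoff_points (dilate N \<Lambda>)) b basis_e) = (\<integral>\<^sup>+k. ennreal (sob_weight (- \<alpha>) k) * ennreal (I k) \<partial>count_space UNIV)"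
        unfolding msq_coords[OF sob_weight_nonneg coord_meas_ecoef[OF e]] ecoef_second_moment[OF J e] I_def ..
      \<comment> \<open>Square roots present the weighted sum of second moments as a
        \<open>wnorm2\<close>, to which bounds on finite sets apply.\<close>
      also have "\<dots> = wnorm2 (sob_weight (- \<alpha>)) (\<lambda>k. sqrt (I k))"
        unfolding wnorm2_def using I by (intro nn_integral_cong) (simp add: ennreal_mult sob_weight_nonneg)
      also have "\<dots> \<le> ennreal C"
      proof (rule wnorm2_le[OF _ sob_weight_nonneg])
        fix S :: "(int \<times> int) set" assume "finite S"
        from le[OF \<kappa>(2) this] show "(\<Sum>k\<in>S. sob_weight (- \<alpha>) k * (sqrt (I k))\<^sup>2) \<le> C" using I unfolding I_def by simp
      qed
      finally show ?thesis .
    qed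
    then show ?thesis using C by blast
  qed
  then show ?thesis unfolding wick_data_def using t unfolding tendsto_Lp_sobolev_2_iff p Lp_sobolev_2_iff
    using J e sob_weight_nonneg by blast
qed

lemma scalar_wick_data:
  assumes g: "g \<in> L2_torus" and \<Lambda>: "cutoff_set \<Lambda>" and \<Phi>: "\<And>n. is_wick_power_at M n g (\<Phi> n)"
  shows "wick_data (\<lambda>N. cutoff_points (dilate N \<Lambda>)) (\<lambda>_. g) origin_weight (sqrt (4 * pi)) (\<lambda>n z k. \<Phi> n z)"
proof -
  obtain \<kappa> where \<kappa>: "\<kappa> \<ge> 1" "\<And>N. admissible \<kappa> (cutoff_points (dilate N \<Lambda>))" using cutoff_admissible[OF \<Lambda>] by blast
  note J = admissible_finite[OF \<kappa>(2)]
  have gi: "integrable torus g" by (rule L2_torus_integrable[OF g])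
  note t = wick_power_at_tendsto[OF \<Phi> \<Lambda>]
  have p: "inner_H (wick_cutoff M n (dilate N \<Lambda>) z) g = pcoef (cutoff_points (dilate N \<Lambda>)) n (\<lambda>_. g) z k" for n N z k
    unfolding inner_H_def pcoef_def wick_cutoff_eq[OF J zero_mem_admissible[OF \<kappa>(2)]] ..
  have t': "\<Phi> n \<in> borel_measurable M" "(\<lambda>N. msq origin_weight (\<lambda>z k. pcoef (cutoff_points (dilate N \<Lambda>)) n (\<lambda>_. g) z k - \<Phi> n z)) \<longlonglongrightarrow> 0" for n
    using t[of n] unfolding tendsto_Lp_2_iff Lp_2_iff by (simp_all add: p[symmetric])
  have "\<exists>C\<ge>0. \<forall>N. msq origin_weight (ecoef (cutoff_points (dilate N \<Lambda>)) b (\<lambda>_. g)) \<le> ennreal C" if b: "\<bar>b\<bar> < sqrt (4 * pi)" for b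
  proof -
    have "\<bar>b\<bar>\<^sup>2 < (sqrt (4 * pi))\<^sup>2" using b by (intro power_strict_mono) auto
    then have "b\<^sup>2 < 4 * pi" by simp
    from scalar_uniform_bound[OF g this \<kappa>(1)] obtain C where C: "C \<ge> 0" and le: "\<And>J. admissible \<kappa> J \<Longrightarrow>
        (\<integral>p. g (fst p) * g (snd p) * exp (b\<^sup>2 * cov J (fst p) (snd p)) \<partial>torus2) \<le> C" by blast
    have "msq origin_weight (ecoef (cutoff_points (dilate N \<Lambda>)) b (\<lambda>_. g)) \<le> ennreal C" for N
      unfolding msq_origin_weight ecoef_second_moment[OF J gi] by (intro ennreal_leI le \<kappa>(2))
    then show ?thesis using C by blast
  qed
  then show ?thesis unfolding wick_data_def using J gi t' coord_meas_const by auto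
qed

lemma wick_sums_exist:
  assumes data: "wick_data J g w b0 \<Phi>" and a: "\<bar>a\<bar> < b0" and fin: "\<And>n. msq w (\<Phi> n) < \<infinity>"
  obtains W where "coord_meas W" "\<And>z. wnorm2 w (W z) < \<infinity>" "msq w W < \<infinity>"
    "\<And>m. msq w (wick_sum \<Phi> a m) < \<infinity>" "(\<lambda>m. msq w (\<lambda>z k. wick_sum \<Phi> a m z k - W z k)) \<longlonglongrightarrow> 0"
proof -
  have w: "\<And>k. w k \<ge> 0" and \<Phi>: "\<And>n. coord_meas (\<Phi> n)" using data unfolding wick_data_def by auto
  have S: "msq w (wick_sum \<Phi> a m) < \<infinity>" for m by (rule msq_wick_sum_finite[OF w \<Phi> fin])
  obtain W where W: "coord_meas W" "\<And>z. wnorm2 w (W z) < \<infinity>" "(\<lambda>m. msq w (\<lambda>z k. wick_sum \<Phi> a m z k - W z k)) \<longlonglongrightarrow> 0"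
    using wick_sum_limit_exists[OF data a S] by blast
  have "msq w W < \<infinity>" by (rule msq_limit_finite[OF w coord_meas_wick_sum[OF \<Phi>] S W(1) W(3)])
  then show ?thesis using that W S by blast
qed

text \<open>Existence of a sum gives content to the choice in \<open>wick_exp\<close>: the chosen
  version then has the convergence by which it is defined.\<close>

lemma sums_wick_exp:
  assumes \<alpha>: "0 < \<alpha>" "\<alpha> \<le> 1" and \<Lambda>: "cutoff_set \<Lambda>" and \<Phi>: "\<And>n. is_wick_power M n (\<Phi> n)" and a: "\<bar>a\<bar> < sqrt (4 * pi * \<alpha>)"
  shows "sums_Lp_sobolev M 2 (- \<alpha>) (\<lambda>n z k. a ^ n / fact n * \<Phi> n z k) (wick_exp M \<alpha> \<Phi> a)"
proof -
  note data = sobolev_wick_data[OF \<alpha> \<Lambda> \<Phi>]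
  have P: "coord_meas (\<Phi> n)" "\<forall>z\<in>space M. \<Phi> n z \<in> sobolev (- \<alpha>)" "msq (sob_weight (- \<alpha>)) (\<Phi> n) < \<infinity>" for n
    using wick_power_tendsto[OF \<Phi> \<Lambda> \<alpha>(1), of n] unfolding tendsto_Lp_sobolev_2_iff Lp_sobolev_2_iff by simp_all
  obtain W where W: "coord_meas W" "\<And>z. wnorm2 (sob_weight (- \<alpha>)) (W z) < \<infinity>" "msq (sob_weight (- \<alpha>)) W < \<infinity>"
    "\<And>m. msq (sob_weight (- \<alpha>)) (wick_sum \<Phi> a m) < \<infinity>" "(\<lambda>m. msq (sob_weight (- \<alpha>)) (\<lambda>z k. wick_sum \<Phi> a m z k - W z k)) \<longlonglongrightarrow> 0"
    by (rule wick_sums_exist[OF data a P(3)]) blast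
  have "wick_sum \<Phi> a m z \<in> sobolev (- \<alpha>)" if "z \<in> space M" for m z
    unfolding wick_sum_def[abs_def] using P(2) that by (intro sobolev_sum sobolev_scale) auto
  then have "tendsto_Lp_sobolev M 2 (- \<alpha>) (wick_sum \<Phi> a) W"
    unfolding tendsto_Lp_sobolev_2_iff Lp_sobolev_2_iff using W coord_meas_wick_sum[OF P(1)] by (auto simp: sobolev_iff)
  then have "sums_Lp_sobolev M 2 (- \<alpha>) (\<lambda>n z k. a ^ n / fact n * \<Phi> n z k) W"
    unfolding sums_Lp_sobolev_def wick_sum_def[abs_def] .
  then show ?thesis unfolding wick_exp_def
    by (rule someI[where P = "sums_Lp_sobolev M 2 (- \<alpha>) (\<lambda>n z k. a ^ n / fact n * \<Phi> n z k)"])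
qed

lemma sums_wick_exp_at:
  assumes g: "g \<in> L2_torus" and \<Lambda>: "cutoff_set \<Lambda>" and \<Phi>: "\<And>n. is_wick_power_at M n g (\<Phi> n)" and a: "\<bar>a\<bar> < sqrt (4 * pi)"
  shows "sums_Lp M 2 (\<lambda>n z. a ^ n / fact n * \<Phi> n z) (wick_exp_at M \<Phi> a)"
proof -
  note data = scalar_wick_data[OF g \<Lambda> \<Phi>]
  have P: "\<Phi> n \<in> borel_measurable M" "msq origin_weight (\<lambda>z k. \<Phi> n z) < \<infinity>" for n
    using wick_power_at_tendsto[OF \<Phi> \<Lambda>, of n] unfolding tendsto_Lp_2_iff Lp_2_iff by simp_all
  obtain W where W: "coord_meas W" "msq origin_weight W < \<infinity>"
    "\<And>m. msq origin_weight (wick_sum (\<lambda>n z k. \<Phi> n z) a m) < \<infinity>" "(\<lambda>m. msq origin_weight (\<lambda>z k. wick_sum (\<lambda>n z k. \<Phi> n z) a m z k - W z k)) \<longlonglongrightarrow> 0"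
    by (rule wick_sums_exist[OF data a P(2)]) blast
  have "tendsto_Lp M 2 (\<lambda>m z. \<Sum>n<m. a ^ n / fact n * \<Phi> n z) (\<lambda>z. W z (0, 0))"
    unfolding tendsto_Lp_2_iff Lp_2_iff using W(2-4) P(1) coord_measD[OF W(1), of "(0, 0)"]
    unfolding msq_origin_weight wick_sum_def by simp
  then have "sums_Lp M 2 (\<lambda>n z. a ^ n / fact n * \<Phi> n z) (\<lambda>z. W z (0, 0))" unfolding sums_Lp_def .
  then show ?thesis unfolding wick_exp_at_def
    by (rule someI[where P = "sums_Lp M 2 (\<lambda>n z. a ^ n / fact n * \<Phi> n z)"])
qed


lemma wick_exp_limit:
  assumes \<alpha>: "0 < \<alpha>" "\<alpha> \<le> 1" and \<Lambda>: "cutoff_set \<Lambda>" and \<Phi>: "\<And>n. is_wick_power M n (\<Phi> n)" and a: "\<bar>a\<bar> < sqrt (4 * pi * \<alpha>)"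
  shows "coord_meas (wick_exp M \<alpha> \<Phi> a)" "\<And>z. z \<in> space M \<Longrightarrow> wick_exp M \<alpha> \<Phi> a z \<in> sobolev (- \<alpha>)"
    "wick_exp M \<alpha> \<Phi> a \<in> Lp_sobolev M 2 (- \<alpha>)"
    "(\<lambda>m. msq (sob_weight (- \<alpha>)) (\<lambda>z k. wick_sum \<Phi> a m z k - wick_exp M \<alpha> \<Phi> a z k)) \<longlonglongrightarrow> 0"
  using sums_wick_exp[OF assms] unfolding sums_Lp_sobolev_def wick_sum_def tendsto_Lp_sobolev_2_iff Lp_sobolev_2_iff by simp_all

lemma wick_exp_at_limit:
  assumes g: "g \<in> L2_torus" and \<Lambda>: "cutoff_set \<Lambda>" and \<Phi>: "\<And>n. is_wick_power_at M n g (\<Phi> n)" and a: "\<bar>a\<bar> < sqrt (4 * pi)"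
  shows "wick_exp_at M \<Phi> a \<in> borel_measurable M" "wick_exp_at M \<Phi> a \<in> Lp M 2"
    "(\<lambda>m. msq origin_weight (\<lambda>z k. wick_sum (\<lambda>n z k. \<Phi> n z) a m z k - wick_exp_at M \<Phi> a z)) \<longlonglongrightarrow> 0"
  using sums_wick_exp_at[OF assms] unfolding sums_Lp_def wick_sum_def tendsto_Lp_2_iff Lp_2_iff by simp_all

lemma exp_cutoff_tendsto:
  assumes \<alpha>: "0 < \<alpha>" "\<alpha> \<le> 1" and \<Lambda>: "cutoff_set \<Lambda>" and \<Phi>: "\<And>n. is_wick_power M n (\<Phi> n)" and a: "\<bar>a\<bar> < sqrt (4 * pi * \<alpha>)"
  shows "tendsto_Lp_sobolev M 2 (- \<alpha>) (\<lambda>N z. fourier_coeffs (exp_cutoff M (dilate N \<Lambda>) a z)) (wick_exp M \<alpha> \<Phi> a)"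
proof -
  note data = sobolev_wick_data[OF \<alpha> \<Lambda> \<Phi>]
  note W = wick_exp_limit[OF assms]
  let ?J = "\<lambda>N. cutoff_points (dilate N \<Lambda>)"
  have J: "finite (?J N)" for N using data unfolding wick_data_def by blast
  have e: "integrable torus (basis_e k)" for k by (rule L2_torus_integrable[OF basis_in_L2_torus])
  have E: "fourier_coeffs (exp_cutoff M (dilate N \<Lambda>) a z) = ecoef (?J N) a basis_e z" for N z
    unfolding fourier_coeffs_def inner_H_def ecoef_def[abs_def] exp_cutoff_eq[OF J] ..
  have "exp_cutoff M (dilate N \<Lambda>) a z = wexp (?J N) a z" for N z by (intro ext exp_cutoff_eq J)
  moreover have "wexp (?J N) a z \<in> L2_torus" for N z
    by (rule bounded_in_L2_torus[OF measurable_wexp_torus, where B = "dom_exp (?J N) a z"]) (simp add: abs_of_pos wexp_pos wexp_le)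
  ultimately have "ecoef (?J N) a basis_e z \<in> sobolev (- \<alpha>)" for N z
    unfolding E[symmetric] using \<alpha> by (intro fourier_coeffs_sobolev) auto
  moreover have "msq (sob_weight (- \<alpha>)) (ecoef (?J N) a basis_e) < \<infinity>" for N
  proof -
    obtain C where "\<And>N. msq (sob_weight (- \<alpha>)) (ecoef (?J N) a basis_e) \<le> ennreal C" using data a unfolding wick_data_def by blast
    then show ?thesis by (rule le_less_trans) simp
  qed
  ultimately show ?thesis
    unfolding tendsto_Lp_sobolev_2_iff E Lp_sobolev_2_iff[of "ecoef _ _ _"]
    using coord_meas_ecoef[of basis_e, OF e] W(3) ecoef_tendsto[OF data a W(1,4)] by blast
qed

lemma exp_cutoff_at_tendsto:
  assumes g: "g \<in> L2_torus" and \<Lambda>: "cutoff_set \<Lambda>" and \<Phi>: "\<And>n. is_wick_power_at M n g (\<Phi> n)" and a: "\<bar>a\<bar> < sqrt (4 * pi)"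
  shows "tendsto_Lp M 2 (\<lambda>N z. inner_H (exp_cutoff M (dilate N \<Lambda>) a z) g) (wick_exp_at M \<Phi> a)"
proof -
  note data = scalar_wick_data[OF g \<Lambda> \<Phi>]
  note W = wick_exp_at_limit[OF assms]
  let ?J = "\<lambda>N. cutoff_points (dilate N \<Lambda>)"
  have J: "finite (?J N)" for N using data unfolding wick_data_def by blast
  have gi: "integrable torus g" by (rule L2_torus_integrable[OF g])
  have E: "inner_H (exp_cutoff M (dilate N \<Lambda>) a z) g = ecoef (?J N) a (\<lambda>_. g) z (0, 0)" for N z
    unfolding inner_H_def ecoef_def exp_cutoff_eq[OF J] ..
  obtain C where "\<And>N. msq origin_weight (ecoef (?J N) a (\<lambda>_. g)) \<le> ennreal C" using data a unfolding wick_data_def by blast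
  then have fin: "msq origin_weight (ecoef (?J N) a (\<lambda>_. g)) < \<infinity>" for N by (rule le_less_trans) simp
  have "(\<lambda>N. msq origin_weight (\<lambda>z k. ecoef (?J N) a (\<lambda>_. g) z k - wick_exp_at M \<Phi> a z)) \<longlonglongrightarrow> 0"
    by (rule ecoef_tendsto[OF data a coord_meas_const[OF W(1)] W(3)])
  then show ?thesis
    unfolding tendsto_Lp_2_iff E Lp_2_iff[of "\<lambda>z. ecoef _ _ _ z _"] using W(2) fin coord_measD[OF coord_meas_ecoef[of "\<lambda>_. g", OF gi], of _ a "(0, 0)"]
    unfolding msq_origin_weight by blast
qed

text \<open>For truncated Wick powers, which are trigonometric polynomials, the identity is exact.
  It passes to the Wick powers in the limit, to partial sums by linearity, and to the series in a
  second limit.\<close>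

lemma wick_exp_at_pairing:
  assumes \<alpha>: "0 < \<alpha>" "\<alpha> \<le> 1" and \<Lambda>: "cutoff_set \<Lambda>" and \<Phi>: "\<And>n. is_wick_power M n (\<Phi> n)"
    and g: "g \<in> L2_torus" and \<Phi>g: "\<And>n. is_wick_power_at M n g (\<Phi>g n)"
    and gs: "fourier_coeffs g \<in> sobolev \<alpha>" and a: "\<bar>a\<bar> < sqrt (4 * pi * \<alpha>)"
  shows "AE z in M. wick_exp_at M \<Phi>g a z = pairing (wick_exp M \<alpha> \<Phi> a z) (fourier_coeffs g)"
proof -
  have "sqrt (4 * pi * \<alpha>) \<le> sqrt (4 * pi)" using \<alpha> by simp
  then have a': "\<bar>a\<bar> < sqrt (4 * pi)" using a by linarith
  obtain \<kappa> where \<kappa>: "\<And>N. admissible \<kappa> (cutoff_points (dilate N \<Lambda>))" using cutoff_admissible[OF \<Lambda>] by blast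
  have \<Phi>': "coord_meas (\<Phi> n)" "z \<in> space M \<Longrightarrow> \<Phi> n z \<in> sobolev (- \<alpha>)" for n z
    using wick_power_tendsto[OF \<Phi> \<Lambda> \<alpha>(1), of n] unfolding tendsto_Lp_sobolev_2_iff Lp_sobolev_2_iff by auto
  have \<Phi>g': "\<Phi>g n \<in> borel_measurable M" for n
    using wick_power_at_tendsto[OF \<Phi>g \<Lambda>, of n] unfolding tendsto_Lp_2_iff Lp_2_iff by auto
  have pow: "AE z in M. \<Phi>g n z = pairing (\<Phi> n z) (fourier_coeffs g)" for n
  proof (rule pairing_limit[OF _ _ gs])
    let ?F = "\<lambda>N z. fourier_coeffs (wick_cutoff M n (dilate N \<Lambda>) z)" and ?f = "\<lambda>N z. inner_H (wick_cutoff M n (dilate N \<Lambda>) z) g"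
    have t: "\<forall>N. coord_meas (?F N) \<and> (\<forall>z\<in>space M. ?F N z \<in> sobolev (- \<alpha>))" "(\<lambda>N. msq (sob_weight (- \<alpha>)) (\<lambda>z k. ?F N z k - \<Phi> n z k)) \<longlonglongrightarrow> 0"
      using wick_power_tendsto[OF \<Phi> \<Lambda> \<alpha>(1), of n] unfolding tendsto_Lp_sobolev_2_iff Lp_sobolev_2_iff by auto
    have t': "\<forall>N. ?f N \<in> borel_measurable M" "(\<lambda>N. \<integral>\<^sup>+z. ennreal ((?f N z - \<Phi>g n z)\<^sup>2) \<partial>M) \<longlonglongrightarrow> 0"
      using wick_power_at_tendsto[OF \<Phi>g \<Lambda>, of n] unfolding tendsto_Lp_2_iff Lp_2_iff msq_origin_weight by auto
    show "coord_meas (?F N)" for N using t by blast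
    show "?F N z \<in> sobolev (- \<alpha>)" if "z \<in> space M" for N z using t that by blast
    show "?f N \<in> borel_measurable M" for N using t' by blast
    show "(\<lambda>N. msq (sob_weight (- \<alpha>)) (\<lambda>z k. ?F N z k - \<Phi> n z k)) \<longlonglongrightarrow> 0" by (rule t)
    show "(\<lambda>N. \<integral>\<^sup>+z. ennreal ((?f N z - \<Phi>g n z)\<^sup>2) \<partial>M) \<longlonglongrightarrow> 0" by (rule t')
    have "wick_cutoff M n (dilate N \<Lambda>) z = (\<lambda>x. fact n * wpow (cutoff_points (dilate N \<Lambda>)) n z x)" for N z
      by (intro ext wick_cutoff_eq admissible_finite[OF \<kappa>] zero_mem_admissible[OF \<kappa>])
    then have "trig_polynomial (wick_cutoff M n (dilate N \<Lambda>) z)" for N z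
      by (simp only: trig_polynomial_scale[OF trig_polynomial_wpow[OF admissible_finite[OF \<kappa>]]])
    then show "AE z in M. ?f N z = pairing (?F N z) (fourier_coeffs g)" for N
      by (intro AE_I2 trig_polynomial_pairing g)
  qed (use \<Phi>' \<Phi>g' in auto)
  show ?thesis
  proof (rule pairing_limit[OF coord_meas_wick_sum[OF \<Phi>'(1)] wick_exp_limit(1)[OF \<alpha> \<Lambda> \<Phi> a] gs])
    show "wick_sum \<Phi> a N z \<in> sobolev (- \<alpha>)" if "z \<in> space M" for N z
      unfolding wick_sum_def[abs_def] by (intro sobolev_sum sobolev_scale \<Phi>'(2) that)
    show "(\<lambda>m. msq (sob_weight (- \<alpha>)) (\<lambda>z k. wick_sum \<Phi> a m z k - wick_exp M \<alpha> \<Phi> a z k)) \<longlonglongrightarrow> 0"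
      by (rule wick_exp_limit(4)[OF \<alpha> \<Lambda> \<Phi> a])
    show "(\<lambda>z. \<Sum>n<N. a ^ n / fact n * \<Phi>g n z) \<in> borel_measurable M" for N using \<Phi>g' by measurable
    show "(\<lambda>N. \<integral>\<^sup>+z. ennreal (((\<Sum>n<N. a ^ n / fact n * \<Phi>g n z) - wick_exp_at M \<Phi>g a z)\<^sup>2) \<partial>M) \<longlonglongrightarrow> 0"
      using wick_exp_at_limit(3)[OF g \<Lambda> \<Phi>g a'] unfolding msq_origin_weight wick_sum_def .
    show "AE z in M. (\<Sum>n<N. a ^ n / fact n * \<Phi>g n z) = pairing (wick_sum \<Phi> a N z) (fourier_coeffs g)" for N
    proof -
      have "AE z in M. \<forall>n. \<Phi>g n z = pairing (\<Phi> n z) (fourier_coeffs g)" unfolding AE_all_countable using pow by blast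
      then show ?thesis using AE_space
      proof eventually_elim
        case (elim z)
        show ?case unfolding wick_sum_def[abs_def] pairing_sum[of "\<lambda>n. \<Phi> n z", OF \<Phi>'(2)[OF elim(2)] gs] using elim(1) by simp
      qed
    qed
  qed (use wick_exp_limit(2)[OF \<alpha> \<Lambda> \<Phi> a] wick_exp_at_limit(1)[OF g \<Lambda> \<Phi>g a'] in auto)
qed

lemma wick_exp_Lp_sobolev:
  assumes \<alpha>: "0 < \<alpha>" "\<alpha> \<le> 1" and \<Lambda>: "cutoff_set \<Lambda>" and \<Phi>: "\<And>n. is_wick_power M n (\<Phi> n)"
    and p: "p \<ge> 2" and a: "\<bar>a\<bar> < sqrt (4 * pi * \<alpha>)" "\<bar>a\<bar> * sqrt (p - 1) < sqrt (4 * pi * \<alpha>)"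
  shows "wick_exp M \<alpha> \<Phi> a \<in> Lp_sobolev M p (- \<alpha>)"
proof -
  note W = wick_exp_limit[OF \<alpha> \<Lambda> \<Phi> a(1)]
  have "(\<integral>\<^sup>+z. ennreal (enn2real (wnorm2 (sob_weight (- \<alpha>)) (wick_exp M \<alpha> \<Phi> a z)) powr (p / 2)) \<partial>M) < \<infinity>"
    by (rule wick_sum_limit_Lp[OF sobolev_wick_data[OF \<alpha> \<Lambda> \<Phi>] W(1,4)]) (use p a(2) W(2) in \<open>auto simp: sobolev_iff\<close>)
  then show ?thesis unfolding Lp_sobolev_iff using W(1,2) by blast
qed

lemma wick_exp_at_Lp:
  assumes g: "g \<in> L2_torus" and \<Lambda>: "cutoff_set \<Lambda>" and \<Phi>: "\<And>n. is_wick_power_at M n g (\<Phi> n)"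
    and p: "p \<ge> 2" and a: "\<bar>a\<bar> < sqrt (4 * pi)" "\<bar>a\<bar> * sqrt (p - 1) < sqrt (4 * pi)"
  shows "wick_exp_at M \<Phi> a \<in> Lp M p"
proof -
  note W = wick_exp_at_limit[OF g \<Lambda> \<Phi> a(1)]
  have "(\<integral>\<^sup>+z. ennreal (enn2real (wnorm2 origin_weight (\<lambda>k. wick_exp_at M \<Phi> a z)) powr (p / 2)) \<partial>M) < \<infinity>"
    by (rule wick_sum_limit_Lp[OF scalar_wick_data[OF g \<Lambda> \<Phi>] coord_meas_const[OF W(1)] W(3)]) (use p a(2) in \<open>auto simp: wnorm2_indicator\<close>)
  moreover have "enn2real (wnorm2 origin_weight (\<lambda>k. y)) powr (p / 2) = \<bar>y\<bar> powr p" for y :: real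
  proof -
    have "enn2real (wnorm2 origin_weight (\<lambda>k. y)) = \<bar>y\<bar> powr 2" unfolding wnorm2_indicator by simp
    then show ?thesis by (simp only: powr_powr) simp
  qed
  ultimately show ?thesis unfolding Lp_iff using W(1) by simp
qed

end

text \<open>Used with r = p - 1: since r \<ge> 1, the condition on a also places a in the range
  where the series converges in L^2.\<close>

lemma mult_sqrt_less:
  fixes a c r :: real
  assumes "\<bar>a\<bar> < sqrt (c / r)" "r \<ge> 1" "c \<ge> 0"
  shows "\<bar>a\<bar> < sqrt c" "\<bar>a\<bar> * sqrt r < sqrt c"
proof -
  have "c / r \<le> c" using assms(2,3) by (simp add: divide_le_eq mult_le_cancel_left1)
  then show "\<bar>a\<bar> < sqrt c" using assms(1) real_sqrt_le_mono[of "c / r" c] by linarith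
  have "\<bar>a\<bar> * sqrt r < sqrt (c / r) * sqrt r" using assms by (intro mult_strict_right_mono) auto
  also have "\<dots> = sqrt c" using assms(2) by (simp add: real_sqrt_mult[symmetric])
  finally show "\<bar>a\<bar> * sqrt r < sqrt c" .
qed

theorem theorem3p4:
  fixes \<delta> \<alpha> p :: real
    and \<mu>0 :: "distribution measure"
    and g :: "real \<times> real \<Rightarrow> real"
    and \<Lambda> :: "(real \<times> real) set"
    and \<Phi> :: "nat \<Rightarrow> distribution \<Rightarrow> distribution"
    and \<Phi>g :: "nat \<Rightarrow> distribution \<Rightarrow> real"
  assumes "\<delta> > 0" and "free_field \<delta> \<mu>0"
    and "0 < \<alpha>" and "\<alpha> \<le> 1" and "p \<ge> 2"
    and "g \<in> L2_torus"
    and "cutoff_set \<Lambda>"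
    and "\<And>n. is_wick_power \<mu>0 n (\<Phi> n)"
    and "\<And>n. is_wick_power_at \<mu>0 n g (\<Phi>g n)"
  shows
    "(\<forall>a. a \<in> {- sqrt (4 * pi * \<alpha>) <..< sqrt (4 * pi * \<alpha>)} \<longrightarrow>
        sums_Lp_sobolev \<mu>0 2 (- \<alpha>) (\<lambda>n z k. a ^ n / fact n * \<Phi> n z k) (wick_exp \<mu>0 \<alpha> \<Phi> a) \<and>
        tendsto_Lp_sobolev \<mu>0 2 (- \<alpha>)
          (\<lambda>N z. fourier_coeffs (exp_cutoff \<mu>0 (dilate N \<Lambda>) a z)) (wick_exp \<mu>0 \<alpha> \<Phi> a)) \<and>
     (\<forall>a. a \<in> {- sqrt (4 * pi) <..< sqrt (4 * pi)} \<longrightarrow>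
        sums_Lp \<mu>0 2 (\<lambda>n z. a ^ n / fact n * \<Phi>g n z) (wick_exp_at \<mu>0 \<Phi>g a) \<and>
        tendsto_Lp \<mu>0 2
          (\<lambda>N z. inner_H (exp_cutoff \<mu>0 (dilate N \<Lambda>) a z) g) (wick_exp_at \<mu>0 \<Phi>g a)) \<and>
     (\<forall>a. fourier_coeffs g \<in> sobolev \<alpha> \<longrightarrow>
        a \<in> {- sqrt (4 * pi * \<alpha>) <..< sqrt (4 * pi * \<alpha>)} \<longrightarrow>
        (AE z in \<mu>0. wick_exp_at \<mu>0 \<Phi>g a z = pairing (wick_exp \<mu>0 \<alpha> \<Phi> a z) (fourier_coeffs g))) \<and>
     (\<forall>a. \<bar>a\<bar> < sqrt (4 * pi * \<alpha> / (p - 1)) \<longrightarrow>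
        wick_exp \<mu>0 \<alpha> \<Phi> a \<in> Lp_sobolev \<mu>0 p (- \<alpha>)) \<and>
     (\<forall>a. \<bar>a\<bar> < sqrt (4 * pi / (p - 1)) \<longrightarrow> wick_exp_at \<mu>0 \<Phi>g a \<in> Lp \<mu>0 p)"
proof -
  interpret gaussian_free_field \<delta> \<mu>0 by standard (rule assms(2))
  note A = assms(3,4,7,8) and B = assms(6,7,9)
  have abs: "\<bar>a\<bar> < c" if "a \<in> {- c <..< c}" for a c :: real using that by auto
  have p: "p - 1 \<ge> 1" "4 * pi * \<alpha> \<ge> 0" "4 * pi \<ge> 0" using assms(3,5) by auto
  show ?thesis
  proof (intro conjI allI impI)
    fix a assume a: "a \<in> {- sqrt (4 * pi * \<alpha>) <..< sqrt (4 * pi * \<alpha>)}"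
    show "sums_Lp_sobolev \<mu>0 2 (- \<alpha>) (\<lambda>n z k. a ^ n / fact n * \<Phi> n z k) (wick_exp \<mu>0 \<alpha> \<Phi> a)"
      by (rule sums_wick_exp[OF A abs[OF a]])
    show "tendsto_Lp_sobolev \<mu>0 2 (- \<alpha>) (\<lambda>N z. fourier_coeffs (exp_cutoff \<mu>0 (dilate N \<Lambda>) a z)) (wick_exp \<mu>0 \<alpha> \<Phi> a)"
      by (rule exp_cutoff_tendsto[OF A abs[OF a]])
    show "AE z in \<mu>0. wick_exp_at \<mu>0 \<Phi>g a z = pairing (wick_exp \<mu>0 \<alpha> \<Phi> a z) (fourier_coeffs g)" if "fourier_coeffs g \<in> sobolev \<alpha>"
      by (rule wick_exp_at_pairing[OF A assms(6,9) that abs[OF a]])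
  next
    fix a assume a: "a \<in> {- sqrt (4 * pi) <..< sqrt (4 * pi)}"
    show "sums_Lp \<mu>0 2 (\<lambda>n z. a ^ n / fact n * \<Phi>g n z) (wick_exp_at \<mu>0 \<Phi>g a)"
      by (rule sums_wick_exp_at[OF B abs[OF a]])
    show "tendsto_Lp \<mu>0 2 (\<lambda>N z. inner_H (exp_cutoff \<mu>0 (dilate N \<Lambda>) a z) g) (wick_exp_at \<mu>0 \<Phi>g a)"
      by (rule exp_cutoff_at_tendsto[OF B abs[OF a]])
  next
    fix a assume a: "\<bar>a\<bar> < sqrt (4 * pi * \<alpha> / (p - 1))"
    show "wick_exp \<mu>0 \<alpha> \<Phi> a \<in> Lp_sobolev \<mu>0 p (- \<alpha>)"
      by (rule wick_exp_Lp_sobolev[OF A assms(5) mult_sqrt_less[OF a p(1,2)]])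
  next
    fix a assume a: "\<bar>a\<bar> < sqrt (4 * pi / (p - 1))"
    show "wick_exp_at \<mu>0 \<Phi>g a \<in> Lp \<mu>0 p"
      by (rule wick_exp_at_Lp[OF B assms(5) mult_sqrt_less[OF a p(1,3)]])
  qed
qed

end
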